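(* Let $(\mathcal{C},\otimes,I)$ be a symmetric monoidal category. There is a $\mathcal{W}_{\mathrm{ob}(\mathcal{C})}$-algebra $H_{\mathcal{C}}:\mathcal{W}_{\mathrm{ob}(\mathcal{C})}\to\mathbf{Set}$ which sends a box $(\mathbf{t}_-,\mathbf{t}_+)$, with $\mathbf{t}_-:S_-\to\mathrm{ob}(\mathcal{C})$ and $\mathbf{t}_+:S_+\to\mathrm{ob}(\mathcal{C})$, to the hom-set $$H_{\mathcal{C}}(\mathbf{t}_-,\mathbf{t}_+)=\mathcal{C}\Big(\bigotimes_{s\in S_-}\mathbf{t}_-(s),\ \bigotimes_{s\in S_+}\mathbf{t}_+(s)\Big),$$ and which sends the diagrams $\mathsf{seq}$, $\mathsf{para}$, $\mathsf{sym}$ to the composition, monoidal product, and symmetry operations of $\mathcal{C}$ respectively. Moreover, if $\mathcal{C}'$ is the symmetric monoidal category obtained from $H_{\mathcal{C}}$ by the construction described in the context, then there is an induced equivalence of symmetric monoidal categories $\mathcal{C}'\to\mathcal{C}$.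
   Context: For a set $\tau$ of types, a $\tau$-typed finite set is a finite set $X$ with a map $X\to\tau$; $\mathbf{Bij}_\tau$ is the category of $\tau$-typed finite sets and type-preserving bijections, and $\oplus$ denotes disjoint union. $\mathbf{Set}$ is regarded as an operad via its cartesian monoidal structure; a $\mathcal{W}_\tau$-algebra is an operad functor $\mathcal{W}_\tau\to\mathbf{Set}$. The operad $\mathcal{W}_\tau$ of acyclic wiring diagrams: objects ("boxes") are pairs $\mathbf{t}=(\mathbf{t}_-,\mathbf{t}_+)$ of $\tau$-typed finite sets; a morphism $\Phi:\mathbf{t}^1,\dots,\mathbf{t}^n\to\mathbf{v}$ is an isomorphism class of spans in $\mathbf{Bij}_\tau$, $\mathbf{v}_-\oplus\mathbf{t}_+\leftarrow\omega\rightarrow\mathbf{t}_-\oplus\mathbf{v}_+$ with $\mathbf{t}_\pm=\bigoplus_i\mathbf{t}^i_\pm$ (elements of $\omega$ are wires, each joining a "source" port in $\mathbf{v}_-\oplus\mathbf{t}_+$ to a "target" port in $\mathbf{t}_-\oplus\mathbf{v}_+$), such that the relation $\mathbf{t}^i\prec\mathbf{t}^j$ whenever a wire goes from an output of $\mathbf{t}^i$ to an input of $\mathbf{t}^j$ is a partial order (no directed cycles). Identities are identity spans; operadic composition $\Psi\,;_i\,\Phi$ substitutes the diagram $\Psi:\mathbf{s}^1,\dots,\mathbf{s}^m\to\mathbf{t}^i$ into the box $\mathbf{t}^i$ of $\Phi$, fusing each wire of $\Phi$ ending at a port of $\mathbf{t}^i$ with the wire of $\Psi$ at that port (wires passing through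 $\mathbf{t}^i$ from input to output are fused into chains $\Phi$-wire, $\Psi$-wire, $\Phi$-wire), and keeping all other wires. Special diagrams: for a typed finite set $\omega$ and type-preserving permutation $\sigma$ of $\omega$, $\mathsf{sym}^\sigma_\omega:()\to(\omega,\omega)$ connects input $x$ to output $\sigma(x)$, and $\mathsf{unit}_\omega=\mathsf{sym}^{\mathrm{id}}_\omega$; $\mathsf{seq}_{(A,B,C)}:(A,B),(B,C)\to(A,C)$ connects outer inputs to the first box, the first box's outputs to the second box's inputs, and the second box's outputs to the outer outputs, all identically; $\mathsf{para}:(A,B),(A',B')\to(A\oplus A',B\oplus B')$ places the two boxes side by side, connecting outer inputs/outputs identically to their ports. Construction of an SMC from a $\mathcal{W}_\tau$-algebra $H$: the symmetric monoidal category $\mathcal{C}_H$ has objects the $\tau$-typed finite sets, hom-sets $\mathcal{C}_H(\mathbf{t}_-,\mathbf{t}_+)=H(\mathbf{t}_-,\mathbf{t}_+)$, identity on $A$ the image of $H(\mathsf{unit}_A):1\to H(A,A)$, composition $H(\mathsf{seq}_{(A,B,C)}):H(A,B)\times H(B,C)\to H(A,C)$, monoidal product $H(\mathsf{para}):H(A,B)\times H(A',B')\to H(A\oplus A',B\oplus B')$, and symmetries given by $H(\mathsf{sym})$. Here $\mathcal{C}'=\mathcal{C}_{H_{\mathcal{C}}}$ with $\tau=\mathrm{ob}(\mathcal{C})$. *)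

theory Defs
  imports Main "HOL-Library.FuncSet" "HOL-Combinatorics.Permutations"
begin

section \<open>Typed finite sets\<close>

text \<open>A universe of elements over an arbitrary set of atoms that is closed under binary
  disjoint unions (tags \<open>InL\<close>, \<open>InR\<close>) and finite disjoint unions (tags \<open>Tag i\<close>).\<close>

datatype 'a elt = Atom 'a | InL "'a elt" | InR "'a elt" | Tag nat "'a elt"

text \<open>A typed finite set is a finite partial map: its domain is the set, its values are the types.\<close>

type_synonym ('a, 't) tfs = "'a elt \<rightharpoonup> 't"

definition is_tfs :: "'t set \<Rightarrow> ('a, 't) tfs \<Rightarrow> bool" where
  "is_tfs \<tau> X \<longleftrightarrow> finite (dom X) \<and> ran X \<subseteq> \<tau>"

text \<open>The morphisms of $\mathbf{Bij}_\tau$; only the values of \<open>f\<close> on \<open>dom X\<close> matter.\<close>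

definition typed_bij :: "('a, 't) tfs \<Rightarrow> ('a, 't) tfs \<Rightarrow> ('a elt \<Rightarrow> 'a elt) \<Rightarrow> bool" where
  "typed_bij X Y f \<longleftrightarrow> bij_betw f (dom X) (dom Y) \<and> (\<forall>x\<in>dom X. Y (f x) = X x)"

fun tsum :: "('a, 't) tfs \<Rightarrow> ('a, 't) tfs \<Rightarrow> ('a, 't) tfs"  (infixr "\<oplus>" 65) where
  "(X \<oplus> Y) (InL x) = X x"
| "(X \<oplus> Y) (InR y) = Y y"
| "(X \<oplus> Y) (Atom a) = None"
| "(X \<oplus> Y) (Tag i z) = None"

fun tSum :: "('a, 't) tfs list \<Rightarrow> ('a, 't) tfs" where
  "tSum Xs (Tag i x) = (if i < length Xs then (Xs ! i) x else None)"
| "tSum Xs (Atom a) = None"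
| "tSum Xs (InL x) = None"
| "tSum Xs (InR x) = None"


section \<open>Operads and operad functors\<close>

text \<open>Operads are coloured and symmetric. The sets of operations \<open>ohom P ts v\<close> need not be
  disjoint, so that composition and the symmetric group action take the colours as arguments:
  \<open>ocomp P ss ts v i \<psi> \<phi>\<close> substitutes \<open>\<psi> \<in> ohom P ss (ts ! i)\<close> at place \<open>i\<close> of
  \<open>\<phi> \<in> ohom P ts v\<close>, and \<open>operm P ts v \<pi> \<phi>\<close> is the operation whose \<open>k\<close>-th input is the
  \<open>\<pi> k\<close>-th input of \<open>\<phi>\<close>.\<close>

record ('o, 'm) operad =
  oobj :: "'o set"
  ohom :: "'o list \<Rightarrow> 'o \<Rightarrow> 'm set"
  oid :: "'o \<Rightarrow> 'm"
  ocomp :: "'o list \<Rightarrow> 'o list \<Rightarrow> 'o \<Rightarrow> nat \<Rightarrow> 'm \<Rightarrow> 'm \<Rightarrow> 'm"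
  operm :: "'o list \<Rightarrow> 'o \<Rightarrow> (nat \<Rightarrow> nat) \<Rightarrow> 'm \<Rightarrow> 'm"

definition subst_list :: "'o list \<Rightarrow> 'o list \<Rightarrow> nat \<Rightarrow> 'o list" where
  "subst_list ss ts i = take i ts @ ss @ drop (Suc i) ts"

definition operad_functor ::
  "('o, 'm) operad \<Rightarrow> ('p, 'n) operad \<Rightarrow> ('o \<Rightarrow> 'p) \<Rightarrow> ('o list \<Rightarrow> 'o \<Rightarrow> 'm \<Rightarrow> 'n) \<Rightarrow> bool" where
  "operad_functor P Q Fo Fm \<longleftrightarrow>
     (\<forall>t\<in>oobj P. Fo t \<in> oobj Q) \<and>
     (\<forall>ts v \<phi>. set ts \<subseteq> oobj P \<longrightarrow> v \<in> oobj P \<longrightarrow> \<phi> \<in> ohom P ts v \<longrightarrow>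
        Fm ts v \<phi> \<in> ohom Q (map Fo ts) (Fo v)) \<and>
     (\<forall>t\<in>oobj P. Fm [t] t (oid P t) = oid Q (Fo t)) \<and>
     (\<forall>ss ts v i \<psi> \<phi>. set ss \<subseteq> oobj P \<longrightarrow> set ts \<subseteq> oobj P \<longrightarrow> v \<in> oobj P \<longrightarrow> i < length ts \<longrightarrow>
        \<psi> \<in> ohom P ss (ts ! i) \<longrightarrow> \<phi> \<in> ohom P ts v \<longrightarrow>
        Fm (subst_list ss ts i) v (ocomp P ss ts v i \<psi> \<phi>) =
        ocomp Q (map Fo ss) (map Fo ts) (Fo v) i (Fm ss (ts ! i) \<psi>) (Fm ts v \<phi>)) \<and>
     (\<forall>ts v \<pi> \<phi>. set ts \<subseteq> oobj P \<longrightarrow> v \<in> oobj P \<longrightarrow> \<pi> permutes {..<length ts} \<longrightarrow>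
        \<phi> \<in> ohom P ts v \<longrightarrow>
        Fm (permute_list \<pi> ts) v (operm P ts v \<pi> \<phi>) =
        operm Q (map Fo ts) (Fo v) \<pi> (Fm ts v \<phi>))"

text \<open>The operad of the cartesian monoidal category of sets (of elements of type \<open>'x\<close>); an
  operation $X_1,\dots,X_n \to Y$ is a function on tuples, which are represented by lists.\<close>

definition set_operad :: "('x set, 'x list \<Rightarrow> 'x) operad" where
  "set_operad = \<lparr>
     oobj = UNIV,
     ohom = (\<lambda>Xs Y. listset Xs \<rightarrow>\<^sub>E Y),
     oid = (\<lambda>X. \<lambda>xs\<in>listset [X]. hd xs),
     ocomp = (\<lambda>Xs Ys Z i g f. \<lambda>zs\<in>listset (subst_list Xs Ys i).
        f (take i zs @ g (take (length Xs) (drop i zs)) # drop (i + length Xs) zs)),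
     operm = (\<lambda>Xs Y \<pi> f. \<lambda>zs\<in>listset (permute_list \<pi> Xs). f (permute_list (inv \<pi>) zs)) \<rparr>"


section \<open>The operad of acyclic wiring diagrams\<close>

text \<open>A box is the pair of its typed sets of input and of output ports.\<close>

type_synonym ('a, 't) box = "('a, 't) tfs \<times> ('a, 't) tfs"

definition is_box :: "'t set \<Rightarrow> ('a, 't) box \<Rightarrow> bool" where
  "is_box \<tau> t \<longleftrightarrow> is_tfs \<tau> (fst t) \<and> is_tfs \<tau> (snd t)"

text \<open>The ports of a diagram with inner boxes \<open>ts\<close> and outer box \<open>v\<close>.
  Sources: \<open>InL x\<close> (outer input), \<open>InR (Tag j y)\<close> (output of box \<open>j\<close>).
  Targets: \<open>InL (Tag j x)\<close> (input of box \<open>j\<close>), \<open>InR y\<close> (outer output).\<close>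

definition sources :: "('a, 't) box list \<Rightarrow> ('a, 't) box \<Rightarrow> ('a, 't) tfs" where
  "sources ts v = fst v \<oplus> tSum (map snd ts)"

definition targets :: "('a, 't) box list \<Rightarrow> ('a, 't) box \<Rightarrow> ('a, 't) tfs" where
  "targets ts v = tSum (map fst ts) \<oplus> snd v"

record ('a, 't) span =
  apex :: "('a, 't) tfs"
  sleg :: "'a elt \<Rightarrow> 'a elt"
  tleg :: "'a elt \<Rightarrow> 'a elt"

definition spans :: "'t set \<Rightarrow> ('a, 't) tfs \<Rightarrow> ('a, 't) tfs \<Rightarrow> ('a, 't) span set" where
  "spans \<tau> S T = {s. is_tfs \<tau> (apex s) \<and> typed_bij (apex s) S (sleg s) \<and> typed_bij (apex s) T (tleg s)}"

definition span_iso :: "('a, 't) span \<Rightarrow> ('a, 't) span \<Rightarrow> bool" where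
  "span_iso s s' \<longleftrightarrow> (\<exists>f. typed_bij (apex s) (apex s') f \<and>
     (\<forall>w\<in>dom (apex s). sleg s' (f w) = sleg s w \<and> tleg s' (f w) = tleg s w))"

definition span_classes :: "'t set \<Rightarrow> ('a, 't) tfs \<Rightarrow> ('a, 't) tfs \<Rightarrow> ('a, 't) span set set" where
  "span_classes \<tau> S T = spans \<tau> S T // {(s, s'). s \<in> spans \<tau> S T \<and> s' \<in> spans \<tau> S T \<and> span_iso s s'}"

definition wires :: "('a, 't) span \<Rightarrow> ('a elt \<times> 'a elt) set" where
  "wires s = (\<lambda>w. (sleg s w, tleg s w)) ` dom (apex s)"

text \<open>\<open>(i, j)\<close> is in this relation if some wire goes from an output of box \<open>i\<close> to an input of
  box \<open>j\<close>.\<close>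

definition precedes :: "('a, 't) span \<Rightarrow> (nat \<times> nat) set" where
  "precedes s = {(i, j). \<exists>x y. (InR (Tag i y), InL (Tag j x)) \<in> wires s}"

definition wiring_diagrams ::
  "'t set \<Rightarrow> ('a, 't) box list \<Rightarrow> ('a, 't) box \<Rightarrow> ('a, 't) span set set" where
  "wiring_diagrams \<tau> ts v =
     {\<Phi> \<in> span_classes \<tau> (sources ts v) (targets ts v). \<forall>s\<in>\<Phi>. acyclic (precedes s)}"

text \<open>A span is determined up to isomorphism by which source port is joined to which target port
  (\<open>span_iso_iff_wires\<close>). Hence the spans with a given set of wires form an isomorphism class
  (\<open>with_wires_in_span_classes\<close>), and diagrams can be specified by listing their wires.\<close>

definition with_wires ::
  "'t set \<Rightarrow> ('a, 't) box list \<Rightarrow> ('a, 't) box \<Rightarrow> ('a elt \<times> 'a elt) set \<Rightarrow> ('a, 't) span set" where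
  "with_wires \<tau> ts v r = {s \<in> spans \<tau> (sources ts v) (targets ts v). wires s = r}"

definition wires_of :: "('a, 't) span set \<Rightarrow> ('a elt \<times> 'a elt) set" where
  "wires_of \<Phi> = (\<Union>s\<in>\<Phi>. wires s)"

lemma span_iso_iff_wires:
  assumes "s \<in> spans \<tau> S T" "s' \<in> spans \<tau> S T"
  shows "span_iso s s' \<longleftrightarrow> wires s = wires s'"
proof
  assume "span_iso s s'"
  then obtain f where f: "bij_betw f (dom (apex s)) (dom (apex s'))"
    and legs: "\<And>w. w \<in> dom (apex s) \<Longrightarrow> sleg s' (f w) = sleg s w \<and> tleg s' (f w) = tleg s w"
    by (auto simp: span_iso_def typed_bij_def)
  have "wires s' = (\<lambda>w. (sleg s' w, tleg s' w)) ` f ` dom (apex s)"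
    using f by (auto simp: wires_def bij_betw_def)
  also have "\<dots> = wires s"
    by (simp add: wires_def image_image legs cong: image_cong_simp)
  finally show "wires s = wires s'" ..
next
  assume eq: "wires s = wires s'"
  have b: "bij_betw (sleg s) (dom (apex s)) (dom S)" "bij_betw (sleg s') (dom (apex s')) (dom S)"
    and ty: "\<And>w. w \<in> dom (apex s) \<Longrightarrow> S (sleg s w) = apex s w"
      "\<And>w. w \<in> dom (apex s') \<Longrightarrow> S (sleg s' w) = apex s' w"
    using assms by (auto simp: spans_def typed_bij_def)
  define f where "f = inv_into (dom (apex s')) (sleg s') \<circ> sleg s"
  have f: "bij_betw f (dom (apex s)) (dom (apex s'))"
    unfolding f_def using b by (intro bij_betw_trans[OF b(1)] bij_betw_inv_into)
  have 1: "sleg s' (f w) = sleg s w" and f_in: "f w \<in> dom (apex s')" if "w \<in> dom (apex s)" for w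
  proof -
    have "sleg s w \<in> sleg s' ` dom (apex s')"
      using b that by (metis bij_betw_imp_surj_on imageI)
    then show "sleg s' (f w) = sleg s w" by (simp add: f_def f_inv_into_f)
    show "f w \<in> dom (apex s')" using f that by (rule bij_betw_apply)
  qed
  have 2: "tleg s' (f w) = tleg s w" if w: "w \<in> dom (apex s)" for w
  proof -
    have "(sleg s w, tleg s w) \<in> wires s" using w unfolding wires_def by (rule imageI)
    then have "(sleg s w, tleg s w) \<in> wires s'" using eq by simp
    then obtain w' where "w' \<in> dom (apex s')"
      and "(sleg s w, tleg s w) = (sleg s' w', tleg s' w')"
      unfolding wires_def by (elim imageE)
    then have w': "w' \<in> dom (apex s')" "sleg s' w' = sleg s w" "tleg s' w' = tleg s w"
      by simp_all
    then have "w' = f w"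
      using inj_onD[OF bij_betw_imp_inj_on[OF b(2)], of w' "f w"] 1[OF w] f_in[OF w] by simp
    with w' show ?thesis by simp
  qed
  have "apex s' (f w) = apex s w" if "w \<in> dom (apex s)" for w
    using ty(1)[OF that] ty(2)[OF f_in[OF that]] 1[OF that] by simp
  with f 1 2 show "span_iso s s'"
    unfolding span_iso_def typed_bij_def by blast
qed

lemma with_wires_in_span_classes:
  assumes "with_wires \<tau> ts v r \<noteq> {}"
  shows "with_wires \<tau> ts v r \<in> span_classes \<tau> (sources ts v) (targets ts v)"
proof -
  let ?R = "{(s, s'). s \<in> spans \<tau> (sources ts v) (targets ts v) \<and>
    s' \<in> spans \<tau> (sources ts v) (targets ts v) \<and> span_iso s s'}"
  obtain s where s: "s \<in> spans \<tau> (sources ts v) (targets ts v)" "wires s = r"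
    using assms by (auto simp: with_wires_def)
  have "with_wires \<tau> ts v r = ?R `` {s}"
    using s by (auto simp: with_wires_def span_iso_iff_wires)
  moreover have "?R `` {s} \<in> spans \<tau> (sources ts v) (targets ts v) // ?R"
    using s by (intro quotientI)
  ultimately show ?thesis
    by (simp only: span_classes_def)
qed

definition wd_id :: "'t set \<Rightarrow> ('a, 't) box \<Rightarrow> ('a, 't) span set" where
  "wd_id \<tau> t = with_wires \<tau> [t] t
     ({(InL x, InL (Tag 0 x)) | x. x \<in> dom (fst t)} \<union>
      {(InR (Tag 0 y), InR y) | y. y \<in> dom (snd t)})"

text \<open>Substituting a diagram \<open>\<Psi>\<close> with \<open>m\<close> boxes into box \<open>i\<close> of \<open>\<Phi>\<close>: the wires of \<open>\<Phi>\<close> and \<open>\<Psi>\<close>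
  are the edges of a graph whose vertices are the sources and targets of the composite together
  with the input and output ports of the replaced box, at which wires of \<open>\<Phi>\<close> and of \<open>\<Psi>\<close> are
  fused. The wires of the composite are the paths from a source to a target. The boxes of \<open>\<Psi>\<close>
  become the boxes \<open>i, \<dots>, i + m - 1\<close> of the composite.\<close>

datatype 'a vertex = Source "'a elt" | Target "'a elt" | MidIn "'a elt" | MidOut "'a elt"

definition renumber :: "nat \<Rightarrow> nat \<Rightarrow> nat \<Rightarrow> nat" where
  "renumber i m j = (if j < i then j else j - 1 + m)"

fun host_source :: "nat \<Rightarrow> nat \<Rightarrow> 'a elt \<Rightarrow> 'a vertex" where
  "host_source i m (InL x) = Source (InL x)"
| "host_source i m (InR (Tag j y)) =
     (if j = i then MidOut y else Source (InR (Tag (renumber i m j) y)))"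

fun host_target :: "nat \<Rightarrow> nat \<Rightarrow> 'a elt \<Rightarrow> 'a vertex" where
  "host_target i m (InL (Tag j x)) =
     (if j = i then MidIn x else Target (InL (Tag (renumber i m j) x)))"
| "host_target i m (InR y) = Target (InR y)"

fun guest_source :: "nat \<Rightarrow> 'a elt \<Rightarrow> 'a vertex" where
  "guest_source i (InL x) = MidIn x"
| "guest_source i (InR (Tag k y)) = Source (InR (Tag (i + k) y))"

fun guest_target :: "nat \<Rightarrow> 'a elt \<Rightarrow> 'a vertex" where
  "guest_target i (InL (Tag k x)) = Target (InL (Tag (i + k) x))"
| "guest_target i (InR y) = MidOut y"

definition wd_graph ::
  "nat \<Rightarrow> nat \<Rightarrow> ('a, 't) span set \<Rightarrow> ('a, 't) span set \<Rightarrow> ('a vertex \<times> 'a vertex) set" where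
  "wd_graph i m \<Psi> \<Phi> =
     map_prod (host_source i m) (host_target i m) ` wires_of \<Phi> \<union>
     map_prod (guest_source i) (guest_target i) ` wires_of \<Psi>"

definition wd_comp :: "'t set \<Rightarrow> ('a, 't) box list \<Rightarrow> ('a, 't) box list \<Rightarrow> ('a, 't) box \<Rightarrow> nat \<Rightarrow>
    ('a, 't) span set \<Rightarrow> ('a, 't) span set \<Rightarrow> ('a, 't) span set" where
  "wd_comp \<tau> ss ts v i \<Psi> \<Phi> = with_wires \<tau> (subst_list ss ts i) v
     {(x, y). (Source x, Target y) \<in> (wd_graph i (length ss) \<Psi> \<Phi>)\<^sup>+}"

fun relabel_source :: "(nat \<Rightarrow> nat) \<Rightarrow> 'a elt \<Rightarrow> 'a elt" where
  "relabel_source \<rho> (InL x) = InL x"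
| "relabel_source \<rho> (InR (Tag j y)) = InR (Tag (\<rho> j) y)"

fun relabel_target :: "(nat \<Rightarrow> nat) \<Rightarrow> 'a elt \<Rightarrow> 'a elt" where
  "relabel_target \<rho> (InL (Tag j x)) = InL (Tag (\<rho> j) x)"
| "relabel_target \<rho> (InR y) = InR y"

definition wd_perm :: "'t set \<Rightarrow> ('a, 't) box list \<Rightarrow> ('a, 't) box \<Rightarrow> (nat \<Rightarrow> nat) \<Rightarrow>
    ('a, 't) span set \<Rightarrow> ('a, 't) span set" where
  "wd_perm \<tau> ts v \<pi> \<Phi> = with_wires \<tau> (permute_list \<pi> ts) v
     (map_prod (relabel_source (inv \<pi>)) (relabel_target (inv \<pi>)) ` wires_of \<Phi>)"

definition wd_operad :: "'t set \<Rightarrow> (('a, 't) box, ('a, 't) span set) operad" where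
  "wd_operad \<tau> = \<lparr>
     oobj = {t. is_box \<tau> t},
     ohom = wiring_diagrams \<tau>,
     oid = wd_id \<tau>,
     ocomp = wd_comp \<tau>,
     operm = wd_perm \<tau> \<rparr>"

definition wd_algebra :: "'t set \<Rightarrow> (('a, 't) box \<Rightarrow> 'x set) \<Rightarrow>
    (('a, 't) box list \<Rightarrow> ('a, 't) box \<Rightarrow> ('a, 't) span set \<Rightarrow> 'x list \<Rightarrow> 'x) \<Rightarrow> bool" where
  "wd_algebra \<tau> Ho Hm \<longleftrightarrow> operad_functor (wd_operad \<tau>) set_operad Ho Hm"

text \<open>The diagram \<open>sym\<close> is defined for a typed bijection \<open>\<sigma>\<close> between any two typed finite sets; a
  permutation is the case \<open>Y = X\<close>. The general case is needed because the two sides of a symmetry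
  \<open>X \<oplus> Y \<rightarrow> Y \<oplus> X\<close> are different sets.\<close>

definition wd_sym :: "'t set \<Rightarrow> ('a elt \<Rightarrow> 'a elt) \<Rightarrow> ('a, 't) tfs \<Rightarrow> ('a, 't) tfs \<Rightarrow> ('a, 't) span set" where
  "wd_sym \<tau> \<sigma> X Y = with_wires \<tau> [] (X, Y) {(InL x, InR (\<sigma> x)) | x. x \<in> dom X}"

definition wd_unit :: "'t set \<Rightarrow> ('a, 't) tfs \<Rightarrow> ('a, 't) span set" where
  "wd_unit \<tau> X = wd_sym \<tau> id X X"

definition wd_seq :: "'t set \<Rightarrow> ('a, 't) tfs \<Rightarrow> ('a, 't) tfs \<Rightarrow> ('a, 't) tfs \<Rightarrow> ('a, 't) span set" where
  "wd_seq \<tau> X Y Z = with_wires \<tau> [(X, Y), (Y, Z)] (X, Z)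
     ({(InL x, InL (Tag 0 x)) | x. x \<in> dom X} \<union>
      {(InR (Tag 0 y), InL (Tag 1 y)) | y. y \<in> dom Y} \<union>
      {(InR (Tag 1 z), InR z) | z. z \<in> dom Z})"

definition wd_para :: "'t set \<Rightarrow> ('a, 't) tfs \<Rightarrow> ('a, 't) tfs \<Rightarrow> ('a, 't) tfs \<Rightarrow> ('a, 't) tfs \<Rightarrow>
    ('a, 't) span set" where
  "wd_para \<tau> X Y X' Y' = with_wires \<tau> [(X, Y), (X', Y')] (X \<oplus> X', Y \<oplus> Y')
     ({(InL (InL x), InL (Tag 0 x)) | x. x \<in> dom X} \<union>
      {(InL (InR x), InL (Tag 1 x)) | x. x \<in> dom X'} \<union>
      {(InR (Tag 0 y), InR (InL y)) | y. y \<in> dom Y} \<union>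
      {(InR (Tag 1 y), InR (InR y)) | y. y \<in> dom Y'})"


section \<open>Symmetric monoidal categories\<close>

text \<open>Composition is written in diagrammatic order. Objects are tensored with \<open>\<boxtimes>\<close>, morphisms
  with \<open>\<otimes>\<close>.\<close>

record ('o, 'm) smc =
  obj :: "'o set"
  arr :: "'m set"
  Dom :: "'m \<Rightarrow> 'o"
  Cod :: "'m \<Rightarrow> 'o"
  idn :: "'o \<Rightarrow> 'm"
  cmp :: "'m \<Rightarrow> 'm \<Rightarrow> 'm"  (infixl "\<Zsemi>\<index>" 60)
  unt :: "'o"
  tob :: "'o \<Rightarrow> 'o \<Rightarrow> 'o"  (infixr "\<boxtimes>\<index>" 70)
  tar :: "'m \<Rightarrow> 'm \<Rightarrow> 'm"  (infixr "\<otimes>\<index>" 70)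
  asc :: "'o \<Rightarrow> 'o \<Rightarrow> 'o \<Rightarrow> 'm"
  lun :: "'o \<Rightarrow> 'm"
  run :: "'o \<Rightarrow> 'm"
  brd :: "'o \<Rightarrow> 'o \<Rightarrow> 'm"

definition hom :: "('o, 'm) smc \<Rightarrow> 'o \<Rightarrow> 'o \<Rightarrow> 'm set" where
  "hom C A B = {f \<in> arr C. Dom C f = A \<and> Cod C f = B}"

definition inverse_in :: "('o, 'm) smc \<Rightarrow> 'o \<Rightarrow> 'o \<Rightarrow> 'm \<Rightarrow> 'm \<Rightarrow> bool" where
  "inverse_in C A B f g \<longleftrightarrow> f \<in> hom C A B \<and> g \<in> hom C B A \<and>
     cmp C f g = idn C A \<and> cmp C g f = idn C B"

definition iso_in :: "('o, 'm) smc \<Rightarrow> 'o \<Rightarrow> 'o \<Rightarrow> 'm \<Rightarrow> bool" where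
  "iso_in C A B f \<longleftrightarrow> (\<exists>g. inverse_in C A B f g)"

locale symmetric_monoidal_category =
  fixes C :: "('o, 'm) smc" (structure)
  assumes arr_obj: "f \<in> arr C \<Longrightarrow> Dom C f \<in> obj C \<and> Cod C f \<in> obj C"
    and idn_hom: "A \<in> obj C \<Longrightarrow> idn C A \<in> hom C A A"
    and cmp_hom: "\<lbrakk>f \<in> hom C A B; g \<in> hom C B D\<rbrakk> \<Longrightarrow> f \<Zsemi> g \<in> hom C A D"
    and idn_cmp: "f \<in> hom C A B \<Longrightarrow> idn C A \<Zsemi> f = f"
    and cmp_idn: "f \<in> hom C A B \<Longrightarrow> f \<Zsemi> idn C B = f"
    and cmp_assoc: "\<lbrakk>f \<in> hom C A B; g \<in> hom C B D; h \<in> hom C D E\<rbrakk> \<Longrightarrow>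
      (f \<Zsemi> g) \<Zsemi> h = f \<Zsemi> (g \<Zsemi> h)"
    and unt_obj: "unt C \<in> obj C"
    and tob_obj: "\<lbrakk>A \<in> obj C; B \<in> obj C\<rbrakk> \<Longrightarrow> A \<boxtimes> B \<in> obj C"
    and tar_hom: "\<lbrakk>f \<in> hom C A B; g \<in> hom C A' B'\<rbrakk> \<Longrightarrow> f \<otimes> g \<in> hom C (A \<boxtimes> A') (B \<boxtimes> B')"
    and tar_idn: "\<lbrakk>A \<in> obj C; B \<in> obj C\<rbrakk> \<Longrightarrow> idn C A \<otimes> idn C B = idn C (A \<boxtimes> B)"
    and tar_cmp: "\<lbrakk>f \<in> hom C A B; g \<in> hom C B D; f' \<in> hom C A' B'; g' \<in> hom C B' D'\<rbrakk> \<Longrightarrow>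
      (f \<Zsemi> g) \<otimes> (f' \<Zsemi> g') = (f \<otimes> f') \<Zsemi> (g \<otimes> g')"
    and asc_iso: "\<lbrakk>A \<in> obj C; B \<in> obj C; D \<in> obj C\<rbrakk> \<Longrightarrow>
      iso_in C ((A \<boxtimes> B) \<boxtimes> D) (A \<boxtimes> (B \<boxtimes> D)) (asc C A B D)"
    and asc_natural: "\<lbrakk>f \<in> hom C A A'; g \<in> hom C B B'; h \<in> hom C D D'\<rbrakk> \<Longrightarrow>
      ((f \<otimes> g) \<otimes> h) \<Zsemi> asc C A' B' D' = asc C A B D \<Zsemi> (f \<otimes> (g \<otimes> h))"
    and lun_iso: "A \<in> obj C \<Longrightarrow> iso_in C (unt C \<boxtimes> A) A (lun C A)"
    and lun_natural: "f \<in> hom C A B \<Longrightarrow> (idn C (unt C) \<otimes> f) \<Zsemi> lun C B = lun C A \<Zsemi> f"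
    and run_iso: "A \<in> obj C \<Longrightarrow> iso_in C (A \<boxtimes> unt C) A (run C A)"
    and run_natural: "f \<in> hom C A B \<Longrightarrow> (f \<otimes> idn C (unt C)) \<Zsemi> run C B = run C A \<Zsemi> f"
    and pentagon: "\<lbrakk>A \<in> obj C; B \<in> obj C; D \<in> obj C; E \<in> obj C\<rbrakk> \<Longrightarrow>
      asc C (A \<boxtimes> B) D E \<Zsemi> asc C A B (D \<boxtimes> E) =
      (asc C A B D \<otimes> idn C E) \<Zsemi> asc C A (B \<boxtimes> D) E \<Zsemi> (idn C A \<otimes> asc C B D E)"
    and triangle: "\<lbrakk>A \<in> obj C; B \<in> obj C\<rbrakk> \<Longrightarrow>
      asc C A (unt C) B \<Zsemi> (idn C A \<otimes> lun C B) = run C A \<otimes> idn C B"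
    and brd_hom: "\<lbrakk>A \<in> obj C; B \<in> obj C\<rbrakk> \<Longrightarrow> brd C A B \<in> hom C (A \<boxtimes> B) (B \<boxtimes> A)"
    and brd_natural: "\<lbrakk>f \<in> hom C A A'; g \<in> hom C B B'\<rbrakk> \<Longrightarrow>
      (f \<otimes> g) \<Zsemi> brd C A' B' = brd C A B \<Zsemi> (g \<otimes> f)"
    and brd_symmetric: "\<lbrakk>A \<in> obj C; B \<in> obj C\<rbrakk> \<Longrightarrow> brd C A B \<Zsemi> brd C B A = idn C (A \<boxtimes> B)"
    and hexagon: "\<lbrakk>A \<in> obj C; B \<in> obj C; D \<in> obj C\<rbrakk> \<Longrightarrow>
      asc C A B D \<Zsemi> brd C A (B \<boxtimes> D) \<Zsemi> asc C B D A =
      (brd C A B \<otimes> idn C D) \<Zsemi> asc C B A D \<Zsemi> (idn C B \<otimes> brd C A D)"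

text \<open>Strong symmetric monoidal functors, with structure isomorphisms
  \<open>Fmu F A B : F A \<boxtimes> F B \<rightarrow> F (A \<boxtimes> B)\<close> and \<open>Feps F : I \<rightarrow> F I\<close>.\<close>

record ('o, 'm, 'p, 'n) mfunctor =
  Fob :: "'o \<Rightarrow> 'p"
  Far :: "'m \<Rightarrow> 'n"
  Fmu :: "'o \<Rightarrow> 'o \<Rightarrow> 'n"
  Feps :: "'n"

locale symmetric_monoidal_functor =
  C: symmetric_monoidal_category C + D: symmetric_monoidal_category D
  for C :: "('o, 'm) smc" and D :: "('p, 'n) smc" (structure) and F :: "('o, 'm, 'p, 'n) mfunctor" +
  assumes Fob_obj: "A \<in> obj C \<Longrightarrow> Fob F A \<in> obj D"
    and Far_hom: "f \<in> hom C A B \<Longrightarrow> Far F f \<in> hom D (Fob F A) (Fob F B)"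
    and Far_idn: "A \<in> obj C \<Longrightarrow> Far F (idn C A) = idn D (Fob F A)"
    and Far_cmp: "\<lbrakk>f \<in> hom C A B; g \<in> hom C B E\<rbrakk> \<Longrightarrow> Far F (cmp C f g) = Far F f \<Zsemi> Far F g"
    and Fmu_iso: "\<lbrakk>A \<in> obj C; B \<in> obj C\<rbrakk> \<Longrightarrow>
      iso_in D (Fob F A \<boxtimes> Fob F B) (Fob F (tob C A B)) (Fmu F A B)"
    and Fmu_natural: "\<lbrakk>f \<in> hom C A A'; g \<in> hom C B B'\<rbrakk> \<Longrightarrow>
      (Far F f \<otimes> Far F g) \<Zsemi> Fmu F A' B' = Fmu F A B \<Zsemi> Far F (tar C f g)"
    and Feps_iso: "iso_in D (unt D) (Fob F (unt C)) (Feps F)"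
    and Fmu_asc: "\<lbrakk>A \<in> obj C; B \<in> obj C; E \<in> obj C\<rbrakk> \<Longrightarrow>
      (Fmu F A B \<otimes> idn D (Fob F E)) \<Zsemi> Fmu F (tob C A B) E \<Zsemi> Far F (asc C A B E) =
      asc D (Fob F A) (Fob F B) (Fob F E) \<Zsemi> (idn D (Fob F A) \<otimes> Fmu F B E) \<Zsemi> Fmu F A (tob C B E)"
    and Fmu_lun: "A \<in> obj C \<Longrightarrow>
      (Feps F \<otimes> idn D (Fob F A)) \<Zsemi> Fmu F (unt C) A \<Zsemi> Far F (lun C A) = lun D (Fob F A)"
    and Fmu_run: "A \<in> obj C \<Longrightarrow>
      (idn D (Fob F A) \<otimes> Feps F) \<Zsemi> Fmu F A (unt C) \<Zsemi> Far F (run C A) = run D (Fob F A)"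
    and Fmu_brd: "\<lbrakk>A \<in> obj C; B \<in> obj C\<rbrakk> \<Longrightarrow>
      Fmu F A B \<Zsemi> Far F (brd C A B) = brd D (Fob F A) (Fob F B) \<Zsemi> Fmu F B A"

definition mfunctor_id :: "('o, 'm) smc \<Rightarrow> ('o, 'm, 'o, 'm) mfunctor" where
  "mfunctor_id C = \<lparr>Fob = (\<lambda>A. A), Far = (\<lambda>f. f), Fmu = (\<lambda>A B. idn C (tob C A B)), Feps = idn C (unt C)\<rparr>"

text \<open>\<open>F\<close> followed by \<open>G\<close>, where \<open>G\<close> has target \<open>E\<close>.\<close>

definition mfunctor_comp :: "('q, 'l) smc \<Rightarrow> ('o, 'm, 'p, 'n) mfunctor \<Rightarrow> ('p, 'n, 'q, 'l) mfunctor \<Rightarrow>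
    ('o, 'm, 'q, 'l) mfunctor" where
  "mfunctor_comp E F G = \<lparr>
     Fob = (\<lambda>A. Fob G (Fob F A)),
     Far = (\<lambda>f. Far G (Far F f)),
     Fmu = (\<lambda>A B. cmp E (Fmu G (Fob F A) (Fob F B)) (Far G (Fmu F A B))),
     Feps = cmp E (Feps G) (Far G (Feps F)) \<rparr>"

definition monoidal_natural_iso :: "('o, 'm) smc \<Rightarrow> ('p, 'n) smc \<Rightarrow> ('o, 'm, 'p, 'n) mfunctor \<Rightarrow>
    ('o, 'm, 'p, 'n) mfunctor \<Rightarrow> ('o \<Rightarrow> 'n) \<Rightarrow> bool" where
  "monoidal_natural_iso C D F G \<alpha> \<longleftrightarrow>
     (\<forall>A\<in>obj C. iso_in D (Fob F A) (Fob G A) (\<alpha> A)) \<and>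
     (\<forall>A B f. f \<in> hom C A B \<longrightarrow> cmp D (Far F f) (\<alpha> B) = cmp D (\<alpha> A) (Far G f)) \<and>
     (\<forall>A\<in>obj C. \<forall>B\<in>obj C.
        cmp D (Fmu F A B) (\<alpha> (tob C A B)) = cmp D (tar D (\<alpha> A) (\<alpha> B)) (Fmu G A B)) \<and>
     cmp D (Feps F) (\<alpha> (unt C)) = Feps G"

definition smc_equivalence :: "('o, 'm) smc \<Rightarrow> ('p, 'n) smc \<Rightarrow> ('o, 'm, 'p, 'n) mfunctor \<Rightarrow> bool" where
  "smc_equivalence C D F \<longleftrightarrow> symmetric_monoidal_functor C D F \<and>
     (\<exists>G. symmetric_monoidal_functor D C G \<and>
        (\<exists>\<eta>. monoidal_natural_iso C C (mfunctor_id C) (mfunctor_comp C F G) \<eta>) \<and>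
        (\<exists>\<epsilon>. monoidal_natural_iso D D (mfunctor_comp D G F) (mfunctor_id D) \<epsilon>))"


section \<open>The symmetric monoidal category of an algebra\<close>

text \<open>Morphisms carry their domain and codomain, since the sets \<open>Ho (A, B)\<close> need not be disjoint.\<close>

fun asc_map :: "'a elt \<Rightarrow> 'a elt" where
  "asc_map (InL (InL x)) = InL x"
| "asc_map (InL (InR x)) = InR (InL x)"
| "asc_map (InR x) = InR (InR x)"

fun untag :: "'a elt \<Rightarrow> 'a elt" where
  "untag (InL x) = x"
| "untag (InR x) = x"

fun swap_map :: "'a elt \<Rightarrow> 'a elt" where
  "swap_map (InL x) = InR x"
| "swap_map (InR x) = InL x"

definition smc_of_algebra :: "'t set \<Rightarrow> (('a, 't) box \<Rightarrow> 'x set) \<Rightarrow>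
    (('a, 't) box list \<Rightarrow> ('a, 't) box \<Rightarrow> ('a, 't) span set \<Rightarrow> 'x list \<Rightarrow> 'x) \<Rightarrow>
    (('a, 't) tfs, ('a, 't) tfs \<times> 'x \<times> ('a, 't) tfs) smc" where
  "smc_of_algebra \<tau> Ho Hm =
     (let sym = (\<lambda>\<sigma> X Y. (X, Hm [] (X, Y) (wd_sym \<tau> \<sigma> X Y) [], Y)) in \<lparr>
     obj = {A. is_tfs \<tau> A},
     arr = {(A, f, B). is_tfs \<tau> A \<and> is_tfs \<tau> B \<and> f \<in> Ho (A, B)},
     Dom = (\<lambda>(A, f, B). A),
     Cod = (\<lambda>(A, f, B). B),
     idn = (\<lambda>A. (A, Hm [] (A, A) (wd_unit \<tau> A) [], A)),
     cmp = (\<lambda>(A, f, B) (B', g, D). (A, Hm [(A, B), (B, D)] (A, D) (wd_seq \<tau> A B D) [f, g], D)),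
     unt = Map.empty,
     tob = (\<lambda>A B. A \<oplus> B),
     tar = (\<lambda>(A, f, B) (A', f', B').
       (A \<oplus> A', Hm [(A, B), (A', B')] (A \<oplus> A', B \<oplus> B') (wd_para \<tau> A B A' B') [f, f'], B \<oplus> B')),
     asc = (\<lambda>A B D. sym asc_map ((A \<oplus> B) \<oplus> D) (A \<oplus> (B \<oplus> D))),
     lun = (\<lambda>A. sym untag (Map.empty \<oplus> A) A),
     run = (\<lambda>A. sym untag (A \<oplus> Map.empty) A),
     brd = (\<lambda>A B. sym swap_map (A \<oplus> B) (B \<oplus> A)) \<rparr>)"


section \<open>Unordered tensor products\<close>

text \<open>Bracketed words with labelled leaves, and their interpretation as iterated tensor products.\<close>

datatype 'x word = One | Leaf 'x | Prod "'x word" "'x word"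

primrec leaves :: "'x word \<Rightarrow> 'x list" where
  "leaves One = []"
| "leaves (Leaf x) = [x]"
| "leaves (Prod u w) = leaves u @ leaves w"

primrec interp :: "('o, 'm) smc \<Rightarrow> ('x \<Rightarrow> 'o) \<Rightarrow> 'x word \<Rightarrow> 'o" where
  "interp C t One = unt C"
| "interp C t (Leaf x) = t x"
| "interp C t (Prod u w) = tob C (interp C t u) (interp C t w)"

text \<open>The morphisms generated by the structural isomorphisms of \<open>C\<close>. If the leaves of \<open>u\<close> are
  distinct, the labels determine a permutation of the factors, and by the coherence theorem
  for symmetric monoidal categories there is exactly one such morphism from \<open>u\<close> to \<open>w\<close> when
  \<open>u\<close> and \<open>w\<close> have the same set of distinct leaves.\<close>

inductive coherence :: "('o, 'm) smc \<Rightarrow> ('x \<Rightarrow> 'o) \<Rightarrow> 'x word \<Rightarrow> 'x word \<Rightarrow> 'm \<Rightarrow> bool" for C t where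
  coh_idn: "coherence C t u u (idn C (interp C t u))"
| coh_cmp: "\<lbrakk>coherence C t u v f; coherence C t v w g\<rbrakk> \<Longrightarrow> coherence C t u w (cmp C f g)"
| coh_tar: "\<lbrakk>coherence C t u v f; coherence C t u' v' f'\<rbrakk> \<Longrightarrow>
    coherence C t (Prod u u') (Prod v v') (tar C f f')"
| coh_inv: "\<lbrakk>coherence C t u v f; inverse_in C (interp C t u) (interp C t v) f g\<rbrakk> \<Longrightarrow>
    coherence C t v u g"
| coh_asc: "coherence C t (Prod (Prod u v) w) (Prod u (Prod v w))
    (asc C (interp C t u) (interp C t v) (interp C t w))"
| coh_lun: "coherence C t (Prod One u) u (lun C (interp C t u))"
| coh_run: "coherence C t (Prod u One) u (run C (interp C t u))"
| coh_brd: "coherence C t (Prod u v) (Prod v u) (brd C (interp C t u) (interp C t v))"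

definition coherence_iso :: "('o, 'm) smc \<Rightarrow> ('x \<Rightarrow> 'o) \<Rightarrow> 'x word \<Rightarrow> 'x word \<Rightarrow> 'm" where
  "coherence_iso C t u w = (THE f. coherence C t u w f)"

text \<open>The tensor product over an unordered finite set depends on a choice of an order and a
  bracketing of each finite set \<open>S\<close>, that is, of a word \<open>W S\<close> in which each element of \<open>S\<close> occurs
  exactly once.\<close>

definition bracketing_choice :: "('x set \<Rightarrow> 'x word) \<Rightarrow> bool" where
  "bracketing_choice W \<longleftrightarrow> (\<forall>S. finite S \<longrightarrow> distinct (leaves (W S)) \<and> set (leaves (W S)) = S)"

definition tensor :: "('o, 'm) smc \<Rightarrow> ('a elt set \<Rightarrow> 'a elt word) \<Rightarrow> ('a, 'o) tfs \<Rightarrow> 'o" where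
  "tensor C W X = interp C (the \<circ> X) (W (dom X))"

text \<open>The symmetry isomorphism which takes the factor at \<open>x\<close> to the factor at \<open>\<sigma> x\<close>. The word
  \<open>map_word \<sigma> (W (dom X))\<close>, typed by \<open>Y\<close>, has the same interpretation as \<open>W (dom X)\<close>, typed by
  \<open>X\<close>, because \<open>\<sigma>\<close> is type-preserving.\<close>

definition permute_tensor :: "('o, 'm) smc \<Rightarrow> ('a elt set \<Rightarrow> 'a elt word) \<Rightarrow> ('a elt \<Rightarrow> 'a elt) \<Rightarrow>
    ('a, 'o) tfs \<Rightarrow> ('a, 'o) tfs \<Rightarrow> 'm" where
  "permute_tensor C W \<sigma> X Y = coherence_iso C (the \<circ> Y) (map_word \<sigma> (W (dom X))) (W (dom Y))"

text \<open>The canonical isomorphisms between \<open>tensor C W (X \<oplus> Y)\<close> and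
  \<open>tensor C W X \<boxtimes> tensor C W Y\<close>.\<close>

definition split_tensor :: "('o, 'm) smc \<Rightarrow> ('a elt set \<Rightarrow> 'a elt word) \<Rightarrow>
    ('a, 'o) tfs \<Rightarrow> ('a, 'o) tfs \<Rightarrow> 'm" where
  "split_tensor C W X Y = coherence_iso C (the \<circ> (X \<oplus> Y))
     (W (dom (X \<oplus> Y))) (Prod (map_word InL (W (dom X))) (map_word InR (W (dom Y))))"

definition merge_tensor :: "('o, 'm) smc \<Rightarrow> ('a elt set \<Rightarrow> 'a elt word) \<Rightarrow>
    ('a, 'o) tfs \<Rightarrow> ('a, 'o) tfs \<Rightarrow> 'm" where
  "merge_tensor C W X Y = coherence_iso C (the \<circ> (X \<oplus> Y))
     (Prod (map_word InL (W (dom X))) (map_word InR (W (dom Y)))) (W (dom (X \<oplus> Y)))"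

definition hom_boxes :: "('o, 'm) smc \<Rightarrow> ('a elt set \<Rightarrow> 'a elt word) \<Rightarrow> ('a, 'o) box \<Rightarrow> 'm set" where
  "hom_boxes C W = (\<lambda>(X, Y). hom C (tensor C W X) (tensor C W Y))"

text \<open>The functor induced on the category of the algebra \<open>hom_boxes C W\<close>: it takes a typed finite
  set to its tensor product and is the identity on hom-sets.\<close>

definition tensor_functor :: "('o, 'm) smc \<Rightarrow> ('a elt set \<Rightarrow> 'a elt word) \<Rightarrow>
    (('a, 'o) tfs, ('a, 'o) tfs \<times> 'm \<times> ('a, 'o) tfs, 'o, 'm) mfunctor" where
  "tensor_functor C W = \<lparr>
     Fob = tensor C W,
     Far = (\<lambda>(X, f, Y). f),
     Fmu = merge_tensor C W,
     Feps = coherence_iso C (the \<circ> Map.empty) One (W {}) \<rparr>"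

end

theory Submission
  imports Defs
begin

text \<open>The coherence theorem, proved by pulling a chosen leaf to the front of both bracketings and
  inducting on the number of leaves, turns each set-indexed tensor product into a functor of the
  labelled factors. Labelled factors can be merged without tags, and on morphisms with disjoint
  labels the resulting product is strictly associative, unital and commutative.

  A wiring diagram is evaluated by executing its boxes one after another in a topological order:
  the state is a morphism out of the outer inputs whose codomain is labelled by the sources (outer
  inputs and outputs of executed boxes) that are still to be consumed, and a box acts on the
  factors its inputs are wired to. Two topological orders differ by exchanging boxes that do not
  feed one another, so the value does not depend on the order. Executing the guest diagram in
  place of its host box executes the composite diagram up to relabelling the sources, which is
  functoriality.

  The category obtained from the algebra has the morphisms of \<open>C\<close> between tensor products of typed
  finite sets as its arrows, so the tensor functor is fully faithful, and the one-element sets make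
  it essentially surjective.\<close>

section \<open>Symmetric monoidal categories\<close>

text \<open>The obstacle is that the bracketing chosen for a union bears no relation to the
  bracketings chosen for its parts, so nothing about tensor products of typed sets holds on the
  nose. Factors are therefore addressed by label and never by position, and an identity between
  composites of canonical isomorphisms reduces to comparing their first and last words. In an
  execution the labels are the sources of the diagram, because a source is joined to exactly one
  target: a label is produced once and consumed at most once, and firing a box needs no separate
  rewiring.

  Substitution tests this choice. A wire passing straight through the guest makes an output of the
  replaced box and the source feeding its input the same source of the composite, so the relabelling
  of host sources need not be injective as a whole. It is injective on the labels that occur up to
  the replaced box and on those that occur after it, and the execution is cut there. Acyclicity
  enters twice: it gives the topological order, and it excludes a host wire from the replaced box to
  itself, whose fusion could produce a closed path.\<close>

context symmetric_monoidal_category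
begin

lemma arr_hom: "f \<in> arr C \<Longrightarrow> f \<in> hom C (Dom C f) (Cod C f)"
  by (simp add: hom_def)

lemma hom_iff: "f \<in> hom C A B \<longleftrightarrow> f \<in> arr C \<and> Dom C f = A \<and> Cod C f = B"
  by (simp add: hom_def)

lemma Dom_Cod_obj [simp]: "f \<in> arr C \<Longrightarrow> Dom C f \<in> obj C" "f \<in> arr C \<Longrightarrow> Cod C f \<in> obj C"
  using arr_obj by auto

declare unt_obj [simp] tob_obj [simp]

lemma idn_simps [simp]:
  assumes "A \<in> obj C"
  shows "idn C A \<in> arr C" "Dom C (idn C A) = A" "Cod C (idn C A) = A"
  using idn_hom[OF assms] by (auto simp: hom_def)

lemma cmp_simps [simp]:
  assumes "f \<in> arr C" "g \<in> arr C" "Cod C f = Dom C g"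
  shows "f \<Zsemi> g \<in> arr C" "Dom C (f \<Zsemi> g) = Dom C f" "Cod C (f \<Zsemi> g) = Cod C g"
  using cmp_hom[of f "Dom C f" "Dom C g" g "Cod C g"] assms by (auto simp: hom_def)

lemma tar_simps [simp]:
  assumes "f \<in> arr C" "g \<in> arr C"
  shows "f \<otimes> g \<in> arr C" "Dom C (f \<otimes> g) = Dom C f \<boxtimes> Dom C g" "Cod C (f \<otimes> g) = Cod C f \<boxtimes> Cod C g"
  using tar_hom[OF arr_hom[OF assms(1)] arr_hom[OF assms(2)]] by (auto simp: hom_def)

lemma iso_in_arr:
  assumes "iso_in C A B f"
  shows "f \<in> arr C" "Dom C f = A" "Cod C f = B"
  using assms by (auto simp: iso_in_def inverse_in_def hom_def)

lemma asc_simps [simp]: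
  assumes "A \<in> obj C" "B \<in> obj C" "D \<in> obj C"
  shows "asc C A B D \<in> arr C" "Dom C (asc C A B D) = (A \<boxtimes> B) \<boxtimes> D"
    "Cod C (asc C A B D) = A \<boxtimes> (B \<boxtimes> D)"
  using iso_in_arr[OF asc_iso[OF assms]] by auto

lemma lun_simps [simp]:
  assumes "A \<in> obj C"
  shows "lun C A \<in> arr C" "Dom C (lun C A) = unt C \<boxtimes> A" "Cod C (lun C A) = A"
  using iso_in_arr[OF lun_iso[OF assms]] by auto

lemma run_simps [simp]:
  assumes "A \<in> obj C"
  shows "run C A \<in> arr C" "Dom C (run C A) = A \<boxtimes> unt C" "Cod C (run C A) = A"
  using iso_in_arr[OF run_iso[OF assms]] by auto

lemma brd_simps [simp]:
  assumes "A \<in> obj C" "B \<in> obj C"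
  shows "brd C A B \<in> arr C" "Dom C (brd C A B) = A \<boxtimes> B" "Cod C (brd C A B) = B \<boxtimes> A"
  using brd_hom[OF assms] by (auto simp: hom_def)

lemma cmp_assoc' [simp]:
  "\<lbrakk>f \<in> arr C; g \<in> arr C; h \<in> arr C; Cod C f = Dom C g; Cod C g = Dom C h\<rbrakk> \<Longrightarrow>
    (f \<Zsemi> g) \<Zsemi> h = f \<Zsemi> (g \<Zsemi> h)"
  by (rule cmp_assoc) (auto simp: hom_def)

lemma idn_cmp' [simp]: "\<lbrakk>f \<in> arr C; Dom C f = A\<rbrakk> \<Longrightarrow> idn C A \<Zsemi> f = f"
  using idn_cmp arr_hom by blast

lemma cmp_idn' [simp]: "\<lbrakk>f \<in> arr C; Cod C f = A\<rbrakk> \<Longrightarrow> f \<Zsemi> idn C A = f"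
  using cmp_idn arr_hom by blast

declare tar_idn [simp]

lemma tar_cmp':
  "\<lbrakk>f \<in> arr C; g \<in> arr C; f' \<in> arr C; g' \<in> arr C; Cod C f = Dom C g; Cod C f' = Dom C g'\<rbrakk> \<Longrightarrow>
    (f \<otimes> f') \<Zsemi> (g \<otimes> g') = (f \<Zsemi> g) \<otimes> (f' \<Zsemi> g')"
  by (rule tar_cmp[symmetric]) (auto simp: hom_def)

lemma cmp_reassoc:
  "\<lbrakk>f \<Zsemi> g = h; f \<in> arr C; g \<in> arr C; k \<in> arr C; Cod C f = Dom C g; Cod C g = Dom C k\<rbrakk> \<Longrightarrow>
    f \<Zsemi> (g \<Zsemi> k) = h \<Zsemi> k"
  using cmp_assoc' by metis

lemma tar_cmp_reassoc:
  "\<lbrakk>f \<in> arr C; g \<in> arr C; f' \<in> arr C; g' \<in> arr C; Cod C f = Dom C g; Cod C f' = Dom C g';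
    k \<in> arr C; Dom C k = Cod C g \<boxtimes> Cod C g'\<rbrakk> \<Longrightarrow>
    (f \<otimes> f') \<Zsemi> ((g \<otimes> g') \<Zsemi> k) = ((f \<Zsemi> g) \<otimes> (f' \<Zsemi> g')) \<Zsemi> k"
  by (rule cmp_reassoc[OF tar_cmp']) simp_all

lemmas tar_merge = tar_cmp' tar_cmp_reassoc

lemma asc_nat:
  "\<lbrakk>f \<in> arr C; g \<in> arr C; h \<in> arr C; Cod C f = A; Cod C g = B; Cod C h = D\<rbrakk> \<Longrightarrow>
    ((f \<otimes> g) \<otimes> h) \<Zsemi> asc C A B D = asc C (Dom C f) (Dom C g) (Dom C h) \<Zsemi> (f \<otimes> (g \<otimes> h))"
  by (rule asc_natural) (auto simp: hom_def)

lemma lun_nat: "\<lbrakk>f \<in> arr C; Cod C f = B\<rbrakk> \<Longrightarrow> (idn C (unt C) \<otimes> f) \<Zsemi> lun C B = lun C (Dom C f) \<Zsemi> f"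
  by (rule lun_natural) (auto simp: hom_def)

lemma run_nat: "\<lbrakk>f \<in> arr C; Cod C f = B\<rbrakk> \<Longrightarrow> (f \<otimes> idn C (unt C)) \<Zsemi> run C B = run C (Dom C f) \<Zsemi> f"
  by (rule run_natural) (auto simp: hom_def)

lemma brd_nat:
  "\<lbrakk>f \<in> arr C; g \<in> arr C; Cod C f = A; Cod C g = B\<rbrakk> \<Longrightarrow>
    (f \<otimes> g) \<Zsemi> brd C A B = brd C (Dom C f) (Dom C g) \<Zsemi> (g \<otimes> f)"
  by (rule brd_natural) (auto simp: hom_def)

section \<open>Isomorphisms, their inverses and cancellation\<close>

definition iso where
  "iso f \<longleftrightarrow> (\<exists>A B. iso_in C A B f)"

text \<open>Inverses are chosen rather than constructed; \<open>ainv_unique\<close> makes every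
  inverse found by other means equal to this one. Off the isomorphisms the value is
  arbitrary.\<close>

definition ainv where
  "ainv f = (SOME g. inverse_in C (Dom C f) (Cod C f) f g)"

lemma iso_arr [simp]: "iso f \<Longrightarrow> f \<in> arr C"
  by (auto simp: iso_def iso_in_arr)

lemma iso_inI: "\<lbrakk>iso f; Dom C f = A; Cod C f = B\<rbrakk> \<Longrightarrow> iso_in C A B f"
  unfolding iso_def using iso_in_arr by blast

lemma iso_inD: "iso_in C A B f \<Longrightarrow> iso f"
  by (auto simp: iso_def)

lemma inverse_in_ainv: "iso f \<Longrightarrow> inverse_in C (Dom C f) (Cod C f) f (ainv f)"
  unfolding ainv_def using iso_inI[OF _ refl refl, of f] unfolding iso_in_def by (rule someI_ex)

lemma ainv_simps [simp]:
  assumes "iso f"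
  shows "ainv f \<in> arr C" "Dom C (ainv f) = Cod C f" "Cod C (ainv f) = Dom C f"
    "f \<Zsemi> ainv f = idn C (Dom C f)" "ainv f \<Zsemi> f = idn C (Cod C f)"
  using inverse_in_ainv[OF assms] by (auto simp: inverse_in_def hom_def)

lemma ainv_cancel [simp]:
  "\<lbrakk>iso f; k \<in> arr C; Dom C k = Dom C f\<rbrakk> \<Longrightarrow> f \<Zsemi> (ainv f \<Zsemi> k) = k"
  "\<lbrakk>iso f; k \<in> arr C; Dom C k = Cod C f\<rbrakk> \<Longrightarrow> ainv f \<Zsemi> (f \<Zsemi> k) = k"
  by (simp_all flip: cmp_assoc')

lemma isoI:
  assumes "f \<in> arr C" "g \<in> arr C" "Cod C f = Dom C g" "Cod C g = Dom C f"
    "f \<Zsemi> g = idn C (Dom C f)" "g \<Zsemi> f = idn C (Cod C f)"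
  shows "iso f"
  unfolding iso_def iso_in_def inverse_in_def hom_def using assms by auto

lemma iso_cancel_left:
  assumes "iso f" "g \<in> arr C" "h \<in> arr C" "Dom C g = Cod C f" "Dom C h = Cod C f"
  shows "f \<Zsemi> g = f \<Zsemi> h \<longleftrightarrow> g = h"
proof
  assume "f \<Zsemi> g = f \<Zsemi> h"
  then have "ainv f \<Zsemi> (f \<Zsemi> g) = ainv f \<Zsemi> (f \<Zsemi> h)" by simp
  then show "g = h" using assms by simp
qed simp

lemma iso_cancel_right:
  assumes "iso f" "g \<in> arr C" "h \<in> arr C" "Cod C g = Dom C f" "Cod C h = Dom C f"
  shows "g \<Zsemi> f = h \<Zsemi> f \<longleftrightarrow> g = h"
proof
  assume "g \<Zsemi> f = h \<Zsemi> f"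
  then have "(g \<Zsemi> f) \<Zsemi> ainv f = (h \<Zsemi> f) \<Zsemi> ainv f" by simp
  then show "g = h" using assms by simp
qed simp

lemma ainv_unique:
  assumes "inverse_in C A B f g" shows "g = ainv f"
proof -
  have i: "iso f" using assms by (auto simp: iso_def iso_in_def)
  then show ?thesis
    using assms iso_cancel_left[OF i, of g "ainv f"] by (auto simp: inverse_in_def hom_def)
qed

lemma ainv_eqI:
  assumes "f \<in> arr C" "g \<in> arr C" "Cod C f = Dom C g" "Cod C g = Dom C f"
    "f \<Zsemi> g = idn C (Dom C f)" "g \<Zsemi> f = idn C (Cod C f)"
  shows "ainv f = g"
  by (rule ainv_unique[symmetric]) (use assms in \<open>auto simp: inverse_in_def hom_def\<close>)

lemma iso_ainv [simp]: "iso f \<Longrightarrow> iso (ainv f)"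
  by (rule isoI[of _ f]) auto

lemma ainv_ainv [simp]: "iso f \<Longrightarrow> ainv (ainv f) = f"
  by (rule ainv_eqI) auto

lemma iso_idn [simp]: "A \<in> obj C \<Longrightarrow> iso (idn C A)"
  by (rule isoI[of _ "idn C A"]) auto

lemma ainv_idn [simp]: "A \<in> obj C \<Longrightarrow> ainv (idn C A) = idn C A"
  by (rule ainv_eqI) auto

lemma iso_cmp [simp]: "\<lbrakk>iso f; iso g; Cod C f = Dom C g\<rbrakk> \<Longrightarrow> iso (f \<Zsemi> g)"
  by (rule isoI[of _ "ainv g \<Zsemi> ainv f"]) auto

lemma ainv_cmp: "\<lbrakk>iso f; iso g; Cod C f = Dom C g\<rbrakk> \<Longrightarrow> ainv (f \<Zsemi> g) = ainv g \<Zsemi> ainv f"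
  by (rule ainv_eqI) auto

lemma iso_tar [simp]: "\<lbrakk>iso f; iso g\<rbrakk> \<Longrightarrow> iso (f \<otimes> g)"
  by (rule isoI[of _ "ainv f \<otimes> ainv g"]) (auto simp: tar_merge)

lemma ainv_tar: "\<lbrakk>iso f; iso g\<rbrakk> \<Longrightarrow> ainv (f \<otimes> g) = ainv f \<otimes> ainv g"
  by (rule ainv_eqI) (auto simp: tar_merge)

lemma iso_structure [simp]:
  "\<lbrakk>A \<in> obj C; B \<in> obj C; D \<in> obj C\<rbrakk> \<Longrightarrow> iso (asc C A B D)"
  "A \<in> obj C \<Longrightarrow> iso (lun C A)"
  "A \<in> obj C \<Longrightarrow> iso (run C A)"
  "\<lbrakk>A \<in> obj C; B \<in> obj C\<rbrakk> \<Longrightarrow> iso (brd C A B)"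
  by (blast intro: iso_inD asc_iso lun_iso run_iso)+
    (rule isoI[of _ "brd C B A"], simp_all add: brd_symmetric)

lemma brd_brd [simp]:
  "\<lbrakk>A \<in> obj C; B \<in> obj C\<rbrakk> \<Longrightarrow> brd C A B \<Zsemi> brd C B A = idn C (A \<boxtimes> B)"
  "\<lbrakk>A \<in> obj C; B \<in> obj C; k \<in> arr C; Dom C k = A \<boxtimes> B\<rbrakk> \<Longrightarrow> brd C A B \<Zsemi> (brd C B A \<Zsemi> k) = k"
  by (simp_all add: brd_symmetric flip: cmp_assoc')

text \<open>Multiplying a square by the inverses of its two invertible sides turns it around, so
  naturality of an inverse structure map follows from naturality of the map itself.\<close>

lemma iso_eq_iff:
  assumes "iso f" "iso k" "g \<in> arr C" "h \<in> arr C"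
    "Dom C g = Cod C f" "Cod C h = Dom C k" "Dom C h = Dom C f" "Cod C k = Cod C g"
  shows "f \<Zsemi> g = h \<Zsemi> k \<longleftrightarrow> g \<Zsemi> ainv k = ainv f \<Zsemi> h"
proof
  assume a: "f \<Zsemi> g = h \<Zsemi> k"
  have "g \<Zsemi> ainv k = ainv f \<Zsemi> ((f \<Zsemi> g) \<Zsemi> ainv k)" using assms by simp
  also have "\<dots> = ainv f \<Zsemi> h" unfolding a using assms by simp
  finally show "g \<Zsemi> ainv k = ainv f \<Zsemi> h" .
next
  assume a: "g \<Zsemi> ainv k = ainv f \<Zsemi> h"
  have "f \<Zsemi> g = f \<Zsemi> ((g \<Zsemi> ainv k) \<Zsemi> k)" using assms by simp
  also have "\<dots> = h \<Zsemi> k" unfolding a using assms by simp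
  finally show "f \<Zsemi> g = h \<Zsemi> k" .
qed

lemma ainv_asc_nat:
  assumes "f \<in> arr C" "g \<in> arr C" "h \<in> arr C" "Cod C f = A" "Cod C g = B" "Cod C h = D"
  shows "(f \<otimes> (g \<otimes> h)) \<Zsemi> ainv (asc C A B D) =
    ainv (asc C (Dom C f) (Dom C g) (Dom C h)) \<Zsemi> ((f \<otimes> g) \<otimes> h)"
  using asc_nat[OF assms] assms by (subst iso_eq_iff[symmetric]) auto

section \<open>Unit laws implied by the pentagon, the triangle and the hexagon\<close>

lemma unt_tar_cancel:
  assumes "f \<in> arr C" "g \<in> arr C" "Dom C f = Dom C g" "Cod C f = Cod C g"
    "idn C (unt C) \<otimes> f = idn C (unt C) \<otimes> g"
  shows "f = g"
proof -
  have "lun C (Dom C f) \<Zsemi> f = lun C (Dom C g) \<Zsemi> g"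
    using assms lun_nat[of f "Cod C f"] lun_nat[of g "Cod C f"] by simp
  then show ?thesis using assms by (simp add: iso_cancel_left)
qed

lemma tar_unt_cancel:
  assumes "f \<in> arr C" "g \<in> arr C" "Dom C f = Dom C g" "Cod C f = Cod C g"
    "f \<otimes> idn C (unt C) = g \<otimes> idn C (unt C)"
  shows "f = g"
proof -
  have "run C (Dom C f) \<Zsemi> f = run C (Dom C g) \<Zsemi> g"
    using assms run_nat[of f "Cod C f"] run_nat[of g "Cod C f"] by simp
  then show ?thesis using assms by (simp add: iso_cancel_left)
qed

text \<open>Kelly's argument: expand the pentagon with two unit factors in front, rewrite the unit
  insertions by the triangle and naturality, and cancel the invertible common part. This gives the
  equation with a unit tensored in front, and tensoring with the unit is faithful because
  \<open>lun\<close> is a natural isomorphism.\<close>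

lemma lun_tob:
  assumes [simp]: "A \<in> obj C" "B \<in> obj C"
  shows "asc C (unt C) A B \<Zsemi> lun C (A \<boxtimes> B) = lun C A \<otimes> idn C B"
proof -
  let ?I = "unt C"
  have "(asc C ?I ?I A \<otimes> idn C B) \<Zsemi> asc C ?I (?I \<boxtimes> A) B \<Zsemi>
      (idn C ?I \<otimes> (asc C ?I A B \<Zsemi> lun C (A \<boxtimes> B)))
    = ((asc C ?I ?I A \<otimes> idn C B) \<Zsemi> asc C ?I (?I \<boxtimes> A) B \<Zsemi> (idn C ?I \<otimes> asc C ?I A B)) \<Zsemi>
      (idn C ?I \<otimes> lun C (A \<boxtimes> B))"
    by (simp add: tar_merge)
  also have "\<dots> = asc C (?I \<boxtimes> ?I) A B \<Zsemi> (asc C ?I ?I (A \<boxtimes> B) \<Zsemi> (idn C ?I \<otimes> lun C (A \<boxtimes> B)))"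
    by (subst pentagon[symmetric]) simp_all
  also have "\<dots> = asc C (?I \<boxtimes> ?I) A B \<Zsemi> (run C ?I \<otimes> (idn C A \<otimes> idn C B))"
    by (simp add: triangle)
  also have "\<dots> = ((run C ?I \<otimes> idn C A) \<otimes> idn C B) \<Zsemi> asc C ?I A B"
    by (simp add: asc_nat del: tar_idn)
  also have "\<dots> = ((asc C ?I ?I A \<Zsemi> (idn C ?I \<otimes> lun C A)) \<otimes> idn C B) \<Zsemi> asc C ?I A B"
    by (simp add: triangle)
  also have "\<dots> = (asc C ?I ?I A \<otimes> idn C B) \<Zsemi> (((idn C ?I \<otimes> lun C A) \<otimes> idn C B) \<Zsemi> asc C ?I A B)"
    by (simp add: tar_merge)
  also have "\<dots> = (asc C ?I ?I A \<otimes> idn C B) \<Zsemi> asc C ?I (?I \<boxtimes> A) B \<Zsemi> (idn C ?I \<otimes> (lun C A \<otimes> idn C B))"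
    by (simp add: asc_nat)
  finally have "idn C ?I \<otimes> (asc C ?I A B \<Zsemi> lun C (A \<boxtimes> B)) = idn C ?I \<otimes> (lun C A \<otimes> idn C B)"
    by (subst (asm) iso_cancel_left) simp_all
  then show ?thesis by (rule unt_tar_cancel[rotated -1]) simp_all
qed

text \<open>The mirror image of \<open>lun_tob\<close>: the pentagon now carries its two unit
  factors at the end, and the equation is obtained after tensoring with a unit on the right.\<close>

lemma run_tob:
  assumes [simp]: "A \<in> obj C" "B \<in> obj C"
  shows "asc C A B (unt C) \<Zsemi> (idn C A \<otimes> run C B) = run C (A \<boxtimes> B)"
proof -
  let ?I = "unt C"
  have "((asc C A B ?I \<Zsemi> (idn C A \<otimes> run C B)) \<otimes> idn C ?I) \<Zsemi> asc C A B ?I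
    = (asc C A B ?I \<otimes> idn C ?I) \<Zsemi> (((idn C A \<otimes> run C B) \<otimes> idn C ?I) \<Zsemi> asc C A B ?I)"
    by (simp add: tar_merge)
  also have "\<dots> = (asc C A B ?I \<otimes> idn C ?I) \<Zsemi> asc C A (B \<boxtimes> ?I) ?I \<Zsemi> (idn C A \<otimes> (run C B \<otimes> idn C ?I))"
    by (simp add: asc_nat)
  also have "\<dots> = ((asc C A B ?I \<otimes> idn C ?I) \<Zsemi> asc C A (B \<boxtimes> ?I) ?I \<Zsemi> (idn C A \<otimes> asc C B ?I ?I)) \<Zsemi>
      (idn C A \<otimes> (idn C B \<otimes> lun C ?I))"
    by (simp add: tar_merge triangle)
  also have "\<dots> = asc C (A \<boxtimes> B) ?I ?I \<Zsemi> (asc C A B (?I \<boxtimes> ?I) \<Zsemi> (idn C A \<otimes> (idn C B \<otimes> lun C ?I)))"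
    by (subst pentagon[symmetric]) simp_all
  also have "\<dots> = asc C (A \<boxtimes> B) ?I ?I \<Zsemi> (((idn C A \<otimes> idn C B) \<otimes> lun C ?I) \<Zsemi> asc C A B ?I)"
    by (simp add: asc_nat del: tar_idn)
  also have "\<dots> = (asc C (A \<boxtimes> B) ?I ?I \<Zsemi> (idn C (A \<boxtimes> B) \<otimes> lun C ?I)) \<Zsemi> asc C A B ?I"
    by simp
  also have "\<dots> = (run C (A \<boxtimes> B) \<otimes> idn C ?I) \<Zsemi> asc C A B ?I"
    by (simp add: triangle)
  finally have "(asc C A B ?I \<Zsemi> (idn C A \<otimes> run C B)) \<otimes> idn C ?I = run C (A \<boxtimes> B) \<otimes> idn C ?I"
    by (subst (asm) iso_cancel_right) simp_all
  then show ?thesis by (rule tar_unt_cancel[rotated -1]) simp_all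
qed

text \<open>Naturality of \<open>lun\<close>, applied to its own component at the unit, identifies
  \<open>lun\<close> at \<open>unt C \<boxtimes> unt C\<close> with the tensored component. Then
  \<open>lun_tob\<close> and the triangle speak of the same composite, and the extra unit factor is
  cancelled.\<close>

lemma lun_unt_eq_run_unt: "lun C (unt C) = run C (unt C)"
proof -
  let ?I = "unt C"
  have "(idn C ?I \<otimes> lun C ?I) \<Zsemi> lun C ?I = lun C (?I \<boxtimes> ?I) \<Zsemi> lun C ?I"
    by (subst lun_nat) simp_all
  then have "lun C (?I \<boxtimes> ?I) = idn C ?I \<otimes> lun C ?I"
    by (subst (asm) iso_cancel_right) simp_all
  then have "run C ?I \<otimes> idn C ?I = lun C ?I \<otimes> idn C ?I"
    by (simp only: lun_tob[of ?I ?I, symmetric] triangle[of ?I ?I, symmetric] unt_obj)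
  then show ?thesis by (rule tar_unt_cancel[symmetric, rotated -1]) simp_all
qed

text \<open>The hexagon whose last two factors are units is combined with naturality of the braiding
  for \<open>lun C (unt C)\<close>. Cancelling a braiding leaves the equation tensored with a
  unit.\<close>

lemma brd_lun:
  assumes [simp]: "A \<in> obj C"
  shows "brd C A (unt C) \<Zsemi> lun C A = run C A"
proof -
  let ?I = "unt C"
  have "(run C A \<otimes> idn C ?I) \<Zsemi> brd C A ?I = (asc C A ?I ?I \<Zsemi> (idn C A \<otimes> lun C ?I)) \<Zsemi> brd C A ?I"
    by (simp add: triangle)
  also have "\<dots> = asc C A ?I ?I \<Zsemi> (brd C A (?I \<boxtimes> ?I) \<Zsemi> (lun C ?I \<otimes> idn C A))"
    by (simp add: brd_nat)
  also have "\<dots> = (asc C A ?I ?I \<Zsemi> brd C A (?I \<boxtimes> ?I) \<Zsemi> asc C ?I ?I A) \<Zsemi> lun C (?I \<boxtimes> A)"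
    by (simp add: lun_tob)
  also have "\<dots> = ((brd C A ?I \<otimes> idn C ?I) \<Zsemi> asc C ?I A ?I \<Zsemi> (idn C ?I \<otimes> brd C A ?I)) \<Zsemi> lun C (?I \<boxtimes> A)"
    by (simp only: hexagon unt_obj assms)
  also have "\<dots> = (brd C A ?I \<otimes> idn C ?I) \<Zsemi> (asc C ?I A ?I \<Zsemi> lun C (A \<boxtimes> ?I)) \<Zsemi> brd C A ?I"
    by (simp add: lun_nat)
  also have "\<dots> = ((brd C A ?I \<Zsemi> lun C A) \<otimes> idn C ?I) \<Zsemi> brd C A ?I"
    by (simp add: lun_tob tar_merge)
  finally have "run C A \<otimes> idn C ?I = (brd C A ?I \<Zsemi> lun C A) \<otimes> idn C ?I"
    by (subst (asm) iso_cancel_right) simp_all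
  then show ?thesis by (rule tar_unt_cancel[symmetric, rotated -1]) simp_all
qed

lemma brd_run:
  assumes [simp]: "A \<in> obj C"
  shows "brd C (unt C) A \<Zsemi> run C A = lun C A"
  by (simp flip: brd_lun)

end

section \<open>Coherence\<close>

text \<open>A deleted leaf becomes \<open>One\<close> instead of vanishing, so the shape of the word
  is kept and every generator of \<open>coherence\<close> is sent to a generator of the same
  kind.\<close>

primrec del :: "'x \<Rightarrow> 'x word \<Rightarrow> 'x word" where
  "del x One = One"
| "del x (Leaf y) = (if y = x then One else Leaf y)"
| "del x (Prod u v) = Prod (del x u) (del x v)"

lemma del_id: "x \<notin> set (leaves u) \<Longrightarrow> del x u = u"
  by (induction u) auto

lemma leaves_del: "leaves (del x u) = filter (\<lambda>y. y \<noteq> x) (leaves u)"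
  by (induction u) auto

lemma coherence_leaves: "coherence C t u v f \<Longrightarrow> mset (leaves u) = mset (leaves v)"
  by (induction rule: coherence.induct) auto

lemma coherence_set_leaves: "coherence C t u v f \<Longrightarrow> set (leaves u) = set (leaves v)"
  by (drule coherence_leaves) (metis set_mset_mset)

lemma coherence_distinct: "coherence C t u v f \<Longrightarrow> distinct (leaves u) \<longleftrightarrow> distinct (leaves v)"
  by (drule coherence_leaves) (metis mset_eq_imp_distinct_iff)

context symmetric_monoidal_category
begin

lemma asc_nat':
  "\<lbrakk>f \<in> arr C; g \<in> arr C; h \<in> arr C; Dom C f = A; Dom C g = B; Dom C h = D\<rbrakk> \<Longrightarrow>
    asc C A B D \<Zsemi> (f \<otimes> (g \<otimes> h)) = ((f \<otimes> g) \<otimes> h) \<Zsemi> asc C (Cod C f) (Cod C g) (Cod C h)"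
  by (simp add: asc_nat)

lemma brd_nat':
  "\<lbrakk>f \<in> arr C; g \<in> arr C; Dom C f = A; Dom C g = B\<rbrakk> \<Longrightarrow>
    brd C A B \<Zsemi> (g \<otimes> f) = (f \<otimes> g) \<Zsemi> brd C (Cod C f) (Cod C g)"
  by (simp add: brd_nat)

section \<open>Moving the middle factor to the front\<close>

definition mid where
  "mid A X B = ainv (asc C A X B) \<Zsemi> (brd C A X \<otimes> idn C B) \<Zsemi> asc C X A B"

lemma mid_simps [simp]:
  assumes "A \<in> obj C" "X \<in> obj C" "B \<in> obj C"
  shows "mid A X B \<in> arr C" "Dom C (mid A X B) = A \<boxtimes> (X \<boxtimes> B)" "Cod C (mid A X B) = X \<boxtimes> (A \<boxtimes> B)"
    "iso (mid A X B)"
  using assms by (simp_all add: mid_def)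

lemma mid_nat:
  assumes [simp]: "f \<in> arr C" "g \<in> arr C" "h \<in> arr C" "Cod C f = A" "Cod C g = X" "Cod C h = B"
  shows "(f \<otimes> (g \<otimes> h)) \<Zsemi> mid A X B = mid (Dom C f) (Dom C g) (Dom C h) \<Zsemi> (g \<otimes> (f \<otimes> h))"
proof -
  have o [simp]: "A \<in> obj C" "X \<in> obj C" "B \<in> obj C"
    using assms Dom_Cod_obj by metis+
  have "(f \<otimes> (g \<otimes> h)) \<Zsemi> mid A X B
    = ((f \<otimes> (g \<otimes> h)) \<Zsemi> ainv (asc C A X B)) \<Zsemi> (brd C A X \<otimes> idn C B) \<Zsemi> asc C X A B"
    by (simp add: mid_def)
  also have "\<dots> = ainv (asc C (Dom C f) (Dom C g) (Dom C h)) \<Zsemi>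
      (((f \<otimes> g) \<Zsemi> brd C A X) \<otimes> (h \<Zsemi> idn C B)) \<Zsemi> asc C X A B"
    by (subst ainv_asc_nat) (simp_all add: tar_merge)
  also have "\<dots> = ainv (asc C (Dom C f) (Dom C g) (Dom C h)) \<Zsemi>
      ((brd C (Dom C f) (Dom C g) \<otimes> idn C (Dom C h)) \<Zsemi> ((g \<otimes> f) \<otimes> h)) \<Zsemi> asc C X A B"
    by (subst brd_nat) (simp_all add: tar_merge)
  also have "\<dots> = mid (Dom C f) (Dom C g) (Dom C h) \<Zsemi> (g \<otimes> (f \<otimes> h))"
    by (simp add: mid_def asc_nat)
  finally show ?thesis .
qed

lemma mid_mid:
  assumes [simp]: "A \<in> obj C" "X \<in> obj C" "B \<in> obj C"
  shows "mid A X B \<Zsemi> mid X A B = idn C (A \<boxtimes> (X \<boxtimes> B))"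
  by (simp add: mid_def tar_merge)

text \<open>The case of the associator in which the moved factor heads the second of three factors.
  The pentagons for \<open>A\<close>, \<open>X\<close>, \<open>B\<close>, \<open>D\<close> and for
  \<open>X\<close>, \<open>A\<close>, \<open>B\<close>, \<open>D\<close> enclose naturality of the
  associator with respect to the braiding.\<close>

lemma mid_asc_middle:
  assumes [simp]: "A \<in> obj C" "X \<in> obj C" "B \<in> obj C" "D \<in> obj C"
  shows "asc C A (X \<boxtimes> B) D \<Zsemi> (idn C A \<otimes> asc C X B D) \<Zsemi> mid A X (B \<boxtimes> D) =
    (mid A X B \<otimes> idn C D) \<Zsemi> asc C X (A \<boxtimes> B) D \<Zsemi> (idn C X \<otimes> asc C A B D)"
proof -
  have "asc C A (X \<boxtimes> B) D \<Zsemi> (idn C A \<otimes> asc C X B D) \<Zsemi> mid A X (B \<boxtimes> D)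
    = (ainv (asc C A X B) \<otimes> idn C D) \<Zsemi>
      ((asc C A X B \<otimes> idn C D) \<Zsemi> asc C A (X \<boxtimes> B) D \<Zsemi> (idn C A \<otimes> asc C X B D)) \<Zsemi> mid A X (B \<boxtimes> D)"
    by (simp add: tar_merge)
  also have "\<dots> = (ainv (asc C A X B) \<otimes> idn C D) \<Zsemi> asc C (A \<boxtimes> X) B D \<Zsemi>
      ((brd C A X \<otimes> (idn C B \<otimes> idn C D)) \<Zsemi> asc C X A (B \<boxtimes> D))"
    by (subst pentagon[symmetric]) (simp_all add: mid_def)
  also have "\<dots> = (ainv (asc C A X B) \<otimes> idn C D) \<Zsemi>
      (asc C (A \<boxtimes> X) B D \<Zsemi> (brd C A X \<otimes> (idn C B \<otimes> idn C D))) \<Zsemi> asc C X A (B \<boxtimes> D)"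
    by simp
  also have "\<dots> = (ainv (asc C A X B) \<otimes> idn C D) \<Zsemi>
      (((brd C A X \<otimes> idn C B) \<otimes> idn C D) \<Zsemi> asc C (X \<boxtimes> A) B D) \<Zsemi> asc C X A (B \<boxtimes> D)"
    by (subst asc_nat) simp_all
  also have "\<dots> = (ainv (asc C A X B) \<otimes> idn C D) \<Zsemi> ((brd C A X \<otimes> idn C B) \<otimes> idn C D) \<Zsemi>
      (asc C (X \<boxtimes> A) B D \<Zsemi> asc C X A (B \<boxtimes> D))"
    by simp
  also have "\<dots> = (mid A X B \<otimes> idn C D) \<Zsemi> asc C X (A \<boxtimes> B) D \<Zsemi> (idn C X \<otimes> asc C A B D)"
    by (subst pentagon) (simp_all add: mid_def tar_merge)
  finally show ?thesis .
qed

text \<open>The locale provides one hexagon. Inverting it, and using that a braiding is inverse to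
  the opposite braiding, gives the other one, stated here through \<open>mid\<close>.\<close>

lemma brd_tob_left:
  assumes [simp]: "A \<in> obj C" "B \<in> obj C" "X \<in> obj C"
  shows "brd C (A \<boxtimes> B) X = asc C A B X \<Zsemi> (idn C A \<otimes> brd C B X) \<Zsemi> mid A X B"
proof -
  have "ainv (asc C X A B \<Zsemi> brd C X (A \<boxtimes> B) \<Zsemi> asc C A B X) =
      ainv ((brd C X A \<otimes> idn C B) \<Zsemi> asc C A X B \<Zsemi> (idn C A \<otimes> brd C X B))"
    by (simp only: hexagon assms)
  moreover have inv_brd: "ainv (brd C P Q) = brd C Q P" if "P \<in> obj C" "Q \<in> obj C" for P Q
    by (rule ainv_eqI) (use that in simp_all)
  ultimately have "ainv (asc C A B X) \<Zsemi> brd C (A \<boxtimes> B) X \<Zsemi> ainv (asc C X A B) =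
      (idn C A \<otimes> brd C B X) \<Zsemi> ainv (asc C A X B) \<Zsemi> (brd C A X \<otimes> idn C B)"
    by (simp add: ainv_cmp ainv_tar)
  then have "asc C A B X \<Zsemi> (ainv (asc C A B X) \<Zsemi> brd C (A \<boxtimes> B) X \<Zsemi> ainv (asc C X A B)) \<Zsemi> asc C X A B =
      asc C A B X \<Zsemi> ((idn C A \<otimes> brd C B X) \<Zsemi> ainv (asc C A X B) \<Zsemi> (brd C A X \<otimes> idn C B)) \<Zsemi> asc C X A B"
    by simp
  then show ?thesis by (simp add: mid_def)
qed

text \<open>The case of the associator in which the moved factor heads the third factor: passing
  \<open>A \<boxtimes> B\<close> at once agrees with passing \<open>B\<close> and then
  \<open>A\<close>. The braiding past the product is split by \<open>brd_tob_left\<close>, and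
  \<open>mid_asc_middle\<close> finishes.\<close>

lemma mid_asc_right:
  assumes [simp]: "A \<in> obj C" "B \<in> obj C" "X \<in> obj C" "D \<in> obj C"
  shows "asc C A B (X \<boxtimes> D) \<Zsemi> (idn C A \<otimes> mid B X D) \<Zsemi> mid A X (B \<boxtimes> D) =
    mid (A \<boxtimes> B) X D \<Zsemi> (idn C X \<otimes> asc C A B D)"
proof -
  have "asc C A B (X \<boxtimes> D) \<Zsemi> (idn C A \<otimes> ainv (asc C B X D)) =
      ainv (asc C (A \<boxtimes> B) X D) \<Zsemi> (asc C (A \<boxtimes> B) X D \<Zsemi> asc C A B (X \<boxtimes> D)) \<Zsemi>
      (idn C A \<otimes> ainv (asc C B X D))"
    by simp
  also have "\<dots> = ainv (asc C (A \<boxtimes> B) X D) \<Zsemi> (asc C A B X \<otimes> idn C D) \<Zsemi> asc C A (B \<boxtimes> X) D"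
    by (subst pentagon) (simp_all add: tar_merge)
  finally have p: "asc C A B (X \<boxtimes> D) \<Zsemi> (idn C A \<otimes> ainv (asc C B X D)) =
      ainv (asc C (A \<boxtimes> B) X D) \<Zsemi> (asc C A B X \<otimes> idn C D) \<Zsemi> asc C A (B \<boxtimes> X) D" .
  have "mid (A \<boxtimes> B) X D \<Zsemi> (idn C X \<otimes> asc C A B D) =
      ainv (asc C (A \<boxtimes> B) X D) \<Zsemi> (asc C A B X \<otimes> idn C D) \<Zsemi> ((idn C A \<otimes> brd C B X) \<otimes> idn C D) \<Zsemi>
      ((mid A X B \<otimes> idn C D) \<Zsemi> asc C X (A \<boxtimes> B) D \<Zsemi> (idn C X \<otimes> asc C A B D))"
    by (subst mid_def, subst brd_tob_left) (simp_all add: tar_merge)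
  also have "\<dots> = ainv (asc C (A \<boxtimes> B) X D) \<Zsemi> (asc C A B X \<otimes> idn C D) \<Zsemi>
      (((idn C A \<otimes> brd C B X) \<otimes> idn C D) \<Zsemi> asc C A (X \<boxtimes> B) D) \<Zsemi>
      (idn C A \<otimes> asc C X B D) \<Zsemi> mid A X (B \<boxtimes> D)"
    by (subst mid_asc_middle[symmetric]) simp_all
  also have "\<dots> = (ainv (asc C (A \<boxtimes> B) X D) \<Zsemi> (asc C A B X \<otimes> idn C D) \<Zsemi> asc C A (B \<boxtimes> X) D) \<Zsemi>
      (idn C A \<otimes> (brd C B X \<otimes> idn C D)) \<Zsemi>
      (idn C A \<otimes> asc C X B D) \<Zsemi> mid A X (B \<boxtimes> D)"
    by (subst asc_nat) simp_all
  also have "\<dots> = asc C A B (X \<boxtimes> D) \<Zsemi> (idn C A \<otimes> mid B X D) \<Zsemi> mid A X (B \<boxtimes> D)"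
    by (subst p[symmetric]) (simp_all add: mid_def tar_merge)
  finally show ?thesis ..
qed

lemma mid_brd_left:
  assumes [simp]: "X \<in> obj C" "A \<in> obj C" "B \<in> obj C"
  shows "brd C (X \<boxtimes> A) B \<Zsemi> mid B X A = asc C X A B \<Zsemi> (idn C X \<otimes> brd C A B)"
  by (subst brd_tob_left) (simp_all add: mid_mid)

lemma mid_brd_right:
  assumes [simp]: "A \<in> obj C" "X \<in> obj C" "B \<in> obj C"
  shows "brd C A (X \<boxtimes> B) \<Zsemi> asc C X B A = mid A X B \<Zsemi> (idn C X \<otimes> brd C A B)"
proof -
  have "brd C A (X \<boxtimes> B) \<Zsemi> asc C X B A =
      ainv (asc C A X B) \<Zsemi> (asc C A X B \<Zsemi> brd C A (X \<boxtimes> B) \<Zsemi> asc C X B A)"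
    by simp
  also have "\<dots> = mid A X B \<Zsemi> (idn C X \<otimes> brd C A B)"
    by (subst hexagon) (simp_all add: mid_def)
  finally show ?thesis .
qed

lemma mid_lun:
  assumes [simp]: "X \<in> obj C" "A \<in> obj C"
  shows "mid (unt C) X A \<Zsemi> (idn C X \<otimes> lun C A) = lun C (X \<boxtimes> A)"
proof -
  have "mid (unt C) X A \<Zsemi> (idn C X \<otimes> lun C A) =
      ainv (asc C (unt C) X A) \<Zsemi> (lun C X \<otimes> idn C A)"
    by (simp add: mid_def triangle tar_merge brd_run)
  then show ?thesis by (simp flip: lun_tob)
qed

lemma interp_obj [simp]: "\<forall>x\<in>set (leaves u). t x \<in> obj C \<Longrightarrow> interp C t u \<in> obj C"
  by (induction u) auto

lemma coherence_iso_arr: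
  assumes "coherence C t u v f" "\<forall>x\<in>set (leaves u). t x \<in> obj C"
  shows "iso f" "Dom C f = interp C t u" "Cod C f = interp C t v"
proof -
  have "iso f \<and> Dom C f = interp C t u \<and> Cod C f = interp C t v"
    using assms
  proof (induction rule: coherence.induct)
    case (coh_cmp u v f w g)
    then show ?case using coherence_set_leaves by force
  next
    case (coh_inv u v f g)
    have "g = ainv f" by (rule ainv_unique[OF coh_inv.hyps(2)])
    with coh_inv show ?case using coherence_set_leaves by force
  qed auto
  then show "iso f" "Dom C f = interp C t u" "Cod C f = interp C t v" by auto
qed

lemma coherence_ainv:
  assumes "coherence C t u v f" "\<forall>x\<in>set (leaves u). t x \<in> obj C"
  shows "coherence C t v u (ainv f)"
  using coherence_iso_arr[OF assms] inverse_in_ainv[of f] coh_inv[OF assms(1)] by simp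

text \<open>\<open>pull\<close> moves the leaf \<open>x\<close> to the front, leaving the unit in its place.\<close>

primrec pull where
  "pull x t One = undefined"
| "pull x t (Leaf y) = ainv (run C (t y))"
| "pull x t (Prod u v) = (if x \<in> set (leaves u)
    then (pull x t u \<otimes> idn C (interp C t v)) \<Zsemi> asc C (t x) (interp C t (del x u)) (interp C t v)
    else (idn C (interp C t u) \<otimes> pull x t v) \<Zsemi> mid (interp C t u) (t x) (interp C t (del x v)))"

lemma pull_simps:
  assumes "x \<in> set (leaves u)" "distinct (leaves u)" "\<forall>y\<in>set (leaves u). t y \<in> obj C"
  shows "iso (pull x t u) \<and> Dom C (pull x t u) = interp C t u \<and>
    Cod C (pull x t u) = t x \<boxtimes> interp C t (del x u)"
  using assms
proof (induction u)
  case (Prod u v)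
  have "interp C t (del x w) \<in> obj C" if "w = u \<or> w = v" for w
    using Prod.prems that by (intro interp_obj) (auto simp: leaves_del)
  moreover have "x \<in> set (leaves u) \<Longrightarrow> del x v = v" "x \<notin> set (leaves u) \<Longrightarrow> del x u = u"
    using Prod.prems by (auto intro!: del_id)
  ultimately show ?case
    using Prod by (cases "x \<in> set (leaves u)") auto
qed auto

text \<open>Since pulling a leaf out is itself a structural morphism, a morphism between two words
  can be assembled from two pulls and a morphism between the shorter words;
  \<open>coherence_exists\<close> does this.\<close>

lemma coherence_pull:
  assumes "x \<in> set (leaves u)" "distinct (leaves u)" "\<forall>y\<in>set (leaves u). t y \<in> obj C"
  shows "coherence C t u (Prod (Leaf x) (del x u)) (pull x t u)"
  using assms
proof (induction u)
  case (Leaf y)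
  then show ?case
    using coherence_ainv[OF coh_run[of C t "Leaf y"]] by auto
next
  case (Prod u v)
  show ?case
  proof (cases "x \<in> set (leaves u)")
    case True
    then have "del x v = v" using Prod.prems by (auto intro!: del_id)
    then show ?thesis
      using Prod True coh_cmp[OF coh_tar[OF _ coh_idn] coh_asc, of C t u "Leaf x" "del x u" _ v] by simp
  next
    case False
    let ?X = "Leaf x"
    have u: "del x u = u" and v: "x \<in> set (leaves v)" using False Prod.prems by (auto intro!: del_id)
    have o: "\<forall>y\<in>set (leaves (Prod u (Prod ?X (del x v)))). t y \<in> obj C"
      using Prod.prems by (auto simp: leaves_del)
    have "coherence C t (Prod u (Prod ?X (del x v))) (Prod ?X (Prod u (del x v)))
        (mid (interp C t u) (t x) (interp C t (del x v)))"
      unfolding mid_def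
      using coh_cmp[OF coh_cmp[OF coherence_ainv[OF coh_asc[of C t u ?X "del x v"]]
            coh_tar[OF coh_brd coh_idn]] coh_asc] o by simp
    then show ?thesis
      using Prod v False u coh_cmp[OF coh_tar[OF coh_idn, of C t v _ _ u]] by simp
  qed
qed auto

text \<open>The induction follows the generators. The associator splits according to the factor that
  contains \<open>x\<close>, which gives the pentagon, \<open>mid_asc_middle\<close> and
  \<open>mid_asc_right\<close>; the braiding gives \<open>mid_brd_left\<close> and
  \<open>mid_brd_right\<close>; the units give \<open>mid_lun\<close> and \<open>run_tob\<close>.
  Each generator thus restricts to the one of the same kind on the words without
  \<open>x\<close>.\<close>

lemma pull_natural:
  assumes "coherence C t u v f" "x \<in> set (leaves u)" "distinct (leaves u)"
    "\<forall>y\<in>set (leaves u). t y \<in> obj C"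
  shows "\<exists>f'. coherence C t (del x u) (del x v) f' \<and>
    f \<Zsemi> pull x t v = pull x t u \<Zsemi> (idn C (t x) \<otimes> f')"
  using assms
proof (induction rule: coherence.induct)
  case (coh_idn u)
  then have "idn C (interp C t u) \<Zsemi> pull x t u = pull x t u \<Zsemi> (idn C (t x) \<otimes> idn C (interp C t (del x u)))"
    using pull_simps[of x u t] by (simp add: leaves_del)
  then show ?case using coherence.coh_idn by blast
next
  case (coh_cmp u v f w g)
  have v: "x \<in> set (leaves v)" "distinct (leaves v)" "\<forall>y\<in>set (leaves v). t y \<in> obj C"
    using coherence_set_leaves[OF coh_cmp.hyps(1)] coherence_distinct[OF coh_cmp.hyps(1)] coh_cmp.prems
    by auto
  have w: "x \<in> set (leaves w)" "distinct (leaves w)" "\<forall>y\<in>set (leaves w). t y \<in> obj C"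
    using coherence_set_leaves[OF coh_cmp.hyps(2)] coherence_distinct[OF coh_cmp.hyps(2)] v by auto
  obtain f' g' where f': "coherence C t (del x u) (del x v) f'"
      "f \<Zsemi> pull x t v = pull x t u \<Zsemi> (idn C (t x) \<otimes> f')"
    and g': "coherence C t (del x v) (del x w) g'"
      "g \<Zsemi> pull x t w = pull x t v \<Zsemi> (idn C (t x) \<otimes> g')"
    using coh_cmp.IH coh_cmp.prems v by blast
  have o: "\<forall>y\<in>set (leaves (del x u)). t y \<in> obj C" "\<forall>y\<in>set (leaves (del x v)). t y \<in> obj C"
    using v(3) coh_cmp.prems by (auto simp: leaves_del)
  note [simp] = coherence_iso_arr[OF f'(1) o(1)] coherence_iso_arr[OF g'(1) o(2)]
    coherence_iso_arr[OF coh_cmp.hyps(1) coh_cmp.prems(3)] coherence_iso_arr[OF coh_cmp.hyps(2) v(3)]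
    pull_simps[OF v] pull_simps[OF w] pull_simps[OF coh_cmp.prems]
  have [simp]: "t x \<in> obj C" using v by auto
  have "(f \<Zsemi> g) \<Zsemi> pull x t w = f \<Zsemi> (g \<Zsemi> pull x t w)" by simp
  also have "\<dots> = (f \<Zsemi> pull x t v) \<Zsemi> (idn C (t x) \<otimes> g')" by (simp add: g'(2))
  also have "\<dots> = pull x t u \<Zsemi> (idn C (t x) \<otimes> (f' \<Zsemi> g'))" by (simp add: f'(2) tar_merge)
  finally show ?case using coherence.coh_cmp[OF f'(1) g'(1)] by blast
next
  case (coh_tar u v f u' v' f')
  note sets = coherence_set_leaves[OF coh_tar.hyps(1)] coherence_set_leaves[OF coh_tar.hyps(2)]
  note dists = coherence_distinct[OF coh_tar.hyps(1)] coherence_distinct[OF coh_tar.hyps(2)]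
  have o: "\<forall>y\<in>set (leaves u). t y \<in> obj C" "\<forall>y\<in>set (leaves u'). t y \<in> obj C" and [simp]: "t x \<in> obj C"
    "interp C t u \<in> obj C" "interp C t u' \<in> obj C" "interp C t v \<in> obj C" "interp C t v' \<in> obj C"
    "interp C t (del x u) \<in> obj C" "interp C t (del x u') \<in> obj C"
    "interp C t (del x v) \<in> obj C" "interp C t (del x v') \<in> obj C"
    using coh_tar.prems sets by (auto simp: leaves_del)
  note [simp] = coherence_iso_arr[OF coh_tar.hyps(1) o(1)] coherence_iso_arr[OF coh_tar.hyps(2) o(2)]
  show ?case
  proof (cases "x \<in> set (leaves u)")
    case True
    then have ids [simp]: "del x u' = u'" "del x v' = v'" and v: "x \<in> set (leaves v)"
      using coh_tar.prems sets by (auto intro!: del_id)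
    obtain h where h: "coherence C t (del x u) (del x v) h"
      "f \<Zsemi> pull x t v = pull x t u \<Zsemi> (idn C (t x) \<otimes> h)"
      using coh_tar.IH(1) coh_tar.prems o True by auto
    have [simp]: "iso h" "Dom C h = interp C t (del x u)" "Cod C h = interp C t (del x v)"
      using coherence_iso_arr[OF h(1)] coh_tar.prems by (auto simp: leaves_del)
      have [simp]: "iso (pull x t u) \<and> Dom C (pull x t u) = interp C t u \<and>
        Cod C (pull x t u) = t x \<boxtimes> interp C t (del x u)"
      "iso (pull x t v) \<and> Dom C (pull x t v) = interp C t v \<and>
        Cod C (pull x t v) = t x \<boxtimes> interp C t (del x v)"
      by (rule pull_simps; use True v o coh_tar.prems dists sets in auto)+
    have "(f \<otimes> f') \<Zsemi> pull x t (Prod v v') =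
        ((f \<Zsemi> pull x t v) \<otimes> f') \<Zsemi> asc C (t x) (interp C t (del x v)) (interp C t v')"
      using v by (simp add: tar_merge)
    also have "\<dots> = (pull x t u \<otimes> idn C (interp C t u')) \<Zsemi> (((idn C (t x) \<otimes> h) \<otimes> f') \<Zsemi>
        asc C (t x) (interp C t (del x v)) (interp C t v'))"
      by (simp add: h(2) tar_merge)
    also have "\<dots> = pull x t (Prod u u') \<Zsemi> (idn C (t x) \<otimes> (h \<otimes> f'))"
      using True by (subst asc_nat) simp_all
    finally show ?thesis
      using coherence.coh_tar[OF h(1) coh_tar.hyps(2)] ids by auto
  next
    case False
    then have ids [simp]: "del x u = u" "del x v = v" and nv: "x \<notin> set (leaves v)"
      and u': "x \<in> set (leaves u')" "x \<in> set (leaves v')"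
      using coh_tar.prems sets by (auto intro!: del_id)
    obtain h where h: "coherence C t (del x u') (del x v') h"
      "f' \<Zsemi> pull x t v' = pull x t u' \<Zsemi> (idn C (t x) \<otimes> h)"
      using coh_tar.IH(2) coh_tar.prems o u' by auto
    have [simp]: "iso h" "Dom C h = interp C t (del x u')" "Cod C h = interp C t (del x v')"
      using coherence_iso_arr[OF h(1)] coh_tar.prems by (auto simp: leaves_del)
    have [simp]: "iso (pull x t u') \<and> Dom C (pull x t u') = interp C t u' \<and>
        Cod C (pull x t u') = t x \<boxtimes> interp C t (del x u')"
      "iso (pull x t v') \<and> Dom C (pull x t v') = interp C t v' \<and>
        Cod C (pull x t v') = t x \<boxtimes> interp C t (del x v')"
      by (rule pull_simps; use u' o coh_tar.prems dists sets in auto)+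
    have "(f \<otimes> f') \<Zsemi> pull x t (Prod v v') =
        (f \<otimes> (f' \<Zsemi> pull x t v')) \<Zsemi> mid (interp C t v) (t x) (interp C t (del x v'))"
      using nv by (simp add: tar_merge)
    also have "\<dots> = (idn C (interp C t u) \<otimes> pull x t u') \<Zsemi> ((f \<otimes> (idn C (t x) \<otimes> h)) \<Zsemi>
        mid (interp C t v) (t x) (interp C t (del x v')))"
      by (simp add: h(2) tar_merge)
    also have "\<dots> = pull x t (Prod u u') \<Zsemi> (idn C (t x) \<otimes> (f \<otimes> h))"
      using False by (subst mid_nat) simp_all
    finally show ?thesis
      using coherence.coh_tar[OF coh_tar.hyps(1) h(1)] ids by auto
  qed
next
  case (coh_inv u v f g)
  have u: "x \<in> set (leaves u)" "distinct (leaves u)" "\<forall>y\<in>set (leaves u). t y \<in> obj C"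
    using coherence_set_leaves[OF coh_inv.hyps(1)] coherence_distinct[OF coh_inv.hyps(1)] coh_inv.prems
    by auto
  obtain f' where f': "coherence C t (del x u) (del x v) f'"
      "f \<Zsemi> pull x t v = pull x t u \<Zsemi> (idn C (t x) \<otimes> f')"
    using coh_inv.IH u by blast
  have o: "\<forall>y\<in>set (leaves (del x u)). t y \<in> obj C"
    and [simp]: "t x \<in> obj C" "interp C t (del x u) \<in> obj C"
    using u by (auto simp: leaves_del)
  note [simp] = coherence_iso_arr[OF f'(1) o] coherence_iso_arr[OF coh_inv.hyps(1) u(3)]
    pull_simps[OF u] pull_simps[OF coh_inv.prems]
  have g: "g = ainv f" by (rule ainv_unique[OF coh_inv.hyps(2)])
  have "g \<Zsemi> pull x t u = ainv f \<Zsemi> (pull x t u \<Zsemi> (idn C (t x) \<otimes> f')) \<Zsemi> (idn C (t x) \<otimes> ainv f')"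
    by (simp add: g tar_merge)
  also have "\<dots> = pull x t v \<Zsemi> (idn C (t x) \<otimes> ainv f')"
    by (subst f'(2)[symmetric]) simp
  finally show ?case using coherence_ainv[OF f'(1) o] by blast
next
  case (coh_asc u v w)
  have o: "\<forall>y\<in>set (leaves u). t y \<in> obj C" "\<forall>y\<in>set (leaves v). t y \<in> obj C"
    "\<forall>y\<in>set (leaves w). t y \<in> obj C" and [simp]: "t x \<in> obj C"
    "interp C t u \<in> obj C" "interp C t v \<in> obj C" "interp C t w \<in> obj C"
    "interp C t (del x u) \<in> obj C" "interp C t (del x v) \<in> obj C" "interp C t (del x w) \<in> obj C"
    using coh_asc.prems by (auto simp: leaves_del)
  have [simp]: "iso (pull x t z) \<and> Dom C (pull x t z) = interp C t z \<and>
      Cod C (pull x t z) = t x \<boxtimes> interp C t (del x z)" if "z \<in> {u, v, w}" "x \<in> set (leaves z)" for z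
    using coh_asc.prems that by (intro pull_simps) auto
  let ?a = "asc C (interp C t (del x u)) (interp C t (del x v)) (interp C t (del x w))"
  have "asc C (interp C t u) (interp C t v) (interp C t w) \<Zsemi> pull x t (Prod u (Prod v w)) =
      pull x t (Prod (Prod u v) w) \<Zsemi> (idn C (t x) \<otimes> ?a)"
  proof -
    \<comment> \<open>Distinctness of the leaves puts \<open>x\<close> in exactly one of the three
      factors.\<close>
    consider (u) "x \<in> set (leaves u)" "x \<notin> set (leaves v)" "x \<notin> set (leaves w)"
      | (v) "x \<notin> set (leaves u)" "x \<in> set (leaves v)" "x \<notin> set (leaves w)"
      | (w) "x \<notin> set (leaves u)" "x \<notin> set (leaves v)" "x \<in> set (leaves w)"
      using coh_asc.prems by auto
    then show ?thesis
    proof cases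
      case u
      have "asc C (interp C t u) (interp C t v) (interp C t w) \<Zsemi> pull x t (Prod u (Prod v w)) =
        (asc C (interp C t u) (interp C t v) (interp C t w) \<Zsemi>
          (pull x t u \<otimes> (idn C (interp C t v) \<otimes> idn C (interp C t w)))) \<Zsemi>
          asc C (t x) (interp C t (del x u)) (interp C t v \<boxtimes> interp C t w)"
        using u by simp
      also have "\<dots> = ((pull x t u \<otimes> idn C (interp C t v)) \<otimes> idn C (interp C t w)) \<Zsemi>
          (asc C (t x \<boxtimes> interp C t (del x u)) (interp C t v) (interp C t w) \<Zsemi>
          asc C (t x) (interp C t (del x u)) (interp C t v \<boxtimes> interp C t w))"
        using u by (subst asc_nat') simp_all
      also have "\<dots> = pull x t (Prod (Prod u v) w) \<Zsemi> (idn C (t x) \<otimes> ?a)"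
        using u by (subst pentagon) (simp_all add: del_id tar_merge)
      finally show ?thesis .
    next
      case v
      have "asc C (interp C t u) (interp C t v) (interp C t w) \<Zsemi> pull x t (Prod u (Prod v w)) =
        (asc C (interp C t u) (interp C t v) (interp C t w) \<Zsemi>
          (idn C (interp C t u) \<otimes> (pull x t v \<otimes> idn C (interp C t w)))) \<Zsemi>
          (idn C (interp C t u) \<otimes> asc C (t x) (interp C t (del x v)) (interp C t w)) \<Zsemi>
          mid (interp C t u) (t x) (interp C t (del x v) \<boxtimes> interp C t w)"
        using v by (simp add: del_id tar_merge)
      also have "\<dots> = ((idn C (interp C t u) \<otimes> pull x t v) \<otimes> idn C (interp C t w)) \<Zsemi>
          (asc C (interp C t u) (t x \<boxtimes> interp C t (del x v)) (interp C t w) \<Zsemi>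
          (idn C (interp C t u) \<otimes> asc C (t x) (interp C t (del x v)) (interp C t w)) \<Zsemi>
          mid (interp C t u) (t x) (interp C t (del x v) \<boxtimes> interp C t w))"
        using v by (subst asc_nat') simp_all
      also have "\<dots> = pull x t (Prod (Prod u v) w) \<Zsemi> (idn C (t x) \<otimes> ?a)"
        using v by (subst mid_asc_middle) (simp_all add: del_id tar_merge)
      finally show ?thesis .
    next
      case w
      have "asc C (interp C t u) (interp C t v) (interp C t w) \<Zsemi> pull x t (Prod u (Prod v w)) =
        (asc C (interp C t u) (interp C t v) (interp C t w) \<Zsemi>
          (idn C (interp C t u) \<otimes> (idn C (interp C t v) \<otimes> pull x t w))) \<Zsemi>
          (idn C (interp C t u) \<otimes> mid (interp C t v) (t x) (interp C t (del x w))) \<Zsemi>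
          mid (interp C t u) (t x) (interp C t v \<boxtimes> interp C t (del x w))"
        using w by (simp add: del_id tar_merge)
      also have "\<dots> = ((idn C (interp C t u) \<otimes> idn C (interp C t v)) \<otimes> pull x t w) \<Zsemi>
          (asc C (interp C t u) (interp C t v) (t x \<boxtimes> interp C t (del x w)) \<Zsemi>
          (idn C (interp C t u) \<otimes> mid (interp C t v) (t x) (interp C t (del x w))) \<Zsemi>
          mid (interp C t u) (t x) (interp C t v \<boxtimes> interp C t (del x w)))"
        using w by (subst asc_nat') simp_all
      also have "\<dots> = pull x t (Prod (Prod u v) w) \<Zsemi> (idn C (t x) \<otimes> ?a)"
        using w by (subst mid_asc_right) (simp_all add: del_id)
      finally show ?thesis .
    qed
  qed
  then show ?case using coherence.coh_asc[of C t "del x u" "del x v" "del x w"] by auto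
next
  case (coh_lun u)
  have u: "x \<in> set (leaves u)" "distinct (leaves u)" "\<forall>y\<in>set (leaves u). t y \<in> obj C"
    using coh_lun by auto
  have [simp]: "t x \<in> obj C" "interp C t u \<in> obj C" "interp C t (del x u) \<in> obj C"
    using u by (auto simp: leaves_del)
  have "lun C (interp C t u) \<Zsemi> pull x t u =
      pull x t (Prod One u) \<Zsemi> (idn C (t x) \<otimes> lun C (interp C t (del x u)))"
    using pull_simps[OF u] by (simp add: mid_lun lun_nat)
  then show ?case using coherence.coh_lun[of C t "del x u"] by auto
next
  case (coh_run u)
  have u: "x \<in> set (leaves u)" "distinct (leaves u)" "\<forall>y\<in>set (leaves u). t y \<in> obj C"
    using coh_run by auto
  have [simp]: "t x \<in> obj C" "interp C t u \<in> obj C" "interp C t (del x u) \<in> obj C"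
    using u by (auto simp: leaves_del)
  have "run C (interp C t u) \<Zsemi> pull x t u =
      pull x t (Prod u One) \<Zsemi> (idn C (t x) \<otimes> run C (interp C t (del x u)))"
    using pull_simps[OF u] u by (simp add: run_tob run_nat)
  then show ?case using coherence.coh_run[of C t "del x u"] by auto
next
  case (coh_brd u v)
  have [simp]: "t x \<in> obj C"
    "interp C t u \<in> obj C" "interp C t v \<in> obj C"
    "interp C t (del x u) \<in> obj C" "interp C t (del x v) \<in> obj C"
    using coh_brd.prems by (auto simp: leaves_del)
  have [simp]: "iso (pull x t z) \<and> Dom C (pull x t z) = interp C t z \<and>
      Cod C (pull x t z) = t x \<boxtimes> interp C t (del x z)" if "z \<in> {u, v}" "x \<in> set (leaves z)" for z
    using coh_brd.prems that by (intro pull_simps) auto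
  have "brd C (interp C t u) (interp C t v) \<Zsemi> pull x t (Prod v u) =
      pull x t (Prod u v) \<Zsemi> (idn C (t x) \<otimes> brd C (interp C t (del x u)) (interp C t (del x v)))"
  proof -
    consider (u) "x \<in> set (leaves u)" "x \<notin> set (leaves v)" | (v) "x \<notin> set (leaves u)" "x \<in> set (leaves v)"
      using coh_brd.prems by auto
    then show ?thesis
    proof cases
      case u
      have "brd C (interp C t u) (interp C t v) \<Zsemi> pull x t (Prod v u) =
          (brd C (interp C t u) (interp C t v) \<Zsemi> (idn C (interp C t v) \<otimes> pull x t u)) \<Zsemi>
          mid (interp C t v) (t x) (interp C t (del x u))"
        using u by simp
      also have "\<dots> = (pull x t u \<otimes> idn C (interp C t v)) \<Zsemi>
          (brd C (t x \<boxtimes> interp C t (del x u)) (interp C t v) \<Zsemi>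
          mid (interp C t v) (t x) (interp C t (del x u)))"
        using u by (subst brd_nat') simp_all
      also have "\<dots> = pull x t (Prod u v) \<Zsemi>
          (idn C (t x) \<otimes> brd C (interp C t (del x u)) (interp C t (del x v)))"
        using u by (subst mid_brd_left) (simp_all add: del_id)
      finally show ?thesis .
    next
      case v
      have "brd C (interp C t u) (interp C t v) \<Zsemi> pull x t (Prod v u) =
          (brd C (interp C t u) (interp C t v) \<Zsemi> (pull x t v \<otimes> idn C (interp C t u))) \<Zsemi>
          asc C (t x) (interp C t (del x v)) (interp C t u)"
        using v by simp
      also have "\<dots> = (idn C (interp C t u) \<otimes> pull x t v) \<Zsemi>
          (brd C (interp C t u) (t x \<boxtimes> interp C t (del x v)) \<Zsemi>
          asc C (t x) (interp C t (del x v)) (interp C t u))"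
        using v by (subst brd_nat') simp_all
      also have "\<dots> = pull x t (Prod u v) \<Zsemi>
          (idn C (t x) \<otimes> brd C (interp C t (del x u)) (interp C t (del x v)))"
        using v by (subst mid_brd_right) (simp_all add: del_id)
      finally show ?thesis .
    qed
  qed
  then show ?case using coherence.coh_brd[of C t "del x u" "del x v"] by auto
qed

section \<open>Words without leaves\<close>

primrec collapse where
  "collapse One = idn C (unt C)"
| "collapse (Leaf x) = undefined"
| "collapse (Prod u v) = (collapse u \<otimes> collapse v) \<Zsemi> lun C (unt C)"

lemma coherence_collapse: "leaves u = [] \<Longrightarrow> coherence C t u One (collapse u)"
proof (induction u)
  case One
  then show ?case using coh_idn[of C t One] by simp
next
  case (Prod u v)
  then show ?case using coh_cmp[OF coh_tar coh_lun[of C t One]] by simp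
qed simp

lemma collapse_simps:
  assumes "leaves u = []"
  shows "iso (collapse u)" "Dom C (collapse u) = interp C t u" "Cod C (collapse u) = unt C"
  using coherence_iso_arr[OF coherence_collapse[OF assms]] assms by auto

text \<open>Base of the uniqueness argument: a word without leaves is a bracketing of units, and it
  is enough that every generator commutes with the collapse to a single unit. The associator,
  \<open>run\<close> and the braiding use that \<open>lun\<close> and \<open>run\<close> agree at
  the unit.\<close>

lemma collapse_natural:
  assumes "coherence C t u v f" "leaves u = []"
  shows "f \<Zsemi> collapse v = collapse u"
  using assms
proof (induction rule: coherence.induct)
  case (coh_idn u)
  then show ?case by (simp add: collapse_simps(1,3) collapse_simps(2)[where t = t])
next
  case (coh_cmp u v f w g)
  have v: "leaves v = []" using coh_cmp.prems coherence_leaves[OF coh_cmp.hyps(1)] by simp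
  then have w: "leaves w = []" using coherence_leaves[OF coh_cmp.hyps(2)] by simp
  note [simp] = collapse_simps(1,3) collapse_simps(2)[where t = t]
  have "f \<in> arr C" "g \<in> arr C" "Cod C f = interp C t v" "Dom C g = interp C t v" "Cod C g = interp C t w"
    using coherence_iso_arr[OF coh_cmp.hyps(1)] coherence_iso_arr[OF coh_cmp.hyps(2)] coh_cmp.prems v
    by auto
  then show ?case using coh_cmp v w by simp
next
  case (coh_tar u v f u' v' f')
  have v: "leaves v = []" and v': "leaves v' = []"
    using coh_tar coherence_leaves by fastforce+
  note [simp] = collapse_simps(1,3) collapse_simps(2)[where t = t]
  have "f \<in> arr C" "f' \<in> arr C" "Cod C f = interp C t v" "Cod C f' = interp C t v'"
    using coherence_iso_arr[OF coh_tar.hyps(1)] coherence_iso_arr[OF coh_tar.hyps(2)] coh_tar.prems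
    by auto
  then show ?case using coh_tar v v' by (simp add: tar_merge)
next
  case (coh_inv u v f g)
  have u: "leaves u = []" using coh_inv coherence_leaves by fastforce
  note [simp] = collapse_simps(1,3) collapse_simps(2)[where t = t]
  have f: "iso f" "Dom C f = interp C t u" "Cod C f = interp C t v"
    using coherence_iso_arr[OF coh_inv.hyps(1)] u by auto
  have g: "g = ainv f" by (rule ainv_unique[OF coh_inv.hyps(2)])
  show ?case
    unfolding g coh_inv.IH[OF u, symmetric] using f coh_inv.prems u by simp
next
  case (coh_asc u v w)
  let ?I = "unt C"
  note [simp] = collapse_simps(1,3) collapse_simps(2)[where t = t]
  have o [simp]: "leaves u = []" "leaves v = []" "leaves w = []" "interp C t u \<in> obj C"
    "interp C t v \<in> obj C" "interp C t w \<in> obj C"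
    using coh_asc by auto
  have "asc C (interp C t u) (interp C t v) (interp C t w) \<Zsemi> collapse (Prod u (Prod v w)) =
      (asc C (interp C t u) (interp C t v) (interp C t w) \<Zsemi> (collapse u \<otimes> (collapse v \<otimes> collapse w))) \<Zsemi>
      (idn C ?I \<otimes> lun C ?I) \<Zsemi> lun C ?I"
    by (simp add: tar_merge)
  also have "\<dots> = ((collapse u \<otimes> collapse v) \<otimes> collapse w) \<Zsemi>
      (asc C ?I ?I ?I \<Zsemi> (idn C ?I \<otimes> lun C ?I)) \<Zsemi> lun C ?I"
    by (subst asc_nat') simp_all
  also have "\<dots> = collapse (Prod (Prod u v) w)"
    by (simp add: triangle lun_unt_eq_run_unt[symmetric] tar_merge)
  finally show ?case .
next
  case (coh_lun u)
  note [simp] = collapse_simps(1,3) collapse_simps(2)[where t = t]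
  show ?case using coh_lun lun_nat[of "collapse u" "unt C"] by simp
next
  case (coh_run u)
  note [simp] = collapse_simps(1,3) collapse_simps(2)[where t = t]
  show ?case using coh_run run_nat[of "collapse u" "unt C"] by (simp add: lun_unt_eq_run_unt)
next
  case (coh_brd u v)
  note [simp] = collapse_simps(1,3) collapse_simps(2)[where t = t]
  have o [simp]: "leaves u = []" "leaves v = []" "interp C t u \<in> obj C" "interp C t v \<in> obj C"
    using coh_brd by auto
  have "brd C (interp C t u) (interp C t v) \<Zsemi> collapse (Prod v u) =
      (brd C (interp C t u) (interp C t v) \<Zsemi> (collapse v \<otimes> collapse u)) \<Zsemi> lun C (unt C)"
    by simp
  also have "\<dots> = (collapse u \<otimes> collapse v) \<Zsemi> (brd C (unt C) (unt C) \<Zsemi> lun C (unt C))"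
    by (subst brd_nat') simp_all
  also have "\<dots> = collapse (Prod u v)"
    by (simp add: brd_lun flip: lun_unt_eq_run_unt)
  finally show ?case .
qed

text \<open>Both morphisms induce morphisms between the words with one leaf deleted, and these agree
  by induction; composing with the invertible \<open>pull\<close> recovers the morphisms themselves.
  Distinctness is what gives \<open>pull\<close> its type.\<close>

theorem coherence_unique:
  assumes "coherence C t u v f" "coherence C t u v g"
    "distinct (leaves u)" "\<forall>x\<in>set (leaves u). t x \<in> obj C"
  shows "f = g"
  using assms
proof (induction "length (leaves u)" arbitrary: u v f g rule: less_induct)
  case less
  note f = coherence_iso_arr[OF less.prems(1,4)] and g = coherence_iso_arr[OF less.prems(2,4)]
  show ?case
  proof (cases "leaves u")
    case Nil
    then have "leaves v = []" using coherence_leaves[OF less.prems(1)] by simp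
    then have "iso (collapse v)" "Dom C (collapse v) = interp C t v"
      by (simp_all add: collapse_simps(1) collapse_simps(2)[where t = t])
    then show ?thesis
      using collapse_natural[OF less.prems(1) Nil] collapse_natural[OF less.prems(2) Nil] f g
        iso_cancel_right[of "collapse v" f g] by simp
  next
    case (Cons x xs)
    then have x: "x \<in> set (leaves u)" by simp
    obtain f' g' where f': "coherence C t (del x u) (del x v) f'"
        "f \<Zsemi> pull x t v = pull x t u \<Zsemi> (idn C (t x) \<otimes> f')"
      and g': "coherence C t (del x u) (del x v) g'"
        "g \<Zsemi> pull x t v = pull x t u \<Zsemi> (idn C (t x) \<otimes> g')"
      using pull_natural[OF less.prems(1) x less.prems(3,4)]
        pull_natural[OF less.prems(2) x less.prems(3,4)] by auto
    have "f' = g'"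
      by (rule less.hyps[OF _ f'(1) g'(1)])
        (use less.prems x in \<open>auto simp: leaves_del intro!: length_filter_less\<close>)
    then have "f \<Zsemi> pull x t v = g \<Zsemi> pull x t v" using f' g' by simp
    moreover have "iso (pull x t v) \<and> Dom C (pull x t v) = interp C t v \<and>
        Cod C (pull x t v) = t x \<boxtimes> interp C t (del x v)"
      using coherence_set_leaves[OF less.prems(1)] coherence_distinct[OF less.prems(1)] x less.prems
      by (intro pull_simps) auto
    ultimately show ?thesis using f g by (subst (asm) iso_cancel_right) auto
  qed
qed

text \<open>Both words are brought to the form of one leaf followed by a shorter word, and the
  shorter words are joined by induction.\<close>

theorem coherence_exists:
  assumes "distinct (leaves u)" "distinct (leaves v)" "set (leaves u) = set (leaves v)"
    "\<forall>x\<in>set (leaves u). t x \<in> obj C"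
  shows "\<exists>f. coherence C t u v f"
  using assms
proof (induction "length (leaves u)" arbitrary: u v rule: less_induct)
  case less
  show ?case
  proof (cases "leaves u")
    case Nil
    then have "leaves v = []" using less.prems by simp
    then show ?thesis
      using coh_cmp[OF coherence_collapse[OF Nil] coherence_ainv[OF coherence_collapse]] by auto
  next
    case (Cons x xs)
    then have x: "x \<in> set (leaves u)" "x \<in> set (leaves v)" using less.prems by auto
    have "\<exists>f. coherence C t (del x u) (del x v) f"
      by (rule less.hyps) (use less.prems x in \<open>auto simp: leaves_del intro!: length_filter_less\<close>)
    then obtain f where f: "coherence C t (del x u) (del x v) f" ..
    have "coherence C t v (Prod (Leaf x) (del x v)) (pull x t v)"
      using less.prems x by (intro coherence_pull) auto
    then have "coherence C t (Prod (Leaf x) (del x v)) v (ainv (pull x t v))"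
      using less.prems by (intro coherence_ainv) (auto simp: leaves_del x)
    then show ?thesis
      using coh_cmp[OF coherence_pull coh_cmp[OF coh_tar[OF coh_idn f]]] x less.prems by blast
  qed
qed

end

section \<open>Morphisms between unordered tensor products\<close>

lemma leaves_map_word [simp]: "leaves (map_word \<sigma> u) = map \<sigma> (leaves u)"
  by (induction u) auto

lemma interp_map_word: "interp C t (map_word \<sigma> u) = interp C (t \<circ> \<sigma>) u"
  by (induction u) auto

lemma interp_cong: "(\<And>x. x \<in> set (leaves u) \<Longrightarrow> t x = t' x) \<Longrightarrow> interp C t u = interp C t' u"
  by (induction u) auto

lemma map_word_cong': "(\<And>x. x \<in> set (leaves u) \<Longrightarrow> f x = g x) \<Longrightarrow> map_word f u = map_word g u"
  by (induction u) auto

text \<open>The generators depend on the interpretation of the leaves and never on the labels, so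
  the same morphism is generated after any change of labels.\<close>

lemma coherence_map_word:
  assumes "coherence C s u v f" "s = t \<circ> \<sigma>"
  shows "coherence C t (map_word \<sigma> u) (map_word \<sigma> v) f"
proof -
  have i: "interp C s w = interp C t (map_word \<sigma> w)" for w
    by (simp add: assms interp_map_word)
  show ?thesis
    using assms(1)
  proof (induction rule: coherence.induct)
    case (coh_inv u v f g)
    then show ?case by (intro coherence.coh_inv[OF coh_inv.IH]) (simp add: i)
  qed (auto simp: i intro: coherence.intros)
qed

lemma coherence_cong:
  assumes "coherence C t u v f" "\<forall>x\<in>set (leaves u). t x = t' x"
  shows "coherence C t' u v f"
  using assms
proof (induction rule: coherence.induct)
  case (coh_cmp u v f w g)
  then show ?case using coherence_set_leaves[OF coh_cmp.hyps(1)] by (auto intro: coherence.coh_cmp)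
next
  case (coh_inv u v f g)
  have "set (leaves u) = set (leaves v)" by (rule coherence_set_leaves[OF coh_inv.hyps(1)])
  moreover from this have "interp C t u = interp C t' u" "interp C t v = interp C t' v"
    using coh_inv.prems by (auto intro: interp_cong)
  ultimately show ?case using coh_inv by (auto intro: coherence.coh_inv)
next
  case (coh_idn u)
  then have "interp C t u = interp C t' u" by (intro interp_cong) auto
  then show ?case by (simp add: coherence.coh_idn)
next
  case (coh_asc u v w)
  then have "interp C t u = interp C t' u" "interp C t v = interp C t' v" "interp C t w = interp C t' w"
    by (auto intro!: interp_cong)
  then show ?case by (simp add: coherence.coh_asc)
next
  case (coh_lun u)
  then have "interp C t u = interp C t' u" by (intro interp_cong) auto
  then show ?case by (simp add: coherence.coh_lun)
next
  case (coh_run u)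
  then have "interp C t u = interp C t' u" by (intro interp_cong) auto
  then show ?case by (simp add: coherence.coh_run)
next
  case (coh_brd u v)
  then have "interp C t u = interp C t' u" "interp C t v = interp C t' v"
    by (auto intro!: interp_cong)
  then show ?case by (simp add: coherence.coh_brd)
qed (auto intro: coherence.intros)

context symmetric_monoidal_category
begin

section \<open>Calculus of canonical isomorphisms\<close>

definition well_typed where
  "well_typed t u \<longleftrightarrow> distinct (leaves u) \<and> (\<forall>x\<in>set (leaves u). t x \<in> obj C)"

abbreviation coh where
  "coh \<equiv> coherence_iso C"

lemma well_typed_simps [simp]:
  "well_typed t One"
  "well_typed t (Leaf x) \<longleftrightarrow> t x \<in> obj C"
  "well_typed t (Prod u v) \<longleftrightarrow> well_typed t u \<and> well_typed t v \<and> set (leaves u) \<inter> set (leaves v) = {}"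
  by (auto simp: well_typed_def)

lemma well_typed_interp: "well_typed t u \<Longrightarrow> interp C t u \<in> obj C"
  by (auto simp: well_typed_def)

text \<open>Makes the definite description usable: exhibiting one structural morphism with the given
  ends computes \<open>coh\<close>.\<close>

lemma coh_eqI: "\<lbrakk>coherence C t u v f; well_typed t u\<rbrakk> \<Longrightarrow> coh t u v = f"
  unfolding coherence_iso_def well_typed_def by (rule the_equality) (auto intro: coherence_unique)

lemma coherence_coh:
  assumes "well_typed t u" "well_typed t v" "set (leaves u) = set (leaves v)"
  shows "coherence C t u v (coh t u v)"
proof -
  obtain f where f: "coherence C t u v f"
    using coherence_exists[of u v t] assms by (auto simp: well_typed_def)
  then show ?thesis using coh_eqI[OF f assms(1)] by simp
qed

lemma coh_simps:
  assumes "well_typed t u" "well_typed t v" "set (leaves u) = set (leaves v)"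
  shows "iso (coh t u v)" "Dom C (coh t u v) = interp C t u" "Cod C (coh t u v) = interp C t v"
  using coherence_iso_arr[OF coherence_coh[OF assms]] assms by (auto simp: well_typed_def)

text \<open>Together with \<open>coh_tensor\<close> this replaces diagram chases: a pasting of
  canonical isomorphisms is determined by its first and last word.\<close>

lemma coh_comp:
  assumes "well_typed t u" "well_typed t v" "well_typed t w"
    "set (leaves u) = set (leaves v)" "set (leaves v) = set (leaves w)"
  shows "coh t u v \<Zsemi> coh t v w = coh t u w"
  by (rule coh_eqI[symmetric], rule coh_cmp[OF coherence_coh coherence_coh]) (use assms in simp_all)

lemma coh_tensor:
  assumes "well_typed t u" "well_typed t v" "set (leaves u) = set (leaves v)"
    "well_typed t u'" "well_typed t v'" "set (leaves u') = set (leaves v')"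
    "set (leaves u) \<inter> set (leaves u') = {}"
  shows "coh t u v \<otimes> coh t u' v' = coh t (Prod u u') (Prod v v')"
  by (rule coh_eqI[symmetric], rule coh_tar[OF coherence_coh coherence_coh]) (use assms in simp_all)

lemma coh_same: "well_typed t u \<Longrightarrow> coh t u u = idn C (interp C t u)"
  by (rule coh_eqI[OF coh_idn])

lemma coh_ainv:
  assumes "well_typed t u" "well_typed t v" "set (leaves u) = set (leaves v)"
  shows "ainv (coh t u v) = coh t v u"
  by (rule coh_eqI[symmetric], rule coherence_ainv[OF coherence_coh])
    (use assms in \<open>simp_all add: well_typed_def\<close>)

lemma coh_map_word:
  assumes "well_typed (t \<circ> \<sigma>) u" "well_typed (t \<circ> \<sigma>) v" "set (leaves u) = set (leaves v)"
    "inj_on \<sigma> (set (leaves u))"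
  shows "coh t (map_word \<sigma> u) (map_word \<sigma> v) = coh (t \<circ> \<sigma>) u v"
  by (rule coh_eqI[OF coherence_map_word[OF coherence_coh refl]])
    (use assms in \<open>auto simp: well_typed_def distinct_map\<close>)

lemma coh_cong:
  assumes "well_typed t u" "well_typed t v" "set (leaves u) = set (leaves v)"
    "\<And>x. x \<in> set (leaves u) \<Longrightarrow> t x = t' x"
  shows "coh t u v = coh t' u v"
  by (rule coh_eqI[symmetric, OF coherence_cong[OF coherence_coh]])
    (use assms in \<open>auto simp: well_typed_def\<close>)

end

section \<open>Typed bijections\<close>

lemma typed_bij_dom: "typed_bij X Y \<sigma> \<Longrightarrow> dom Y = \<sigma> ` dom X"
  by (auto simp: typed_bij_def bij_betw_def)

lemma typed_bij_inj: "typed_bij X Y \<sigma> \<Longrightarrow> inj_on \<sigma> (dom X)"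
  by (auto simp: typed_bij_def bij_betw_def)

lemma typed_bij_app: "\<lbrakk>typed_bij X Y \<sigma>; x \<in> dom X\<rbrakk> \<Longrightarrow> Y (\<sigma> x) = X x"
  by (auto simp: typed_bij_def)

lemma typed_bij_comp: "\<lbrakk>typed_bij X Y \<sigma>; typed_bij Y Z \<rho>\<rbrakk> \<Longrightarrow> typed_bij X Z (\<rho> \<circ> \<sigma>)"
  unfolding typed_bij_def by (metis (no_types, lifting) bij_betw_apply bij_betw_trans comp_apply)

lemma typed_bij_id: "typed_bij X X id"
  by (simp add: typed_bij_def)

lemma typed_bij_cong: "\<lbrakk>\<And>x. x \<in> dom X \<Longrightarrow> \<sigma> x = \<rho> x\<rbrakk> \<Longrightarrow> typed_bij X Y \<sigma> \<longleftrightarrow> typed_bij X Y \<rho>"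
  unfolding typed_bij_def by (metis bij_betw_cong)

lemma typed_bij_inv:
  assumes "typed_bij X Y \<sigma>"
  shows "typed_bij Y X (inv_into (dom X) \<sigma>)"
proof -
  have b: "bij_betw \<sigma> (dom X) (dom Y)" and t: "\<forall>x\<in>dom X. Y (\<sigma> x) = X x"
    using assms by (auto simp: typed_bij_def)
  have "X (inv_into (dom X) \<sigma> y) = Y y" if "y \<in> dom Y" for y
    using t that b by (metis bij_betw_imp_surj_on f_inv_into_f inv_into_into)
  then show ?thesis using bij_betw_inv_into[OF b] by (simp add: typed_bij_def)
qed

lemma typed_bij_add:
  assumes "typed_bij X Y \<sigma>" "typed_bij X' Y' \<sigma>" "dom X \<inter> dom X' = {}" "dom Y \<inter> dom Y' = {}"
  shows "typed_bij (X ++ X') (Y ++ Y') \<sigma>"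
  unfolding typed_bij_def
proof
  show "bij_betw \<sigma> (dom (X ++ X')) (dom (Y ++ Y'))"
    using bij_betw_combine[of \<sigma> "dom X" "dom Y" "dom X'" "dom Y'"] assms
    by (auto simp: typed_bij_def Un_commute)
  show "\<forall>x\<in>dom (X ++ X'). (Y ++ Y') (\<sigma> x) = (X ++ X') x"
  proof
    fix x assume "x \<in> dom (X ++ X')"
    then consider "x \<in> dom X" "x \<notin> dom X'" | "x \<in> dom X'" using assms by auto
    then show "(Y ++ Y') (\<sigma> x) = (X ++ X') x"
    proof cases
      case 1
      then have "\<sigma> x \<in> dom Y" using assms(1) typed_bij_dom by blast
      then have "\<sigma> x \<notin> dom Y'" using assms by auto
      then show ?thesis using 1 typed_bij_app[OF assms(1)] by (simp add: map_add_dom_app_simps)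
    next
      case 2
      then have "\<sigma> x \<in> dom Y'" using assms(2) typed_bij_dom by blast
      then show ?thesis using 2 typed_bij_app[OF assms(2)] by (simp add: map_add_dom_app_simps)
    qed
  qed
qed

lemma is_tfs_add: "\<lbrakk>is_tfs \<tau> X; is_tfs \<tau> Y\<rbrakk> \<Longrightarrow> is_tfs \<tau> (X ++ Y)"
  unfolding is_tfs_def by (auto simp: ran_def map_add_Some_iff)

lemma is_tfs_empty: "is_tfs \<tau> Map.empty"
  by (simp add: is_tfs_def)

lemma is_tfs_the: "\<lbrakk>is_tfs \<tau> X; x \<in> dom X\<rbrakk> \<Longrightarrow> the (X x) \<in> \<tau>"
  by (auto simp: is_tfs_def ran_def)

text \<open>Morphisms between the tensor products of typed finite sets, together with their domain and
  codomain. Since the summands of \<open>X ++ Y\<close> are not tagged, coherence makes the tensor product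
  \<open>m \<uplus> n\<close> of such morphisms strictly associative, unital and commutative.\<close>

type_synonym ('a, 'o, 'm) tarr = "('a, 'o) tfs \<times> 'm \<times> ('a, 'o) tfs"

abbreviation dm :: "('a, 'o, 'm) tarr \<Rightarrow> ('a, 'o) tfs" where "dm m \<equiv> fst m"
abbreviation cd :: "('a, 'o, 'm) tarr \<Rightarrow> ('a, 'o) tfs" where "cd m \<equiv> snd (snd m)"
abbreviation md :: "('a, 'o, 'm) tarr \<Rightarrow> 'm" where "md m \<equiv> fst (snd m)"

locale bracketed_smc = symmetric_monoidal_category C
  for C :: "('o, 'm) smc" (structure) +
  fixes W :: "'a elt set \<Rightarrow> 'a elt word"
  assumes bracketing: "bracketing_choice W"
begin

abbreviation tfs :: "('a, 'o) tfs \<Rightarrow> bool" where "tfs \<equiv> is_tfs (obj C)"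
abbreviation T :: "('a, 'o) tfs \<Rightarrow> 'o" where "T \<equiv> tensor C W"
abbreviation ty :: "('a, 'o) tfs \<Rightarrow> 'a elt \<Rightarrow> 'o" where "ty X \<equiv> the \<circ> X"

definition tarr :: "('a, 'o, 'm) tarr \<Rightarrow> bool" where
  "tarr m \<longleftrightarrow> tfs (dm m) \<and> tfs (cd m) \<and> md m \<in> hom C (T (dm m)) (T (cd m))"

definition cp :: "('a, 'o, 'm) tarr \<Rightarrow> ('a, 'o, 'm) tarr \<Rightarrow> ('a, 'o, 'm) tarr"  (infixl "\<bullet>" 60) where
  "m \<bullet> n = (dm m, md m \<Zsemi> md n, cd n)"

text \<open>\<open>sp\<close> and \<open>mg\<close> are the untagged counterparts of
  \<open>split_tensor\<close> and \<open>merge_tensor\<close>. They are meant for disjoint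
  \<open>A\<close> and \<open>B\<close>, where the leaves of \<open>Prod (W A) (W B)\<close> are
  distinct.\<close>

definition sp where "sp t A B = coh t (W (A \<union> B)) (Prod (W A) (W B))"
definition mg where "mg t A B = coh t (Prod (W A) (W B)) (W (A \<union> B))"

definition un :: "('a, 'o, 'm) tarr \<Rightarrow> ('a, 'o, 'm) tarr \<Rightarrow> ('a, 'o, 'm) tarr"  (infixl "\<uplus>" 65) where
  "m \<uplus> n = (dm m ++ dm n,
     sp (ty (dm m ++ dm n)) (dom (dm m)) (dom (dm n)) \<Zsemi> (md m \<otimes> md n) \<Zsemi>
     mg (ty (cd m ++ cd n)) (dom (cd m)) (dom (cd n)), cd m ++ cd n)"

definition pm :: "('a elt \<Rightarrow> 'a elt) \<Rightarrow> ('a, 'o) tfs \<Rightarrow> ('a, 'o) tfs \<Rightarrow> ('a, 'o, 'm) tarr" where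
  "pm \<sigma> X Y = (X, permute_tensor C W \<sigma> X Y, Y)"

abbreviation idt :: "('a, 'o) tfs \<Rightarrow> ('a, 'o, 'm) tarr" where "idt X \<equiv> pm id X X"

lemma leaves_W [simp]: "finite A \<Longrightarrow> set (leaves (W A)) = A" "finite A \<Longrightarrow> distinct (leaves (W A))"
  using bracketing by (auto simp: bracketing_choice_def)

lemma well_typed_W: "\<lbrakk>finite A; \<forall>x\<in>A. t x \<in> obj C\<rbrakk> \<Longrightarrow> well_typed t (W A)"
  by (simp add: well_typed_def)

lemma tfs_finite: "tfs X \<Longrightarrow> finite (dom X)"
  by (simp add: is_tfs_def)

lemma tfs_ty: "\<lbrakk>tfs X; x \<in> dom X\<rbrakk> \<Longrightarrow> ty X x \<in> obj C"
  by (simp add: is_tfs_the)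

lemma tfs_obj: "tfs X \<Longrightarrow> \<forall>x\<in>dom X. ty X x \<in> obj C"
  using tfs_ty by blast

lemma well_typed_tfs: "tfs X \<Longrightarrow> well_typed (ty X) (W (dom X))"
  by (intro well_typed_W) (auto simp: tfs_finite dest: is_tfs_the)

lemma T_obj: "tfs X \<Longrightarrow> T X \<in> obj C"
  unfolding tensor_def by (rule well_typed_interp[OF well_typed_tfs])

lemma T_eq: "\<lbrakk>tfs X; \<And>x. x \<in> dom X \<Longrightarrow> t x = ty X x\<rbrakk> \<Longrightarrow> interp C t (W (dom X)) = T X"
  unfolding tensor_def by (rule interp_cong) (simp add: tfs_finite)

lemma tarr_eqI: "\<lbrakk>dm m = dm n; md m = md n; cd m = cd n\<rbrakk> \<Longrightarrow> m = n"
  by (simp add: prod_eq_iff)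

lemma tarrD:
  assumes "tarr m"
  shows "tfs (dm m)" "tfs (cd m)" "md m \<in> arr C" "Dom C (md m) = T (dm m)" "Cod C (md m) = T (cd m)"
  using assms by (auto simp: tarr_def hom_iff)

lemma cp_simps [simp]:
  "dm (m \<bullet> n) = dm m" "cd (m \<bullet> n) = cd n" "md (m \<bullet> n) = md m \<Zsemi> md n"
  by (simp_all add: cp_def)

lemma tarr_cp [simp]: "\<lbrakk>tarr m; tarr n; cd m = dm n\<rbrakk> \<Longrightarrow> tarr (m \<bullet> n)"
  by (auto simp: tarr_def hom_iff)

lemma cp_assoc: "\<lbrakk>tarr m; tarr n; tarr k; cd m = dm n; cd n = dm k\<rbrakk> \<Longrightarrow> (m \<bullet> n) \<bullet> k = m \<bullet> (n \<bullet> k)"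
  by (rule tarr_eqI) (simp_all add: tarrD)

lemma pm_simps [simp]: "dm (pm \<sigma> X Y) = X" "cd (pm \<sigma> X Y) = Y"
  "md (pm \<sigma> X Y) = coh (ty Y) (map_word \<sigma> (W (dom X))) (W (dom Y))"
  by (simp_all add: pm_def permute_tensor_def)

lemma well_typed_map:
  assumes "tfs X" "typed_bij X Y \<sigma>"
  shows "well_typed (ty Y) (map_word \<sigma> (W (dom X)))" "set (leaves (map_word \<sigma> (W (dom X)))) = dom Y"
  using assms typed_bij_app[OF assms(2)]
  by (auto simp: well_typed_def distinct_map tfs_finite typed_bij_inj typed_bij_dom domIff
      dest: is_tfs_the)

lemma interp_map_T: "\<lbrakk>tfs X; typed_bij X Y \<sigma>\<rbrakk> \<Longrightarrow> interp C (ty Y) (map_word \<sigma> (W (dom X))) = T X"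
  by (subst interp_map_word, rule T_eq) (auto simp: typed_bij_app domIff)

lemma tarr_pm [simp]:
  assumes "tfs X" "tfs Y" "typed_bij X Y \<sigma>"
  shows "tarr (pm \<sigma> X Y)"
proof -
  have "well_typed (ty Y) (W (dom Y))" "set (leaves (W (dom Y))) = dom Y"
    using assms well_typed_tfs tfs_finite by auto
  then show ?thesis
    unfolding tarr_def hom_iff using assms well_typed_map[OF assms(1,3)] interp_map_T[OF assms(1,3)]
    by (simp add: coh_simps) (simp add: tensor_def)
qed

lemma md_idt: "tfs X \<Longrightarrow> md (idt X) = idn C (T X)"
  by (simp add: word.map_id0 coh_same well_typed_tfs tensor_def)

lemma idt_cp [simp]: "\<lbrakk>tarr m; X = dm m\<rbrakk> \<Longrightarrow> idt X \<bullet> m = m"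
  by (rule tarr_eqI) (use tarrD[of m] in \<open>simp_all add: md_idt del: pm_simps(3)\<close>)

lemma cp_idt [simp]: "\<lbrakk>tarr m; X = cd m\<rbrakk> \<Longrightarrow> m \<bullet> idt X = m"
  by (rule tarr_eqI) (use tarrD[of m] in \<open>simp_all add: md_idt del: pm_simps(3)\<close>)

lemma pm_cong:
  assumes "\<And>x. x \<in> dom X \<Longrightarrow> \<sigma> x = \<rho> x" "tfs X"
  shows "pm \<sigma> X Y = pm \<rho> X Y"
proof -
  have "map_word \<sigma> (W (dom X)) = map_word \<rho> (W (dom X))"
    by (rule map_word_cong') (simp add: assms tfs_finite)
  then show ?thesis by (simp add: pm_def permute_tensor_def)
qed

text \<open>The first relabelling is transported along \<rho> to the labels of \<open>Z\<close>;
  over this common typing both factors are canonical and compose by \<open>coh_comp\<close>.\<close>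

lemma pm_pm:
  assumes "tfs X" "tfs Y" "tfs Z" "typed_bij X Y \<sigma>" "typed_bij Y Z \<rho>"
  shows "pm \<sigma> X Y \<bullet> pm \<rho> Y Z = pm (\<rho> \<circ> \<sigma>) X Z"
proof (rule tarr_eqI)
  let ?u = "map_word \<sigma> (W (dom X))"
  note wu = well_typed_map[OF assms(1,4)] and wv = well_typed_map[OF assms(2,5)]
  have v: "well_typed (ty Y) (W (dom Y))" "set (leaves (W (dom Y))) = dom Y"
    "well_typed (ty Z) (W (dom Z))" "set (leaves (W (dom Z))) = dom Z"
    using assms well_typed_tfs tfs_finite by auto
  have t: "ty Y y = (ty Z \<circ> \<rho>) y" if "y \<in> dom Y" for y
    using typed_bij_app[OF assms(5) that] by simp
  have "coh (ty Y) ?u (W (dom Y)) = coh (ty Z \<circ> \<rho>) ?u (W (dom Y))"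
    by (rule coh_cong[OF wu(1) v(1)]) (use wu v t in auto)
  also have "\<dots> = coh (ty Z) (map_word \<rho> ?u) (map_word \<rho> (W (dom Y)))"
  proof (rule coh_map_word[symmetric])
    show "well_typed (ty Z \<circ> \<rho>) ?u" "well_typed (ty Z \<circ> \<rho>) (W (dom Y))"
      using wu v t unfolding well_typed_def by auto
  qed (use wu v typed_bij_inj[OF assms(5)] in auto)
  finally have "coh (ty Y) ?u (W (dom Y)) = coh (ty Z) (map_word \<rho> ?u) (map_word \<rho> (W (dom Y)))" .
  moreover have "map_word \<rho> ?u = map_word (\<rho> \<circ> \<sigma>) (W (dom X))"
    by (simp add: word.map_comp)
  ultimately show "md (pm \<sigma> X Y \<bullet> pm \<rho> Y Z) = md (pm (\<rho> \<circ> \<sigma>) X Z)"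
    using wv v well_typed_map[OF assms(1) typed_bij_comp[OF assms(4,5)]] by (simp add: coh_comp)
qed simp_all

lemma un_simps [simp]:
  "dm (m \<uplus> n) = dm m ++ dm n" "cd (m \<uplus> n) = cd m ++ cd n"
  by (simp_all add: un_def)

lemma sp_mg:
  assumes "finite A" "finite B" "A \<inter> B = {}" "\<forall>x\<in>A \<union> B. t x \<in> obj C"
  shows "iso (sp t A B)" "Dom C (sp t A B) = interp C t (W (A \<union> B))"
    "Cod C (sp t A B) = interp C t (W A) \<boxtimes> interp C t (W B)"
    "iso (mg t A B)" "Cod C (mg t A B) = interp C t (W (A \<union> B))"
    "Dom C (mg t A B) = interp C t (W A) \<boxtimes> interp C t (W B)"
    "sp t A B \<Zsemi> mg t A B = idn C (interp C t (W (A \<union> B)))"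
    "mg t A B \<Zsemi> sp t A B = idn C (interp C t (W A) \<boxtimes> interp C t (W B))"
proof -
  have w: "well_typed t (W A)" "well_typed t (W B)" "well_typed t (W (A \<union> B))"
    using assms by (auto simp: well_typed_def)
  then show "iso (sp t A B)" "Dom C (sp t A B) = interp C t (W (A \<union> B))"
    "Cod C (sp t A B) = interp C t (W A) \<boxtimes> interp C t (W B)"
    "iso (mg t A B)" "Cod C (mg t A B) = interp C t (W (A \<union> B))"
    "Dom C (mg t A B) = interp C t (W A) \<boxtimes> interp C t (W B)"
    "sp t A B \<Zsemi> mg t A B = idn C (interp C t (W (A \<union> B)))"
    "mg t A B \<Zsemi> sp t A B = idn C (interp C t (W A) \<boxtimes> interp C t (W B))"
    using assms by (simp_all add: sp_def mg_def coh_simps coh_comp coh_same)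
qed

lemma sp_mg_cong:
  assumes "finite A" "finite B" "A \<inter> B = {}" "\<forall>x\<in>A \<union> B. t x \<in> obj C" "\<And>x. x \<in> A \<union> B \<Longrightarrow> t x = t' x"
  shows "sp t A B = sp t' A B" "mg t A B = mg t' A B"
  unfolding sp_def mg_def
  by (rule coh_cong; use assms in \<open>auto simp: well_typed_def\<close>)+

lemma sp_mg_tfs:
  assumes "tfs X" "tfs Y" "dom X \<inter> dom Y = {}"
  defines "t \<equiv> ty (X ++ Y)"
  shows "iso (sp t (dom X) (dom Y))" "Dom C (sp t (dom X) (dom Y)) = T (X ++ Y)"
    "Cod C (sp t (dom X) (dom Y)) = T X \<boxtimes> T Y"
    "iso (mg t (dom X) (dom Y))" "Cod C (mg t (dom X) (dom Y)) = T (X ++ Y)"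
    "Dom C (mg t (dom X) (dom Y)) = T X \<boxtimes> T Y"
    "sp t (dom X) (dom Y) \<Zsemi> mg t (dom X) (dom Y) = idn C (T (X ++ Y))"
    "mg t (dom X) (dom Y) \<Zsemi> sp t (dom X) (dom Y) = idn C (T X \<boxtimes> T Y)"
proof -
  have f: "finite (dom X)" "finite (dom Y)" using assms tfs_finite by auto
  have o: "\<forall>x\<in>dom X \<union> dom Y. t x \<in> obj C"
    using is_tfs_the[OF is_tfs_add[OF assms(1,2)]] by (auto simp: t_def)
  have "interp C t (W (dom X \<union> dom Y)) = T (X ++ Y)"
    by (simp add: tensor_def t_def Un_commute)
  moreover have "interp C t (W (dom X)) = T X" "interp C t (W (dom Y)) = T Y"
    using assms(1-3) by (intro T_eq; auto simp: t_def map_add_def split: option.splits)+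
  ultimately show "iso (sp t (dom X) (dom Y))" "Dom C (sp t (dom X) (dom Y)) = T (X ++ Y)"
    "Cod C (sp t (dom X) (dom Y)) = T X \<boxtimes> T Y"
    "iso (mg t (dom X) (dom Y))" "Cod C (mg t (dom X) (dom Y)) = T (X ++ Y)"
    "Dom C (mg t (dom X) (dom Y)) = T X \<boxtimes> T Y"
    "sp t (dom X) (dom Y) \<Zsemi> mg t (dom X) (dom Y) = idn C (T (X ++ Y))"
    "mg t (dom X) (dom Y) \<Zsemi> sp t (dom X) (dom Y) = idn C (T X \<boxtimes> T Y)"
    using sp_mg[OF f assms(3) o] by simp_all
qed

definition compat where
  "compat m n \<longleftrightarrow> dom (dm m) \<inter> dom (dm n) = {} \<and> dom (cd m) \<inter> dom (cd n) = {}"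

lemma tarr_un [simp]:
  assumes "tarr m" "tarr n" "compat m n"
  shows "tarr (m \<uplus> n)"
  unfolding tarr_def hom_iff
  using assms sp_mg_tfs[of "dm m" "dm n"] sp_mg_tfs[of "cd m" "cd n"] tarrD[of m] tarrD[of n]
  by (simp add: un_def compat_def is_tfs_add)

text \<open>The merging after the first pair and the splitting before the second are mutually
  inverse and cancel in the middle; what remains is functoriality of the tensor product.\<close>

lemma un_cp:
  assumes "tarr m" "tarr n" "tarr m'" "tarr n'" "cd m = dm m'" "cd n = dm n'"
    "compat m n" "compat m' n'"
  shows "(m \<bullet> m') \<uplus> (n \<bullet> n') = (m \<uplus> n) \<bullet> (m' \<uplus> n')"
  using assms sp_mg_tfs[of "dm m" "dm n"] sp_mg_tfs[of "dm m'" "dm n'"] sp_mg_tfs[of "cd m'" "cd n'"]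
    tarrD[of m] tarrD[of n] tarrD[of m'] tarrD[of n']
    cmp_reassoc[OF sp_mg_tfs(8)[of "dm m'" "dm n'"],
      of "(md m' \<otimes> md n') \<Zsemi> mg (ty (cd m' ++ cd n')) (dom (cd m')) (dom (cd n'))"]
  by (intro tarr_eqI) (simp_all add: un_def cp_def compat_def tar_merge T_obj)

lemma un_idt:
  assumes "tfs X" "tfs Y" "dom X \<inter> dom Y = {}"
  shows "idt X \<uplus> idt Y = idt (X ++ Y)"
  using assms sp_mg_tfs[OF assms]
  by (intro tarr_eqI) (simp_all add: un_def md_idt is_tfs_add T_obj del: pm_simps(3))

text \<open>Partial maps with disjoint domains commute under \<open>++\<close>, so the two sides
  have the same domain and codomain. The braidings by which their splittings and mergings differ
  cancel by naturality.\<close>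

lemma un_commute:
  assumes "tarr m" "tarr n" "compat m n"
  shows "m \<uplus> n = n \<uplus> m"
proof (rule tarr_eqI)
  have d: "dm n ++ dm m = dm m ++ dm n" "cd n ++ cd m = cd m ++ cd n"
    using assms(3) by (auto simp: compat_def intro!: map_add_comm)
  then show "dm (m \<uplus> n) = dm (n \<uplus> m)" "cd (m \<uplus> n) = cd (n \<uplus> m)" by simp_all
  note D = tarrD[OF assms(1)] tarrD[OF assms(2)]
  \<comment> \<open>The braiding is itself canonical, so it relates the splittings, and the
    mergings, for the two orders.\<close>
  have swap: "sp (ty (X ++ Y)) (dom Y) (dom X) = sp (ty (X ++ Y)) (dom X) (dom Y) \<Zsemi> brd C (T X) (T Y)"
    "mg (ty (X ++ Y)) (dom X) (dom Y) = brd C (T X) (T Y) \<Zsemi> mg (ty (X ++ Y)) (dom Y) (dom X)"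
    if XY: "tfs X" "tfs Y" "dom X \<inter> dom Y = {}" for X Y
  proof -
    let ?t = "ty (X ++ Y)"
    have f: "finite (dom X)" "finite (dom Y)" using XY tfs_finite by auto
    have "\<forall>x\<in>dom X \<union> dom Y. ?t x \<in> obj C"
      using is_tfs_the[OF is_tfs_add[OF XY(1,2)]] by auto
    then have w: "well_typed ?t (W (dom X))" "well_typed ?t (W (dom Y))" "well_typed ?t (W (dom X \<union> dom Y))"
      using f by (auto simp: well_typed_def)
    have "coh ?t (Prod (W (dom X)) (W (dom Y))) (Prod (W (dom Y)) (W (dom X))) =
        brd C (interp C ?t (W (dom X))) (interp C ?t (W (dom Y)))"
      using w f XY(3) by (intro coh_eqI coh_brd) simp
    moreover have "interp C ?t (W (dom X)) = T X" "interp C ?t (W (dom Y)) = T Y"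
      using XY by (intro T_eq; auto simp: map_add_def split: option.splits)+
    ultimately have b: "brd C (T X) (T Y) = coh ?t (Prod (W (dom X)) (W (dom Y))) (Prod (W (dom Y)) (W (dom X)))"
      by simp
    show "sp ?t (dom Y) (dom X) = sp ?t (dom X) (dom Y) \<Zsemi> brd C (T X) (T Y)"
      "mg ?t (dom X) (dom Y) = brd C (T X) (T Y) \<Zsemi> mg ?t (dom Y) (dom X)"
      unfolding sp_def mg_def b using w f XY(3)
      by (simp_all add: coh_comp Un_commute Int_commute Un_commute[of "dom Y"])
  qed
  let ?t = "ty (dm m ++ dm n)" and ?s = "ty (cd m ++ cd n)"
  have c: "dom (dm m) \<inter> dom (dm n) = {}" "dom (cd m) \<inter> dom (cd n) = {}"
    using assms(3) by (auto simp: compat_def)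
  note S = sp_mg_tfs[OF D(1,6) c(1)] sp_mg_tfs[OF D(2,7) c(2)]
  have S': "iso (mg ?s (dom (cd n)) (dom (cd m)))"
    "Dom C (mg ?s (dom (cd n)) (dom (cd m))) = T (cd n) \<boxtimes> T (cd m)"
    using sp_mg_tfs[OF D(7,2)] c(2) by (simp_all add: d Int_commute)
  have "md (n \<uplus> m) = sp ?t (dom (dm n)) (dom (dm m)) \<Zsemi> (md n \<otimes> md m) \<Zsemi> mg ?s (dom (cd n)) (dom (cd m))"
    by (simp add: un_def d)
  also have "\<dots> = sp ?t (dom (dm m)) (dom (dm n)) \<Zsemi> (brd C (T (dm m)) (T (dm n)) \<Zsemi> (md n \<otimes> md m)) \<Zsemi>
      mg ?s (dom (cd n)) (dom (cd m))"
    using D S S' c by (subst swap) (simp_all add: T_obj)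
  also have "\<dots> = sp ?t (dom (dm m)) (dom (dm n)) \<Zsemi> (md m \<otimes> md n) \<Zsemi>
      (brd C (T (cd m)) (T (cd n)) \<Zsemi> mg ?s (dom (cd n)) (dom (cd m)))"
    using D S S' by (subst brd_nat') (simp_all add: T_obj)
  also have "\<dots> = md (m \<uplus> n)"
    using D c by (subst swap(2)[symmetric]) (simp_all add: un_def)
  finally show "md (m \<uplus> n) = md (n \<uplus> m)" ..
qed

text \<open>The associator is canonical too, so in each equation both sides are the canonical
  isomorphism between the same two words.\<close>

lemma sp_mg_assoc:
  assumes f: "finite A" "finite B" "finite D" and d: "A \<inter> B = {}" "A \<inter> D = {}" "B \<inter> D = {}"
    and o: "\<forall>x\<in>A \<union> B \<union> D. t x \<in> obj C"
  defines "i \<equiv> \<lambda>E. interp C t (W E)"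
  shows "sp t (A \<union> B) D \<Zsemi> (sp t A B \<otimes> idn C (i D)) \<Zsemi> asc C (i A) (i B) (i D) =
      sp t A (B \<union> D) \<Zsemi> (idn C (i A) \<otimes> sp t B D)" (is ?sp)
    and "asc C (i A) (i B) (i D) \<Zsemi> (idn C (i A) \<otimes> mg t B D) \<Zsemi> mg t A (B \<union> D) =
      (mg t A B \<otimes> idn C (i D)) \<Zsemi> mg t (A \<union> B) D" (is ?mg)
proof -
  have w: "well_typed t (W A)" "well_typed t (W B)" "well_typed t (W D)" "well_typed t (W (A \<union> B))"
    "well_typed t (W (B \<union> D))" "well_typed t (W (A \<union> B \<union> D))" "well_typed t (W (A \<union> (B \<union> D)))"
    using f o by (auto simp: well_typed_def)
  have a: "asc C (i A) (i B) (i D) = coh t (Prod (Prod (W A) (W B)) (W D)) (Prod (W A) (Prod (W B) (W D)))"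
    unfolding i_def using w f d by (intro coh_eqI[symmetric] coh_asc) auto
  have e: "idn C (i A) = coh t (W A) (W A)" "idn C (i D) = coh t (W D) (W D)"
    unfolding i_def using w by (simp_all add: coh_same)
  have d': "(A \<union> B) \<inter> D = {}" "A \<inter> (B \<union> D) = {}" "D \<inter> B = {}" "B \<inter> A = {}" "D \<inter> A = {}" using d by auto
  show ?sp ?mg
    unfolding sp_def mg_def a e using w f d d'
    by (simp_all add: coh_tensor coh_comp Un_assoc Int_Un_distrib Int_Un_distrib2)
qed

text \<open>Naturality carries the associator past the three morphisms; before and after them it is
  absorbed into the splittings and mergings by \<open>sp_mg_assoc\<close>.\<close>

lemma un_assoc:
  assumes "tarr m" "tarr n" "tarr k" "compat m n" "compat m k" "compat n k"
  shows "(m \<uplus> n) \<uplus> k = m \<uplus> (n \<uplus> k)"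
proof (rule tarr_eqI)
  show "dm (m \<uplus> n \<uplus> k) = dm (m \<uplus> (n \<uplus> k))" "cd (m \<uplus> n \<uplus> k) = cd (m \<uplus> (n \<uplus> k))" by simp_all
  note D = tarrD[OF assms(1)] tarrD[OF assms(2)] tarrD[OF assms(3)]
  \<comment> \<open>The partial sums come with their own typings; they are all replaced by the
    typings \<open>t\<close> and \<open>s\<close> of the threefold sums, over which
    \<open>sp_mg_assoc\<close> applies.\<close>
  define t where "t = ty (dm m ++ dm n ++ dm k)"
  define s where "s = ty (cd m ++ cd n ++ cd k)"
  define A B E where "A = dom (dm m)" and "B = dom (dm n)" and "E = dom (dm k)"
  define A' B' E' where "A' = dom (cd m)" and "B' = dom (cd n)" and "E' = dom (cd k)"
  note defs = A_def B_def E_def A'_def B'_def E'_def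
  have f: "finite A" "finite B" "finite E" "finite A'" "finite B'" "finite E'"
    using D tfs_finite by (auto simp: defs)
  have d: "A \<inter> B = {}" "A \<inter> E = {}" "B \<inter> E = {}" "A' \<inter> B' = {}" "A' \<inter> E' = {}" "B' \<inter> E' = {}"
    using assms by (auto simp: compat_def defs)
  have ot: "\<forall>x\<in>A \<union> B \<union> E. t x \<in> obj C" and os: "\<forall>x\<in>A' \<union> B' \<union> E'. s x \<in> obj C"
    using tfs_obj[OF is_tfs_add[OF is_tfs_add[OF D(1,6)] D(11)]]
      tfs_obj[OF is_tfs_add[OF is_tfs_add[OF D(2,7)] D(12)]]
    by (simp_all add: defs t_def s_def ball_Un)
  have i: "interp C t (W A) = T (dm m)" "interp C t (W B) = T (dm n)" "interp C t (W E) = T (dm k)"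
    "interp C s (W A') = T (cd m)" "interp C s (W B') = T (cd n)" "interp C s (W E') = T (cd k)"
    using D d unfolding defs t_def s_def
    by (intro T_eq; auto simp: map_add_def split: option.splits)+
  have c: "sp (ty (dm m ++ dm n)) A B = sp t A B" "sp (ty (dm n ++ dm k)) B E = sp t B E"
    "mg (ty (cd m ++ cd n)) A' B' = mg s A' B'" "mg (ty (cd n ++ cd k)) B' E' = mg s B' E'"
    using f d ot os
    by (intro sp_mg_cong[symmetric]; auto simp: defs t_def s_def map_add_def split: option.splits)+
  have d': "(A \<union> B) \<inter> E = {}" "A \<inter> (B \<union> E) = {}" "(A' \<union> B') \<inter> E' = {}" "A' \<inter> (B' \<union> E') = {}"
    using d by auto
  have o2: "\<forall>x\<in>A \<union> B. t x \<in> obj C" "\<forall>x\<in>B \<union> E. t x \<in> obj C" "\<forall>x\<in>A \<union> (B \<union> E). t x \<in> obj C"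
    "\<forall>x\<in>A' \<union> B'. s x \<in> obj C" "\<forall>x\<in>B' \<union> E'. s x \<in> obj C" "\<forall>x\<in>A' \<union> (B' \<union> E'). s x \<in> obj C"
    using ot os by auto
  note S = sp_mg[OF f(1,2) d(1) o2(1)] sp_mg[OF f(2,3) d(3) o2(2)]
    sp_mg[OF finite_UnI[OF f(1,2)] f(3) d'(1) ot] sp_mg[OF f(1) finite_UnI[OF f(2,3)] d'(2) o2(3)]
    sp_mg[OF f(4,5) d(4) o2(4)] sp_mg[OF f(5,6) d(6) o2(5)]
    sp_mg[OF finite_UnI[OF f(4,5)] f(6) d'(3) os] sp_mg[OF f(4) finite_UnI[OF f(5,6)] d'(4) o2(6)]
  note O = T_obj[OF D(1)] T_obj[OF D(2)] T_obj[OF D(6)] T_obj[OF D(7)] T_obj[OF D(11)] T_obj[OF D(12)]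
  have oi: "interp C t (W (A \<union> B)) \<in> obj C" "interp C t (W (B \<union> E)) \<in> obj C"
    "interp C s (W (A' \<union> B')) \<in> obj C" "interp C s (W (B' \<union> E')) \<in> obj C"
    using f ot os by (auto intro!: interp_obj)
  have "md ((m \<uplus> n) \<uplus> k) = sp t (A \<union> B) E \<Zsemi>
      ((sp t A B \<Zsemi> (md m \<otimes> md n) \<Zsemi> mg s A' B') \<otimes> md k) \<Zsemi> mg s (A' \<union> B') E'"
    unfolding c[symmetric] by (simp add: un_def t_def s_def defs Un_commute)
  also have "\<dots> = sp t (A \<union> B) E \<Zsemi> (sp t A B \<otimes> idn C (T (dm k))) \<Zsemi> ((md m \<otimes> md n) \<otimes> md k) \<Zsemi>
      ((mg s A' B' \<otimes> idn C (T (cd k))) \<Zsemi> mg s (A' \<union> B') E')"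
    using D S O oi i by (simp add: tar_merge)
  also have "\<dots> = sp t (A \<union> B) E \<Zsemi> (sp t A B \<otimes> idn C (T (dm k))) \<Zsemi> (((md m \<otimes> md n) \<otimes> md k) \<Zsemi>
      asc C (T (cd m)) (T (cd n)) (T (cd k))) \<Zsemi> (idn C (T (cd m)) \<otimes> mg s B' E') \<Zsemi> mg s A' (B' \<union> E')"
    using D S O oi i sp_mg_assoc(2)[OF f(4-6) d(4-6) os, symmetric]
    by (simp add: Un_assoc)
  also have "\<dots> = (sp t (A \<union> B) E \<Zsemi> (sp t A B \<otimes> idn C (T (dm k))) \<Zsemi>
      asc C (T (dm m)) (T (dm n)) (T (dm k))) \<Zsemi> (md m \<otimes> (md n \<otimes> md k)) \<Zsemi>
      (idn C (T (cd m)) \<otimes> mg s B' E') \<Zsemi> mg s A' (B' \<union> E')"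
    using D S O oi i by (subst asc_nat) (simp_all add: Un_assoc)
  also have "\<dots> = (sp t A (B \<union> E) \<Zsemi> (idn C (T (dm m)) \<otimes> sp t B E)) \<Zsemi> (md m \<otimes> (md n \<otimes> md k)) \<Zsemi>
      (idn C (T (cd m)) \<otimes> mg s B' E') \<Zsemi> mg s A' (B' \<union> E')"
    using sp_mg_assoc(1)[OF f(1-3) d(1-3) ot] by (simp only: i)
  also have "\<dots> = sp t A (B \<union> E) \<Zsemi> (md m \<otimes> (sp t B E \<Zsemi> (md n \<otimes> md k) \<Zsemi> mg s B' E')) \<Zsemi> mg s A' (B' \<union> E')"
    using D S O oi i by (simp add: tar_merge)
  also have "\<dots> = md (m \<uplus> (n \<uplus> k))"
    unfolding c[symmetric] by (simp add: un_def t_def s_def defs Un_commute)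
  finally show "md ((m \<uplus> n) \<uplus> k) = md (m \<uplus> (n \<uplus> k))" .
qed

text \<open>\<open>W {}\<close> may be any bracketing of units, so the empty typed set need not be
  interpreted as the unit object. The proof uses the canonical isomorphism \<open>e\<close> from one
  to the other and the right unitor \<open>K\<close> that it induces.\<close>

lemma un_empty:
  assumes "tarr m"
  shows "m \<uplus> idt Map.empty = m"
proof (rule tarr_eqI)
  show "dm (m \<uplus> idt Map.empty) = dm m" "cd (m \<uplus> idt Map.empty) = cd m" by simp_all
  note D = tarrD[OF assms]
  define e where "e = coh (ty Map.empty) (W {}) One"
  have w: "well_typed t (W {})" for t by (simp add: well_typed_def)
  have e: "coh t (W {}) One = e" for t
    unfolding e_def by (rule coh_cong) (simp_all add: w)
  have E: "iso e" "Dom C e = T Map.empty" "Cod C e = unt C"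
    unfolding e_def using w[of "ty Map.empty"] by (simp_all add: coh_simps tensor_def)
  define K where "K = (\<lambda>X. (idn C (T X) \<otimes> e) \<Zsemi> run C (T X))"
  have K: "sp (ty X) (dom X) {} = ainv (K X)" "mg (ty X) (dom X) {} = K X" "iso (K X)"
    "Dom C (K X) = T X \<boxtimes> T Map.empty" "Cod C (K X) = T X" if X: "tfs X" for X
  proof -
    have wx: "well_typed (ty X) (W (dom X))" "set (leaves (W (dom X))) = dom X"
      using X by (simp_all add: well_typed_tfs tfs_finite)
    have "K X = coh (ty X) (Prod (W (dom X)) (W {})) (W (dom X))"
    proof -
      have "idn C (T X) \<otimes> e = coh (ty X) (Prod (W (dom X)) (W {})) (Prod (W (dom X)) One)"
        unfolding e[of "ty X", symmetric] tensor_def coh_same[OF wx(1), symmetric]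
        using wx w by (intro coh_tensor) simp_all
      moreover have "run C (T X) = coh (ty X) (Prod (W (dom X)) One) (W (dom X))"
        unfolding tensor_def using wx by (intro coh_eqI[symmetric] coh_run) simp
      ultimately show ?thesis unfolding K_def using wx w by (simp add: coh_comp)
    qed
    then show "sp (ty X) (dom X) {} = ainv (K X)" "mg (ty X) (dom X) {} = K X"
      using wx w by (simp_all add: sp_def mg_def coh_ainv)
    show "iso (K X)" "Dom C (K X) = T X \<boxtimes> T Map.empty" "Cod C (K X) = T X"
      unfolding K_def using E T_obj[OF X] by simp_all
  qed
  have o: "T Map.empty \<in> obj C" by (rule T_obj[OF is_tfs_empty])
  note O = T_obj[OF D(1)] T_obj[OF D(2)]
  have "md (m \<uplus> idt Map.empty) = ainv (K (dm m)) \<Zsemi> ((md m \<otimes> idn C (T Map.empty)) \<Zsemi> K (cd m))"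
    using K(1)[OF D(1)] K(2)[OF D(2)]
    by (simp add: un_def md_idt[OF is_tfs_empty] K(3-5) D O o del: pm_simps(3))
  also have "(md m \<otimes> idn C (T Map.empty)) \<Zsemi> K (cd m) = ((md m \<otimes> e) \<Zsemi> run C (T (cd m)))"
    unfolding K_def using D O E o by (simp add: tar_merge)
  also have "\<dots> = (idn C (T (dm m)) \<otimes> e) \<Zsemi> ((md m \<otimes> idn C (unt C)) \<Zsemi> run C (T (cd m)))"
    using D O E by (simp add: tar_merge)
  also have "\<dots> = K (dm m) \<Zsemi> md m"
    unfolding K_def using D O E by (subst run_nat) simp_all
  also have "ainv (K (dm m)) \<Zsemi> \<dots> = md m"
    using K(3-5)[OF D(1)] D by simp
  finally show "md (m \<uplus> idt Map.empty) = md m" .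
qed

text \<open>After the splitting of the domain has been transported along \<sigma>, everything is
  canonical over the typing of \<open>Y ++ Y'\<close>, and the two sides have the same ends.\<close>

lemma un_pm:
  assumes "tfs X" "tfs Y" "tfs X'" "tfs Y'" "typed_bij X Y \<sigma>" "typed_bij X' Y' \<sigma>"
    "dom X \<inter> dom X' = {}" "dom Y \<inter> dom Y' = {}"
  shows "pm \<sigma> X Y \<uplus> pm \<sigma> X' Y' = pm \<sigma> (X ++ X') (Y ++ Y')"
proof (rule tarr_eqI)
  let ?t = "ty (Y ++ Y')" and ?s = "ty (X ++ X')"
  let ?V = "W (dom X \<union> dom X')"
  note b = typed_bij_add[OF assms(5-8)]
  have f: "finite (dom X)" "finite (dom X')" "finite (dom Y)" "finite (dom Y')"
    using assms tfs_finite by auto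
  have wXX: "well_typed ?s (W (dom X))" "well_typed ?s (W (dom X'))" "well_typed ?s ?V"
    using f is_tfs_the[OF is_tfs_add[OF assms(1,3)]] by (auto simp: well_typed_def)
  have wYY: "well_typed ?t (W (dom Y))" "well_typed ?t (W (dom Y'))" "well_typed ?t (W (dom Y \<union> dom Y'))"
    using f is_tfs_the[OF is_tfs_add[OF assms(2,4)]] by (auto simp: well_typed_def)
  have st: "?s x = (?t \<circ> \<sigma>) x" if "x \<in> dom X \<union> dom X'" for x
  proof -
    have "x \<in> dom (X ++ X')" using that by auto
    from typed_bij_app[OF b this] show ?thesis by simp
  qed
  have i: "inj_on \<sigma> (dom X \<union> dom X')" using typed_bij_inj[OF b] by (simp add: Un_commute)
  have wm: "well_typed ?t (map_word \<sigma> (W (dom X)))" "well_typed ?t (map_word \<sigma> (W (dom X')))"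
    "well_typed ?t (map_word \<sigma> ?V)"
    and lm: "set (leaves (map_word \<sigma> (W (dom X)))) = dom Y" "set (leaves (map_word \<sigma> (W (dom X')))) = dom Y'"
    "set (leaves (map_word \<sigma> ?V)) = dom Y \<union> dom Y'"
    using f i wXX st typed_bij_dom[OF assms(5)] typed_bij_dom[OF assms(6)]
    unfolding well_typed_def by (auto simp: distinct_map inj_on_Un)
  have "sp ?s (dom X) (dom X') = coh (?t \<circ> \<sigma>) ?V (Prod (W (dom X)) (W (dom X')))"
    unfolding sp_def using wXX f assms(7) st by (intro coh_cong) auto
  also have "\<dots> = coh ?t (map_word \<sigma> ?V) (map_word \<sigma> (Prod (W (dom X)) (W (dom X'))))"
    using wXX f assms(7) st i by (intro coh_map_word[symmetric]) (auto simp: well_typed_def)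
  finally have 1: "sp ?s (dom X) (dom X') =
    coh ?t (map_word \<sigma> ?V) (Prod (map_word \<sigma> (W (dom X))) (map_word \<sigma> (W (dom X'))))" by simp
  have 2: "md (pm \<sigma> X Y) = coh ?t (map_word \<sigma> (W (dom X))) (W (dom Y))"
    "md (pm \<sigma> X' Y') = coh ?t (map_word \<sigma> (W (dom X'))) (W (dom Y'))"
    unfolding pm_simps
    using wm wYY lm f assms(8)
    by (intro coh_cong[symmetric]; auto simp: map_add_def split: option.splits)+
  show "md (pm \<sigma> X Y \<uplus> pm \<sigma> X' Y') = md (pm \<sigma> (X ++ X') (Y ++ Y'))"
    unfolding un_def fst_conv snd_conv 2 pm_simps(1,2) 1 mg_def
    using wm wYY lm f assms(7,8) by (simp add: coh_tensor coh_comp Un_commute)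
qed simp_all

end

section \<open>Executing a list of morphisms\<close>

text \<open>The typed set carried over along \<sigma>. As a function of \<sigma> and
  \<open>X\<close> it lets relabelled domains and codomains be computed by rewriting; if \<sigma> is
  not injective, an arbitrary preimage supplies the type.\<close>

definition push :: "('a elt \<Rightarrow> 'a elt) \<Rightarrow> ('a, 't) tfs \<Rightarrow> ('a, 't) tfs" where
  "push \<sigma> X = (\<lambda>b. if b \<in> \<sigma> ` dom X then X (inv_into (dom X) \<sigma> b) else None)"

lemma image_disjoint: "\<lbrakk>inj_on \<sigma> (A \<union> B); A \<inter> B = {}\<rbrakk> \<Longrightarrow> \<sigma> ` A \<inter> \<sigma> ` B = {}"
  by (simp add: inj_on_image_Int[of \<sigma> "A \<union> B", symmetric])

lemma dom_push [simp]: "dom (push \<sigma> X) = \<sigma> ` dom X"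
proof -
  have "X (inv_into (dom X) \<sigma> b) \<noteq> None" if "b \<in> \<sigma> ` dom X" for b
    using inv_into_into[OF that] by blast
  then show ?thesis by (auto simp: push_def domIff split: if_splits)
qed

lemma is_tfs_push: "is_tfs \<tau> X \<Longrightarrow> is_tfs \<tau> (push \<sigma> X)"
  unfolding is_tfs_def dom_push by (auto simp: ran_def push_def)

lemma push_app: "\<lbrakk>inj_on \<sigma> (dom X); x \<in> dom X\<rbrakk> \<Longrightarrow> push \<sigma> X (\<sigma> x) = X x"
  by (simp add: push_def)

lemma typed_bij_push: "inj_on \<sigma> (dom X) \<Longrightarrow> typed_bij X (push \<sigma> X) \<sigma>"
  by (simp add: typed_bij_def push_app inj_on_imp_bij_betw)

text \<open>Characterises \<open>push\<close> by a typed bijection along \<sigma>, so that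
  identities about \<open>push\<close> are proved by exhibiting such a bijection.\<close>

lemma push_unique:
  assumes "typed_bij X Y \<sigma>" shows "push \<sigma> X = Y"
proof
  fix b
  show "push \<sigma> X b = Y b"
  proof (cases "b \<in> \<sigma> ` dom X")
    case True
    then obtain x where "x \<in> dom X" "b = \<sigma> x" by blast
    then show ?thesis using assms by (simp add: typed_bij_inj push_app typed_bij_app)
  next
    case False
    then have "b \<notin> dom (push \<sigma> X)" "b \<notin> dom Y"
      using typed_bij_dom[OF assms] by simp_all
    then show ?thesis unfolding domIff by simp
  qed
qed

lemma push_cong:
  assumes "inj_on \<sigma> (dom X)" "\<And>x. x \<in> dom X \<Longrightarrow> \<sigma> x = \<rho> x"
  shows "push \<sigma> X = push \<rho> X"
  using push_unique[of X "push \<sigma> X" \<rho>] typed_bij_push[OF assms(1)] typed_bij_cong[of X \<sigma> \<rho>] assms(2)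
  by simp

lemma push_push:
  assumes "inj_on \<sigma> (dom X)" "inj_on \<rho> (\<sigma> ` dom X)"
  shows "push \<rho> (push \<sigma> X) = push (\<rho> \<circ> \<sigma>) X"
  by (rule push_unique[symmetric], rule typed_bij_comp[OF typed_bij_push typed_bij_push])
    (use assms in simp_all)

lemma push_id [simp]: "push id X = X"
  by (rule push_unique[OF typed_bij_id])

lemma push_empty [simp]: "push \<sigma> Map.empty = Map.empty"
  by (simp add: push_def)

lemma push_add:
  assumes "inj_on \<sigma> (dom X \<union> dom Y)" "dom X \<inter> dom Y = {}"
  shows "push \<sigma> (X ++ Y) = push \<sigma> X ++ push \<sigma> Y"
proof (rule push_unique, rule typed_bij_add)
  show "dom (push \<sigma> X) \<inter> dom (push \<sigma> Y) = {}"
    using assms by (simp add: image_disjoint)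
qed (use assms in \<open>auto intro: typed_bij_push simp: inj_on_Un\<close>)

lemma is_tfs_restrict: "is_tfs \<tau> X \<Longrightarrow> is_tfs \<tau> (X |` A)"
  unfolding is_tfs_def dom_restrict by (auto simp: ran_def restrict_map_def split: if_splits)

lemma map_add_restrict: "A \<subseteq>\<^sub>m X \<Longrightarrow> A ++ X |` (- dom A) = X"
  by (rule ext) (auto simp: map_add_def restrict_map_def map_le_def dom_def split: option.splits)

lemma map_le_dom: "A \<subseteq>\<^sub>m X \<Longrightarrow> dom A \<subseteq> dom X"
  by (rule map_le_implies_dom_le)

lemma restrict_map_add: "(Y ++ Z) |` S = Y |` S ++ Z |` S"
  by (rule ext) (simp add: restrict_map_def map_add_def)

lemma restrict_superset: "dom Y \<subseteq> S \<Longrightarrow> Y |` S = Y"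
  by (rule ext) (metis domIff restrict_in restrict_out subsetD)

lemma map_le_restrict: "\<lbrakk>A \<subseteq>\<^sub>m X; dom A \<inter> B = {}\<rbrakk> \<Longrightarrow> A \<subseteq>\<^sub>m X |` (- B)"
  by (auto simp: map_le_def restrict_map_def)

lemma map_le_add_right: "A \<subseteq>\<^sub>m Z \<Longrightarrow> A \<subseteq>\<^sub>m Y ++ Z"
  using map_le_map_add map_le_trans by blast

lemma map_le_add_left: "\<lbrakk>A \<subseteq>\<^sub>m Y; dom A \<inter> dom Z = {}\<rbrakk> \<Longrightarrow> A \<subseteq>\<^sub>m Y ++ Z"
  unfolding map_le_def by (metis disjoint_iff map_add_dom_app_simps(3))

lemma push_restrict:
  assumes "inj_on \<sigma> (dom X)" "A \<subseteq> dom X"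
  shows "push \<sigma> (X |` (- A)) = push \<sigma> X |` (- \<sigma> ` A)"
proof (rule push_unique)
  have "bij_betw \<sigma> (dom X - A) (\<sigma> ` dom X - \<sigma> ` A)"
    using assms by (simp add: bij_betw_def inj_on_diff inj_on_image_set_diff[OF assms(1)])
  moreover have "dom X \<inter> - A = dom X - A" "\<sigma> ` dom X \<inter> - \<sigma> ` A = \<sigma> ` dom X - \<sigma> ` A" by auto
  moreover have "(push \<sigma> X |` (- \<sigma> ` A)) (\<sigma> x) = (X |` (- A)) x" if "x \<in> dom X - A" for x
  proof -
    have "\<sigma> x \<notin> \<sigma> ` A" using assms that inj_on_image_mem_iff[OF assms(1)] by blast
    then show ?thesis using assms(1) that by (simp add: push_app)
  qed
  ultimately show "typed_bij (X |` (- A)) (push \<sigma> X |` (- \<sigma> ` A)) \<sigma>"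
    unfolding typed_bij_def dom_restrict dom_push by simp
qed

lemma push_map_le:
  assumes "inj_on \<sigma> (dom X)" "A \<subseteq>\<^sub>m X"
  shows "push \<sigma> A \<subseteq>\<^sub>m push \<sigma> X"
  unfolding map_le_def
proof
  fix b assume "b \<in> dom (push \<sigma> A)"
  then obtain x where x: "x \<in> dom A" "b = \<sigma> x" by auto
  have "dom A \<subseteq> dom X" using assms(2) by (rule map_le_dom)
  then have "inj_on \<sigma> (dom A)" "x \<in> dom X" using assms(1) x inj_on_subset by auto
  then show "push \<sigma> A b = push \<sigma> X b"
    using x assms by (simp add: push_app map_le_def)
qed

section \<open>Relabelled morphisms\<close>

context bracketed_smc
begin

lemma pm_inv:
  assumes "tfs X" "tfs Y" "typed_bij X Y \<sigma>"
  shows "pm (inv_into (dom X) \<sigma>) Y X \<bullet> pm \<sigma> X Y = idt Y" "pm \<sigma> X Y \<bullet> pm (inv_into (dom X) \<sigma>) Y X = idt X"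
proof -
  note i = typed_bij_inv[OF assms(3)]
  have "pm (\<sigma> \<circ> inv_into (dom X) \<sigma>) Y Y = idt Y"
    using assms typed_bij_dom[OF assms(3)] by (intro pm_cong) (auto simp: f_inv_into_f)
  moreover have "pm (inv_into (dom X) \<sigma> \<circ> \<sigma>) X X = idt X"
    using assms typed_bij_inj[OF assms(3)] by (intro pm_cong) (auto simp: inv_into_f_f)
  ultimately show "pm (inv_into (dom X) \<sigma>) Y X \<bullet> pm \<sigma> X Y = idt Y" "pm \<sigma> X Y \<bullet> pm (inv_into (dom X) \<sigma>) Y X = idt X"
    using assms i by (simp_all add: pm_pm)
qed

text \<open>Conjugation by the two relabellings. The inverse relabelling of the domain is written as
  a \<open>pm\<close> along \<open>inv_into\<close>, so that \<open>pm_pm\<close> and associativity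
  suffice for calculating with it.\<close>

definition rel where
  "rel \<sigma> \<rho> m = pm (inv_into (dom (dm m)) \<sigma>) (push \<sigma> (dm m)) (dm m) \<bullet> (m \<bullet> pm \<rho> (cd m) (push \<rho> (cd m)))"

lemma rel_simps [simp]: "dm (rel \<sigma> \<rho> m) = push \<sigma> (dm m)" "cd (rel \<sigma> \<rho> m) = push \<rho> (cd m)"
  by (simp_all add: rel_def)

lemma tarr_pm_push:
  assumes "tfs X" "inj_on \<sigma> (dom X)"
  shows "tarr (pm \<sigma> X (push \<sigma> X))" "tarr (pm (inv_into (dom X) \<sigma>) (push \<sigma> X) X)"
  using assms typed_bij_push[OF assms(2)] typed_bij_inv[OF typed_bij_push[OF assms(2)]]
  by (simp_all add: is_tfs_push)

lemma tarr_rel [simp]: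
  assumes "tarr m" "inj_on \<sigma> (dom (dm m))" "inj_on \<rho> (dom (cd m))"
  shows "tarr (rel \<sigma> \<rho> m)"
  unfolding rel_def using assms tarrD[OF assms(1)] by (intro tarr_cp tarr_pm_push) simp_all

lemma rel_square:
  assumes "tarr m" "inj_on \<sigma> (dom (dm m))" "inj_on \<rho> (dom (cd m))"
  shows "pm \<sigma> (dm m) (push \<sigma> (dm m)) \<bullet> rel \<sigma> \<rho> m = m \<bullet> pm \<rho> (cd m) (push \<rho> (cd m))"
proof -
  note D = tarrD[OF assms(1)]
  note t = tarr_pm_push[OF D(1) assms(2)] tarr_pm_push[OF D(2) assms(3)]
  have "pm \<sigma> (dm m) (push \<sigma> (dm m)) \<bullet> rel \<sigma> \<rho> m =
      (pm \<sigma> (dm m) (push \<sigma> (dm m)) \<bullet> pm (inv_into (dom (dm m)) \<sigma>) (push \<sigma> (dm m)) (dm m)) \<bullet>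
      (m \<bullet> pm \<rho> (cd m) (push \<rho> (cd m)))"
    unfolding rel_def using t assms by (intro cp_assoc[symmetric]) simp_all
  then show ?thesis
    using t assms D by (simp add: pm_inv is_tfs_push typed_bij_push)
qed

text \<open>\<open>rel\<close> is the only filler of the square in \<open>rel_square\<close>,
  because relabellings are invertible. The identities below are proved by checking this square,
  without unfolding the inverse relabelling.\<close>

lemma rel_eqI:
  assumes "tarr m" "tarr n" "inj_on \<sigma> (dom (dm m))" "inj_on \<rho> (dom (cd m))"
    "dm n = push \<sigma> (dm m)" "cd n = push \<rho> (cd m)"
    "pm \<sigma> (dm m) (push \<sigma> (dm m)) \<bullet> n = m \<bullet> pm \<rho> (cd m) (push \<rho> (cd m))"
  shows "rel \<sigma> \<rho> m = n"
proof -
  note D = tarrD[OF assms(1)]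
  note t = tarr_pm_push[OF D(1) assms(3)] tarr_pm_push[OF D(2) assms(4)]
  have "rel \<sigma> \<rho> m = (pm (inv_into (dom (dm m)) \<sigma>) (push \<sigma> (dm m)) (dm m) \<bullet>
      pm \<sigma> (dm m) (push \<sigma> (dm m))) \<bullet> n"
    unfolding rel_def assms(7)[symmetric] using t assms by (intro cp_assoc[symmetric]) simp_all
  also have "\<dots> = n"
    using assms D by (simp add: pm_inv is_tfs_push typed_bij_push)
  finally show ?thesis .
qed

text \<open>The intermediate labels may be chosen freely: \<mu> and its inverse meet in the middle
  and cancel.\<close>

lemma rel_cp:
  assumes "tarr m" "tarr n" "cd m = dm n"
    "inj_on \<sigma> (dom (dm m))" "inj_on \<mu> (dom (cd m))" "inj_on \<rho> (dom (cd n))"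
  shows "rel \<sigma> \<rho> (m \<bullet> n) = rel \<sigma> \<mu> m \<bullet> rel \<mu> \<rho> n"
proof (rule rel_eqI)
  note D = tarrD[OF assms(1)] tarrD[OF assms(2)]
  note t = tarr_pm_push[OF D(1) assms(4)] tarr_pm_push[OF D(2) assms(5)] tarr_pm_push[OF D(7) assms(6)]
  have "pm \<sigma> (dm m) (push \<sigma> (dm m)) \<bullet> (rel \<sigma> \<mu> m \<bullet> rel \<mu> \<rho> n) =
      (pm \<sigma> (dm m) (push \<sigma> (dm m)) \<bullet> rel \<sigma> \<mu> m) \<bullet> rel \<mu> \<rho> n"
    using assms t by (intro cp_assoc[symmetric]) simp_all
  also have "\<dots> = m \<bullet> (pm \<mu> (dm n) (push \<mu> (dm n)) \<bullet> rel \<mu> \<rho> n)"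
    using assms t by (simp add: rel_square cp_assoc)
  also have "\<dots> = (m \<bullet> n) \<bullet> pm \<rho> (cd n) (push \<rho> (cd n))"
    using assms t by (simp add: rel_square cp_assoc)
  finally show "pm \<sigma> (dm (m \<bullet> n)) (push \<sigma> (dm (m \<bullet> n))) \<bullet> (rel \<sigma> \<mu> m \<bullet> rel \<mu> \<rho> n) =
      (m \<bullet> n) \<bullet> pm \<rho> (cd (m \<bullet> n)) (push \<rho> (cd (m \<bullet> n)))"
    by simp
qed (use assms in simp_all)

lemma rel_rel:
  assumes "tarr m" "inj_on \<sigma> (dom (dm m))" "inj_on \<rho> (dom (cd m))"
    "inj_on \<sigma>' (\<sigma> ` dom (dm m))" "inj_on \<rho>' (\<rho> ` dom (cd m))"
  shows "rel \<sigma>' \<rho>' (rel \<sigma> \<rho> m) = rel (\<sigma>' \<circ> \<sigma>) (\<rho>' \<circ> \<rho>) m"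
proof (rule rel_eqI[symmetric])
  note D = tarrD[OF assms(1)]
  have pp: "pm (\<sigma>' \<circ> \<sigma>) X (push (\<sigma>' \<circ> \<sigma>) X) = pm \<sigma> X (push \<sigma> X) \<bullet> pm \<sigma>' (push \<sigma> X) (push \<sigma>' (push \<sigma> X))"
    if "tfs X" "inj_on \<sigma> (dom X)" "inj_on \<sigma>' (\<sigma> ` dom X)" for \<sigma> \<sigma>' X
    using that push_push[OF that(2,3)] typed_bij_push[of \<sigma> X] typed_bij_push[of \<sigma>' "push \<sigma> X"]
    by (simp add: pm_pm is_tfs_push)
  have t: "tarr (pm \<sigma> (dm m) (push \<sigma> (dm m)))" "tarr (pm \<rho> (cd m) (push \<rho> (cd m)))"
    "tarr (pm \<sigma>' (push \<sigma> (dm m)) (push \<sigma>' (push \<sigma> (dm m))))"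
    "tarr (pm \<rho>' (push \<rho> (cd m)) (push \<rho>' (push \<rho> (cd m))))"
    using D assms by (simp_all add: is_tfs_push typed_bij_push)
  have "pm (\<sigma>' \<circ> \<sigma>) (dm m) (push (\<sigma>' \<circ> \<sigma>) (dm m)) \<bullet> rel \<sigma>' \<rho>' (rel \<sigma> \<rho> m) =
      pm \<sigma> (dm m) (push \<sigma> (dm m)) \<bullet> (pm \<sigma>' (push \<sigma> (dm m)) (push \<sigma>' (push \<sigma> (dm m))) \<bullet>
        rel \<sigma>' \<rho>' (rel \<sigma> \<rho> m))"
    unfolding pp[OF D(1) assms(2,4)] using assms t by (intro cp_assoc) simp_all
  also have "\<dots> = (pm \<sigma> (dm m) (push \<sigma> (dm m)) \<bullet> rel \<sigma> \<rho> m) \<bullet>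
      pm \<rho>' (push \<rho> (cd m)) (push \<rho>' (push \<rho> (cd m)))"
    using assms t rel_square[of "rel \<sigma> \<rho> m" \<sigma>' \<rho>'] by (simp add: cp_assoc)
  also have "\<dots> = m \<bullet> pm (\<rho>' \<circ> \<rho>) (cd m) (push (\<rho>' \<circ> \<rho>) (cd m))"
    unfolding pp[OF D(2) assms(3,5)] using assms t by (simp add: rel_square cp_assoc)
  finally show "pm (\<sigma>' \<circ> \<sigma>) (dm m) (push (\<sigma>' \<circ> \<sigma>) (dm m)) \<bullet> rel \<sigma>' \<rho>' (rel \<sigma> \<rho> m) =
    m \<bullet> pm (\<rho>' \<circ> \<rho>) (cd m) (push (\<rho>' \<circ> \<rho>) (cd m))" .
qed (use assms in \<open>simp_all add: comp_inj_on push_push\<close>)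

text \<open>Injectivity on the union of the labels, and not only on each summand, keeps the
  relabelled summands disjoint.\<close>

lemma rel_un:
  assumes "tarr m" "tarr n" "compat m n"
    "inj_on \<sigma> (dom (dm m) \<union> dom (dm n))" "inj_on \<rho> (dom (cd m) \<union> dom (cd n))"
  shows "rel \<sigma> \<rho> (m \<uplus> n) = rel \<sigma> \<rho> m \<uplus> rel \<sigma> \<rho> n" "compat (rel \<sigma> \<rho> m) (rel \<sigma> \<rho> n)"
proof -
  note D = tarrD[OF assms(1)] tarrD[OF assms(2)]
  have i: "inj_on \<sigma> (dom (dm m))" "inj_on \<sigma> (dom (dm n))" "inj_on \<rho> (dom (cd m))" "inj_on \<rho> (dom (cd n))"
    using assms by (auto simp: inj_on_Un)
  have d: "dom (dm m) \<inter> dom (dm n) = {}" "dom (cd m) \<inter> dom (cd n) = {}"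
    using assms(3) by (auto simp: compat_def)
  have d': "dom (push \<sigma> (dm m)) \<inter> dom (push \<sigma> (dm n)) = {}" "dom (push \<rho> (cd m)) \<inter> dom (push \<rho> (cd n)) = {}"
    using assms(4,5) d by (simp_all add: image_disjoint)
  then show c: "compat (rel \<sigma> \<rho> m) (rel \<sigma> \<rho> n)" by (simp add: compat_def)
  have p: "push \<sigma> (dm m ++ dm n) = push \<sigma> (dm m) ++ push \<sigma> (dm n)"
    "push \<rho> (cd m ++ cd n) = push \<rho> (cd m) ++ push \<rho> (cd n)"
    using assms d by (simp_all add: push_add)
  have c': "compat (pm \<sigma> (dm m) (push \<sigma> (dm m))) (pm \<sigma> (dm n) (push \<sigma> (dm n)))"
    "compat (pm \<rho> (cd m) (push \<rho> (cd m))) (pm \<rho> (cd n) (push \<rho> (cd n)))"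
    using d d' by (simp_all add: compat_def)
  note t = tarr_pm_push(1)[OF D(1) i(1)] tarr_pm_push(1)[OF D(6) i(2)]
    tarr_pm_push(1)[OF D(2) i(3)] tarr_pm_push(1)[OF D(7) i(4)]
  have u: "pm \<sigma> (dm m) (push \<sigma> (dm m)) \<uplus> pm \<sigma> (dm n) (push \<sigma> (dm n)) =
      pm \<sigma> (dm m ++ dm n) (push \<sigma> (dm m) ++ push \<sigma> (dm n))"
    "pm \<rho> (cd m) (push \<rho> (cd m)) \<uplus> pm \<rho> (cd n) (push \<rho> (cd n)) =
      pm \<rho> (cd m ++ cd n) (push \<rho> (cd m) ++ push \<rho> (cd n))"
    using D d d' i by (simp_all add: un_pm is_tfs_push typed_bij_push)
  show "rel \<sigma> \<rho> (m \<uplus> n) = rel \<sigma> \<rho> m \<uplus> rel \<sigma> \<rho> n"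
  proof (rule rel_eqI)
    have "pm \<sigma> (dm m ++ dm n) (push \<sigma> (dm m) ++ push \<sigma> (dm n)) \<bullet> (rel \<sigma> \<rho> m \<uplus> rel \<sigma> \<rho> n) =
        (pm \<sigma> (dm m) (push \<sigma> (dm m)) \<bullet> rel \<sigma> \<rho> m) \<uplus> (pm \<sigma> (dm n) (push \<sigma> (dm n)) \<bullet> rel \<sigma> \<rho> n)"
      unfolding u[symmetric] using assms i t c c' by (intro un_cp[symmetric]) simp_all
    also have "\<dots> = (m \<uplus> n) \<bullet> pm \<rho> (cd m ++ cd n) (push \<rho> (cd m) ++ push \<rho> (cd n))"
      unfolding u[symmetric] using assms i t c c' by (simp add: rel_square un_cp)
    finally show "pm \<sigma> (dm (m \<uplus> n)) (push \<sigma> (dm (m \<uplus> n))) \<bullet> (rel \<sigma> \<rho> m \<uplus> rel \<sigma> \<rho> n) =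
        (m \<uplus> n) \<bullet> pm \<rho> (cd (m \<uplus> n)) (push \<rho> (cd (m \<uplus> n)))"
      by (simp add: p)
  qed (use assms i c p in \<open>simp_all add: Un_commute\<close>)
qed

lemma rel_cong:
  assumes "tarr m" "inj_on \<sigma> (dom (dm m))" "inj_on \<rho> (dom (cd m))"
    "\<And>x. x \<in> dom (dm m) \<Longrightarrow> \<sigma> x = \<sigma>' x" "\<And>x. x \<in> dom (cd m) \<Longrightarrow> \<rho> x = \<rho>' x"
  shows "rel \<sigma> \<rho> m = rel \<sigma>' \<rho>' m"
proof (rule rel_eqI)
  note D = tarrD[OF assms(1)]
  have i: "inj_on \<sigma>' (dom (dm m))" "inj_on \<rho>' (dom (cd m))"
    using assms inj_on_cong[of "dom (dm m)" \<sigma> \<sigma>'] inj_on_cong[of "dom (cd m)" \<rho> \<rho>'] by auto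
  have p: "push \<sigma> (dm m) = push \<sigma>' (dm m)" "push \<rho> (cd m) = push \<rho>' (cd m)"
    using assms by (auto intro!: push_cong)
  have q: "pm \<sigma> (dm m) Y = pm \<sigma>' (dm m) Y" "pm \<rho> (cd m) Y = pm \<rho>' (cd m) Y" for Y
    using assms D by (auto intro!: pm_cong)
  show "pm \<sigma> (dm m) (push \<sigma> (dm m)) \<bullet> rel \<sigma>' \<rho>' m = m \<bullet> pm \<rho> (cd m) (push \<rho> (cd m))"
    unfolding p q using assms(1) i by (rule rel_square)
  show "tarr (rel \<sigma>' \<rho>' m)" "dm (rel \<sigma>' \<rho>' m) = push \<sigma> (dm m)" "cd (rel \<sigma>' \<rho>' m) = push \<rho> (cd m)"
    using assms(1) i by (simp_all add: p)
qed (use assms in simp_all)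

lemma rel_id [simp]: "tarr m \<Longrightarrow> rel id id m = m"
  using tarrD[of m] by (intro rel_eqI) simp_all

text \<open>A relabelled relabelling is again one, along any map of labels that closes the square
  formed by \<mu>, \<sigma> and \<rho>.\<close>

lemma rel_pm:
  assumes "tfs X" "tfs Y" "typed_bij X Y \<mu>" "inj_on \<sigma> (dom X)" "inj_on \<rho> (dom Y)"
    "inj_on \<mu>' (\<sigma> ` dom X)" "\<And>x. x \<in> dom X \<Longrightarrow> \<mu>' (\<sigma> x) = \<rho> (\<mu> x)"
  shows "rel \<sigma> \<rho> (pm \<mu> X Y) = pm \<mu>' (push \<sigma> X) (push \<rho> Y)"
proof (rule rel_eqI)
  note b = typed_bij_push[OF assms(4)] typed_bij_push[OF assms(5)]
  have "push \<rho> Y = push (\<rho> \<circ> \<mu>) X"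
    using push_unique[OF typed_bij_comp[OF assms(3) b(2)]] by simp
  also have "\<dots> = push (\<mu>' \<circ> \<sigma>) X"
  proof (rule push_cong)
    show "inj_on (\<rho> \<circ> \<mu>) (dom X)"
      using assms(5) typed_bij_dom[OF assms(3)] typed_bij_inj[OF assms(3)] by (simp add: comp_inj_on)
  qed (simp add: assms(7))
  also have "\<dots> = push \<mu>' (push \<sigma> X)" using assms by (simp add: push_push)
  finally have b': "typed_bij (push \<sigma> X) (push \<rho> Y) \<mu>'"
    using assms(6) typed_bij_push[of \<mu>' "push \<sigma> X"] by simp
  have "pm \<sigma> X (push \<sigma> X) \<bullet> pm \<mu>' (push \<sigma> X) (push \<rho> Y) = pm (\<mu>' \<circ> \<sigma>) X (push \<rho> Y)"
    using assms b b' by (simp add: pm_pm is_tfs_push)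
  also have "\<dots> = pm (\<rho> \<circ> \<mu>) X (push \<rho> Y)" using assms by (intro pm_cong) auto
  also have "\<dots> = pm \<mu> X Y \<bullet> pm \<rho> Y (push \<rho> Y)" using assms b by (simp add: pm_pm is_tfs_push)
  finally show "pm \<sigma> (dm (pm \<mu> X Y)) (push \<sigma> (dm (pm \<mu> X Y))) \<bullet> pm \<mu>' (push \<sigma> X) (push \<rho> Y) =
    pm \<mu> X Y \<bullet> pm \<rho> (cd (pm \<mu> X Y)) (push \<rho> (cd (pm \<mu> X Y)))" by simp
  show "tarr (pm \<mu>' (push \<sigma> X) (push \<rho> Y))" using assms b' by (simp add: is_tfs_push)
qed (use assms in simp_all)

lemma rel_idt: "\<lbrakk>tfs X; inj_on \<sigma> (dom X)\<rbrakk> \<Longrightarrow> rel \<sigma> \<sigma> (idt X) = idt (push \<sigma> X)"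
  by (rule rel_pm) (simp_all add: typed_bij_id)

text \<open>Relabelling back along the inverses recovers the morphism. The value of a diagram is
  specified through its relabelled form, so its uniqueness needs this.\<close>

lemma rel_inj:
  assumes "tarr m" "tarr n" "dm m = dm n" "cd m = cd n" "rel \<sigma> \<rho> m = rel \<sigma> \<rho> n"
    "inj_on \<sigma> (dom (dm m))" "inj_on \<rho> (dom (cd m))"
  shows "m = n"
proof -
  have "rel (inv_into (dom (dm k)) \<sigma>) (inv_into (dom (cd k)) \<rho>) (rel \<sigma> \<rho> k) = k"
    if "k = m \<or> k = n" for k
  proof -
    have k: "tarr k" "inj_on \<sigma> (dom (dm k))" "inj_on \<rho> (dom (cd k))" using assms that by auto
    have "rel (inv_into (dom (dm k)) \<sigma>) (inv_into (dom (cd k)) \<rho>) (rel \<sigma> \<rho> k) =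
        rel (inv_into (dom (dm k)) \<sigma> \<circ> \<sigma>) (inv_into (dom (cd k)) \<rho> \<circ> \<rho>) k"
      using k by (intro rel_rel) (auto simp: inj_on_inv_into)
    also have "\<dots> = rel id id k"
      by (rule rel_cong[symmetric]) (use k in simp_all)
    finally show ?thesis using k by simp
  qed
  note inv = this
  have "m = rel (inv_into (dom (dm m)) \<sigma>) (inv_into (dom (cd m)) \<rho>) (rel \<sigma> \<rho> m)"
    by (rule inv[symmetric]) simp
  also have "\<dots> = rel (inv_into (dom (dm n)) \<sigma>) (inv_into (dom (cd n)) \<rho>) (rel \<sigma> \<rho> n)"
    by (simp only: assms)
  also have "\<dots> = n" by (rule inv) simp
  finally show ?thesis .
qed

section \<open>Firing a morphism inside a larger state\<close>

definition rest where "rest X m = X |` (- dom (dm m))"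

definition fire where "fire m X = m \<uplus> idt (rest X m)"

text \<open>The produced labels must avoid what is left of the state; a label that has just been
  consumed may be produced again.\<close>

definition can where
  "can m X \<longleftrightarrow> tarr m \<and> dm m \<subseteq>\<^sub>m X \<and> dom (cd m) \<inter> dom (rest X m) = {}"

primrec exec where
  "exec X [] = idt X"
| "exec X (m # ms) = fire m X \<bullet> exec (cd m ++ rest X m) ms"

primrec valid where
  "valid X [] \<longleftrightarrow> True"
| "valid X (m # ms) \<longleftrightarrow> can m X \<and> valid (cd m ++ rest X m) ms"

lemma dom_rest: "dom (rest X m) = dom X - dom (dm m)"
  by (auto simp: rest_def)

lemma tfs_rest [simp]: "tfs X \<Longrightarrow> tfs (rest X m)"
  by (simp add: rest_def is_tfs_restrict)

lemma dm_rest: "can m X \<Longrightarrow> dm m ++ rest X m = X"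
  by (simp add: can_def rest_def map_add_restrict)

lemma tarr_idt [simp]: "tfs X \<Longrightarrow> tarr (idt X)"
  by (simp add: typed_bij_id)

lemma canD:
  assumes "can m X"
  shows "tarr m" "dm m \<subseteq>\<^sub>m X" "dom (cd m) \<inter> dom (rest X m) = {}" "dom (dm m) \<inter> dom (rest X m) = {}"
    "dom (dm m) \<subseteq> dom X" "compat m (idt (rest X m))"
  using assms map_le_dom[of "dm m" X] by (auto simp: can_def dom_rest compat_def)

lemma fire_simps [simp]:
  assumes "can m X" "tfs X"
  shows "tarr (fire m X)" "dm (fire m X) = X" "cd (fire m X) = cd m ++ rest X m"
  using assms canD[OF assms(1)] by (simp_all add: fire_def dm_rest)

lemma tfs_fire [simp]: "\<lbrakk>can m X; tfs X\<rbrakk> \<Longrightarrow> tfs (cd m ++ rest X m)"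
  using tarrD(2)[OF fire_simps(1)] by simp

lemma exec_simps [simp]:
  assumes "valid X ms" "tfs X"
  shows "tarr (exec X ms)" "dm (exec X ms) = X"
proof -
  have "tarr (exec X ms) \<and> dm (exec X ms) = X"
    using assms
  proof (induction ms arbitrary: X)
    case (Cons m ms)
    then show ?case using tfs_fire[of m X] by simp
  qed simp
  then show "tarr (exec X ms)" "dm (exec X ms) = X" by auto
qed

lemma valid_append:
  "tfs X \<Longrightarrow> valid X (ms @ ns) \<longleftrightarrow> valid X ms \<and> valid (cd (exec X ms)) ns"
proof (induction ms arbitrary: X)
  case (Cons m ms)
  then show ?case using tfs_fire[of m X] by auto
qed simp

lemma exec_append:
  "\<lbrakk>tfs X; valid X ms; valid (cd (exec X ms)) ns\<rbrakk> \<Longrightarrow>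
    exec X (ms @ ns) = exec X ms \<bullet> exec (cd (exec X ms)) ns"
proof (induction ms arbitrary: X)
  case (Cons m ms)
  then show ?case
    using tarrD(2)[OF exec_simps(1), of "cd m ++ rest X m" ms] by (simp add: cp_assoc)
qed simp

text \<open>Every label of every state of the execution lies in this set. It is where relabellings
  have to be injective and which frames have to avoid.\<close>

definition labels where "labels X ms = dom X \<union> (\<Union>m\<in>set ms. dom (cd m))"

lemma labels_simps [simp]:
  "labels X [] = dom X" "labels X (m # ms) = dom (cd m) \<union> labels X ms"
  by (auto simp: labels_def)

lemma labels_step: "labels (cd m ++ rest X m) ms \<subseteq> labels X (m # ms)"
  by (auto simp: labels_def dom_rest)

lemma dom_labels: "dom X \<subseteq> labels X ms"
  by (simp add: labels_def)

lemma cd_exec_labels: "\<lbrakk>valid X ms; tfs X\<rbrakk> \<Longrightarrow> dom (cd (exec X ms)) \<subseteq> labels X ms"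
proof (induction ms arbitrary: X)
  case (Cons m ms)
  then show ?case using labels_step[of m X ms] by fastforce
qed simp

text \<open>Each firing keeps \<open>R\<close> in its identity summand, since no label of
  \<open>R\<close> is ever consumed or produced; \<open>un_assoc\<close> regroups the summands and
  \<open>un_cp\<close> collects the identities. This embeds the execution of a guest into the state
  of its host.\<close>

lemma exec_frame:
  assumes "valid X ms" "tfs X" "tfs R" "dom R \<inter> labels X ms = {}"
  shows "valid (X ++ R) ms \<and> exec (X ++ R) ms = exec X ms \<uplus> idt R"
  using assms
proof (induction ms arbitrary: X)
  case Nil
  then have "dom X \<inter> dom R = {}" by auto
  then show ?case using un_idt[OF Nil(2,3)] by (simp add: id_def)
next
  case (Cons m ms)
  let ?Y = "cd m ++ rest X m"
  have c: "can m X" and v: "valid ?Y ms" and Y: "tfs ?Y" using Cons.prems by auto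
  note cD = canD[OF c]
  have d: "dom R \<inter> dom X = {}" "dom R \<inter> dom (cd m) = {}" "dom R \<inter> labels ?Y ms = {}"
    using Cons.prems(4)[unfolded labels_simps] labels_step[of m X ms, unfolded labels_simps]
      dom_labels[of X ms] by blast+
  have dR: "dom (dm m) \<inter> dom R = {}" "dom (cd m) \<inter> dom R = {}" using d cD(5) by blast+
  have r: "rest (X ++ R) m = rest X m ++ R"
  proof -
    have "dom R \<subseteq> - dom (dm m)" using d(1) cD(5) by blast
    from restrict_superset[OF this] show ?thesis by (simp add: rest_def restrict_map_add)
  qed
  have "dm m \<subseteq>\<^sub>m X ++ R"
    using map_le_add_left[OF cD(2), of R] cD(5) d(1) by blast
  then have c': "can m (X ++ R)" using cD d unfolding can_def r by auto
  have IH: "valid (?Y ++ R) ms" "exec (?Y ++ R) ms = exec ?Y ms \<uplus> idt R"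
    using Cons.IH[OF v Y Cons.prems(3) d(3)] by (auto simp: id_def)
  have "dom (rest X m) \<inter> dom R = {}" using d by (auto simp: dom_rest)
  then have "fire m (X ++ R) = m \<uplus> (idt (rest X m) \<uplus> idt R)"
    unfolding fire_def r using Cons.prems by (simp add: un_idt)
  also have "\<dots> = fire m X \<uplus> idt R"
    unfolding fire_def using Cons.prems cD d dR
    by (intro un_assoc[symmetric]) (auto simp: compat_def dom_rest)
  finally have f: "fire m (X ++ R) = fire m X \<uplus> idt R" .
  have "exec (X ++ R) (m # ms) = (fire m X \<uplus> idt R) \<bullet> (exec ?Y ms \<uplus> idt R)"
    using f IH by (simp add: r)
  also have "\<dots> = (fire m X \<bullet> exec ?Y ms) \<uplus> (idt R \<bullet> idt R)"
  proof (rule un_cp[symmetric])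
    show "compat (fire m X) (idt R)"
      using c Cons.prems d by (auto simp: compat_def dom_rest)
    show "compat (exec ?Y ms) (idt R)"
    proof -
      have sub: "B \<inter> dom R = {}" if "B \<subseteq> labels ?Y ms" for B using d(3) that by blast
      show ?thesis
        unfolding compat_def pm_simps exec_simps(2)[OF v Y]
        by (intro conjI sub cd_exec_labels[OF v Y] dom_labels)
    qed
  qed (use c v Y Cons.prems in simp_all)
  also have "idt R \<bullet> idt R = idt R" using Cons.prems(3) by simp
  finally show ?case using c' IH(1) Cons.prems by (simp add: r id_def)
qed

lemma fire_rel:
  assumes "can m X" "tfs X" "inj_on \<sigma> (dom X \<union> dom (cd m))"
  shows "can (rel \<sigma> \<sigma> m) (push \<sigma> X)" "rest (push \<sigma> X) (rel \<sigma> \<sigma> m) = push \<sigma> (rest X m)"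
    "push \<sigma> (cd m ++ rest X m) = cd (rel \<sigma> \<sigma> m) ++ rest (push \<sigma> X) (rel \<sigma> \<sigma> m)"
    "fire (rel \<sigma> \<sigma> m) (push \<sigma> X) = rel \<sigma> \<sigma> (fire m X)"
proof -
  note cD = canD[OF assms(1)]
  have i: "inj_on \<sigma> (dom (dm m))" "inj_on \<sigma> (dom (cd m))" "inj_on \<sigma> (dom X)"
    "inj_on \<sigma> (dom (cd m) \<union> dom (rest X m))" "inj_on \<sigma> (dom (rest X m))"
    by (rule inj_on_subset[OF assms(3)]; use cD(5) in \<open>auto simp: dom_rest\<close>)+
  show r: "rest (push \<sigma> X) (rel \<sigma> \<sigma> m) = push \<sigma> (rest X m)"
    unfolding rest_def rel_simps dom_push using i cD by (intro push_restrict[symmetric]) auto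
  show "push \<sigma> (cd m ++ rest X m) = cd (rel \<sigma> \<sigma> m) ++ rest (push \<sigma> X) (rel \<sigma> \<sigma> m)"
    unfolding r using i cD by (simp add: push_add)
  have "\<sigma> ` dom (cd m) \<inter> \<sigma> ` dom (rest X m) = {}"
    using i(4) cD(3) by (rule image_disjoint)
  then show "can (rel \<sigma> \<sigma> m) (push \<sigma> X)"
    unfolding can_def r using i cD by (simp add: push_map_le)
  have "dom (dm m) \<union> dom (rest X m) = dom X" using cD by (auto simp: dom_rest)
  then show "fire (rel \<sigma> \<sigma> m) (push \<sigma> X) = rel \<sigma> \<sigma> (fire m X)"
    unfolding fire_def r using i cD assms by (subst rel_un) (simp_all add: rel_idt)
qed

text \<open>A relabelling that separates all labels that occur commutes with each firing, hence with
  the execution. In this way an execution of one diagram becomes a segment of an execution of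
  another.\<close>

lemma exec_rel:
  assumes "valid X ms" "tfs X" "inj_on \<sigma> (labels X ms)"
  shows "valid (push \<sigma> X) (map (rel \<sigma> \<sigma>) ms) \<and>
    exec (push \<sigma> X) (map (rel \<sigma> \<sigma>) ms) = rel \<sigma> \<sigma> (exec X ms)"
  using assms
proof (induction ms arbitrary: X)
  case Nil
  then show ?case by (simp add: rel_idt)
next
  case (Cons m ms)
  let ?Y = "cd m ++ rest X m"
  have c: "can m X" and v: "valid ?Y ms" and Y: "tfs ?Y" using Cons.prems by auto
  have i: "inj_on \<sigma> (labels ?Y ms)"
    by (rule inj_on_subset[OF Cons.prems(3) labels_step])
  have ix: "inj_on \<sigma> (dom X \<union> dom (cd m))"
    by (rule inj_on_subset[OF Cons.prems(3)]) (use dom_labels[of X ms] in auto)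
  note F = fire_rel[OF c Cons.prems(2) ix]
  have IH: "valid (push \<sigma> ?Y) (map (rel \<sigma> \<sigma>) ms)" "exec (push \<sigma> ?Y) (map (rel \<sigma> \<sigma>) ms) = rel \<sigma> \<sigma> (exec ?Y ms)"
    using Cons.IH[OF v Y i] by auto
  have "rel \<sigma> \<sigma> (exec X (m # ms)) = rel \<sigma> \<sigma> (fire m X) \<bullet> rel \<sigma> \<sigma> (exec ?Y ms)"
    unfolding exec.simps
  proof (rule rel_cp)
    show "inj_on \<sigma> (dom (dm (fire m X)))" "inj_on \<sigma> (dom (cd (fire m X)))"
      by (rule inj_on_subset[OF ix]; use c Cons.prems in \<open>auto simp: dom_rest\<close>)+
    show "inj_on \<sigma> (dom (cd (exec ?Y ms)))"
      by (rule inj_on_subset[OF i cd_exec_labels[OF v Y]])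
  qed (use c v Y Cons.prems in simp_all)
  then show ?case using F IH by simp
qed

section \<open>Independence of the order of execution\<close>

definition fresh where
  "fresh U ms \<longleftrightarrow> (\<forall>m\<in>set ms. dom (cd m) \<inter> U = {}) \<and>
    sorted_wrt (\<lambda>m n. dom (cd m) \<inter> dom (cd n) = {}) ms"

text \<open>Two consecutive morphisms, the second of which does not use the output of the first, act
  on disjoint parts of the state. The form of the result matters: it is symmetric in
  \<open>a\<close> and \<open>b\<close> by \<open>un_commute\<close>, which is what
  \<open>fire_swap\<close> exploits.\<close>

lemma fire_fire:
  assumes "can b X" "can a (cd b ++ rest X b)" "tfs X" "dm a \<subseteq>\<^sub>m X" "dom (dm a) \<inter> dom (dm b) = {}"
    "dom (cd a) \<inter> dom X = {}" "dom (cd b) \<inter> dom X = {}" "dom (cd a) \<inter> dom (cd b) = {}"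
  defines "R \<equiv> rest (rest X a) b"
  shows "fire b X \<bullet> fire a (cd b ++ rest X b) = (b \<uplus> a) \<uplus> idt R"
    "cd a ++ rest (cd b ++ rest X b) a = (cd a ++ cd b) ++ R"
    "can a X"
proof -
  note b = canD[OF assms(1)] and a = canD[OF assms(2)]
  have A: "dom (dm a) \<subseteq> dom X" using map_le_dom[OF assms(4)] .
  have AB: "dom (cd b) \<inter> dom (dm a) = {}" "dom (dm a) \<inter> dom (cd b) = {}" using A assms(7) by blast+
  have R: "tfs R" "dom R = dom X - dom (dm a) - dom (dm b)"
    using assms(3) by (auto simp: R_def dom_rest)
  have rb: "rest X b = dm a ++ R"
    using map_add_restrict[OF map_le_restrict[OF assms(4,5)]]
    by (simp add: R_def rest_def Int_commute)
  have ra: "rest (cd b ++ rest X b) a = cd b ++ R"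
  proof -
    have "dom (cd b) \<subseteq> - dom (dm a)" using assms(7) A by blast
    from restrict_superset[OF this] show ?thesis
      by (simp add: rest_def R_def restrict_map_add Int_commute)
  qed
  show "cd a ++ rest (cd b ++ rest X b) a = (cd a ++ cd b) ++ R" by (simp add: ra)
  show "can a X" using assms a by (auto simp: can_def dom_rest)
  have f1: "fire b X = (b \<uplus> idt (dm a)) \<uplus> idt R"
  proof -
    have "fire b X = b \<uplus> (idt (dm a) \<uplus> idt R)"
      unfolding fire_def rb using a R tarrD[OF a(1)] by (subst un_idt) auto
    also have "\<dots> = (b \<uplus> idt (dm a)) \<uplus> idt R"
      using a b R tarrD[OF a(1)] assms A AB by (intro un_assoc[symmetric]) (auto simp: compat_def)
    finally show ?thesis .
  qed
  have f2: "fire a (cd b ++ rest X b) = (idt (cd b) \<uplus> a) \<uplus> idt R"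
  proof -
    have "fire a (cd b ++ rest X b) = a \<uplus> (idt (cd b) \<uplus> idt R)"
      unfolding fire_def ra using b R tarrD[OF b(1)] assms by (subst un_idt) auto
    also have "\<dots> = (a \<uplus> idt (cd b)) \<uplus> idt R"
      using a b R tarrD[OF b(1)] assms A AB by (intro un_assoc[symmetric]) (auto simp: compat_def)
    also have "a \<uplus> idt (cd b) = idt (cd b) \<uplus> a"
      using a b tarrD[OF b(1)] assms A AB by (intro un_commute) (auto simp: compat_def)
    finally show ?thesis .
  qed
  have c: "compat b (idt (dm a))" "compat (idt (cd b)) a" "compat (b \<uplus> idt (dm a)) (idt R)"
    "compat (idt (cd b) \<uplus> a) (idt R)" "compat b a"
    using assms A AB R by (auto simp: compat_def)
  \<comment> \<open>By interchange, \<open>b\<close> meets the identity of its codomain and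
    \<open>a\<close> the identity of its domain.\<close>
  have "((b \<uplus> idt (dm a)) \<uplus> idt R) \<bullet> ((idt (cd b) \<uplus> a) \<uplus> idt R) =
      ((b \<uplus> idt (dm a)) \<bullet> (idt (cd b) \<uplus> a)) \<uplus> (idt R \<bullet> idt R)"
    using a b R tarrD[OF a(1)] tarrD[OF b(1)] c by (intro un_cp[symmetric]) simp_all
  also have "(b \<uplus> idt (dm a)) \<bullet> (idt (cd b) \<uplus> a) = (b \<bullet> idt (cd b)) \<uplus> (idt (dm a) \<bullet> a)"
    using a b R tarrD[OF a(1)] tarrD[OF b(1)] c by (intro un_cp[symmetric]) simp_all
  also have "b \<bullet> idt (cd b) = b" using b by simp
  also have "idt (dm a) \<bullet> a = a" using a by simp
  also have "idt R \<bullet> idt R = idt R" using R by simp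
  finally show "fire b X \<bullet> fire a (cd b ++ rest X b) = (b \<uplus> a) \<uplus> idt R"
    unfolding f1 f2 .
qed

lemma fire_swap:
  assumes "can b X" "can a (cd b ++ rest X b)" "tfs X" "dm a \<subseteq>\<^sub>m X" "dom (dm a) \<inter> dom (dm b) = {}"
    "dom (cd a) \<inter> dom X = {}" "dom (cd b) \<inter> dom X = {}" "dom (cd a) \<inter> dom (cd b) = {}"
  shows "can a X" "can b (cd a ++ rest X a)"
    "fire b X \<bullet> fire a (cd b ++ rest X b) = fire a X \<bullet> fire b (cd a ++ rest X a)"
    "cd a ++ rest (cd b ++ rest X b) a = cd b ++ rest (cd a ++ rest X a) b"
proof -
  note b = canD[OF assms(1)] and a = canD[OF assms(2)]
  note F = fire_fire[OF assms]
  show c: "can a X" by (rule F(3))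
  have le: "dm b \<subseteq>\<^sub>m cd a ++ rest X a"
    unfolding rest_def using b(2) assms(5) by (intro map_le_add_right map_le_restrict) auto
  then show c': "can b (cd a ++ rest X a)"
    using b assms unfolding can_def by (auto simp: dom_rest)
  have "dom (dm b) \<inter> dom (dm a) = {}" "dom (cd b) \<inter> dom (cd a) = {}" using assms by auto
  note G = fire_fire[OF c c' assms(3) b(2) this(1) assms(7,6) this(2)]
  have r: "rest (rest X a) b = rest (rest X b) a"
    by (auto simp: rest_def Int_commute)
  have cc: "compat b a" using assms by (auto simp: compat_def)
  show "fire b X \<bullet> fire a (cd b ++ rest X b) = fire a X \<bullet> fire b (cd a ++ rest X a)"
    unfolding F(1) G(1) r using un_commute[OF b(1) a(1) cc] by simp
  show "cd a ++ rest (cd b ++ rest X b) a = cd b ++ rest (cd a ++ rest X a) b"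
    unfolding F(2) G(2) r using map_add_comm[OF assms(8)] by simp
qed

text \<open>Labels are never produced twice, so what a later box consumes has been present ever since.\<close>

lemma consumed:
  assumes "valid X (ys @ a # zs)" "fresh U (ys @ a # zs)" "dom X \<subseteq> U"
  shows "dom (dm a) \<inter> U \<subseteq> dom X"
  using assms
proof (induction ys arbitrary: X U)
  case Nil
  then show ?case using canD(5)[of a X] by auto
next
  case (Cons b ys)
  let ?Y = "cd b ++ rest X b"
  have "fresh (U \<union> dom (cd b)) (ys @ a # zs)"
    using Cons.prems(2) by (simp add: fresh_def Int_Un_distrib) blast
  then have "dom (dm a) \<inter> (U \<union> dom (cd b)) \<subseteq> dom ?Y"
    using Cons.prems by (intro Cons.IH) (auto simp: dom_rest)
  moreover have "dom (cd b) \<inter> U = {}" using Cons.prems(2) by (auto simp: fresh_def)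
  ultimately show ?case by (auto simp: dom_rest)
qed

text \<open>A morphism whose inputs are present from the start is swapped to the front one step at a
  time. No morphism before it can take these inputs, since they would have to be produced a second
  time; \<open>U\<close> collects the labels seen so far.\<close>

lemma exec_bubble:
  assumes "valid X (ys @ a # zs)" "fresh U (ys @ a # zs)" "dom X \<subseteq> U" "tfs X" "dm a \<subseteq>\<^sub>m X"
  shows "valid X (a # ys @ zs) \<and> exec X (ys @ a # zs) = exec X (a # ys @ zs)"
  using assms
proof (induction ys arbitrary: X U)
  case (Cons b ys)
  let ?Y = "cd b ++ rest X b"
  have c: "can b X" and v: "valid ?Y (ys @ a # zs)" and Y: "tfs ?Y" using Cons.prems by auto
  have fr: "fresh (U \<union> dom (cd b)) (ys @ a # zs)"
    using Cons.prems(2) by (simp add: fresh_def Int_Un_distrib) blast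
  have d: "dom (cd b) \<inter> U = {}" "dom (cd a) \<inter> U = {}" "dom (cd a) \<inter> dom (cd b) = {}"
    using Cons.prems(2) by (auto simp: fresh_def)
  have YU: "dom ?Y \<subseteq> U \<union> dom (cd b)" using Cons.prems(3) by (auto simp: dom_rest)
  have A: "dom (dm a) \<subseteq> dom X" by (rule map_le_dom[OF Cons.prems(5)])
  \<comment> \<open>A label consumed by both would be an old label missing from the state after
    \<open>b\<close>, contrary to \<open>consumed\<close>.\<close>
  have ab: "dom (dm a) \<inter> dom (dm b) = {}"
    using consumed[OF v fr YU] A Cons.prems(3) d by (simp add: dom_rest) blast
  have le: "dm a \<subseteq>\<^sub>m ?Y"
    unfolding rest_def using Cons.prems(5) ab by (intro map_le_add_right map_le_restrict)
  have IH: "valid ?Y (a # ys @ zs)" "exec ?Y (ys @ a # zs) = exec ?Y (a # ys @ zs)"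
    using Cons.IH[OF v fr YU Y le] by auto
  have d': "dom (cd a) \<inter> dom X = {}" "dom (cd b) \<inter> dom X = {}" using d Cons.prems(3) by blast+
  have ca: "can a ?Y" using IH(1) by simp
  note S = fire_swap[OF c ca Cons.prems(4,5) ab d' d(3)]
  have v': "valid (cd a ++ rest ?Y a) (ys @ zs)" using IH(1) by simp
  then have v2: "valid X (a # b # ys @ zs)" using S by simp
  have "exec X (b # ys @ a # zs) = fire b X \<bullet> (fire a ?Y \<bullet> exec (cd a ++ rest ?Y a) (ys @ zs))"
    using IH(2) by simp
  also have "\<dots> = (fire b X \<bullet> fire a ?Y) \<bullet> exec (cd a ++ rest ?Y a) (ys @ zs)"
    using c ca Y Cons.prems(4) v' by (intro cp_assoc[symmetric]) simp_all
  also have "\<dots> = (fire a X \<bullet> fire b (cd a ++ rest X a)) \<bullet> exec (cd a ++ rest ?Y a) (ys @ zs)"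
    by (simp only: S(3))
  also have "\<dots> = fire a X \<bullet> (fire b (cd a ++ rest X a) \<bullet> exec (cd a ++ rest ?Y a) (ys @ zs))"
    using S(1,2,4) Cons.prems(4) v' Y ca by (intro cp_assoc) (simp_all del: map_add_assoc)
  finally show ?case using v2 S(4) by simp
qed simp

text \<open>The head of the first list has its inputs in the start state, so
  \<open>exec_bubble\<close> brings it to the front of the second list as well; the tails agree by
  induction.\<close>

lemma exec_mset:
  assumes "valid X xs" "valid X ys" "fresh U xs" "fresh U ys" "dom X \<subseteq> U" "tfs X" "mset xs = mset ys"
  shows "exec X xs = exec X ys"
  using assms
proof (induction xs arbitrary: X U ys)
  case (Cons a xs)
  have "a \<in> set ys" using Cons.prems(7) by (metis list.set_intros(1) mset_eq_setD)
  then obtain ys1 ys2 where ys: "ys = ys1 @ a # ys2" by (meson split_list)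
  have "dm a \<subseteq>\<^sub>m X" using Cons.prems(1) canD(2) by simp
  then have B: "valid X (a # ys1 @ ys2)" "exec X ys = exec X (a # ys1 @ ys2)"
    using exec_bubble[of X ys1 a ys2 U] Cons.prems ys by auto
  have "exec (cd a ++ rest X a) xs = exec (cd a ++ rest X a) (ys1 @ ys2)"
  proof (rule Cons.IH)
    show "fresh (U \<union> dom (cd a)) xs"
      using Cons.prems(3) by (simp add: fresh_def Int_Un_distrib) blast
    show "fresh (U \<union> dom (cd a)) (ys1 @ ys2)"
      using Cons.prems(4) unfolding ys
      by (simp add: fresh_def sorted_wrt_append Int_Un_distrib) blast
    show "dom (cd a ++ rest X a) \<subseteq> U \<union> dom (cd a)"
      using Cons.prems(5) by (auto simp: dom_rest)
    show "mset xs = mset (ys1 @ ys2)" using Cons.prems(7) by (simp add: ys)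
  qed (use Cons.prems B in simp_all)
  then show ?case using B(2) by simp
qed simp

end

section \<open>Evaluation of wiring diagrams\<close>

lemma in_listset: "xs \<in> listset As \<longleftrightarrow> length xs = length As \<and> (\<forall>i<length As. xs ! i \<in> As ! i)"
proof (induction As arbitrary: xs)
  case (Cons A As)
  then show ?case
    by (cases xs) (auto simp: set_Cons_def nth_Cons split: nat.splits)
qed auto

lemma sources_simps [simp]:
  "sources ts v (InL x) = fst v x"
  "sources ts v (InR (Tag j y)) = (if j < length ts then snd (ts ! j) y else None)"
  "sources ts v (InR (InL z)) = None" "sources ts v (InR (InR z)) = None"
  "sources ts v (InR (Atom a)) = None" "sources ts v (Atom a) = None" "sources ts v (Tag j z) = None"
  by (simp_all add: sources_def)

lemma targets_simps [simp]:
  "targets ts v (InR x) = snd v x"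
  "targets ts v (InL (Tag j y)) = (if j < length ts then fst (ts ! j) y else None)"
  "targets ts v (InL (InL z)) = None" "targets ts v (InL (InR z)) = None"
  "targets ts v (InL (Atom a)) = None" "targets ts v (Atom a) = None" "targets ts v (Tag j z) = None"
  by (simp_all add: targets_def)

lemma sources_dom [simp]:
  "InL x \<in> dom (sources ts v) \<longleftrightarrow> x \<in> dom (fst v)"
  "InR (Tag j y) \<in> dom (sources ts v) \<longleftrightarrow> j < length ts \<and> y \<in> dom (snd (ts ! j))"
  by (auto simp: domIff)

lemma targets_dom [simp]:
  "InR x \<in> dom (targets ts v) \<longleftrightarrow> x \<in> dom (snd v)"
  "InL (Tag j y) \<in> dom (targets ts v) \<longleftrightarrow> j < length ts \<and> y \<in> dom (fst (ts ! j))"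
  by (auto simp: domIff)

lemma source_cases:
  assumes "s \<in> dom (sources ts v)"
  obtains (outer) x where "s = InL x" "x \<in> dom (fst v)"
  | (inner) j y where "s = InR (Tag j y)" "j < length ts" "y \<in> dom (snd (ts ! j))"
proof (cases s)
  case (InR z)
  then have "\<exists>j y. z = Tag j y" using assms by (cases z) (simp_all add: domIff)
  then show ?thesis using assms InR inner sources_dom(2)[of _ _ ts v] by blast
qed (use assms outer in \<open>simp_all add: domIff\<close>)

lemma target_cases:
  assumes "s \<in> dom (targets ts v)"
  obtains (outer) x where "s = InR x" "x \<in> dom (snd v)"
  | (inner) j y where "s = InL (Tag j y)" "j < length ts" "y \<in> dom (fst (ts ! j))"
proof (cases s)
  case (InL z)
  then have "\<exists>j y. z = Tag j y" using assms by (cases z) (simp_all add: domIff)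
  then show ?thesis using assms InL inner targets_dom(2)[of _ _ ts v] by blast
qed (use assms outer in \<open>simp_all add: domIff\<close>)

lemma is_tfs_targets:
  assumes "\<forall>t\<in>set ts. is_box \<tau> t" "is_box \<tau> v"
  shows "is_tfs \<tau> (targets ts v)"
  unfolding is_tfs_def
proof
  have "dom (targets ts v) \<subseteq> InR ` dom (snd v) \<union> (\<Union>j<length ts. (\<lambda>y. InL (Tag j y)) ` dom (fst (ts ! j)))"
    by (intro subsetI, erule target_cases) blast+
  then show "finite (dom (targets ts v))"
    by (rule finite_subset) (use assms in \<open>auto simp: is_box_def is_tfs_def\<close>)
  show "ran (targets ts v) \<subseteq> \<tau>"
  proof
    fix o' assume "o' \<in> ran (targets ts v)"
    then obtain s where s: "targets ts v s = Some o'" by (auto simp: ran_def)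
    then have "s \<in> dom (targets ts v)" by auto
    then show "o' \<in> \<tau>"
    proof (cases rule: target_cases)
      case (outer x)
      then show ?thesis using s assms(2) by (auto simp: is_box_def is_tfs_def intro: ranI)
    next
      case (inner j y)
      then have "is_box \<tau> (ts ! j)" using assms(1) by simp
      then show ?thesis using s inner by (auto simp: is_box_def is_tfs_def intro: ranI)
    qed
  qed
qed

text \<open>A diagram is described by the map taking each target to the source it is joined to.\<close>

definition wiring :: "('a, 't) box list \<Rightarrow> ('a, 't) box \<Rightarrow> ('a elt \<Rightarrow> 'a elt) \<Rightarrow> bool" where
  "wiring ts v \<phi> \<longleftrightarrow> typed_bij (targets ts v) (sources ts v) \<phi>"

definition graph :: "('a, 't) box list \<Rightarrow> ('a, 't) box \<Rightarrow> ('a elt \<Rightarrow> 'a elt) \<Rightarrow> ('a elt \<times> 'a elt) set" where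
  "graph ts v \<phi> = (\<lambda>y. (\<phi> y, y)) ` dom (targets ts v)"

lemma graph_iff: "(x, y) \<in> graph ts v \<phi> \<longleftrightarrow> y \<in> dom (targets ts v) \<and> \<phi> y = x"
  unfolding graph_def by blast

definition prec :: "('a, 't) box list \<Rightarrow> ('a, 't) box \<Rightarrow> ('a elt \<Rightarrow> 'a elt) \<Rightarrow> (nat \<times> nat) set" where
  "prec ts v \<phi> = {(i, j). \<exists>x y. InL (Tag j x) \<in> dom (targets ts v) \<and> \<phi> (InL (Tag j x)) = InR (Tag i y)}"

text \<open>The targets themselves serve as the apex and the identity as the target leg, so every
  source map is realised by a span.\<close>

lemma wiring_span:
  assumes "wiring ts v \<phi>" "is_tfs \<tau> (targets ts v)"
  shows "\<lparr>apex = targets ts v, sleg = \<phi>, tleg = id\<rparr> \<in> with_wires \<tau> ts v (graph ts v \<phi>)"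
  using assms by (auto simp: with_wires_def spans_def wires_def graph_def wiring_def typed_bij_id)

lemma wires_of_with_wires:
  assumes "wiring ts v \<phi>" "is_tfs \<tau> (targets ts v)"
  shows "wires_of (with_wires \<tau> ts v (graph ts v \<phi>)) = graph ts v \<phi>"
  using wiring_span[OF assms] unfolding wires_of_def by (auto simp: with_wires_def)

text \<open>Conversely, inverting the target leg of a span normalises it to a source map.\<close>

lemma span_wiring:
  assumes "s \<in> spans \<tau> (sources ts v) (targets ts v)"
  shows "\<exists>\<phi>. wiring ts v \<phi> \<and> wires s = graph ts v \<phi>"
proof -
  let ?A = "dom (apex s)"
  have sl: "typed_bij (apex s) (sources ts v) (sleg s)" and tl: "typed_bij (apex s) (targets ts v) (tleg s)"
    using assms by (auto simp: spans_def)
  define \<phi> where "\<phi> = sleg s \<circ> inv_into ?A (tleg s)"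
  have "wiring ts v \<phi>"
    unfolding wiring_def \<phi>_def by (rule typed_bij_comp[OF typed_bij_inv[OF tl] sl])
  moreover have "wires s = graph ts v \<phi>"
    unfolding wires_def graph_def typed_bij_dom[OF tl] image_image \<phi>_def
    using typed_bij_inj[OF tl] by (intro image_cong) auto
  ultimately show ?thesis by blast
qed

text \<open>All members of an isomorphism class have the same wires, so one source map describes the
  class and inherits acyclicity from any member.\<close>

lemma diagram_wiring:
  assumes "\<Phi> \<in> wiring_diagrams \<tau> ts v"
  shows "\<exists>\<phi>. wiring ts v \<phi> \<and> wires_of \<Phi> = graph ts v \<phi> \<and> acyclic (prec ts v \<phi>)"
proof -
  let ?S = "spans \<tau> (sources ts v) (targets ts v)"
  have Q: "\<Phi> \<in> span_classes \<tau> (sources ts v) (targets ts v)" and ac: "\<forall>s\<in>\<Phi>. acyclic (precedes s)"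
    using assms by (auto simp: wiring_diagrams_def)
  from Q obtain s where s: "s \<in> ?S" and \<Phi>: "\<Phi> = {(s, s'). s \<in> ?S \<and> s' \<in> ?S \<and> span_iso s s'} `` {s}"
    unfolding span_classes_def by (rule quotientE)
  have w: "wires s' = wires s" if "s' \<in> \<Phi>" for s'
  proof -
    have "s' \<in> ?S" "span_iso s s'" using that unfolding \<Phi> by simp_all
    then show ?thesis using span_iso_iff_wires[OF s] by simp
  qed
  have "s \<in> \<Phi>" using s span_iso_iff_wires[OF s s] unfolding \<Phi> by simp
  then have "wires_of \<Phi> = wires s" using w unfolding wires_of_def by blast
  obtain \<phi> where \<phi>: "wiring ts v \<phi>" "wires s = graph ts v \<phi>" using span_wiring[OF s] by blast
  have "prec ts v \<phi> = precedes s"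
    unfolding prec_def precedes_def \<phi>(2) graph_iff ..
  then have "acyclic (prec ts v \<phi>)" using ac \<open>s \<in> \<Phi>\<close> by simp
  with \<phi> \<open>wires_of \<Phi> = wires s\<close> show ?thesis by auto
qed

definition src :: "('a, 't) span set \<Rightarrow> 'a elt \<Rightarrow> 'a elt" where
  "src \<Phi> y = (THE x. (x, y) \<in> wires_of \<Phi>)"

lemma src_eq: "\<lbrakk>wires_of \<Phi> = graph ts v \<phi>; y \<in> dom (targets ts v)\<rbrakk> \<Longrightarrow> src \<Phi> y = \<phi> y"
  unfolding src_def by (rule the_equality) (auto simp: graph_def)

text \<open>By finiteness and acyclicity some element has no successor in \<open>A\<close>; it is
  placed last, and the others are ordered by induction.\<close>

lemma topological_order:
  assumes "finite A" "acyclic r"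
  shows "\<exists>js. distinct js \<and> set js = A \<and>
    (\<forall>ks j ls. js = ks @ j # ls \<longrightarrow> (\<forall>i\<in>A. (i, j) \<in> r \<longrightarrow> i \<in> set ks))"
  using assms(1)
proof (induction "card A" arbitrary: A)
  case 0
  then show ?case by (intro exI[of _ "[]"]) simp
next
  case (Suc n)
  let ?r = "r \<inter> A \<times> A"
  have "finite ?r" using Suc.prems by simp
  moreover have "acyclic ?r" using assms(2) by (rule acyclic_subset) blast
  ultimately have wf: "wf (?r\<inverse>)" by (rule finite_acyclic_wf_converse)
  have "A \<noteq> {}" using Suc.hyps(2) by auto
  then obtain a0 where "a0 \<in> A" by blast
  from wf[unfolded wf_eq_minimal, rule_format, OF this]
  obtain a where a: "a \<in> A" "\<forall>b\<in>A. (a, b) \<notin> r" by blast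
  have "n = card (A - {a})" using Suc.hyps(2) Suc.prems a(1) by simp
  from Suc.hyps(1)[OF this finite_Diff[OF Suc.prems]] obtain js where js: "distinct js" "set js = A - {a}"
    "\<forall>ks j ls. js = ks @ j # ls \<longrightarrow> (\<forall>i\<in>A - {a}. (i, j) \<in> r \<longrightarrow> i \<in> set ks)"
    by blast
  have ord: "\<forall>i\<in>A. (i, j) \<in> r \<longrightarrow> i \<in> set ks" if eq: "js @ [a] = ks @ j # ls" for ks j ls
  proof (cases ls rule: rev_cases)
    case Nil
    then have "ks = js" "j = a" using eq by auto
    then show ?thesis using js(2) a by blast
  next
    case (snoc ls' b)
    have js_eq: "js = ks @ j # ls'" using eq unfolding snoc by (metis append1_eq_conv append_Cons append_assoc)
    then have "j \<in> A" using js(2) by auto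
    then have "(a, j) \<notin> r" using a by blast
    then show ?thesis using js(3)[rule_format, OF js_eq] by blast
  qed
  have "distinct (js @ [a])" "set (js @ [a]) = A" using js(1,2) a(1) by auto
  then show ?case using ord by (intro exI[of _ "js @ [a]"] conjI allI impI)
qed

context bracketed_smc
begin

text \<open>Brings the outcome of an execution, whose labels are sources, back to the ports of the
  outer box; \<open>evals_exists\<close> needs this.\<close>

lemma rel_surj:
  assumes "tarr k" "dm k = push \<sigma> X" "cd k = push \<rho> Y" "tfs X" "tfs Y" "inj_on \<sigma> (dom X)" "inj_on \<rho> (dom Y)"
  shows "\<exists>m. tarr m \<and> dm m = X \<and> cd m = Y \<and> rel \<sigma> \<rho> m = k"
proof -
  let ?\<sigma> = "inv_into (dom X) \<sigma>" and ?\<rho> = "inv_into (dom Y) \<rho>"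
  have i: "inj_on ?\<sigma> (\<sigma> ` dom X)" "inj_on ?\<rho> (\<rho> ` dom Y)" by (simp_all add: inj_on_inv_into)
  have p: "push ?\<sigma> (push \<sigma> X) = X" "push ?\<rho> (push \<rho> Y) = Y"
    using push_unique[OF typed_bij_inv[OF typed_bij_push]] assms by auto
  let ?m = "rel ?\<sigma> ?\<rho> k"
  have m: "tarr ?m" "dm ?m = X" "cd ?m = Y" using assms i p by simp_all
  have "rel \<sigma> \<rho> ?m = rel (\<sigma> \<circ> ?\<sigma>) (\<rho> \<circ> ?\<rho>) k"
    using assms i by (intro rel_rel) (simp_all add: image_image)
  also have "\<dots> = rel id id k"
    by (rule rel_cong[symmetric]) (use assms in \<open>auto simp: f_inv_into_f\<close>)
  finally have "rel \<sigma> \<rho> ?m = k" using assms by simp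
  with m show ?thesis by blast
qed

section \<open>The value of a filled diagram\<close>

abbreviation box :: "('a, 'o) box \<Rightarrow> bool" where "box \<equiv> is_box (obj C)"

definition args :: "('a, 'o) box list \<Rightarrow> ('a, 'o) box \<Rightarrow> 'm list \<Rightarrow> bool" where
  "args ts v fs \<longleftrightarrow> box v \<and> (\<forall>t\<in>set ts. box t) \<and> fs \<in> listset (map (hom_boxes C W) ts)"

definition filled :: "('a, 'o) box list \<Rightarrow> 'm list \<Rightarrow> nat \<Rightarrow> ('a, 'o, 'm) tarr" where
  "filled ts fs j = (fst (ts ! j), fs ! j, snd (ts ! j))"

lemma filled_simps [simp]:
  "dm (filled ts fs j) = fst (ts ! j)" "cd (filled ts fs j) = snd (ts ! j)" "md (filled ts fs j) = fs ! j"
  by (simp_all add: filled_def)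

lemma args_length: "args ts v fs \<Longrightarrow> length fs = length ts"
  by (simp add: args_def in_listset)

lemma tarr_filled: "\<lbrakk>args ts v fs; j < length ts\<rbrakk> \<Longrightarrow> tarr (filled ts fs j)"
  unfolding args_def in_listset tarr_def is_box_def hom_boxes_def
  by (simp add: case_prod_beta)

text \<open>The filling of box \<open>j\<close>, with each input labelled by the source that feeds
  it and each output labelled by itself as a source. A label produced by one node is then literally
  the label consumed by another.\<close>

definition node where
  "node ts \<phi> fs j = rel (\<lambda>x. \<phi> (InL (Tag j x))) (\<lambda>y. InR (Tag j y)) (filled ts fs j)"

definition start :: "('a, 'o) box \<Rightarrow> ('a, 'o) tfs" where
  "start v = push InL (fst v)"

text \<open>The order of execution is existentially quantified, and \<open>evals_unique\<close>
  shows that it does not matter. The map \<open>\<phi> \<circ> InR\<close> sends an outer output to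
  the source it is joined to, the label under which it is found in the final state.\<close>

definition evals where
  "evals ts v \<phi> fs m \<longleftrightarrow> tarr m \<and> dm m = fst v \<and> cd m = snd v \<and>
    (\<exists>js. distinct js \<and> set js = {..<length ts} \<and> valid (start v) (map (node ts \<phi> fs) js) \<and>
      exec (start v) (map (node ts \<phi> fs) js) = rel InL (\<phi> \<circ> InR) m)"

lemma inj_tags [simp]: "inj_on InL A" "inj_on InR A" "inj_on (\<lambda>y. InR (Tag j y)) A" "inj_on (Tag j) A"
  "inj_on (\<lambda>y. InL (Tag j y)) A"
  by (auto simp: inj_on_def)

lemma wiring_inj_box:
  assumes "wiring ts v \<phi>" "j < length ts"
  shows "inj_on (\<lambda>x. \<phi> (InL (Tag j x))) (dom (fst (ts ! j)))"
proof -
  have "inj_on \<phi> (dom (targets ts v))" using assms by (simp add: wiring_def typed_bij_inj)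
  note inj = inj_onD[OF this]
  show ?thesis
  proof (rule inj_onI)
    fix x y assume "x \<in> dom (fst (ts ! j))" "y \<in> dom (fst (ts ! j))" "\<phi> (InL (Tag j x)) = \<phi> (InL (Tag j y))"
    then show "x = y" using inj[of "InL (Tag j x)" "InL (Tag j y)"] assms(2) by simp
  qed
qed

lemma wiring_inj_out: "wiring ts v \<phi> \<Longrightarrow> inj_on (\<phi> \<circ> InR) (dom (snd v))"
  unfolding wiring_def using typed_bij_inj by (fastforce simp: inj_on_def)

lemma node_simps [simp]:
  "dm (node ts \<phi> fs j) = push (\<lambda>x. \<phi> (InL (Tag j x))) (fst (ts ! j))"
  "cd (node ts \<phi> fs j) = push (\<lambda>y. InR (Tag j y)) (snd (ts ! j))"
  by (simp_all add: node_def)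

lemma tarr_node: "\<lbrakk>args ts v fs; wiring ts v \<phi>; j < length ts\<rbrakk> \<Longrightarrow> tarr (node ts \<phi> fs j)"
  unfolding node_def by (intro tarr_rel) (simp_all add: tarr_filled wiring_inj_box)

lemma tfs_start: "box v \<Longrightarrow> tfs (start v)"
  by (simp add: start_def is_tfs_push is_box_def)

lemma dom_start [simp]: "dom (start v) = InL ` dom (fst v)"
  by (simp add: start_def)

lemma fresh_nodes: "distinct js \<Longrightarrow> fresh (dom (start v)) (map (node ts \<phi> fs) js)"
  by (induction js) (auto simp: fresh_def)

text \<open>The labels of the state once exactly the boxes in \<open>J\<close> have fired. That this
  depends on the set \<open>J\<close> and not on the order of firing makes it usable as the
  invariant of \<open>exec_live\<close>.\<close>

definition live :: "('a, 'o) box list \<Rightarrow> ('a, 'o) box \<Rightarrow> ('a elt \<Rightarrow> 'a elt) \<Rightarrow> nat set \<Rightarrow> 'a elt set" where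
  "live ts v \<phi> J = {s \<in> dom (sources ts v). (\<forall>j y. s = InR (Tag j y) \<longrightarrow> j \<in> J) \<and>
     (\<forall>j x. j \<in> J \<longrightarrow> InL (Tag j x) \<in> dom (targets ts v) \<longrightarrow> s \<noteq> \<phi> (InL (Tag j x)))}"

text \<open>Induction over the prefixes of a topological order. The inputs of the next box are fed
  by outer inputs or by boxes already fired, and injectivity of \<phi> excludes that another box has
  consumed them.\<close>

lemma exec_live:
  assumes "args ts v fs" "wiring ts v \<phi>" "distinct js" "set js \<subseteq> {..<length ts}"
    "\<forall>ks j ls. js = ks @ j # ls \<longrightarrow> (\<forall>i<length ts. (i, j) \<in> prec ts v \<phi> \<longrightarrow> i \<in> set ks)"
  shows "valid (start v) (map (node ts \<phi> fs) js) \<and>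
    cd (exec (start v) (map (node ts \<phi> fs) js)) = sources ts v |` live ts v \<phi> (set js)"
  using assms(3-5)
proof (induction js rule: rev_induct)
  case Nil
  have "start v = sources ts v |` live ts v \<phi> {}"
  proof (rule ext)
    fix s
    show "start v s = (sources ts v |` live ts v \<phi> {}) s"
    proof (cases "\<exists>x. s = InL x")
      case True
      then show ?thesis
        by (auto simp: start_def live_def restrict_map_def push_def image_iff domIff)
    next
      case False
      have "s \<notin> live ts v \<phi> {}"
      proof
        assume "s \<in> live ts v \<phi> {}"
        then have s: "s \<in> dom (sources ts v)" "\<forall>j y. s \<noteq> InR (Tag j y)" by (simp_all add: live_def)
        from s(1) show False by (rule source_cases) (use s(2) False in blast)+
      qed
      moreover have "start v s = None" using False by (auto simp: start_def push_def)
      ultimately show ?thesis by simp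
    qed
  qed
  then show ?case by simp
next
  case (snoc j js)
  let ?n = "node ts \<phi> fs" and ?S = "sources ts v"
  let ?X = "?S |` live ts v \<phi> (set js)"
  have j: "j < length ts" "j \<notin> set js" "distinct js" "set js \<subseteq> {..<length ts}"
    using snoc.prems by auto
  have "\<forall>ks k ls. js = ks @ k # ls \<longrightarrow> (\<forall>i<length ts. (i, k) \<in> prec ts v \<phi> \<longrightarrow> i \<in> set ks)"
    using snoc.prems(3) by auto
  then have IH: "valid (start v) (map ?n js)" "cd (exec (start v) (map ?n js)) = ?X"
    using snoc.IH j by auto
  have bij: "bij_betw \<phi> (dom (targets ts v)) (dom ?S)"
    and typing: "\<And>y. y \<in> dom (targets ts v) \<Longrightarrow> ?S (\<phi> y) = targets ts v y"
    using assms(2) by (auto simp: wiring_def typed_bij_def)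
  have inj: "\<phi> y = \<phi> y' \<Longrightarrow> y \<in> dom (targets ts v) \<Longrightarrow> y' \<in> dom (targets ts v) \<Longrightarrow> y = y'" for y y'
    using bij by (auto simp: bij_betw_def inj_on_def)
  have pr: "i \<in> set js" if "(i, j) \<in> prec ts v \<phi>" "i < length ts" for i
    using snoc.prems(3) that by blast
  have inX: "\<phi> (InL (Tag j x)) \<in> live ts v \<phi> (set js)" "?S (\<phi> (InL (Tag j x))) = fst (ts ! j) x"
    if "x \<in> dom (fst (ts ! j))" for x
  proof -
    have t: "InL (Tag j x) \<in> dom (targets ts v)" using that j by simp
    then have s: "\<phi> (InL (Tag j x)) \<in> dom ?S" using bij by (rule bij_betw_apply[rotated])
    moreover have "i \<in> set js" if "\<phi> (InL (Tag j x)) = InR (Tag i y)" for i y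
      using that s t by (intro pr) (auto simp: prec_def)
    moreover have "\<phi> (InL (Tag j x)) \<noteq> \<phi> (InL (Tag k x'))"
      if "k \<in> set js" "InL (Tag k x') \<in> dom (targets ts v)" for k x'
      using inj[OF _ t that(2)] j(2) that(1) by auto
    ultimately show "\<phi> (InL (Tag j x)) \<in> live ts v \<phi> (set js)" by (auto simp: live_def)
    show "?S (\<phi> (InL (Tag j x))) = fst (ts ! j) x" using typing[OF t] j by simp
  qed
  have le: "dm (?n j) \<subseteq>\<^sub>m ?X"
    unfolding map_le_def
  proof
    fix s assume "s \<in> dom (dm (?n j))"
    then obtain x where "x \<in> dom (fst (ts ! j))" "s = \<phi> (InL (Tag j x))" by auto
    then show "dm (?n j) s = ?X s"
      using push_app[OF wiring_inj_box[OF assms(2) j(1)]] inX by simp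
  qed
  have fr: "dom (cd (?n j)) \<inter> dom ?X = {}"
    using j(2) by (auto simp: live_def)
  then have can: "can (?n j) ?X"
    using tarr_node[OF assms(1,2) j(1)] le by (auto simp: can_def dom_rest)
  have "cd (?n j) ++ rest ?X (?n j) = ?S |` live ts v \<phi> (set (js @ [j]))"
  proof (rule ext)
    fix s
    show "(cd (?n j) ++ rest ?X (?n j)) s = (?S |` live ts v \<phi> (set (js @ [j]))) s"
    proof (cases "\<exists>y. s = InR (Tag j y)")
      case True
      then obtain y where s: "s = InR (Tag j y)" by blast
      have "s \<notin> dom ?X" using s j(2) by (auto simp: live_def)
      then have "rest ?X (?n j) s = None" using dom_rest[of ?X "?n j"] by blast
      moreover have "cd (?n j) s = ?S s"
      proof (cases "y \<in> dom (snd (ts ! j))")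
        case True
        then show ?thesis
          using j(1) push_app[of "\<lambda>y. InR (Tag j y)" "snd (ts ! j)" y] by (simp add: s)
      next
        case False
        then have "s \<notin> dom (cd (?n j))" "s \<notin> dom ?S" by (auto simp: s)
        then show ?thesis unfolding domIff by simp
      qed
      moreover have "s \<in> live ts v \<phi> (set (js @ [j]))" if "s \<in> dom ?S"
      proof -
        \<comment> \<open>A fresh output of \<open>j\<close> cannot already be consumed: its
          consumer would come after \<open>j\<close> in the order.\<close>
        have "InR (Tag j y) \<noteq> \<phi> (InL (Tag k x))"
          if k: "k \<in> set (js @ [j])" "InL (Tag k x) \<in> dom (targets ts v)" for k x
        proof
          assume e: "InR (Tag j y) = \<phi> (InL (Tag k x))"
          have jk: "(j, k) \<in> prec ts v \<phi>" unfolding prec_def using k(2) e[symmetric] by blast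
          show False
          proof (cases "k = j")
            case True
            then show ?thesis using pr[of j] jk j by auto
          next
            case False
            then have "k \<in> set js" using k(1) by auto
            then obtain ks ls where "js = ks @ k # ls" by (meson split_list)
            then have "j \<in> set ks" using snoc.prems(3) jk j(1) by auto
            then show ?thesis using j(2) \<open>js = ks @ k # ls\<close> by auto
          qed
        qed
        then show ?thesis using that by (auto simp: live_def s)
      qed
      ultimately show ?thesis
        by (cases "?S s") (simp_all add: map_add_def restrict_map_def domIff del: node_simps)
    next
      case False
      then have "cd (?n j) s = None" using domIff[of s "cd (?n j)"] by auto
      moreover have "s \<in> live ts v \<phi> (set (js @ [j])) \<longleftrightarrow>
          s \<in> live ts v \<phi> (set js) \<and> s \<notin> dom (dm (?n j))"
      proof -
        have "s \<in> dom (dm (?n j)) \<longleftrightarrow> (\<exists>x. InL (Tag j x) \<in> dom (targets ts v) \<and> s = \<phi> (InL (Tag j x)))"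
          unfolding node_simps dom_push targets_dom using j(1) by blast
        then show ?thesis
          using False unfolding live_def by (simp del: targets_dom node_simps) blast
      qed
      ultimately show ?thesis
        by (auto simp: map_add_def rest_def restrict_map_def split: option.splits)
    qed
  qed
  moreover have "tfs (start v)" using assms(1) by (simp add: tfs_start args_def)
  moreover have "tfs ?X" using IH calculation(2) tarrD(2)[OF exec_simps(1)] by metis
  ultimately show ?case
    using IH can by (simp add: valid_append exec_append)
qed

text \<open>When all boxes have fired, every target at a box has consumed its source; since \<phi>
  is onto, the surviving sources are those joined to outer outputs.\<close>

lemma live_all:
  assumes "wiring ts v \<phi>"
  shows "sources ts v |` live ts v \<phi> {..<length ts} = push (\<phi> \<circ> InR) (snd v)"
proof (rule push_unique[symmetric])
  let ?S = "sources ts v" and ?L = "live ts v \<phi> {..<length ts}"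
  have bij: "bij_betw \<phi> (dom (targets ts v)) (dom ?S)"
    and typing: "\<And>y. y \<in> dom (targets ts v) \<Longrightarrow> ?S (\<phi> y) = targets ts v y"
    using assms by (auto simp: wiring_def typed_bij_def)
  have L: "?L = (\<phi> \<circ> InR) ` dom (snd v)"
  proof (intro equalityI subsetI)
    fix s assume s: "s \<in> ?L"
    then have "s \<in> \<phi> ` dom (targets ts v)"
      using bij by (simp add: live_def bij_betw_def)
    then obtain y where y: "y \<in> dom (targets ts v)" "s = \<phi> y" by blast
    from y(1) show "s \<in> (\<phi> \<circ> InR) ` dom (snd v)"
    proof (cases rule: target_cases)
      case (inner j x)
      have "s \<noteq> \<phi> (InL (Tag j x))"
        using s y(1) inner(1,2) unfolding live_def by blast
      then show ?thesis using y inner by simp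
    qed (use y in auto)
  next
    fix s assume "s \<in> (\<phi> \<circ> InR) ` dom (snd v)"
    then obtain x where x: "x \<in> dom (snd v)" "s = \<phi> (InR x)" by auto
    then have t: "InR x \<in> dom (targets ts v)" by simp
    have "s \<in> dom ?S" using bij_betw_apply[OF bij t] x by simp
    moreover have "\<phi> (InR x) \<noteq> \<phi> (InL (Tag j x'))" if "InL (Tag j x') \<in> dom (targets ts v)" for j x'
      using inj_onD[OF bij_betw_imp_inj_on[OF bij] _ t that] by blast
    moreover have "j < length ts" if "s = InR (Tag j y)" for j y
      using \<open>s \<in> dom ?S\<close> that by simp
    ultimately show "s \<in> ?L" unfolding live_def x(2) by blast
  qed
  have "?L \<subseteq> dom ?S" by (auto simp: live_def)
  then have "dom (?S |` ?L) = ?L" by auto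
  moreover have "(?S |` ?L) ((\<phi> \<circ> InR) x) = snd v x" if "x \<in> dom (snd v)" for x
    using that typing[of "InR x"] L by auto
  ultimately show "typed_bij (snd v) (?S |` ?L) (\<phi> \<circ> InR)"
    unfolding typed_bij_def using wiring_inj_out[OF assms] L by (auto simp: bij_betw_def)
qed

lemma evals_exists:
  assumes "args ts v fs" "wiring ts v \<phi>" "acyclic (prec ts v \<phi>)"
  shows "\<exists>m. evals ts v \<phi> fs m"
proof -
  obtain js where js: "distinct js" "set js = {..<length ts}"
    "\<forall>ks j ls. js = ks @ j # ls \<longrightarrow> (\<forall>i\<in>{..<length ts}. (i, j) \<in> prec ts v \<phi> \<longrightarrow> i \<in> set ks)"
    using topological_order[OF finite_lessThan assms(3)] by blast
  have v: "valid (start v) (map (node ts \<phi> fs) js)"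
    and c: "cd (exec (start v) (map (node ts \<phi> fs) js)) = push (\<phi> \<circ> InR) (snd v)"
    using exec_live[OF assms(1,2) js(1)] js(2,3) live_all[OF assms(2)] by auto
  have b: "tfs (fst v)" "tfs (snd v)" "tfs (start v)"
    using assms(1) by (auto simp: args_def is_box_def tfs_start)
  have "\<exists>m. tarr m \<and> dm m = fst v \<and> cd m = snd v \<and>
      rel InL (\<phi> \<circ> InR) m = exec (start v) (map (node ts \<phi> fs) js)"
    using v c b wiring_inj_out[OF assms(2)]
    by (intro rel_surj) (auto simp: start_def)
  then show ?thesis unfolding evals_def using js v by metis
qed

text \<open>Both executions fire the same nodes, so \<open>exec_mset\<close> equates them. Freshness
  holds because the output labels carry the number of their box.\<close>

lemma evals_unique:
  assumes "args ts v fs" "wiring ts v \<phi>" "evals ts v \<phi> fs m" "evals ts v \<phi> fs n"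
  shows "m = n"
proof -
  from assms(3) obtain js where js: "distinct js" "set js = {..<length ts}"
    "valid (start v) (map (node ts \<phi> fs) js)"
    "exec (start v) (map (node ts \<phi> fs) js) = rel InL (\<phi> \<circ> InR) m"
    and m: "tarr m" "dm m = fst v" "cd m = snd v"
    by (auto simp: evals_def)
  from assms(4) obtain ks where ks: "distinct ks" "set ks = {..<length ts}"
    "valid (start v) (map (node ts \<phi> fs) ks)"
    "exec (start v) (map (node ts \<phi> fs) ks) = rel InL (\<phi> \<circ> InR) n"
    and n: "tarr n" "dm n = fst v" "cd n = snd v"
    by (auto simp: evals_def)
  have "mset js = mset ks" using js ks by (simp flip: set_eq_iff_mset_eq_distinct)
  then have "exec (start v) (map (node ts \<phi> fs) js) = exec (start v) (map (node ts \<phi> fs) ks)"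
    using js ks fresh_nodes assms(1)
    by (intro exec_mset[where U = "dom (start v)"]) (auto simp: args_def tfs_start)
  then show ?thesis
    using js ks m n wiring_inj_out[OF assms(2)] by (intro rel_inj[of m n InL "\<phi> \<circ> InR"]) simp_all
qed

lemma node_cong:
  assumes "args ts v fs" "wiring ts v \<phi>" "\<And>y. y \<in> dom (targets ts v) \<Longrightarrow> \<phi> y = \<phi>' y" "j < length ts"
  shows "node ts \<phi> fs j = node ts \<phi>' fs j"
  unfolding node_def using assms wiring_inj_box[OF assms(2,4)]
  by (intro rel_cong) (simp_all add: tarr_filled)

text \<open>Links the source map \<open>src \<Phi>\<close>, by which \<open>H\<close> is defined, to
  the explicit source maps that the constructions provide; the two agree on targets only.\<close>

lemma evals_cong:
  assumes "args ts v fs" "wiring ts v \<phi>" "\<And>y. y \<in> dom (targets ts v) \<Longrightarrow> \<phi> y = \<phi>' y"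
    "evals ts v \<phi> fs m"
  shows "evals ts v \<phi>' fs m"
proof -
  have "map (node ts \<phi> fs) js = map (node ts \<phi>' fs) js" if "set js = {..<length ts}" for js
    using that node_cong[OF assms(1,2,3)] by auto
  moreover have "rel InL (\<phi> \<circ> InR) m = rel InL (\<phi>' \<circ> InR) m"
    using assms wiring_inj_out[OF assms(2)] by (intro rel_cong) (auto simp: evals_def)
  ultimately show ?thesis using assms(4) unfolding evals_def by metis
qed

text \<open>The restriction makes the value \<open>undefined\<close> outside the product of the
  hom-sets, as operations of \<open>set_operad\<close> are extensional functions.\<close>

definition H :: "('a, 'o) box list \<Rightarrow> ('a, 'o) box \<Rightarrow> ('a, 'o) span set \<Rightarrow> 'm list \<Rightarrow> 'm" where
  "H ts v \<Phi> = (\<lambda>fs\<in>listset (map (hom_boxes C W) ts). md (THE m. evals ts v (src \<Phi>) fs m))"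

lemma H_eqI:
  assumes "args ts v fs" "wiring ts v \<phi>" "wires_of \<Phi> = graph ts v \<phi>" "evals ts v \<phi> fs m"
  shows "H ts v \<Phi> fs = md m"
proof -
  have e: "y \<in> dom (targets ts v) \<Longrightarrow> \<phi> y = src \<Phi> y" for y
    using src_eq[OF assms(3)] by simp
  have w: "wiring ts v (src \<Phi>)"
    using assms(2) e typed_bij_cong[of "targets ts v" \<phi> "src \<Phi>"] by (simp add: wiring_def)
  have "evals ts v (src \<Phi>) fs m" by (rule evals_cong[OF assms(1,2) e assms(4)])
  then have "(THE m. evals ts v (src \<Phi>) fs m) = m"
    using evals_unique[OF assms(1) w] by blast
  then show ?thesis using assms(1) by (simp add: H_def args_def)
qed

lemma H_evals:
  assumes "args ts v fs" "wiring ts v \<phi>" "wires_of \<Phi> = graph ts v \<phi>" "acyclic (prec ts v \<phi>)"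
  shows "evals ts v \<phi> fs (fst v, H ts v \<Phi> fs, snd v)"
proof -
  obtain m where m: "evals ts v \<phi> fs m" using evals_exists[OF assms(1,2,4)] by blast
  then have "H ts v \<Phi> fs = md m" by (rule H_eqI[OF assms(1-3)])
  moreover have "m = (fst v, md m, snd v)" using m by (auto simp: evals_def prod_eq_iff)
  ultimately show ?thesis using m by simp
qed

end

section \<open>The graph of a composite diagram\<close>

lemma length_subst_list: "i < length ts \<Longrightarrow> length (subst_list ss ts i) = length ts - 1 + length ss"
  by (simp add: subst_list_def)

lemma subst_list_guest:
  assumes "i < length ts" "k < length ss"
  shows "subst_list ss ts i ! (i + k) = ss ! k" "i + k < length (subst_list ss ts i)"
  using assms by (simp_all add: subst_list_def nth_append)

lemma subst_list_host:
  assumes "i < length ts" "j < length ts" "j \<noteq> i"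
  shows "subst_list ss ts i ! renumber i (length ss) j = ts ! j"
    "renumber i (length ss) j < length (subst_list ss ts i)"
proof -
  show "subst_list ss ts i ! renumber i (length ss) j = ts ! j"
  proof (cases "j < i")
    case False
    then obtain d where "j = Suc (i + d)" using assms(3) less_imp_Suc_add[of i j] by auto
    then show ?thesis using assms
      by (simp add: subst_list_def renumber_def nth_append)
  qed (use assms in \<open>simp add: subst_list_def renumber_def nth_append\<close>)
  show "renumber i (length ss) j < length (subst_list ss ts i)"
    using assms by (auto simp: length_subst_list renumber_def)
qed

lemma subst_list_index_cases:
  assumes "c < length (subst_list ss ts i)" "i < length ts"
  obtains (host) j where "j < length ts" "j \<noteq> i" "c = renumber i (length ss) j"
  | (guest) k where "k < length ss" "c = i + k"
proof -
  consider "c < i" | "i \<le> c" "c < i + length ss" | "i + length ss \<le> c" by linarith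
  then show ?thesis
  proof cases
    case 1
    then show ?thesis using host[of c] assms by (simp add: renumber_def)
  next
    case 2
    then show ?thesis using guest[of "c - i"] by simp
  next
    case 3
    then show ?thesis
      using host[of "c + 1 - length ss"] assms by (simp add: renumber_def length_subst_list)
  qed
qed

lemma renumber_inj: "\<lbrakk>renumber i m j = renumber i m j'; j \<noteq> i; j' \<noteq> i\<rbrakk> \<Longrightarrow> j = j'"
  by (auto simp: renumber_def split: if_splits)

lemma renumber_neq: "\<lbrakk>k < m; j \<noteq> i\<rbrakk> \<Longrightarrow> renumber i m j \<noteq> i + k"
  by (auto simp: renumber_def)

lemma map_subst_list: "subst_list (map f ss) (map f ts) i = map f (subst_list ss ts i)"
  by (simp add: subst_list_def take_map drop_map)

text \<open>Acyclicity of the host enters through \<open>no_loop\<close>: no host wire returns from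
  the replaced box to itself, so a fused chain passes through the guest at most once.\<close>

locale wd_subst =
  fixes ss ts :: "('a, 't) box list" and v :: "('a, 't) box" and i :: nat and \<phi> \<psi> :: "'a elt \<Rightarrow> 'a elt"
  assumes i: "i < length ts" and host: "wiring ts v \<phi>" and guest: "wiring ss (ts ! i) \<psi>"
    and acyclic: "acyclic (prec ts v \<phi>)"
begin

abbreviation "m \<equiv> length ss"
abbreviation "us \<equiv> subst_list ss ts i"
abbreviation "ren \<equiv> renumber i m"

text \<open>Meaningful for sources other than the outputs of box \<open>i\<close>, which have no
  number in the composite. Separating it from \<open>rho\<close> avoids a circular definition:
  \<open>rho\<close> refers to \<open>kappa\<close>, and \<open>kappa\<close> refers only to
  \<open>rho0\<close>.\<close>

fun rho0 :: "'a elt \<Rightarrow> 'a elt" where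
  "rho0 (InR (Tag j y)) = InR (Tag (ren j) y)"
| "rho0 s = s"

text \<open>\<open>kappa\<close> and \<open>rho\<close> send a source of the guest or of the host diagram to the source of the
  composite from which it is reached.\<close>

fun kappa :: "'a elt \<Rightarrow> 'a elt" where
  "kappa (InL x) = rho0 (\<phi> (InL (Tag i x)))"
| "kappa (InR (Tag k y)) = InR (Tag (i + k) y)"
| "kappa s = s"

fun rho :: "'a elt \<Rightarrow> 'a elt" where
  "rho (InR (Tag j y)) = (if j = i then kappa (\<psi> (InR y)) else InR (Tag (ren j) y))"
| "rho s = s"

text \<open>The source map of the composite. The three ranges of \<open>c\<close> are the host boxes
  before \<open>i\<close>, the guest boxes, and the host boxes after \<open>i\<close>, where
  \<open>c + 1 - m\<close> undoes the renumbering \<open>j - 1 + m\<close>.\<close>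

fun chi :: "'a elt \<Rightarrow> 'a elt" where
  "chi (InL (Tag c x)) = (if c < i then rho (\<phi> (InL (Tag c x)))
     else if c < i + m then kappa (\<psi> (InL (Tag (c - i) x)))
     else rho (\<phi> (InL (Tag (c + 1 - m) x))))"
| "chi t = rho (\<phi> t)"

declare chi.simps(1) [simp del]

lemma host_bij: "bij_betw \<phi> (dom (targets ts v)) (dom (sources ts v))"
  and host_type: "t \<in> dom (targets ts v) \<Longrightarrow> sources ts v (\<phi> t) = targets ts v t"
  using host by (auto simp: wiring_def typed_bij_def)

lemma guest_bij: "bij_betw \<psi> (dom (targets ss (ts ! i))) (dom (sources ss (ts ! i)))"
  and guest_type: "t \<in> dom (targets ss (ts ! i)) \<Longrightarrow> sources ss (ts ! i) (\<psi> t) = targets ss (ts ! i) t"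
  using guest by (auto simp: wiring_def typed_bij_def)

lemma host_surj: "s \<in> dom (sources ts v) \<Longrightarrow> \<exists>t. s = \<phi> t \<and> t \<in> dom (targets ts v)"
  unfolding bij_betw_imp_surj_on[OF host_bij, symmetric] by (elim imageE) (rule exI, erule conjI)

lemma guest_surj: "s \<in> dom (sources ss (ts ! i)) \<Longrightarrow> \<exists>t. s = \<psi> t \<and> t \<in> dom (targets ss (ts ! i))"
  unfolding bij_betw_imp_surj_on[OF guest_bij, symmetric] by (elim imageE) (rule exI, erule conjI)

lemma no_loop:
  assumes "x \<in> dom (fst (ts ! i))"
  shows "\<phi> (InL (Tag i x)) \<noteq> InR (Tag i y)"
proof
  assume "\<phi> (InL (Tag i x)) = InR (Tag i y)"
  moreover have "InL (Tag i x) \<in> dom (targets ts v)" using assms i by simp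
  ultimately have "(i, i) \<in> prec ts v \<phi>" unfolding prec_def by blast
  then show False using acyclic by (meson acyclic_def r_into_trancl')
qed

lemma chi_host: "j \<noteq> i \<Longrightarrow> chi (InL (Tag (ren j) x)) = rho (\<phi> (InL (Tag j x)))"
  by (auto simp: renumber_def chi.simps(1))

lemma chi_guest: "k < m \<Longrightarrow> chi (InL (Tag (i + k) x)) = kappa (\<psi> (InL (Tag k x)))"
  by (simp add: chi.simps(1))

lemma rho_rho0: "(\<And>y. s \<noteq> InR (Tag i y)) \<Longrightarrow> rho s = rho0 s"
  by (cases s rule: rho0.cases) auto

text \<open>On genuine inputs of the replaced box \<open>rho0\<close> may be exchanged for
  \<open>rho\<close>, because by \<open>no_loop\<close> such an input is not fed by the box
  itself.\<close>

lemma kappa_InL: "x \<in> dom (fst (ts ! i)) \<Longrightarrow> kappa (InL x) = rho (\<phi> (InL (Tag i x)))"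
  using no_loop by (simp add: rho_rho0)

lemma target_i: "x \<in> dom (fst (ts ! i)) \<Longrightarrow> InL (Tag i x) \<in> dom (targets ts v)"
  using i by simp

lemma rho0_type:
  assumes "s \<in> dom (sources ts v)" "\<And>y. s \<noteq> InR (Tag i y)"
  shows "sources us v (rho0 s) = sources ts v s"
  using assms(1)
proof (cases rule: source_cases)
  case (inner j y)
  then have "j \<noteq> i" using assms(2) by blast
  then show ?thesis using inner subst_list_host[OF i inner(2)] by simp
qed simp

lemma kappa_type:
  assumes "s \<in> dom (sources ss (ts ! i))"
  shows "sources us v (kappa s) = sources ss (ts ! i) s"
  using assms
proof (cases rule: source_cases)
  case (outer x)
  note t = target_i[OF outer(2)]
  have "sources us v (kappa s) = sources ts v (\<phi> (InL (Tag i x)))"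
    using outer bij_betw_apply[OF host_bij t] no_loop by (simp add: rho0_type)
  also have "\<dots> = fst (ts ! i) x" using host_type[OF t] i by simp
  finally show ?thesis using outer by simp
next
  case (inner k y)
  then show ?thesis using subst_list_guest[OF i, of k ss] i by simp
qed

lemma rho_type:
  assumes "s \<in> dom (sources ts v)"
  shows "sources us v (rho s) = sources ts v s"
proof (cases "\<exists>y. s = InR (Tag i y)")
  case True
  then obtain y where y: "s = InR (Tag i y)" by blast
  then have t: "InR y \<in> dom (targets ss (ts ! i))" using assms by simp
  show ?thesis
    using kappa_type[OF bij_betw_apply[OF guest_bij t]] guest_type[OF t] i y by simp
next
  case False
  then show ?thesis using assms rho0_type rho_rho0 by auto
qed

lemma target_us_cases:
  assumes "t \<in> dom (targets us v)"
  obtains (outer) x where "t = InR x" "x \<in> dom (snd v)"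
  | (host) j x where "t = InL (Tag (ren j) x)" "j < length ts" "j \<noteq> i" "x \<in> dom (fst (ts ! j))"
  | (guest) k x where "t = InL (Tag (i + k) x)" "k < m" "x \<in> dom (fst (ss ! k))"
  using assms
proof (cases rule: target_cases)
  case (inner c x)
  from inner(2) i show ?thesis
  proof (cases rule: subst_list_index_cases)
    case (host j)
    then show ?thesis using that(2) inner subst_list_host(1)[OF i host(1,2), of ss] by simp
  next
    case (guest k)
    then show ?thesis using that(3) inner subst_list_guest[OF i guest(1)] by simp
  qed
qed (use that in blast)

lemma source_us_cases:
  assumes "s \<in> dom (sources us v)"
  obtains (outer) x where "s = InL x" "x \<in> dom (fst v)"
  | (host) j x where "s = InR (Tag (ren j) x)" "j < length ts" "j \<noteq> i" "x \<in> dom (snd (ts ! j))"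
  | (guest) k x where "s = InR (Tag (i + k) x)" "k < m" "x \<in> dom (snd (ss ! k))"
  using assms
proof (cases rule: source_cases)
  case (inner c x)
  from inner(2) i show ?thesis
  proof (cases rule: subst_list_index_cases)
    case (host j)
    then show ?thesis using that(2) inner subst_list_host(1)[OF i host(1,2), of ss] by simp
  next
    case (guest k)
    then show ?thesis using that(3) inner subst_list_guest[OF i guest(1)] by simp
  qed
qed (use that in blast)

lemma chi_type:
  assumes "t \<in> dom (targets us v)"
  shows "sources us v (chi t) = targets us v t"
  using assms
proof (cases rule: target_us_cases)
  case (outer x)
  then have "InR x \<in> dom (targets ts v)" by simp
  from rho_type[OF bij_betw_apply[OF host_bij this]] host_type[OF this] outer show ?thesis by simp
next
  case (host j x)
  then have "InL (Tag j x) \<in> dom (targets ts v)" by simp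
  from rho_type[OF bij_betw_apply[OF host_bij this]] host_type[OF this] host
  show ?thesis using subst_list_host[OF i host(2,3), of ss] by (simp add: chi_host)
next
  case (guest k x)
  then have "InL (Tag k x) \<in> dom (targets ss (ts ! i))" by simp
  from kappa_type[OF bij_betw_apply[OF guest_bij this]] guest_type[OF this] guest
  show ?thesis using subst_list_guest[OF i guest(2)] i by (simp add: chi_guest)
qed

text \<open>Every source is followed forwards to a target. The auxiliary facts are ordered by how
  much of the chain remains: \<open>through\<close> for a host wire that does not enter box
  \<open>i\<close>, \<open>after\<close> for an output of box \<open>i\<close>,
  \<open>inside\<close> for a source of the guest, and \<open>all\<close> for any source of the
  host.\<close>

lemma chi_surj:
  assumes "s \<in> dom (sources us v)"
  shows "s \<in> chi ` dom (targets us v)"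
proof -
  have through: "rho s \<in> chi ` dom (targets us v)"
    if s: "s = \<phi> t" "t \<in> dom (targets ts v)" "\<And>x. t \<noteq> InL (Tag i x)" for s t
    using s(2)
  proof (cases rule: target_cases)
    case (outer x)
    then show ?thesis using s by (intro image_eqI[of _ _ t]) simp_all
  next
    case (inner j x)
    then have j: "j \<noteq> i" using s(3) by blast
    have c: "chi (InL (Tag (ren j) x)) = rho s" using inner s j by (simp add: chi_host)
    have "InL (Tag (ren j) x) \<in> dom (targets us v)"
      using inner j subst_list_host[OF i inner(2) j, of ss] by simp
    from imageI[OF this, of chi] show ?thesis unfolding c .
  qed
  have after: "rho (InR (Tag i y)) \<in> chi ` dom (targets us v)" if "y \<in> dom (snd (ts ! i))" for y
  proof -
    have "InR (Tag i y) \<in> dom (sources ts v)" using that i by simp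
    from host_surj[OF this] obtain t where t: "InR (Tag i y) = \<phi> t" "t \<in> dom (targets ts v)"
      by (elim exE conjE)
    have "t \<noteq> InL (Tag i x)" for x
    proof
      assume e: "t = InL (Tag i x)"
      then have "x \<in> dom (fst (ts ! i))" using t(2) by simp
      from no_loop[OF this, of y] show False using t(1) e by simp
    qed
    from through[OF t this] show ?thesis .
  qed
  have inside: "kappa s \<in> chi ` dom (targets us v)" if "s \<in> dom (sources ss (ts ! i))" for s
  proof -
    from guest_surj[OF that] obtain t where t: "s = \<psi> t" "t \<in> dom (targets ss (ts ! i))"
      by (elim exE conjE)
    from t(2) show ?thesis
    proof (cases rule: target_cases)
      case (outer y)
      then show ?thesis using after[of y] t by simp
    next
      case (inner k x)
      have c: "chi (InL (Tag (i + k) x)) = kappa s" using inner t by (simp add: chi_guest)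
      have "InL (Tag (i + k) x) \<in> dom (targets us v)"
        using inner subst_list_guest[OF i inner(2)] i by simp
      from imageI[OF this, of chi] show ?thesis unfolding c .
    qed
  qed
  have all: "rho s \<in> chi ` dom (targets us v)" if "s \<in> dom (sources ts v)" for s
  proof -
    from host_surj[OF that] obtain t where t: "s = \<phi> t" "t \<in> dom (targets ts v)"
      by (elim exE conjE)
    show ?thesis
    proof (cases "\<exists>x. t = InL (Tag i x)")
      case True
      then obtain x where x: "t = InL (Tag i x)" by blast
      then have xi: "x \<in> dom (fst (ts ! i))" using t(2) by simp
      have "rho s = kappa (InL x)" unfolding kappa_InL[OF xi] t(1) x ..
      then show ?thesis using inside[of "InL x"] xi by (simp del: kappa.simps(1))
    next
      case False
      then show ?thesis using through[OF t] by blast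
    qed
  qed
  show ?thesis
    using assms
  proof (cases rule: source_us_cases)
    case (outer x)
    then show ?thesis using all[of s] by simp
  next
    case (host j x)
    then show ?thesis using all[of "InR (Tag j x)"] by simp
  next
    case (guest k x)
    then show ?thesis using inside[of "InR (Tag k x)"] by simp
  qed
qed

section \<open>Paths in the graph of fused wires\<close>

context
  fixes \<Phi> \<Psi> :: "('a, 't) span set"
  assumes wires_host: "wires_of \<Phi> = graph ts v \<phi>" and wires_guest: "wires_of \<Psi> = graph ss (ts ! i) \<psi>"
begin

lemma edge_cases:
  assumes "(a, b) \<in> wd_graph i m \<Psi> \<Phi>"
  obtains (host) t where "t \<in> dom (targets ts v)" "a = host_source i m (\<phi> t)" "b = host_target i m t"
  | (guest) t where "t \<in> dom (targets ss (ts ! i))" "a = guest_source i (\<psi> t)" "b = guest_target i t"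
  using assms unfolding wd_graph_def wires_host wires_guest by (auto simp: graph_def)

lemma host_edge: "t \<in> dom (targets ts v) \<Longrightarrow> (host_source i m (\<phi> t), host_target i m t) \<in> wd_graph i m \<Psi> \<Phi>"
  unfolding wd_graph_def wires_host by (force simp: graph_def)

lemma guest_edge:
  "t \<in> dom (targets ss (ts ! i)) \<Longrightarrow> (guest_source i (\<psi> t), guest_target i t) \<in> wd_graph i m \<Psi> \<Phi>"
  unfolding wd_graph_def wires_guest by (force simp: graph_def)

text \<open>Every vertex of the graph is reached from a unique source, its origin.\<close>

fun origin :: "'a vertex \<Rightarrow> 'a elt" where
  "origin (Source x) = x"
| "origin (Target y) = chi y"
| "origin (MidIn x) = kappa (InL x)"
| "origin (MidOut y) = rho (InR (Tag i y))"

lemma origin_host_source: "s \<in> dom (sources ts v) \<Longrightarrow> origin (host_source i m s) = rho s"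
  by (erule source_cases) simp_all

lemma origin_guest_source: "s \<in> dom (sources ss (ts ! i)) \<Longrightarrow> origin (guest_source i s) = kappa s"
  by (erule source_cases) simp_all

lemma origin_host_target:
  assumes "t \<in> dom (targets ts v)"
  shows "origin (host_target i m t) = rho (\<phi> t)"
  using assms
proof (cases rule: target_cases)
  case (inner j x)
  then show ?thesis
    by (cases "j = i") (simp_all add: chi_host kappa_InL del: kappa.simps(1))
qed simp

lemma origin_guest_target: "t \<in> dom (targets ss (ts ! i)) \<Longrightarrow> origin (guest_target i t) = kappa (\<psi> t)"
  by (erule target_cases) (simp_all add: chi_guest)

lemma origin_edge: "(a, b) \<in> wd_graph i m \<Psi> \<Phi> \<Longrightarrow> origin a = origin b"
proof (erule edge_cases)
  fix t assume "t \<in> dom (targets ts v)" "a = host_source i m (\<phi> t)" "b = host_target i m t"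
  then show "origin a = origin b"
    using bij_betw_apply[OF host_bij] by (simp add: origin_host_source origin_host_target)
next
  fix t assume "t \<in> dom (targets ss (ts ! i))" "a = guest_source i (\<psi> t)" "b = guest_target i t"
  then show "origin a = origin b"
    using bij_betw_apply[OF guest_bij] by (simp add: origin_guest_source origin_guest_target)
qed

lemma origin_path: "(a, b) \<in> (wd_graph i m \<Psi> \<Phi>)\<^sup>+ \<Longrightarrow> origin a = origin b"
  by (induction rule: trancl_induct) (simp_all add: origin_edge)

lemma path_direct:
  assumes "t \<in> dom (targets ts v)" "\<And>y. \<phi> t \<noteq> InR (Tag i y)"
  shows "(Source (rho (\<phi> t)), host_target i m t) \<in> wd_graph i m \<Psi> \<Phi>"
proof -
  have "host_source i m (\<phi> t) = Source (rho (\<phi> t))"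
    using bij_betw_apply[OF host_bij assms(1)] assms(2) by (elim source_cases) auto
  then show ?thesis using host_edge[OF assms(1)] by simp
qed

lemma path_guest:
  assumes "t \<in> dom (targets ss (ts ! i))"
  shows "(Source (kappa (\<psi> t)), guest_target i t) \<in> (wd_graph i m \<Psi> \<Phi>)\<^sup>+"
  using bij_betw_apply[OF guest_bij assms]
proof (cases rule: source_cases)
  case (outer x)
  have "(Source (kappa (\<psi> t)), MidIn x) \<in> wd_graph i m \<Psi> \<Phi>"
    using path_direct[OF target_i[OF outer(2)]] no_loop[OF outer(2)] kappa_InL[OF outer(2)] outer(1) by simp
  moreover have "(MidIn x, guest_target i t) \<in> wd_graph i m \<Psi> \<Phi>"
    using guest_edge[OF assms] outer by simp
  ultimately show ?thesis by (meson trancl.simps)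
next
  case (inner k y)
  then show ?thesis using guest_edge[OF assms] by (simp add: r_into_trancl)
qed

lemma path_host:
  assumes "t \<in> dom (targets ts v)"
  shows "(Source (rho (\<phi> t)), host_target i m t) \<in> (wd_graph i m \<Psi> \<Phi>)\<^sup>+"
proof (cases "\<exists>y. \<phi> t = InR (Tag i y)")
  case True
  then obtain y where y: "\<phi> t = InR (Tag i y)" by blast
  then have "y \<in> dom (snd (ts ! i))" using bij_betw_apply[OF host_bij assms] by simp
  then have "(Source (rho (\<phi> t)), MidOut y) \<in> (wd_graph i m \<Psi> \<Phi>)\<^sup>+"
    using path_guest[of "InR y"] y by simp
  then show ?thesis using host_edge[OF assms] y by (simp add: trancl_into_trancl)
next
  case False
  then show ?thesis using path_direct[OF assms] by (simp add: r_into_trancl)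
qed

lemma path_chi:
  assumes "t \<in> dom (targets us v)"
  shows "(Source (chi t), Target t) \<in> (wd_graph i m \<Psi> \<Phi>)\<^sup>+"
  using assms
proof (cases rule: target_us_cases)
  case (outer x)
  then show ?thesis using path_host[of "InR x"] by simp
next
  case (host j x)
  then show ?thesis using path_host[of "InL (Tag j x)"] by (simp add: chi_host)
next
  case (guest k x)
  then show ?thesis using path_guest[of "InL (Tag k x)"] by (simp add: chi_guest)
qed

lemma host_source_inj:
  "\<lbrakk>s \<in> dom (sources ts v); s' \<in> dom (sources ts v); host_source i m s = host_source i m s'\<rbrakk> \<Longrightarrow> s = s'"
  by (elim source_cases) (auto split: if_splits dest: renumber_inj)

lemma guest_source_inj:
  "\<lbrakk>s \<in> dom (sources ss (ts ! i)); s' \<in> dom (sources ss (ts ! i)); guest_source i s = guest_source i s'\<rbrakk> \<Longrightarrow> s = s'"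
  by (elim source_cases) auto

lemma host_guest_source:
  "\<lbrakk>s \<in> dom (sources ts v); s' \<in> dom (sources ss (ts ! i))\<rbrakk> \<Longrightarrow> host_source i m s \<noteq> guest_source i s'"
  by (elim source_cases) (auto split: if_splits dest: renumber_neq)

text \<open>Host and guest sources are different vertices and both source maps are injective, so at
  most one wire leaves each vertex.\<close>

lemma single_valued_graph: "single_valued (wd_graph i m \<Psi> \<Phi>)"
proof (rule single_valuedI)
  fix a b c assume ab: "(a, b) \<in> wd_graph i m \<Psi> \<Phi>" and ac: "(a, c) \<in> wd_graph i m \<Psi> \<Phi>"
  note h = bij_betw_apply[OF host_bij] and g = bij_betw_apply[OF guest_bij]
  note hi = inj_onD[OF bij_betw_imp_inj_on[OF host_bij]] and gi = inj_onD[OF bij_betw_imp_inj_on[OF guest_bij]]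
  from ab show "b = c"
  proof (cases rule: edge_cases)
    case t: (host t)
    from ac show ?thesis
    proof (cases rule: edge_cases)
      case (host t')
      then show ?thesis using t host_source_inj[OF h h] hi by metis
    next
      case (guest t')
      then show ?thesis using t host_guest_source[OF h g] by metis
    qed
  next
    case t: (guest t)
    from ac show ?thesis
    proof (cases rule: edge_cases)
      case (host t')
      then show ?thesis using t host_guest_source[OF h g] by metis
    next
      case (guest t')
      then show ?thesis using t guest_source_inj[OF g g] gi by metis
    qed
  qed
qed

lemma no_edge_from_target: "(Target t, b) \<notin> wd_graph i m \<Psi> \<Phi>"
proof
  assume "(Target t, b) \<in> wd_graph i m \<Psi> \<Phi>"
  then show False
  proof (cases rule: edge_cases)
    case (host t')
    with bij_betw_apply[OF host_bij host(1)] show ?thesis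
      by (elim source_cases) (auto split: if_splits)
  next
    case (guest t')
    with bij_betw_apply[OF guest_bij guest(1)] show ?thesis
      by (elim source_cases) auto
  qed
qed

text \<open>Two targets with the same source are reached from one vertex. In a single-valued graph
  one of them is then reachable from the other, but no edge leaves a target.\<close>

lemma chi_inj:
  assumes "t \<in> dom (targets us v)" "t' \<in> dom (targets us v)" "chi t = chi t'"
  shows "t = t'"
proof -
  have "(Source (chi t), Target t) \<in> (wd_graph i m \<Psi> \<Phi>)\<^sup>*" "(Source (chi t), Target t') \<in> (wd_graph i m \<Psi> \<Phi>)\<^sup>*"
    using path_chi[OF assms(1)] path_chi[OF assms(2)] assms(3) by (simp_all add: trancl_into_rtrancl)
  from single_valued_confluent[OF single_valued_graph this]
  have "(Target t, Target t') \<in> (wd_graph i m \<Psi> \<Phi>)\<^sup>* \<or> (Target t', Target t) \<in> (wd_graph i m \<Psi> \<Phi>)\<^sup>*" .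
  then have "Target t = Target t'"
    by (metis converse_rtranclE no_edge_from_target)
  then show ?thesis by simp
qed

lemma edge_target: "(a, Target t) \<in> wd_graph i m \<Psi> \<Phi> \<Longrightarrow> t \<in> dom (targets us v)"
proof (erule edge_cases)
  fix t' assume t': "t' \<in> dom (targets ts v)" "Target t = host_target i m t'"
  from this(1) show "t \<in> dom (targets us v)"
  proof (cases rule: target_cases)
    case (inner j x)
    then have "j \<noteq> i" "t = InL (Tag (ren j) x)" using t' by (auto split: if_splits)
    then show ?thesis using inner subst_list_host[OF i inner(2), of ss] by simp
  qed (use t' in simp)
next
  fix t' assume t': "t' \<in> dom (targets ss (ts ! i))" "Target t = guest_target i t'"
  from this(1) show "t \<in> dom (targets us v)"
  proof (cases rule: target_cases)
    case (inner k x)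
    then show ?thesis using t' subst_list_guest[OF i inner(2)] i by simp
  qed (use t' in simp)
qed

lemma wiring_chi: "wiring us v chi"
  unfolding wiring_def typed_bij_def bij_betw_def
proof (intro conjI ballI)
  show "inj_on chi (dom (targets us v))" using chi_inj by (intro inj_onI) blast
  show "chi ` dom (targets us v) = dom (sources us v)"
  proof (intro equalityI subsetI)
    fix s assume "s \<in> chi ` dom (targets us v)"
    then obtain t where "t \<in> dom (targets us v)" "s = chi t" by blast
    then show "s \<in> dom (sources us v)" using chi_type[of t] by (simp add: domIff)
  qed (rule chi_surj)
qed (rule chi_type)

text \<open>One inclusion is \<open>path_chi\<close>. For the other, \<open>origin\<close> is
  constant along paths, so the start of a path from a source to a target is determined by its
  end.\<close>

lemma paths_chi: "{(x, y). (Source x, Target y) \<in> (wd_graph i m \<Psi> \<Phi>)\<^sup>+} = graph us v chi"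
proof (intro set_eqI iffI; clarify)
  fix x y assume p: "(Source x, Target y) \<in> (wd_graph i m \<Psi> \<Phi>)\<^sup>+"
  then have "x = chi y" using origin_path[OF p] by simp
  moreover from p have "y \<in> dom (targets us v)"
    by (metis edge_target tranclE)
  ultimately show "(x, y) \<in> graph us v chi" by (simp add: graph_iff)
next
  fix x y assume "(x, y) \<in> graph us v chi"
  then show "(Source x, Target y) \<in> (wd_graph i m \<Psi> \<Phi>)\<^sup>+"
    using path_chi by (auto simp: graph_def)
qed

lemma wires_of_comp: "is_tfs \<tau> (targets us v) \<Longrightarrow> wires_of (wd_comp \<tau> ss ts v i \<Psi> \<Phi>) = graph us v chi"
  unfolding wd_comp_def paths_chi by (rule wires_of_with_wires[OF wiring_chi])

end

end

section \<open>Compatibility with substitution\<close>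

context bracketed_smc
begin

lemma labels_nodes:
  assumes "box v" "wiring ts v \<phi>"
  shows "labels (start v) (map (node ts \<phi> fs) js) =
    InL ` dom (fst v) \<union> (\<Union>j\<in>set js. (\<lambda>y. InR (Tag j y)) ` dom (snd (ts ! j)))"
  by (simp add: labels_def)

text \<open>Covers host boxes, guest boxes and permuted boxes alike: whenever a map \<open>r\<close>
  of labels carries the old source map to the new one at the ports of a box, it carries the old node
  to the new node.\<close>

lemma rel_node:
  assumes "args us v' zs" "wiring us v' \<chi>" "c < length us" "args ts v fs" "j < length ts" "wiring ts v \<phi>"
    and "us ! c = ts ! j" "zs ! c = fs ! j"
    and "\<And>x. x \<in> dom (fst (ts ! j)) \<Longrightarrow> \<chi> (InL (Tag c x)) = r (\<phi> (InL (Tag j x)))"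
    and "\<And>y. y \<in> dom (snd (ts ! j)) \<Longrightarrow> r (InR (Tag j y)) = InR (Tag c y)"
  shows "node us \<chi> zs c = rel r r (node ts \<phi> fs j)"
proof -
  have f: "filled us zs c = filled ts fs j" using assms by (simp add: filled_def)
  have i: "inj_on (\<lambda>x. \<chi> (InL (Tag c x))) (dom (fst (ts ! j)))"
    using wiring_inj_box[OF assms(2,3)] assms(7) by simp
  have i1: "inj_on (\<lambda>x. r (\<phi> (InL (Tag j x)))) (dom (fst (ts ! j)))"
    using i inj_on_cong[of "dom (fst (ts ! j))" "\<lambda>x. \<chi> (InL (Tag c x))" "\<lambda>x. r (\<phi> (InL (Tag j x)))"] assms(9)
    by simp
  have i2: "inj_on (\<lambda>y. r (InR (Tag j y))) (dom (snd (ts ! j)))"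
    using inj_on_cong[of "dom (snd (ts ! j))" "\<lambda>y. r (InR (Tag j y))" "\<lambda>y. InR (Tag c y)"] assms(10) by simp
  have "rel r r (node ts \<phi> fs j) = rel (r \<circ> (\<lambda>x. \<phi> (InL (Tag j x)))) (r \<circ> (\<lambda>y. InR (Tag j y))) (filled ts fs j)"
    unfolding node_def
  proof (rule rel_rel)
    show "inj_on r ((\<lambda>x. \<phi> (InL (Tag j x))) ` dom (dm (filled ts fs j)))"
      "inj_on r ((\<lambda>y. InR (Tag j y)) ` dom (cd (filled ts fs j)))"
      using i1 i2 by (auto intro: inj_on_imageI simp: comp_def)
  qed (use assms wiring_inj_box[OF assms(6,5)] in \<open>simp_all add: tarr_filled\<close>)
  also have "\<dots> = node us \<chi> zs c"
    unfolding node_def f using assms i1 i2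
    by (intro rel_cong) (simp_all add: tarr_filled comp_def)
  finally show ?thesis ..
qed

text \<open>The order of the host is cut at \<open>i\<close> and the order of the guest is inserted.
  The three segments are relabelled by \<open>rho\<close>, \<open>kappa\<close> and
  \<open>rho\<close>, and they fit because the guest relabelled by \<open>kappa\<close> has the same
  effect as box \<open>i\<close> relabelled by \<open>rho\<close>. The cut is essential since
  \<open>rho\<close> may identify a label before it with one after it.\<close>

lemma evals_subst:
  assumes "wd_subst ss ts v i \<phi> \<psi>"
    and us: "args (subst_list ss ts i) v zs" and chi: "wiring (subst_list ss ts i) v \<chi>"
    and \<chi>: "\<chi> = wd_subst.chi ss i \<phi> \<psi>"
    and gs: "args ss (ts ! i) gs" "gs = take (length ss) (drop i zs)"
    and n: "evals ss (ts ! i) \<psi> gs n"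
    and fs: "args ts v fs" "fs = take i zs @ md n # drop (i + length ss) zs"
    and k: "evals ts v \<phi> fs k"
  shows "evals (subst_list ss ts i) v \<chi> zs k"
proof -
  interpret wd_subst ss ts v i \<phi> \<psi> by fact
  let ?us = "subst_list ss ts i"
  have lz: "length zs = length ts - 1 + m" using args_length[OF us] i by (simp add: length_subst_list)
  have bv: "box v" "box (ts ! i)" using fs(1) i by (auto simp: args_def)
  from k obtain js where js: "distinct js" "set js = {..<length ts}"
    and vjs: "valid (start v) (map (node ts \<phi> fs) js)"
    and ejs: "exec (start v) (map (node ts \<phi> fs) js) = rel InL (\<phi> \<circ> InR) k"
    and kk: "tarr k" "dm k = fst v" "cd k = snd v"
    by (auto simp: evals_def)
  from n obtain ks where ks: "distinct ks" "set ks = {..<m}"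
    and vks: "valid (start (ts ! i)) (map (node ss \<psi> gs) ks)"
    and eks: "exec (start (ts ! i)) (map (node ss \<psi> gs) ks) = rel InL (\<psi> \<circ> InR) n"
    and nn: "tarr n" "dm n = fst (ts ! i)" "cd n = snd (ts ! i)"
    by (auto simp: evals_def)
  have "i \<in> set js" using js i by simp
  then obtain pre post where pp: "js = pre @ i # post" by (meson split_list)
  have nj: "j < length ts" "j \<noteq> i" if "j \<in> set pre \<union> set post" for j
    using that js unfolding pp by auto
  have zhost: "zs ! ren j = fs ! j" if "j < length ts" "j \<noteq> i" for j
  proof (cases "j < i")
    case True
    then show ?thesis using i lz by (simp add: fs(2) renumber_def nth_append)
  next
    case False
    then have "i < j" using that by simp
    then obtain d where "j = Suc (i + d)" using less_imp_Suc_add by blast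
    then have "ren j = i + m + d" "fs ! j = zs ! (i + m + d)"
      using i lz that by (simp_all add: fs(2) renumber_def nth_append)
    then show ?thesis by simp
  qed
  have zi: "fs ! i = md n" using i lz by (simp add: fs(2) nth_append)
  have zguest: "zs ! (i + k) = gs ! k" if "k < m" for k
    using that lz i by (simp add: gs(2))
  have fi: "filled ts fs i = n" using nn zi by (simp add: filled_def prod_eq_iff)
  have nhost: "node ?us \<chi> zs (ren j) = rel rho rho (node ts \<phi> fs j)" if "j < length ts" "j \<noteq> i" for j
    by (rule rel_node[OF us chi subst_list_host(2)[OF i that] fs(1) that(1) host subst_list_host(1)[OF i that]])
      (use that in \<open>simp_all add: zhost \<chi> chi_host\<close>)
  have nguest: "node ?us \<chi> zs (i + k) = rel kappa kappa (node ss \<psi> gs k)" if "k < m" for k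
    by (rule rel_node[OF us chi subst_list_guest(2)[OF i that] gs(1) that guest subst_list_guest(1)[OF i that]])
      (use that in \<open>simp_all add: zguest \<chi> chi_guest\<close>)
  \<comment> \<open>On these sources \<open>rho\<close> merely renumbers, hence is injective; the
    outputs of box \<open>i\<close>, which it sends into the guest, are left out.\<close>
  define L0 where "L0 = {s \<in> dom (sources ts v). \<forall>y. s \<noteq> InR (Tag i y)}"
  \<comment> \<open>Contains all labels that occur while the guest runs inside the
    composite.\<close>
  define K where "K = kappa ` dom (sources ss (ts ! i))"
  have L0_form: "(\<exists>x. s = InL x) \<or> (\<exists>j y. s = InR (Tag j y) \<and> j \<noteq> i)" if "s \<in> L0" for s
  proof -
    have s: "s \<in> dom (sources ts v)" "\<forall>y. s \<noteq> InR (Tag i y)" using that unfolding L0_def by blast+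
    from s(1) show ?thesis by (rule source_cases) (use s(2) in blast)+
  qed
  have rho_L0: "inj_on rho L0"
  proof (rule inj_onI)
    fix s s' assume s: "s \<in> L0" "s' \<in> L0" "rho s = rho s'"
    from L0_form[OF s(1)] L0_form[OF s(2)] s(3) show "s = s'"
      by (elim disjE exE conjE) (auto dest: renumber_inj)
  qed
  have rhoL0_guest: "rho s \<noteq> InR (Tag (i + k) y)" if "s \<in> L0" "k < m" for s k y
    using L0_form[OF that(1)] by (elim disjE exE conjE) (simp_all add: renumber_neq[OF that(2)])
  have in_L0: "\<phi> (InL (Tag i x)) \<in> L0" if "x \<in> dom (fst (ts ! i))" for x
    unfolding L0_def using bij_betw_apply[OF host_bij target_i[OF that]] no_loop[OF that] by simp
  \<comment> \<open>Different inputs of the replaced box are fed by different host sources in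
    \<open>L0\<close>, and none of these becomes an output of a guest box.\<close>
  have kappa_inj: "inj_on kappa (dom (sources ss (ts ! i)))"
  proof (rule inj_onI)
    fix s s' assume a: "s \<in> dom (sources ss (ts ! i))" "s' \<in> dom (sources ss (ts ! i))" "kappa s = kappa s'"
    have inj: "x = x'" if "x \<in> dom (fst (ts ! i))" "x' \<in> dom (fst (ts ! i))" "kappa (InL x) = kappa (InL x')" for x x'
    proof -
      have "\<phi> (InL (Tag i x)) = \<phi> (InL (Tag i x'))"
        using that(3) unfolding kappa_InL[OF that(1)] kappa_InL[OF that(2)]
        by (rule inj_onD[OF rho_L0 _ in_L0[OF that(1)] in_L0[OF that(2)]])
      then show ?thesis
        using inj_onD[OF bij_betw_imp_inj_on[OF host_bij] _ target_i[OF that(1)] target_i[OF that(2)]] by simp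
    qed
    have neq: "kappa (InL x) \<noteq> InR (Tag (i + k) y)" if "x \<in> dom (fst (ts ! i))" "k < m" for x k y
      using rhoL0_guest[OF in_L0[OF that(1)] that(2)] kappa_InL[OF that(1)] by simp
    from a(1) show "s = s'"
    proof (cases rule: source_cases)
      case s: (outer x)
      from a(2) show ?thesis
      proof (cases rule: source_cases)
        case s': (outer x')
        have "kappa (InL x) = kappa (InL x')" using a(3) unfolding s(1) s'(1) .
        from inj[OF s(2) s'(2) this] show ?thesis using s(1) s'(1) by simp
      next
        case s': (inner k y)
        then show ?thesis using a(3) neq[OF s(2) s'(2), of y] s(1) by (simp del: kappa.simps(1))
      qed
    next
      case s: (inner k y)
      from a(2) show ?thesis
      proof (cases rule: source_cases)
        case (outer x)
        then show ?thesis using s a(3) neq[OF outer(2) s(2), of y] by (simp del: kappa.simps(1))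
      qed (use s a(3) in simp)
    qed
  qed
  let ?a = "node ts \<phi> fs i"
  let ?A = "dom (dm ?a)"
  have a: "tarr ?a" "dm ?a = push (\<lambda>x. \<phi> (InL (Tag i x))) (fst (ts ! i))"
    "cd ?a = push (\<lambda>y. InR (Tag i y)) (snd (ts ! i))"
    using tarr_node[OF fs(1) host i] by simp_all
  have A_L0: "?A \<subseteq> L0"
    unfolding a(2) dom_push by (rule image_subsetI) (rule in_L0)
  have K_eq: "K \<subseteq> rho ` ?A \<union> {InR (Tag (i + k) y) | k y. k < m}"
  proof
    fix s assume "s \<in> K"
    then obtain s' where s': "s' \<in> dom (sources ss (ts ! i))" "s = kappa s'" unfolding K_def by blast
    from s'(1) show "s \<in> rho ` ?A \<union> {InR (Tag (i + k) y) | k y. k < m}"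
    proof (cases rule: source_cases)
      case (outer x)
      then have "s = rho (\<phi> (InL (Tag i x)))" using s'(2) kappa_InL[OF outer(2)] by simp
      then show ?thesis using outer(2) by simp
    qed (use s' in auto)
  qed
  \<comment> \<open>A host label that is not an input of box \<open>i\<close> never meets a label of
    the guest; this supplies the frame condition below.\<close>
  have K_disjoint: "rho ` Q \<inter> K = {}" if "Q \<subseteq> L0" "Q \<inter> ?A = {}" for Q
  proof -
    have "rho ` Q \<inter> rho ` ?A = {}"
      by (rule image_disjoint[OF inj_on_subset[OF rho_L0 Un_least[OF that(1) A_L0]] that(2)])
    moreover have "s \<in> rho ` ?A" if s: "s \<in> rho ` Q" "s \<in> K" for s
    proof -
      obtain q where q: "q \<in> L0" "s = rho q" using s(1) \<open>Q \<subseteq> L0\<close> by blast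
      from K_eq s(2) have or: "s \<in> rho ` ?A \<or> s \<in> {InR (Tag (i + k) y) | k y. k < m}" by blast
      have not: "s \<notin> {InR (Tag (i + k) y) | k y. k < m}"
        unfolding q(2) using rhoL0_guest[OF q(1)] by blast
      from or show ?thesis by (rule disjE) (assumption, erule notE[OF not])
    qed
    ultimately show ?thesis by (meson disjoint_iff)
  qed
  \<comment> \<open>An output of box \<open>i\<close> receives the label of the guest source joined
    to it, which for a wire passing through is the label of an input of box
    \<open>i\<close>.\<close>
  have rho_out: "inj_on rho (dom (cd ?a)) \<and> rho ` dom (cd ?a) \<subseteq> K"
  proof
    have t: "InR y \<in> dom (targets ss (ts ! i))" if "y \<in> dom (snd (ts ! i))" for y
      using that by simp
    show "inj_on rho (dom (cd ?a))"
    proof (rule inj_onI)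
      fix s s' assume "s \<in> dom (cd ?a)" "s' \<in> dom (cd ?a)" and e: "rho s = rho s'"
      then obtain y y' where y: "s = InR (Tag i y)" "y \<in> dom (snd (ts ! i))"
        "s' = InR (Tag i y')" "y' \<in> dom (snd (ts ! i))" by auto
      then have "\<psi> (InR y) = \<psi> (InR y')"
        using inj_onD[OF kappa_inj] bij_betw_apply[OF guest_bij t] e by simp
      then show "s = s'"
        using inj_onD[OF bij_betw_imp_inj_on[OF guest_bij] _ t t] y by simp
    qed
    show "rho ` dom (cd ?a) \<subseteq> K"
      unfolding a(3) dom_push image_image K_def
    proof (rule image_subsetI)
      fix y assume "y \<in> dom (snd (ts ! i))"
      from imageI[OF bij_betw_apply[OF guest_bij t[OF this]], of kappa]
      show "rho (InR (Tag i y)) \<in> kappa ` dom (sources ss (ts ! i))" by simp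
    qed
  qed
  have rho_after: "inj_on rho (dom (cd ?a) \<union> Q)" if "Q \<subseteq> L0" "Q \<inter> ?A = {}" for Q
    unfolding inj_on_Un using rho_out inj_on_subset[OF rho_L0 that(1)] K_disjoint[OF that] by blast
  let ?X0 = "start v" and ?pre = "map (node ts \<phi> fs) pre" and ?post = "map (node ts \<phi> fs) post"
  have X0: "tfs ?X0" using bv tfs_start by blast
  have v1: "valid ?X0 ?pre" and v2: "valid (cd (exec ?X0 ?pre)) (?a # ?post)"
    using vjs X0 unfolding pp by (simp_all add: valid_append)
  define X1 where "X1 = cd (exec ?X0 ?pre)"
  have X1: "tfs X1" unfolding X1_def using tarrD(2)[OF exec_simps(1)[OF v1 X0]] .
  have can: "can ?a X1" and v3: "valid (cd ?a ++ rest X1 ?a) ?post"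
    using v2 by (simp_all add: X1_def)
  \<comment> \<open>The part of the state that waits while box \<open>i\<close>, or the guest in its
    place, is executed.\<close>
  define R where "R = rest X1 ?a"
  define X2 where "X2 = cd ?a ++ R"
  note cD = canD[OF can]
  have R: "tfs R" "dom R = dom X1 - ?A" using X1 by (simp_all add: R_def dom_rest)
  have X2: "tfs X2" unfolding X2_def R_def by (rule tfs_fire[OF can X1])
  have labs: "labels ?X0 ?pre \<subseteq> L0"
    unfolding labels_nodes[OF bv(1) host] L0_def using nj by auto
  then have X1_L0: "dom X1 \<subseteq> L0" unfolding X1_def using cd_exec_labels[OF v1 X0] by simp
  define Outs where "Outs = (\<Union>j\<in>set post. (\<lambda>y. InR (Tag j y)) ` dom (snd (ts ! j)))"
  have Outs: "Outs \<subseteq> L0" unfolding Outs_def L0_def using nj by auto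
  \<comment> \<open>The inputs of box \<open>i\<close> are available before it fires, whereas
    outputs of later boxes carry other numbers, so no later label collides with them.\<close>
  have "?A \<subseteq> labels ?X0 ?pre" using cD(5) cd_exec_labels[OF v1 X0] by (simp add: X1_def)
  moreover have "labels ?X0 ?pre \<inter> Outs = {}"
    unfolding labels_nodes[OF bv(1) host] Outs_def using js(1) unfolding pp by auto
  ultimately have OA: "Outs \<inter> ?A = {}" by blast
  have RA: "dom R \<subseteq> L0" "dom R \<inter> ?A = {}" using R X1_L0 by auto
  have labs2: "labels X2 ?post = dom (cd ?a) \<union> (dom R \<union> Outs)"
    by (simp add: labels_def X2_def Outs_def Un_ac)
  have inj_post: "inj_on rho (labels X2 ?post)"
    unfolding labs2
    by (rule rho_after[OF Un_least[OF RA(1) Outs]]) (simp only: Int_Un_distrib2 RA(2) OA Un_empty_left)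
  have inj_pre: "inj_on rho (labels ?X0 ?pre)" by (rule inj_on_subset[OF rho_L0 labs])
  note E1 = exec_rel[OF v1 X0 inj_pre]
  note E3 = exec_rel[OF v3[folded R_def, folded X2_def] X2 inj_post]
  have pX0: "push rho ?X0 = ?X0"
  proof -
    have "push rho ?X0 = push (rho \<circ> InL) (fst v)"
      unfolding start_def by (rule push_push) (simp_all add: inj_on_def)
    also have "rho \<circ> InL = InL" by auto
    finally show ?thesis by (simp add: start_def)
  qed
  let ?Xi = "start (ts ! i)" and ?gs = "map (node ss \<psi> gs) ks"
  have Xi: "tfs ?Xi" using bv tfs_start by blast
  have labs_i: "labels ?Xi ?gs \<subseteq> dom (sources ss (ts ! i))"
    unfolding labels_nodes[OF bv(2) guest] using ks by auto
  note EG = exec_rel[OF vks Xi inj_on_subset[OF kappa_inj labs_i]]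
  have kappa_InL_inj: "inj_on kappa (InL ` dom (fst (ts ! i)))"
    by (rule inj_on_subset[OF kappa_inj]) (rule image_subsetI, simp)
  \<comment> \<open>The start of the guest, relabelled by \<open>kappa\<close>, is exactly what box
    \<open>i\<close>, relabelled by \<open>rho\<close>, consumes.\<close>
  have pXi: "push kappa ?Xi = push rho (dm ?a)"
  proof -
    have i1: "inj_on (\<lambda>x. \<phi> (InL (Tag i x))) (dom (fst (ts ! i)))" by (rule wiring_inj_box[OF host i])
    have "push kappa ?Xi = push (kappa \<circ> InL) (fst (ts ! i))"
      unfolding start_def using kappa_InL_inj by (intro push_push) simp_all
    also have "\<dots> = push (rho \<circ> (\<lambda>x. \<phi> (InL (Tag i x)))) (fst (ts ! i))"
    proof (rule push_cong)
      show "inj_on (kappa \<circ> InL) (dom (fst (ts ! i)))"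
        using kappa_InL_inj by (intro comp_inj_on) simp_all
    qed (simp add: kappa_InL del: kappa.simps(1))
    also have "\<dots> = push rho (dm ?a)"
      unfolding a(2) using i1 inj_on_subset[OF rho_L0 A_L0] by (intro push_push[symmetric]) simp_all
    finally show ?thesis .
  qed
  have vG: "valid (push rho (dm ?a)) (map (rel kappa kappa) ?gs)"
    and eG: "exec (push rho (dm ?a)) (map (rel kappa kappa) ?gs) = rel kappa kappa (rel InL (\<psi> \<circ> InR) n)"
    using EG unfolding pXi eks by auto
  have inj_n: "inj_on InL (dom (dm n))" "inj_on (\<psi> \<circ> InR) (dom (cd n))"
    "inj_on kappa (InL ` dom (dm n))" "inj_on kappa ((\<psi> \<circ> InR) ` dom (cd n))"
  proof -
    show "inj_on (\<psi> \<circ> InR) (dom (cd n))" using wiring_inj_out[OF guest] nn by simp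
    show "inj_on kappa (InL ` dom (dm n))" using nn by (intro inj_on_subset[OF kappa_inj]) auto
    show "inj_on kappa ((\<psi> \<circ> InR) ` dom (cd n))"
      using nn bij_betw_apply[OF guest_bij, of "InR _"] by (intro inj_on_subset[OF kappa_inj]) (auto simp: image_subset_iff)
  qed simp
  have inj_a: "inj_on rho ?A" "inj_on rho (dom (cd ?a))" "inj_on rho (?A \<union> dom R)" "inj_on rho (dom (cd ?a) \<union> dom R)"
    using inj_on_subset[OF rho_L0, of "?A \<union> dom R"] A_L0 RA rho_out rho_after[OF RA]
    by (auto simp: inj_on_Un)
  \<comment> \<open>Both sides relabel the value \<open>n\<close> of the guest, and their maps of
    labels agree on its ports by the definitions of \<open>rho\<close> and
    \<open>kappa\<close>.\<close>
  have ra: "rel rho rho ?a = rel kappa kappa (rel InL (\<psi> \<circ> InR) n)"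
  proof -
    have "rel rho rho ?a = rel (rho \<circ> (\<lambda>x. \<phi> (InL (Tag i x)))) (rho \<circ> (\<lambda>y. InR (Tag i y))) n"
      unfolding node_def fi using nn wiring_inj_box[OF host i] inj_a(1,2) unfolding node_simps dom_push
      by (intro rel_rel) simp_all
    also have "\<dots> = rel (kappa \<circ> InL) (kappa \<circ> (\<psi> \<circ> InR)) n"
    proof (rule rel_cong[symmetric])
      show "inj_on (kappa \<circ> InL) (dom (dm n))" "inj_on (kappa \<circ> (\<psi> \<circ> InR)) (dom (cd n))"
        using inj_n by (auto intro!: comp_inj_on)
    qed (use nn in \<open>simp_all add: kappa_InL del: kappa.simps(1)\<close>)
    also have "\<dots> = rel kappa kappa (rel InL (\<psi> \<circ> InR) n)"
      using nn inj_n by (intro rel_rel[symmetric]) simp_all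
    finally show ?thesis .
  qed
  have labsG: "labels (push rho (dm ?a)) (map (rel kappa kappa) ?gs) \<subseteq> K"
  proof -
    have "labels (push rho (dm ?a)) (map (rel kappa kappa) ?gs) = kappa ` labels ?Xi ?gs"
      unfolding pXi[symmetric] by (simp add: labels_def image_Un image_UN image_image)
    then show ?thesis unfolding K_def using labs_i by blast
  qed
  \<comment> \<open>With the waiting part disjoint from all labels of the guest,
    \<open>exec_frame\<close> runs the guest inside the state of the host.\<close>
  have "dom (push rho R) \<inter> labels (push rho (dm ?a)) (map (rel kappa kappa) ?gs) = {}"
    unfolding dom_push using K_disjoint[OF RA] labsG by blast
  note frame = exec_frame[OF vG is_tfs_push[OF tarrD(1)[OF a(1)]] is_tfs_push[OF R(1)] this]
  have vG': "valid (push rho (dm ?a) ++ push rho R) (map (rel kappa kappa) ?gs)"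
    by (rule frame[THEN conjunct1])
  have eG': "exec (push rho (dm ?a) ++ push rho R) (map (rel kappa kappa) ?gs) = rel rho rho ?a \<uplus> idt (push rho R)"
    unfolding ra eG[symmetric] by (rule frame[THEN conjunct2])
  have pX1: "push rho (dm ?a) ++ push rho R = push rho X1"
    unfolding dm_rest[OF can, folded R_def, symmetric] using inj_a(3) RA by (intro push_add[symmetric]) auto
  have "compat ?a (idt R)" using cD(6) by (simp add: R_def)
  then have fire: "rel rho rho (fire ?a X1) = rel rho rho ?a \<uplus> idt (push rho R)"
    unfolding fire_def R_def[symmetric] using a(1) R inj_a by (subst rel_un) (simp_all add: rel_idt inj_on_Un)
  define pre' mid' post' where "pre' = map (node ?us \<chi> zs) (map ren pre)"
    and "mid' = map (node ?us \<chi> zs) (map (\<lambda>k. i + k) ks)" and "post' = map (node ?us \<chi> zs) (map ren post)"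
  have pre': "pre' = map (rel rho rho) ?pre" and post': "post' = map (rel rho rho) ?post"
    and mid': "mid' = map (rel kappa kappa) ?gs"
    unfolding pre'_def mid'_def post'_def using nj ks nhost nguest by auto
  have V1: "valid ?X0 pre'" and W1: "exec ?X0 pre' = rel rho rho (exec ?X0 ?pre)"
    using E1 unfolding pX0 pre' by auto
  have V2: "valid (push rho X1) mid'" and W2: "exec (push rho X1) mid' = rel rho rho (fire ?a X1)"
    using vG' eG' unfolding pX1 mid' fire by auto
  have V3: "valid (push rho X2) post'" and W3: "exec (push rho X2) post' = rel rho rho (exec X2 ?post)"
    using E3 unfolding post' by auto
  have c1: "cd (exec ?X0 pre') = push rho X1" unfolding W1 X1_def by simp
  have c2: "cd (exec (push rho X1) mid') = push rho X2"
    unfolding W2 rel_simps using can X1 by (simp add: X2_def R_def)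
  have inj1: "inj_on rho (dom X1)" by (rule inj_on_subset[OF rho_L0 X1_L0])
  have inj2: "inj_on rho (dom X2)" using inj_post by (rule inj_on_subset) (rule dom_labels)
  have tX1: "tfs (push rho X1)" using X1 by (rule is_tfs_push)
  let ?fin = "exec X2 ?post"
  have v3': "valid X2 ?post" using v3 by (simp add: X2_def R_def)
  have injf: "inj_on rho (dom (cd ?fin))"
    by (rule inj_on_subset[OF inj_post cd_exec_labels[OF v3' X2]])
  have V: "valid ?X0 (pre' @ mid' @ post')"
    using V1 V2 V3 X0 tX1 by (simp add: valid_append c1 c2)
  \<comment> \<open>The relabelled segments compose to the relabelled execution of the host, whose
    value is known from \<open>ejs\<close>.\<close>
  have "exec ?X0 (pre' @ mid' @ post') = exec ?X0 pre' \<bullet> (exec (push rho X1) mid' \<bullet> exec (push rho X2) post')"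
    using V1 V2 V3 X0 tX1 by (simp add: exec_append valid_append c1 c2)
  also have "\<dots> = rel rho rho (exec ?X0 ?pre) \<bullet> (rel rho rho (fire ?a X1) \<bullet> rel rho rho ?fin)"
    unfolding W1 W2 W3 ..
  also have "\<dots> = rel rho rho (exec ?X0 ?pre \<bullet> (fire ?a X1 \<bullet> ?fin))"
  proof -
    have t: "tarr (exec ?X0 ?pre)" "dm (exec ?X0 ?pre) = ?X0" "tarr (fire ?a X1)" "dm (fire ?a X1) = X1"
      "cd (fire ?a X1) = X2" "tarr ?fin" "dm ?fin = X2" "cd (exec ?X0 ?pre) = X1"
      using v1 X0 can X1 v3' X2 by (simp_all add: X1_def X2_def R_def)
    have "rel rho rho (fire ?a X1) \<bullet> rel rho rho ?fin = rel rho rho (fire ?a X1 \<bullet> ?fin)"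
      using t inj1 inj2 injf by (intro rel_cp[symmetric]) simp_all
    moreover have "rel rho rho (exec ?X0 ?pre) \<bullet> rel rho rho (fire ?a X1 \<bullet> ?fin) =
        rel rho rho (exec ?X0 ?pre \<bullet> (fire ?a X1 \<bullet> ?fin))"
      using t inj1 injf inj_pre dom_labels[of ?X0 ?pre] by (intro rel_cp[symmetric]) (auto intro: inj_on_subset)
    ultimately show ?thesis by simp
  qed
  also have "exec ?X0 ?pre \<bullet> (fire ?a X1 \<bullet> ?fin) = exec ?X0 (map (node ts \<phi> fs) js)"
    using v1 v2 X0 unfolding pp by (simp add: exec_append X1_def X2_def R_def)
  also have "rel rho rho (exec ?X0 (map (node ts \<phi> fs) js)) = rel (rho \<circ> InL) (rho \<circ> (\<phi> \<circ> InR)) k"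
  proof -
    have "cd ?fin = cd (exec ?X0 (map (node ts \<phi> fs) js))"
      using v1 v2 X0 unfolding pp by (simp add: exec_append X1_def X2_def R_def)
    then have "dom (cd ?fin) = (\<phi> \<circ> InR) ` dom (cd k)" unfolding ejs by simp
    then have "inj_on rho ((\<phi> \<circ> InR) ` dom (cd k))" using injf by simp
    then show ?thesis
      unfolding ejs using kk wiring_inj_out[OF host] by (intro rel_rel) (simp_all add: inj_on_def)
  qed
  also have "rho \<circ> InL = InL" by auto
  also have "rho \<circ> (\<phi> \<circ> InR) = \<chi> \<circ> InR" unfolding \<chi> by auto
  finally have W: "exec ?X0 (pre' @ mid' @ post') = rel InL (\<chi> \<circ> InR) k" .
  let ?js = "map ren pre @ map (\<lambda>k. i + k) ks @ map ren post"
  have "distinct ?js"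
  proof -
    have "distinct pre" "distinct post" "set pre \<inter> set post = {}" using js(1) unfolding pp by auto
    moreover have "inj_on ren (set pre \<union> set post)"
      by (rule inj_onI) (rule renumber_inj, assumption, (rule nj(2), assumption)+)
    moreover have "ren j \<noteq> i + k" "i + k \<noteq> ren j" if "j \<in> set pre \<union> set post" "k < m" for j k
      using renumber_neq[OF that(2)] nj(2)[OF that(1)] by metis+
    ultimately show ?thesis
      using ks image_disjoint[of ren "set pre" "set post"]
      by (auto simp: distinct_map inj_on_Un)
  qed
  moreover have "set ?js = {..<length ?us}"
  proof (intro equalityI subsetI)
    fix c assume "c \<in> set ?js"
    then consider j where "c = ren j" "j \<in> set pre \<union> set post" | k where "c = i + k" "k < m"
      using ks by auto
    then show "c \<in> {..<length ?us}"
      by cases (use nj i subst_list_host(2)[of i ts _ ss] subst_list_guest(2)[of i ts _ ss] in auto)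
  next
    fix c assume "c \<in> {..<length ?us}"
    then have "c < length ?us" by simp
    then show "c \<in> set ?js"
      using i
    proof (cases rule: subst_list_index_cases)
      case (host j)
      then have "j \<in> set js" using js by simp
      then show ?thesis using host unfolding pp by auto
    qed (use ks in auto)
  qed
  ultimately show ?thesis
    unfolding evals_def using kk V W by (intro conjI exI[of _ ?js]) (simp_all add: pre'_def mid'_def post'_def)
qed

end

section \<open>Special diagrams and the algebra\<close>

lemma typed_bij_witness:
  assumes "\<And>x. x \<in> dom X \<Longrightarrow> Y (f x) = X x \<and> g (f x) = x"
    and "\<And>y. y \<in> dom Y \<Longrightarrow> g y \<in> dom X \<and> f (g y) = y"
  shows "typed_bij X Y f"
  unfolding typed_bij_def
proof
  show "bij_betw f (dom X) (dom Y)"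
  proof (rule bij_betw_byWitness[where f' = g])
    show "f ` dom X \<subseteq> dom Y"
    proof (rule image_subsetI)
      fix x assume "x \<in> dom X"
      then show "f x \<in> dom Y" using assms(1) by (simp add: domIff)
    qed
  qed (use assms in blast)+
qed (use assms in blast)

lemma push_inj: "inj \<sigma> \<Longrightarrow> push \<sigma> X (\<sigma> x) = X x"
  by (cases "x \<in> dom X") (auto simp: push_def inj_image_mem_iff inj_on_subset domIff inv_into_f_f)

lemma inj_InL_InR: "inj InL" "inj InR"
  by (simp_all add: inj_def)

text \<open>Reduces tagged sums to \<open>++\<close>, so that the untagged calculus of
  \<open>\<uplus>\<close> applies to them.\<close>

lemma tsum_push: "X \<oplus> Y = push InL X ++ push InR Y"
proof
  fix z
  show "(X \<oplus> Y) z = (push InL X ++ push InR Y) z"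
  proof (cases z)
    case (InL x)
    have "push InR Y z = None" by (auto simp: push_def InL)
    moreover have "push InL X z = X x" by (simp add: InL push_inj inj_InL_InR)
    ultimately show ?thesis by (simp add: InL map_add_def)
  next
    case (InR x)
    have "push InR Y z = Y x" by (simp add: InR push_inj inj_InL_InR)
    moreover have "push InL X z = None" by (auto simp: push_def InR)
    ultimately show ?thesis by (simp add: InR map_add_def split: option.splits)
  qed (auto simp: push_def map_add_def)
qed

lemma dom_tsum [simp]: "dom (X \<oplus> Y) = InL ` dom X \<union> InR ` dom Y"
  by (simp add: tsum_push Un_commute)

lemma is_tfs_tsum: "\<lbrakk>is_tfs \<tau> X; is_tfs \<tau> Y\<rbrakk> \<Longrightarrow> is_tfs \<tau> (X \<oplus> Y)"
  by (simp add: tsum_push is_tfs_add is_tfs_push)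

section \<open>Permuting the boxes of a diagram\<close>

lemma inj_on_relabel_source:
  assumes "inj \<pi>"
  shows "inj_on (relabel_source \<pi>) (dom (sources ts v))"
proof (rule inj_onI)
  fix s s' assume s: "s \<in> dom (sources ts v)" "s' \<in> dom (sources ts v)" "relabel_source \<pi> s = relabel_source \<pi> s'"
  from s(1) show "s = s'"
  proof (cases rule: source_cases)
    case x: (outer x)
    from s(2) show ?thesis by (rule source_cases) (use x s(3) in simp_all)
  next
    case x: (inner j y)
    from s(2) show ?thesis by (rule source_cases) (use x s(3) inj_eq[OF assms] in simp_all)
  qed
qed

context
  fixes ts :: "('a, 't) box list" and v :: "('a, 't) box" and \<phi> :: "'a elt \<Rightarrow> 'a elt" and \<pi> :: "nat \<Rightarrow> nat"
  assumes w: "wiring ts v \<phi>" and \<pi>: "\<pi> permutes {..<length ts}"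
begin

text \<open>Box \<open>j\<close> of the permuted list is box \<open>\<pi> j\<close> of the original,
  so targets are translated by \<pi> and the sources found there are translated back by its
  inverse.\<close>

definition perm_src :: "'a elt \<Rightarrow> 'a elt" where
  "perm_src = relabel_source (inv \<pi>) \<circ> (\<phi> \<circ> relabel_target \<pi>)"

lemma perm_simps: "\<pi> (inv \<pi> j) = j" "inv \<pi> (\<pi> j) = j" "\<pi> j < length ts \<longleftrightarrow> j < length ts"
  "inv \<pi> j < length ts \<longleftrightarrow> j < length ts"
  using \<pi> permutes_inv[OF \<pi>] permutes_in_image[of \<pi>] permutes_in_image[of "inv \<pi>"]
  by (auto simp: permutes_inverses)

lemma nth_perm: "j < length ts \<Longrightarrow> permute_list \<pi> ts ! j = ts ! \<pi> j"
  using \<pi> by (simp add: permute_list_nth)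

lemma wiring_perm: "wiring (permute_list \<pi> ts) v perm_src"
  unfolding wiring_def perm_src_def
proof (rule typed_bij_comp[OF typed_bij_comp])
  show "typed_bij (targets (permute_list \<pi> ts) v) (targets ts v) (relabel_target \<pi>)"
    by (rule typed_bij_witness[where g = "relabel_target (inv \<pi>)"]; erule target_cases)
      (simp_all add: perm_simps nth_perm)
  show "typed_bij (targets ts v) (sources ts v) \<phi>" using w by (simp add: wiring_def)
  show "typed_bij (sources ts v) (sources (permute_list \<pi> ts) v) (relabel_source (inv \<pi>))"
    by (rule typed_bij_witness[where g = "relabel_source \<pi>"]; erule source_cases)
      (simp_all add: perm_simps nth_perm)
qed

lemma wires_of_perm:
  assumes "wires_of \<Phi> = graph ts v \<phi>" "is_tfs \<tau> (targets (permute_list \<pi> ts) v)"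
  shows "wires_of (wd_perm \<tau> ts v \<pi> \<Phi>) = graph (permute_list \<pi> ts) v perm_src"
proof -
  have undo: "relabel_target \<pi> (relabel_target (inv \<pi>) t) = t"
    and dom: "relabel_target (inv \<pi>) t \<in> dom (targets (permute_list \<pi> ts) v)" if "t \<in> dom (targets ts v)" for t
    using that by (cases rule: target_cases; simp add: perm_simps nth_perm)+
  have fwd: "relabel_target (inv \<pi>) (relabel_target \<pi> t) = t"
    and dom': "relabel_target \<pi> t \<in> dom (targets ts v)" if "t \<in> dom (targets (permute_list \<pi> ts) v)" for t
    using that by (cases rule: target_cases; simp add: perm_simps nth_perm)+
  have "dom (targets (permute_list \<pi> ts) v) = relabel_target (inv \<pi>) ` dom (targets ts v)"
  proof (intro equalityI subsetI)
    fix t assume t: "t \<in> dom (targets (permute_list \<pi> ts) v)"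
    from imageI[OF dom'[OF t], of "relabel_target (inv \<pi>)"]
    show "t \<in> relabel_target (inv \<pi>) ` dom (targets ts v)" by (simp only: fwd[OF t])
  next
    fix t assume "t \<in> relabel_target (inv \<pi>) ` dom (targets ts v)"
    then obtain t' where "t' \<in> dom (targets ts v)" "t = relabel_target (inv \<pi>) t'" by (elim imageE)
    then show "t \<in> dom (targets (permute_list \<pi> ts) v)" using dom by simp
  qed
  then have "map_prod (relabel_source (inv \<pi>)) (relabel_target (inv \<pi>)) ` wires_of \<Phi> =
      graph (permute_list \<pi> ts) v perm_src"
    unfolding assms(1) graph_def by (simp add: image_image perm_src_def undo cong: image_cong_simp)
  then show ?thesis
    unfolding wd_perm_def using wires_of_with_wires[OF wiring_perm assms(2)] by simp
qed

end

section \<open>Source maps of the special diagrams\<close>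

fun id_src :: "'a elt \<Rightarrow> 'a elt" where
  "id_src (InL (Tag j x)) = InL x"
| "id_src (InR y) = InR (Tag 0 y)"
| "id_src z = z"

fun seq_src :: "'a elt \<Rightarrow> 'a elt" where
  "seq_src (InL (Tag j x)) = (if j = 0 then InL x else InR (Tag 0 x))"
| "seq_src (InR y) = InR (Tag 1 y)"
| "seq_src z = z"

fun para_src :: "'a elt \<Rightarrow> 'a elt" where
  "para_src (InL (Tag j x)) = (if j = 0 then InL (InL x) else InL (InR x))"
| "para_src (InR (InL y)) = InR (Tag 0 y)"
| "para_src (InR (InR y)) = InR (Tag 1 y)"
| "para_src z = z"

text \<open>The parameter is the inverse of the bijection in \<open>wd_sym\<close>, because a source
  map runs from targets to sources.\<close>

fun sym_src :: "('a elt \<Rightarrow> 'a elt) \<Rightarrow> 'a elt \<Rightarrow> 'a elt" where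
  "sym_src \<rho> (InR y) = InL (\<rho> y)"
| "sym_src \<rho> z = z"

lemma less_2: "(j::nat) < 2 \<longleftrightarrow> j = 0 \<or> j = 1" "(j::nat) < Suc (Suc 0) \<longleftrightarrow> j = 0 \<or> j = 1"
  by auto

lemma dom_targets:
  "dom (targets ts v) = (\<Union>j<length ts. (\<lambda>x. InL (Tag j x)) ` dom (fst (ts ! j))) \<union> InR ` dom (snd v)"
proof (intro equalityI subsetI)
  fix t assume "t \<in> dom (targets ts v)"
  then show "t \<in> (\<Union>j<length ts. (\<lambda>x. InL (Tag j x)) ` dom (fst (ts ! j))) \<union> InR ` dom (snd v)"
    by (rule target_cases) blast+
next
  fix t assume "t \<in> (\<Union>j<length ts. (\<lambda>x. InL (Tag j x)) ` dom (fst (ts ! j))) \<union> InR ` dom (snd v)"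
  then show "t \<in> dom (targets ts v)" by (elim UnE UN_E imageE) simp_all
qed

lemma wiring_id: "wiring [t] t id_src"
  unfolding wiring_def
  by (rule typed_bij_witness[where g = "\<lambda>s. case s of InL x \<Rightarrow> InL (Tag 0 x) | InR (Tag j y) \<Rightarrow> InR y | _ \<Rightarrow> s"];
      (erule target_cases | erule source_cases)) simp_all

lemma graph_id: "graph [t] t id_src =
  {(InL x, InL (Tag 0 x)) | x. x \<in> dom (fst t)} \<union> {(InR (Tag 0 y), InR y) | y. y \<in> dom (snd t)}"
  unfolding graph_def dom_targets by (simp add: image_Un image_image lessThan_Suc Setcompr_eq_image)

lemma wiring_seq: "wiring [(X, Y), (Y, Z)] (X, Z) seq_src"
  unfolding wiring_def
  by (rule typed_bij_witness[where g = "\<lambda>s. case s of InL x \<Rightarrow> InL (Tag 0 x)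
        | InR (Tag j y) \<Rightarrow> if j = 0 then InL (Tag 1 y) else InR y | _ \<Rightarrow> s"];
      (erule target_cases | erule source_cases)) (auto simp: less_2)

lemma graph_seq: "graph [(X, Y), (Y, Z)] (X, Z) seq_src =
  {(InL x, InL (Tag 0 x)) | x. x \<in> dom X} \<union> {(InR (Tag 0 y), InL (Tag 1 y)) | y. y \<in> dom Y} \<union>
  {(InR (Tag 1 z), InR z) | z. z \<in> dom Z}"
  unfolding graph_def dom_targets
  by (simp add: image_Un image_image lessThan_Suc Setcompr_eq_image Un_ac)

lemma wiring_para: "wiring [(X, Y), (X', Y')] (X \<oplus> X', Y \<oplus> Y') para_src"
  unfolding wiring_def
  by (rule typed_bij_witness[where g = "\<lambda>s. case s of InL (InL x) \<Rightarrow> InL (Tag 0 x) | InL (InR x) \<Rightarrow> InL (Tag 1 x)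
        | InR (Tag j y) \<Rightarrow> if j = 0 then InR (InL y) else InR (InR y) | _ \<Rightarrow> s"];
      (erule target_cases | erule source_cases)) (auto simp: less_2)

lemma graph_para: "graph [(X, Y), (X', Y')] (X \<oplus> X', Y \<oplus> Y') para_src =
  {(InL (InL x), InL (Tag 0 x)) | x. x \<in> dom X} \<union> {(InL (InR x), InL (Tag 1 x)) | x. x \<in> dom X'} \<union>
  {(InR (Tag 0 y), InR (InL y)) | y. y \<in> dom Y} \<union> {(InR (Tag 1 y), InR (InR y)) | y. y \<in> dom Y'}"
  unfolding graph_def dom_targets
  by (simp add: image_Un image_image lessThan_Suc Setcompr_eq_image Un_ac)

lemma wiring_sym:
  assumes "typed_bij X Y \<sigma>"
  shows "wiring [] (X, Y) (sym_src (inv_into (dom X) \<sigma>))"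
  unfolding wiring_def
proof (rule typed_bij_witness[where g = "\<lambda>s. case s of InL x \<Rightarrow> InR (\<sigma> x) | _ \<Rightarrow> s"])
  let ?\<phi> = "sym_src (inv_into (dom X) \<sigma>)" and ?g = "\<lambda>s. case s of InL x \<Rightarrow> InR (\<sigma> x) | _ \<Rightarrow> s"
  fix t assume "t \<in> dom (targets [] (X, Y))"
  then show "sources [] (X, Y) (?\<phi> t) = targets [] (X, Y) t \<and> ?g (?\<phi> t) = t"
  proof (cases rule: target_cases)
    case (outer y)
    then have "y \<in> \<sigma> ` dom X" "y \<in> dom Y" using typed_bij_dom[OF assms] by simp_all
    then show ?thesis
      using outer typed_bij_app[OF typed_bij_inv[OF assms], of y] by (simp add: f_inv_into_f)
  qed simp
next
  let ?\<phi> = "sym_src (inv_into (dom X) \<sigma>)" and ?g = "\<lambda>s. case s of InL x \<Rightarrow> InR (\<sigma> x) | _ \<Rightarrow> s"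
  fix s assume "s \<in> dom (sources [] (X, Y))"
  then show "?g s \<in> dom (targets [] (X, Y)) \<and> ?\<phi> (?g s) = s"
    by (rule source_cases) (use typed_bij_dom[OF assms] typed_bij_inj[OF assms] in simp_all)
qed

lemma graph_sym:
  assumes "typed_bij X Y \<sigma>"
  shows "graph [] (X, Y) (sym_src (inv_into (dom X) \<sigma>)) = {(InL x, InR (\<sigma> x)) | x. x \<in> dom X}"
  unfolding graph_def dom_targets
  using typed_bij_inj[OF assms]
  by (simp add: image_image typed_bij_dom[OF assms] Setcompr_eq_image cong: image_cong_simp)

context bracketed_smc
begin

text \<open>The boxes are executed in the same order under their new numbers. A single injective
  relabelling turns all old nodes into new ones, so \<open>exec_rel\<close> applies to the whole
  execution.\<close>

lemma evals_perm:
  assumes "args ts v fs" "wiring ts v \<phi>" and \<pi>: "\<pi> permutes {..<length ts}"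
    and us: "args (permute_list \<pi> ts) v zs" and fs: "fs = permute_list (inv \<pi>) zs"
    and m: "evals ts v \<phi> fs m"
  shows "evals (permute_list \<pi> ts) v (perm_src \<phi> \<pi>) zs m"
proof -
  let ?us = "permute_list \<pi> ts" and ?\<chi> = "perm_src \<phi> \<pi>" and ?r = "relabel_source (inv \<pi>)"
  note ps = perm_simps[OF assms(2) \<pi>] and np = nth_perm[OF assms(2) \<pi>] and wp = wiring_perm[OF assms(2) \<pi>]
  have \<chi>: "?\<chi> = ?r \<circ> (\<phi> \<circ> relabel_target \<pi>)" by (rule perm_src_def[OF assms(2) \<pi>])
  have lz: "length zs = length ts" using args_length[OF us] by simp
  have bv: "box v" using assms(1) by (simp add: args_def)
  from m obtain js where js: "distinct js" "set js = {..<length ts}"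
    and vjs: "valid (start v) (map (node ts \<phi> fs) js)"
    and ejs: "exec (start v) (map (node ts \<phi> fs) js) = rel InL (\<phi> \<circ> InR) m"
    and mm: "tarr m" "dm m = fst v" "cd m = snd v"
    by (auto simp: evals_def)
  have invperm: "inv \<pi> permutes {..<length zs}" using permutes_inv[OF \<pi>] lz by simp
  have "inj (inv \<pi>)" by (rule permutes_inj[OF permutes_inv[OF \<pi>]])
  note inj = inj_on_relabel_source[OF this, of ts v]
  have n: "node ?us ?\<chi> zs (inv \<pi> j) = rel ?r ?r (node ts \<phi> fs j)" if "j < length ts" for j
    by (rule rel_node[OF us wp _ assms(1) that assms(2)])
      (use that ps invperm lz in \<open>simp_all add: np \<chi> fs permute_list_nth\<close>)
  have labs: "labels (start v) (map (node ts \<phi> fs) js) \<subseteq> dom (sources ts v)"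
    unfolding labels_nodes[OF bv assms(2)] using js(2) by (intro Un_least UN_least image_subsetI) simp_all
  note E = exec_rel[OF vjs tfs_start[OF bv] inj_on_subset[OF inj labs]]
  have ps': "push ?r (start v) = start v"
  proof -
    have "push ?r (start v) = push (?r \<circ> InL) (fst v)"
      unfolding start_def by (rule push_push) (simp_all add: inj_on_def)
    also have "?r \<circ> InL = InL" by auto
    finally show ?thesis by (simp add: start_def)
  qed
  have mp: "map (node ?us ?\<chi> zs) (map (inv \<pi>) js) = map (rel ?r ?r) (map (node ts \<phi> fs) js)"
    using n js(2) by simp
  have "rel ?r ?r (rel InL (\<phi> \<circ> InR) m) = rel (?r \<circ> InL) (?r \<circ> (\<phi> \<circ> InR)) m"
  proof (rule rel_rel)
    show "inj_on ?r (InL ` dom (dm m))"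
      by (rule inj_on_subset[OF inj]) (use mm in \<open>auto intro!: image_subsetI simp del: dom_def\<close>)
    show "inj_on ?r ((\<phi> \<circ> InR) ` dom (cd m))"
    proof (rule inj_on_subset[OF inj], rule image_subsetI)
      fix y assume "y \<in> dom (cd m)"
      then have "InR y \<in> dom (targets ts v)" using mm by simp
      then show "(\<phi> \<circ> InR) y \<in> dom (sources ts v)"
        using assms(2) bij_betw_apply unfolding wiring_def typed_bij_def by fastforce
    qed
  qed (use mm wiring_inj_out[OF assms(2)] in simp_all)
  also have "?r \<circ> InL = InL" by auto
  also have "?r \<circ> (\<phi> \<circ> InR) = ?\<chi> \<circ> InR" unfolding \<chi> by auto
  finally have e: "rel ?r ?r (rel InL (\<phi> \<circ> InR) m) = rel InL (?\<chi> \<circ> InR) m" .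
  have W: "exec (start v) (map (node ?us ?\<chi> zs) (map (inv \<pi>) js)) = rel InL (?\<chi> \<circ> InR) m"
    unfolding mp E[THEN conjunct2, unfolded ps'] ejs e ..
  have V: "valid (start v) (map (node ?us ?\<chi> zs) (map (inv \<pi>) js))"
    unfolding mp using E ps' by simp
  have "distinct (map (inv \<pi>) js)"
    using js(1) inj_on_subset[OF \<open>inj (inv \<pi>)\<close> subset_UNIV] by (simp add: distinct_map)
  moreover have "set (map (inv \<pi>) js) = {..<length ?us}"
    using js(2) permutes_image[OF permutes_inv[OF \<pi>]] by simp
  ultimately show ?thesis
    unfolding evals_def using mm V W by (intro conjI exI[of _ "map (inv \<pi>) js"]) simp_all
qed

text \<open>In \<open>id\<close> and \<open>seq\<close> each box consumes the whole state, so no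
  frame remains and firing is plain composition.\<close>

lemma fire_exact:
  assumes "tarr m" "X = dm m"
  shows "can m X" "rest X m = Map.empty" "fire m X = m"
proof -
  show r: "rest X m = Map.empty" using assms(2) by (simp add: rest_def restrict_map_def domIff fun_eq_iff)
  show "can m X" using assms r by (simp add: can_def)
  show "fire m X = m" unfolding fire_def r using assms by (simp add: un_empty)
qed

lemma evals_id:
  assumes "args [t] t [f]"
  shows "evals [t] t id_src [f] (fst t, f, snd t)"
proof -
  let ?m = "(fst t, f, snd t)" and ?n = "node [t] id_src [f] 0"
  have m: "tarr ?m" using tarr_filled[OF assms, of 0] by (simp add: filled_def)
  have n: "tarr ?n" using tarr_node[OF assms wiring_id, of 0] by simp
  have "start t = dm ?n" by (simp add: start_def)
  note F = fire_exact[OF n this]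
  have "?n = rel InL (id_src \<circ> InR) ?m"
    by (simp add: node_def filled_def comp_def)
  then show ?thesis
    unfolding evals_def using m n F by (intro conjI exI[of _ "[0]"]) (simp_all add: lessThan_Suc)
qed

text \<open>Without boxes the execution is an identity; the bijection enters through the relabelling
  of the outer outputs, which undoes that of \<open>pm \<sigma> X Y\<close>.\<close>

lemma evals_sym:
  assumes "tfs X" "tfs Y" "typed_bij X Y \<sigma>"
  shows "evals [] (X, Y) (sym_src (inv_into (dom X) \<sigma>)) [] (pm \<sigma> X Y)"
proof -
  let ?\<phi> = "sym_src (inv_into (dom X) \<sigma>)"
  have c: "?\<phi> \<circ> InR = InL \<circ> inv_into (dom X) \<sigma>" by auto
  have i: "inj_on (?\<phi> \<circ> InR) (dom Y)" using wiring_inj_out[OF wiring_sym[OF assms(3)]] by simp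
  have "rel InL (?\<phi> \<circ> InR) (pm \<sigma> X Y) = pm id (push InL X) (push (?\<phi> \<circ> InR) Y)"
    using assms i typed_bij_inj[OF assms(3)] by (intro rel_pm) simp_all
  also have "push (?\<phi> \<circ> InR) Y = push InL X"
    unfolding c by (rule push_unique[OF typed_bij_comp[OF typed_bij_inv[OF assms(3)] typed_bij_push]]) simp
  finally have e: "rel InL (?\<phi> \<circ> InR) (pm \<sigma> X Y) = idt (push InL X)" .
  show ?thesis
    unfolding evals_def
  proof (intro conjI exI[of _ "[]"])
    show "exec (start (X, Y)) (map (node [] ?\<phi> []) []) = rel InL (?\<phi> \<circ> InR) (pm \<sigma> X Y)"
      unfolding e list.map exec.simps start_def fst_conv ..
  qed (use assms in simp_all)
qed

lemma evals_seq:
  assumes "args [(X, Y), (Y, Z)] (X, Z) [f, g]"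
  shows "evals [(X, Y), (Y, Z)] (X, Z) seq_src [f, g] ((X, f, Y) \<bullet> (Y, g, Z))"
proof -
  let ?ts = "[(X, Y), (Y, Z)]"
  let ?n = "node ?ts seq_src [f, g]"
  have f: "tarr (X, f, Y)" and g: "tarr (Y, g, Z)"
    using tarr_filled[OF assms, of 0] tarr_filled[OF assms, of 1] by (simp_all add: filled_def)
  have n: "tarr (?n 0)" "tarr (?n 1)"
    using tarr_node[OF assms wiring_seq, of 0] tarr_node[OF assms wiring_seq, of 1] by simp_all
  note F0 = fire_exact[OF n(1), of "start (X, Z)"] and F1 = fire_exact[OF n(2), of "cd (?n 0)"]
  have s: "start (X, Z) = dm (?n 0)" "cd (?n 0) = dm (?n 1)" by (simp_all add: start_def)
  \<comment> \<open>The output labels of the first box serve as the intermediate labels in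
    \<open>rel_cp\<close>.\<close>
  have "rel InL (seq_src \<circ> InR) ((X, f, Y) \<bullet> (Y, g, Z)) =
      rel InL (\<lambda>y. InR (Tag 0 y)) (X, f, Y) \<bullet> rel (\<lambda>y. InR (Tag 0 y)) (seq_src \<circ> InR) (Y, g, Z)"
    using f g by (intro rel_cp) (simp_all add: inj_on_def)
  also have "rel InL (\<lambda>y. InR (Tag 0 y)) (X, f, Y) = ?n 0" by (simp add: node_def filled_def)
  also have "rel (\<lambda>y. InR (Tag 0 y)) (seq_src \<circ> InR) (Y, g, Z) = ?n 1"
    by (simp add: node_def filled_def comp_def)
  finally have "rel InL (seq_src \<circ> InR) ((X, f, Y) \<bullet> (Y, g, Z)) = ?n 0 \<bullet> ?n 1" .
  moreover have "valid (start (X, Z)) (map ?n [0, 1])" "exec (start (X, Z)) (map ?n [0, 1]) = ?n 0 \<bullet> ?n 1"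
    using n F0[OF s(1)] F1[OF s(2)] tarrD(2)[OF n(2)] by (simp_all del: node_simps)
  ultimately show ?thesis
    unfolding evals_def using f g by (intro conjI exI[of _ "[0, 1]"]) (auto simp: less_2)
qed

text \<open>The tagged product, which is the value of \<open>para\<close> and the monoidal product
  of the category of the algebra. The strict laws of \<open>\<uplus>\<close> become the laws of that
  category up to relabelling.\<close>

definition tn where "tn m n = rel InL InL m \<uplus> rel InR InR n"

lemma tn_simps [simp]: "dm (tn m n) = dm m \<oplus> dm n" "cd (tn m n) = cd m \<oplus> cd n"
  by (simp_all add: tn_def tsum_push)

lemma tn_compat: "compat (rel InL InL m) (rel InR InR n)"
  by (auto simp: compat_def)

lemma tarr_tn [simp]: "\<lbrakk>tarr m; tarr n\<rbrakk> \<Longrightarrow> tarr (tn m n)"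
  unfolding tn_def by (intro tarr_un tarr_rel tn_compat) simp_all

lemma rel_tn:
  assumes "tarr m" "tarr n" "inj_on \<sigma> (dom (dm m \<oplus> dm n))" "inj_on \<rho> (dom (cd m \<oplus> cd n))"
  shows "rel \<sigma> \<rho> (tn m n) = rel (\<sigma> \<circ> InL) (\<rho> \<circ> InL) m \<uplus> rel (\<sigma> \<circ> InR) (\<rho> \<circ> InR) n"
proof -
  have "rel \<sigma> \<rho> (tn m n) = rel \<sigma> \<rho> (rel InL InL m) \<uplus> rel \<sigma> \<rho> (rel InR InR n)"
    unfolding tn_def using assms by (intro rel_un(1)) (simp_all add: tn_compat)
  then show ?thesis using assms by (simp add: rel_rel inj_on_Un)
qed

text \<open>Both boxes are ready at the start and together consume the whole state, so
  \<open>fire_fire\<close> applies with an empty remainder.\<close>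

lemma evals_para:
  assumes "args [(X, Y), (X', Y')] (X \<oplus> X', Y \<oplus> Y') [f, g]"
  shows "evals [(X, Y), (X', Y')] (X \<oplus> X', Y \<oplus> Y') para_src [f, g] (tn (X, f, Y) (X', g, Y'))"
proof -
  let ?ts = "[(X, Y), (X', Y')]" and ?v = "(X \<oplus> X', Y \<oplus> Y')"
  let ?n = "node ?ts para_src [f, g]"
  have f: "tarr (X, f, Y)" and g: "tarr (X', g, Y')"
    using tarr_filled[OF assms, of 0] tarr_filled[OF assms, of 1] by (simp_all add: filled_def)
  have n: "tarr (?n 0)" "tarr (?n 1)"
    using tarr_node[OF assms wiring_para, of 0] tarr_node[OF assms wiring_para, of 1] by simp_all
  have d: "dom (dm (?n 0)) = InL ` InL ` dom X" "dom (dm (?n 1)) = InL ` InR ` dom X'"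
    "dom (cd (?n 0)) = (\<lambda>y. InR (Tag 0 y)) ` dom Y" "dom (cd (?n 1)) = (\<lambda>y. InR (Tag 1 y)) ` dom Y'"
    by (simp_all add: image_image)
  have s: "start ?v = dm (?n 0) ++ dm (?n 1)"
  proof -
    have "dom (push InL X) \<inter> dom (push InR X') = {}" by auto
    then show ?thesis
      by (simp add: start_def tsum_push push_add[OF inj_tags(1)] push_push comp_def)
  qed
  have tX: "tfs (start ?v)" using assms by (intro tfs_start) (simp add: args_def)
  have dd: "dom (dm (?n 0)) \<inter> dom (dm (?n 1)) = {}" "dom (cd (?n 0)) \<inter> dom (dm (?n 1)) = {}"
    "dom (cd (?n 0)) \<inter> dom (start ?v) = {}" "dom (cd (?n 1)) \<inter> dom (start ?v) = {}"
    "dom (cd (?n 1)) \<inter> dom (cd (?n 0)) = {}" "dom (dm (?n 1)) \<inter> dom (dm (?n 0)) = {}"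
    unfolding s dom_map_add d by auto
  have r0: "rest (start ?v) (?n 0) = dm (?n 1)"
  proof -
    have "dom (dm (?n 1)) \<subseteq> - dom (dm (?n 0))" using dd(1) by blast
    moreover have "dm (?n 0) |` (- dom (dm (?n 0))) = Map.empty"
      by (rule ext) (simp add: restrict_map_def domIff del: node_simps)
    ultimately show ?thesis unfolding rest_def s restrict_map_add by (simp add: restrict_superset del: node_simps)
  qed
  have l0: "dm (?n 0) \<subseteq>\<^sub>m start ?v" unfolding s by (rule map_le_add_left[OF map_le_refl dd(1)])
  have l1: "dm (?n 1) \<subseteq>\<^sub>m start ?v" unfolding s by (rule map_le_add_right[OF map_le_refl])
  have c0: "can (?n 0) (start ?v)" unfolding can_def r0 using n l0 dd(2) by blast
  let ?X1 = "cd (?n 0) ++ rest (start ?v) (?n 0)"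
  have le1: "dm (?n 1) \<subseteq>\<^sub>m ?X1" unfolding r0 by (rule map_le_add_right[OF map_le_refl])
  have "dom (rest ?X1 (?n 1)) \<subseteq> dom (cd (?n 0))" unfolding dom_rest r0 dom_map_add by blast
  then have c1: "can (?n 1) ?X1" unfolding can_def using n le1 dd(5) by blast
  note FF = fire_fire[OF c0 c1 tX l1 dd(6,4,3,5)]
  have "rest (rest (start ?v) (?n 1)) (?n 0) = Map.empty"
  proof -
    have "dom (rest (rest (start ?v) (?n 1)) (?n 0)) = {}" unfolding dom_rest s dom_map_add by blast
    then show ?thesis unfolding dom_eq_empty_conv .
  qed
  note FF = FF[unfolded this]
  have cc: "compat (?n 0) (?n 1)" unfolding compat_def using dd(1,5) by blast
  have e: "fire (?n 0) (start ?v) \<bullet> fire (?n 1) ?X1 = ?n 0 \<uplus> ?n 1"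
    unfolding FF(1) by (rule un_empty[OF tarr_un[OF n cc]])
  have "rel InL (para_src \<circ> InR) (tn (X, f, Y) (X', g, Y')) =
      rel (InL \<circ> InL) (para_src \<circ> InR \<circ> InL) (X, f, Y) \<uplus> rel (InL \<circ> InR) (para_src \<circ> InR \<circ> InR) (X', g, Y')"
    using wiring_inj_out[OF wiring_para[of X Y X' Y']] by (intro rel_tn[OF f g]) simp_all
  also have "rel (InL \<circ> InL) (para_src \<circ> InR \<circ> InL) (X, f, Y) = ?n 0"
    by (simp add: node_def filled_def comp_def)
  also have "rel (InL \<circ> InR) (para_src \<circ> InR \<circ> InR) (X', g, Y') = ?n 1"
    by (simp add: node_def filled_def comp_def)
  finally have m: "rel InL (para_src \<circ> InR) (tn (X, f, Y) (X', g, Y')) = ?n 0 \<uplus> ?n 1" .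
  have v: "valid (start ?v) (map ?n [0, 1])" using c0 c1 by simp
  have "tarr (fire (?n 1) ?X1)" "tfs (cd (?n 1) ++ rest ?X1 (?n 1))"
    using c0 c1 tX tfs_fire[OF c1 tfs_fire[OF c0 tX]] by (simp_all del: node_simps)
  then have "exec (start ?v) (map ?n [0, 1]) = fire (?n 0) (start ?v) \<bullet> fire (?n 1) ?X1"
    using c0 c1 tX by (simp del: node_simps)
  then have "exec (start ?v) (map ?n [0, 1]) = rel InL (para_src \<circ> InR) (tn (X, f, Y) (X', g, Y'))"
    unfolding m e .
  then show ?thesis
    unfolding evals_def using v f g by (intro conjI exI[of _ "[0, 1]"]) (auto simp: less_2)
qed

text \<open>By definition the inverse relabelling is canonical over the typing of \<open>X\<close>;
  inverting \<open>pm\<close> expresses it over the typing of \<open>push \<sigma> X\<close>, where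
  it composes with the splittings.\<close>

lemma md_pm_inv:
  assumes "tfs X" "inj_on \<sigma> (dom X)"
  shows "md (pm (inv_into (dom X) \<sigma>) (push \<sigma> X) X) =
    coh (ty (push \<sigma> X)) (W (dom (push \<sigma> X))) (map_word \<sigma> (W (dom X)))"
proof -
  let ?p = "pm \<sigma> X (push \<sigma> X)" and ?q = "pm (inv_into (dom X) \<sigma>) (push \<sigma> X) X"
  note b = typed_bij_push[OF assms(2)]
  have tp: "tfs (push \<sigma> X)" using assms by (simp add: is_tfs_push)
  note t = tarr_pm_push[OF assms]
  note D = tarrD[OF t(1)] tarrD[OF t(2)]
  note inv = pm_inv[OF assms(1) tp b]
  have "md ?p \<Zsemi> md ?q = md (idt X)" "md ?q \<Zsemi> md ?p = md (idt (push \<sigma> X))"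
    unfolding inv[symmetric] by simp_all
  then have "ainv (md ?p) = md ?q"
    using D by (intro ainv_eqI) (simp_all add: md_idt assms tp del: pm_simps(3))
  moreover have "ainv (md ?p) = coh (ty (push \<sigma> X)) (W (dom (push \<sigma> X))) (map_word \<sigma> (W (dom X)))"
    unfolding pm_simps using well_typed_map[OF assms(1) b] well_typed_tfs[OF tp] tfs_finite[OF tp]
    by (intro coh_ainv) simp_all
  ultimately show ?thesis by simp
qed

lemma md_rel:
  assumes "tarr m" "inj_on \<sigma> (dom (dm m))" "inj_on \<rho> (dom (cd m))"
  shows "md (rel \<sigma> \<rho> m) = coh (ty (push \<sigma> (dm m))) (W (dom (push \<sigma> (dm m)))) (map_word \<sigma> (W (dom (dm m)))) \<Zsemi>
    (md m \<Zsemi> coh (ty (push \<rho> (cd m))) (map_word \<rho> (W (dom (cd m)))) (W (dom (push \<rho> (cd m)))))"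
  unfolding rel_def cp_simps md_pm_inv[OF tarrD(1)[OF assms(1)] assms(2)] by simp

lemma coh_tags:
  assumes "tfs X" "tfs X'"
  defines "t \<equiv> ty (X \<oplus> X')"
  shows "well_typed t (map_word InL (W (dom X)))" "well_typed t (map_word InR (W (dom X')))"
    "well_typed t (W (InL ` dom X))" "well_typed t (W (InR ` dom X'))" "well_typed t (W (InL ` dom X \<union> InR ` dom X'))"
    "\<And>x. x \<in> InL ` dom X \<Longrightarrow> t x = ty (push InL X) x"
    "\<And>x. x \<in> InR ` dom X' \<Longrightarrow> t x = ty (push InR X') x"
    "interp C t (map_word InL (W (dom X))) = T X" "interp C t (map_word InR (W (dom X'))) = T X'"
proof -
  have f: "finite (dom X)" "finite (dom X')" using assms tfs_finite by auto
  have o: "\<forall>x\<in>InL ` dom X \<union> InR ` dom X'. t x \<in> obj C"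
    using tfs_obj[OF is_tfs_tsum[OF assms(1,2)]] by (simp add: t_def)
  show "well_typed t (map_word InL (W (dom X)))" "well_typed t (map_word InR (W (dom X')))"
    "well_typed t (W (InL ` dom X))" "well_typed t (W (InR ` dom X'))" "well_typed t (W (InL ` dom X \<union> InR ` dom X'))"
    using f o by (simp_all add: well_typed_def distinct_map)
  show "\<And>x. x \<in> InL ` dom X \<Longrightarrow> t x = ty (push InL X) x"
    "\<And>x. x \<in> InR ` dom X' \<Longrightarrow> t x = ty (push InR X') x"
    unfolding t_def by (elim imageE; simp add: push_app)+
  show "interp C t (map_word InL (W (dom X))) = T X" "interp C t (map_word InR (W (dom X'))) = T X'"
    unfolding interp_map_word using assms(1,2) by (intro T_eq; simp add: t_def)+
qed

lemma split_merge:
  assumes "tfs X" "tfs X'"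
  shows "iso (split_tensor C W X X')" "Dom C (split_tensor C W X X') = T (X \<oplus> X')"
    "Cod C (split_tensor C W X X') = T X \<boxtimes> T X'" "merge_tensor C W X X' = ainv (split_tensor C W X X')"
    "iso (merge_tensor C W X X')" "Cod C (merge_tensor C W X X') = T (X \<oplus> X')"
    "Dom C (merge_tensor C W X X') = T X \<boxtimes> T X'"
proof -
  note c = coh_tags[OF assms]
  have f: "finite (dom X)" "finite (dom X')" using assms tfs_finite by auto
  have dj: "InL ` dom X \<inter> InR ` dom X' = {}" by auto
  show s: "iso (split_tensor C W X X')" "Dom C (split_tensor C W X X') = T (X \<oplus> X')"
    "Cod C (split_tensor C W X X') = T X \<boxtimes> T X'" "merge_tensor C W X X' = ainv (split_tensor C W X X')"
    unfolding split_tensor_def merge_tensor_def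
    using c(1-5,8,9) f dj by (simp_all add: coh_simps coh_ainv tensor_def)
  show "iso (merge_tensor C W X X')" "Cod C (merge_tensor C W X X') = T (X \<oplus> X')"
    "Dom C (merge_tensor C W X X') = T X \<boxtimes> T X'"
    using s by simp_all
qed

text \<open>Over the typing of the tagged sum the relabellings by \<open>InL\<close> and
  \<open>InR\<close> are canonical, so they are absorbed into the untagged splitting and merging.
  What remains is the tensor product between the tagged ones.\<close>

lemma md_tn:
  assumes "tarr m" "tarr n"
  shows "md (tn m n) = split_tensor C W (dm m) (dm n) \<Zsemi> (md m \<otimes> md n) \<Zsemi> merge_tensor C W (cd m) (cd n)"
proof -
  note D = tarrD[OF assms(1)] tarrD[OF assms(2)]
  note d = coh_tags[OF D(1,6)] and c = coh_tags[OF D(2,7)]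
  have f: "finite (dom (dm m))" "finite (dom (dm n))" "finite (dom (cd m))" "finite (dom (cd n))"
    using D tfs_finite by auto
  let ?t = "ty (dm m \<oplus> dm n)" and ?s = "ty (cd m \<oplus> cd n)"
  define a where "a = coh ?t (W (InL ` dom (dm m))) (map_word InL (W (dom (dm m))))"
  define b where "b = coh ?t (W (InR ` dom (dm n))) (map_word InR (W (dom (dm n))))"
  define a' where "a' = coh ?s (map_word InL (W (dom (cd m)))) (W (InL ` dom (cd m)))"
  define b' where "b' = coh ?s (map_word InR (W (dom (cd n)))) (W (InR ` dom (cd n)))"
  have "a = coh (ty (push InL (dm m))) (W (InL ` dom (dm m))) (map_word InL (W (dom (dm m))))"
    unfolding a_def by (rule coh_cong[OF d(3) d(1)], simp add: f, rule d(6), simp add: f)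
  moreover have "b = coh (ty (push InR (dm n))) (W (InR ` dom (dm n))) (map_word InR (W (dom (dm n))))"
    unfolding b_def by (rule coh_cong[OF d(4) d(2)], simp add: f, rule d(7), simp add: f)
  moreover have "a' = coh (ty (push InL (cd m))) (map_word InL (W (dom (cd m)))) (W (InL ` dom (cd m)))"
    unfolding a'_def by (rule coh_cong[OF c(1) c(3)], simp add: f, rule c(6), simp add: f)
  moreover have "b' = coh (ty (push InR (cd n))) (map_word InR (W (dom (cd n)))) (W (InR ` dom (cd n)))"
    unfolding b'_def by (rule coh_cong[OF c(2) c(4)], simp add: f, rule c(7), simp add: f)
  ultimately have r: "md (rel InL InL m) = a \<Zsemi> (md m \<Zsemi> a')" "md (rel InR InR n) = b \<Zsemi> (md n \<Zsemi> b')"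
    using assms by (simp_all add: md_rel)
  have ab: "iso a" "iso b" "iso a'" "iso b'" "Cod C a = T (dm m)" "Cod C b = T (dm n)"
    "Dom C a' = T (cd m)" "Dom C b' = T (cd n)"
    "Dom C a = interp C ?t (W (InL ` dom (dm m)))" "Dom C b = interp C ?t (W (InR ` dom (dm n)))"
    "Cod C a' = interp C ?s (W (InL ` dom (cd m)))" "Cod C b' = interp C ?s (W (InR ` dom (cd n)))"
    unfolding a_def b_def a'_def b'_def using d(1-5,8,9) c(1-5,8,9) f by (simp_all add: coh_simps)
  let ?sp = "sp ?t (InL ` dom (dm m)) (InR ` dom (dm n))" and ?mg = "mg ?s (InL ` dom (cd m)) (InR ` dom (cd n))"
  have dj: "InL ` dom (dm m) \<inter> InR ` dom (dm n) = {}" "InL ` dom (cd m) \<inter> InR ` dom (cd n) = {}" by auto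
  have S: "iso ?sp" "Cod C ?sp = interp C ?t (W (InL ` dom (dm m))) \<boxtimes> interp C ?t (W (InR ` dom (dm n)))"
    "iso ?mg" "Dom C ?mg = interp C ?s (W (InL ` dom (cd m))) \<boxtimes> interp C ?s (W (InR ` dom (cd n)))"
    and sp: "?sp \<Zsemi> (a \<otimes> b) = split_tensor C W (dm m) (dm n)"
    and mg: "(a' \<otimes> b') \<Zsemi> ?mg = merge_tensor C W (cd m) (cd n)"
    unfolding sp_def mg_def a_def b_def a'_def b'_def split_tensor_def merge_tensor_def
    using d(1-5,8,9) c(1-5,8,9) f dj by (simp_all add: coh_simps coh_tensor coh_comp)
  have "md (tn m n) = ?sp \<Zsemi> (md (rel InL InL m) \<otimes> md (rel InR InR n)) \<Zsemi> ?mg"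
    unfolding tn_def un_def fst_conv snd_conv rel_simps dom_push tsum_push[symmetric] ..
  also have "\<dots> = (?sp \<Zsemi> (a \<otimes> b)) \<Zsemi> (md m \<otimes> md n) \<Zsemi> ((a' \<otimes> b') \<Zsemi> ?mg)"
    unfolding r using D ab S by (simp add: tar_merge)
  finally show ?thesis unfolding sp mg .
qed

lemma tfs_targets: "args ts v fs \<Longrightarrow> is_tfs (obj C) (targets ts v)"
  by (rule is_tfs_targets) (simp_all add: args_def)

lemma H_special:
  assumes "args ts v fs" "wiring ts v \<phi>" "graph ts v \<phi> = r" "evals ts v \<phi> fs m"
  shows "H ts v (with_wires (obj C) ts v r) fs = md m"
  unfolding assms(3)[symmetric]
  by (rule H_eqI[OF assms(1,2) wires_of_with_wires[OF assms(2) tfs_targets[OF assms(1)]] assms(4)])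

lemma H_seq:
  assumes "tarr m" "tarr n" "cd m = dm n"
  shows "H [(dm m, cd m), (dm n, cd n)] (dm m, cd n) (wd_seq (obj C) (dm m) (cd m) (cd n)) [md m, md n] =
    md m \<Zsemi> md n"
proof -
  note D = tarrD[OF assms(1)] tarrD[OF assms(2)]
  have a: "args [(dm m, dm n), (dm n, cd n)] (dm m, cd n) [md m, md n]"
    unfolding args_def using D assms by (simp add: is_box_def set_Cons_def image_iff hom_boxes_def hom_iff)
  from H_special[OF a wiring_seq graph_seq evals_seq[OF a]]
  show ?thesis unfolding wd_seq_def assms(3) by simp
qed

lemma H_para:
  assumes "tarr m" "tarr n"
  shows "H [(dm m, cd m), (dm n, cd n)] (dm m \<oplus> dm n, cd m \<oplus> cd n) (wd_para (obj C) (dm m) (cd m) (dm n) (cd n))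
    [md m, md n] = md (tn m n)"
proof -
  note D = tarrD[OF assms(1)] tarrD[OF assms(2)]
  have a: "args [(dm m, cd m), (dm n, cd n)] (dm m \<oplus> dm n, cd m \<oplus> cd n) [md m, md n]"
    unfolding args_def using D assms
    by (simp add: is_box_def set_Cons_def image_iff hom_boxes_def hom_iff is_tfs_tsum)
  from H_special[OF a wiring_para graph_para evals_para[OF a]]
  show ?thesis unfolding wd_para_def by simp
qed

lemma H_sym:
  assumes "tfs X" "tfs Y" "typed_bij X Y \<sigma>"
  shows "H [] (X, Y) (wd_sym (obj C) \<sigma> X Y) [] = md (pm \<sigma> X Y)"
proof -
  have a: "args [] (X, Y) []" using assms by (simp add: args_def is_box_def)
  from H_special[OF a wiring_sym[OF assms(3)] graph_sym[OF assms(3)] evals_sym[OF assms]]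
  show ?thesis unfolding wd_sym_def .
qed

section \<open>The algebra laws\<close>

lemma evals_hom: "\<lbrakk>evals ts v \<phi> fs m; args ts v fs\<rbrakk> \<Longrightarrow> md m \<in> hom_boxes C W v"
  unfolding evals_def tarr_def hom_boxes_def case_prod_beta by (elim conjE) simp

text \<open>Both sides are \<open>undefined\<close> on inadmissible tuples, so the laws, which are
  equations between functions, need to be checked on admissible ones only.\<close>

lemma H_eq_restrict:
  assumes "\<And>fs. fs \<in> listset (map (hom_boxes C W) ts) \<Longrightarrow> H ts v \<Phi> fs = g fs"
  shows "H ts v \<Phi> = restrict g (listset (map (hom_boxes C W) ts))"
proof
  fix fs
  show "H ts v \<Phi> fs = restrict g (listset (map (hom_boxes C W) ts)) fs"
    using assms[of fs] by (cases "fs \<in> listset (map (hom_boxes C W) ts)") (simp_all add: H_def)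
qed

text \<open>The value of a diagram is unique, so each law reduces to showing that a particular
  morphism is a value: \<open>evals_id\<close>, \<open>evals_subst\<close> and
  \<open>evals_perm\<close> provide it, and \<open>H_eqI\<close> converts it into an
  equation.\<close>

lemma wd_algebra_H: "wd_algebra (obj C) (hom_boxes C W) H"
  unfolding wd_algebra_def operad_functor_def
proof (intro conjI allI impI ballI)
  fix t :: "('a, 'o) box" assume "t \<in> oobj (wd_operad (obj C))"
  then have t: "box t" by (simp add: wd_operad_def)
  show "hom_boxes C W t \<in> oobj set_operad" by (simp add: set_operad_def)
  have "H [t] t (wd_id (obj C) t) xs = hd xs" if xs: "xs \<in> listset (map (hom_boxes C W) [t])" for xs
  proof -
    from xs have "length xs = 1" unfolding in_listset by simp
    then obtain f where f: "xs = [f]" by (cases xs) auto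
    have a: "args [t] t [f]" using t xs unfolding args_def f by simp
    from H_special[OF a wiring_id graph_id evals_id[OF a]]
    show ?thesis unfolding wd_id_def f by simp
  qed
  from H_eq_restrict[OF this]
  show "H [t] t (oid (wd_operad (obj C)) t) = oid set_operad (hom_boxes C W t)"
    unfolding wd_operad_def set_operad_def operad.simps list.map .
next
  fix ts :: "('a, 'o) box list" and v \<Phi>
  assume "set ts \<subseteq> oobj (wd_operad (obj C))" "v \<in> oobj (wd_operad (obj C))" "\<Phi> \<in> ohom (wd_operad (obj C)) ts v"
  then have b: "\<forall>t\<in>set ts. box t" "box v" and \<Phi>: "\<Phi> \<in> wiring_diagrams (obj C) ts v"
    by (auto simp: wd_operad_def)
  obtain \<phi> where \<phi>: "wiring ts v \<phi>" "wires_of \<Phi> = graph ts v \<phi>" "acyclic (prec ts v \<phi>)"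
    using diagram_wiring[OF \<Phi>] by blast
  have "H ts v \<Phi> fs \<in> hom_boxes C W v" if "fs \<in> listset (map (hom_boxes C W) ts)" for fs
  proof -
    have a: "args ts v fs" using b that by (simp add: args_def)
    from evals_hom[OF H_evals[OF a \<phi>] a] show ?thesis by simp
  qed
  then show "H ts v \<Phi> \<in> ohom set_operad (map (hom_boxes C W) ts) (hom_boxes C W v)"
    unfolding set_operad_def operad.simps by (intro PiE_I) (simp_all add: H_def)
next
  fix ss ts :: "('a, 'o) box list" and v i \<Psi> \<Phi>
  assume "set ss \<subseteq> oobj (wd_operad (obj C))" "set ts \<subseteq> oobj (wd_operad (obj C))" "v \<in> oobj (wd_operad (obj C))"
    and i: "i < length ts" and "\<Psi> \<in> ohom (wd_operad (obj C)) ss (ts ! i)" "\<Phi> \<in> ohom (wd_operad (obj C)) ts v"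
  then have b: "\<forall>t\<in>set ss. box t" "\<forall>t\<in>set ts. box t" "box v" and \<Psi>: "\<Psi> \<in> wiring_diagrams (obj C) ss (ts ! i)"
    and \<Phi>: "\<Phi> \<in> wiring_diagrams (obj C) ts v"
    by (auto simp: wd_operad_def)
  have bi: "box (ts ! i)" using b i by simp
  obtain \<phi> where \<phi>: "wiring ts v \<phi>" "wires_of \<Phi> = graph ts v \<phi>" "acyclic (prec ts v \<phi>)"
    using diagram_wiring[OF \<Phi>] by blast
  obtain \<psi> where \<psi>: "wiring ss (ts ! i) \<psi>" "wires_of \<Psi> = graph ss (ts ! i) \<psi>" "acyclic (prec ss (ts ! i) \<psi>)"
    using diagram_wiring[OF \<Psi>] by blast
  interpret wd_subst ss ts v i \<phi> \<psi> by unfold_locales (use i \<phi> \<psi> in auto)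
  have bus: "\<forall>t\<in>set us. box t" using b by (auto simp: subst_list_def dest: in_set_takeD in_set_dropD)
  note chi = wiring_chi[OF \<phi>(2) \<psi>(2)] and wires = wires_of_comp[OF \<phi>(2) \<psi>(2) is_tfs_targets[OF bus b(3)]]
  have "H us v (wd_comp (obj C) ss ts v i \<Psi> \<Phi>) zs =
      H ts v \<Phi> (take i zs @ H ss (ts ! i) \<Psi> (take m (drop i zs)) # drop (i + m) zs)"
    if zs: "zs \<in> listset (map (hom_boxes C W) us)" for zs
  proof -
    let ?gs = "take m (drop i zs)"
    have us: "args us v zs" using bus b zs by (simp add: args_def)
    have lz: "length zs = length ts - 1 + m" using args_length[OF us] i by (simp add: length_subst_list)
    have zn: "zs ! c \<in> hom_boxes C W (us ! c)" if "c < length us" for c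
      using zs that by (simp add: in_listset)
    have gs: "args ss (ts ! i) ?gs"
      unfolding args_def in_listset using b bi lz i zn[OF subst_list_guest(2)[OF i]] subst_list_guest(1)[OF i]
      by auto
    note n = H_evals[OF gs \<psi>]
    let ?fs = "take i zs @ H ss (ts ! i) \<Psi> ?gs # drop (i + m) zs"
    have fs: "args ts v ?fs"
      unfolding args_def in_listset
    proof (intro conjI allI impI b)
      show "length ?fs = length (map (hom_boxes C W) ts)" using lz i by simp
      fix j assume j: "j < length (map (hom_boxes C W) ts)"
      consider "j < i" | "j = i" | d where "j = Suc (i + d)"
        using less_imp_Suc_add[of i j] by (metis linorder_neqE_nat)
      then show "?fs ! j \<in> map (hom_boxes C W) ts ! j"
      proof cases
        case 1
        then show ?thesis using zn[of j] j lz i by (simp add: nth_append subst_list_def)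
      next
        case 2
        then show ?thesis using evals_hom[OF n gs] lz i by (simp add: nth_append)
      next
        case 3
        have "?fs ! j = zs ! (i + m + d)" using 3 j lz i by (simp add: nth_append)
        moreover have "ren j = i + m + d" using 3 by (simp add: renumber_def)
        then have "us ! (i + m + d) = ts ! j" "i + m + d < length us"
          using 3 j subst_list_host[OF i, of j ss] by simp_all
        ultimately show ?thesis using zn[of "i + m + d"] j by simp
      qed
    qed
    have "evals us v chi zs (fst v, H ts v \<Phi> ?fs, snd v)"
      using H_evals[OF fs \<phi>]
      by (intro evals_subst[OF wd_subst_axioms us chi refl gs refl n fs]) simp_all
    from H_eqI[OF us chi wires this] show ?thesis by simp
  qed
  from H_eq_restrict[OF this] show "H us v (ocomp (wd_operad (obj C)) ss ts v i \<Psi> \<Phi>) =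
    ocomp set_operad (map (hom_boxes C W) ss) (map (hom_boxes C W) ts) (hom_boxes C W v) i
      (H ss (ts ! i) \<Psi>) (H ts v \<Phi>)"
    unfolding wd_operad_def set_operad_def operad.simps map_subst_list length_map .
next
  fix ts :: "('a, 'o) box list" and v \<pi> \<Phi>
  assume "set ts \<subseteq> oobj (wd_operad (obj C))" "v \<in> oobj (wd_operad (obj C))"
    and \<pi>: "\<pi> permutes {..<length ts}" and "\<Phi> \<in> ohom (wd_operad (obj C)) ts v"
  then have b: "\<forall>t\<in>set ts. box t" "box v" and \<Phi>: "\<Phi> \<in> wiring_diagrams (obj C) ts v"
    by (auto simp: wd_operad_def)
  obtain \<phi> where \<phi>: "wiring ts v \<phi>" "wires_of \<Phi> = graph ts v \<phi>" "acyclic (prec ts v \<phi>)"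
    using diagram_wiring[OF \<Phi>] by blast
  let ?us = "permute_list \<pi> ts"
  have bus: "\<forall>t\<in>set ?us. box t" using b \<pi> by simp
  note np = nth_perm[OF \<phi>(1) \<pi>] and ps = perm_simps[OF \<phi>(1) \<pi>]
  have "H ?us v (wd_perm (obj C) ts v \<pi> \<Phi>) zs = H ts v \<Phi> (permute_list (inv \<pi>) zs)"
    if zs: "zs \<in> listset (map (hom_boxes C W) ?us)" for zs
  proof -
    have us: "args ?us v zs" using bus b zs by (simp add: args_def)
    have lz: "length zs = length ts" using args_length[OF us] by simp
    have inv: "inv \<pi> permutes {..<length zs}" using permutes_inv[OF \<pi>] lz by simp
    have "permute_list (inv \<pi>) zs ! j \<in> hom_boxes C W (ts ! j)" if "j < length ts" for j
    proof -
      have "zs ! inv \<pi> j \<in> hom_boxes C W (?us ! inv \<pi> j)" using zs that ps by (simp add: in_listset)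
      then show ?thesis using that ps inv lz by (simp add: np permute_list_nth)
    qed
    then have fs: "args ts v (permute_list (inv \<pi>) zs)"
      using b lz by (simp add: args_def in_listset)
    from H_eqI[OF us wiring_perm[OF \<phi>(1) \<pi>] wires_of_perm[OF \<phi>(1) \<pi> \<phi>(2) is_tfs_targets[OF bus b(2)]]
        evals_perm[OF fs \<phi>(1) \<pi> us refl H_evals[OF fs \<phi>]]]
    show ?thesis by simp
  qed
  note eq = H_eq_restrict[OF this]
  have "map (hom_boxes C W) ?us = permute_list \<pi> (map (hom_boxes C W) ts)"
    using \<pi> by (simp add: permute_list_map)
  from eq[unfolded this] show "H ?us v (operm (wd_operad (obj C)) ts v \<pi> \<Phi>) =
    operm set_operad (map (hom_boxes C W) ts) (hom_boxes C W v) \<pi> (H ts v \<Phi>)"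
    unfolding wd_operad_def set_operad_def operad.simps .
qed

end

section \<open>Equivalences from fully faithful, essentially surjective functors\<close>

text \<open>The witnesses \<open>G0\<close> and \<open>e\<close> of essential surjectivity are
  parameters. Full faithfulness then forces the rest of the quasi-inverse if \<open>e\<close> is to
  be natural and monoidal.\<close>

locale monoidal_equivalence = symmetric_monoidal_functor C D F
  for C :: "('o, 'm) smc" and D :: "('p, 'n) smc" (structure) and F :: "('o, 'm, 'p, 'n) mfunctor" +
  fixes G0 :: "'p \<Rightarrow> 'o" and e :: "'p \<Rightarrow> 'n"
  assumes fully_faithful: "\<lbrakk>A \<in> obj C; A' \<in> obj C; h \<in> hom D (Fob F A) (Fob F A')\<rbrakk> \<Longrightarrow>
      \<exists>!f. f \<in> hom C A A' \<and> Far F f = h"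
    and G0_obj [simp]: "B \<in> obj D \<Longrightarrow> G0 B \<in> obj C"
    and e_iso: "B \<in> obj D \<Longrightarrow> iso_in D (Fob F (G0 B)) B (e B)"
begin

lemma e_simps [simp]:
  assumes "B \<in> obj D"
  shows "D.iso (e B)" "Dom D (e B) = Fob F (G0 B)" "Cod D (e B) = B"
  using e_iso[OF assms] D.iso_inD D.iso_in_arr by auto

declare Fob_obj [simp]

lemma Far_simps [simp]:
  assumes "f \<in> arr C"
  shows "Far F f \<in> arr D" "Dom D (Far F f) = Fob F (Dom C f)" "Cod D (Far F f) = Fob F (Cod C f)"
  using Far_hom[OF C.arr_hom[OF assms]] by (simp_all add: D.hom_iff)

lemma Far_comp: "\<lbrakk>f \<in> arr C; g \<in> arr C; Cod C f = Dom C g\<rbrakk> \<Longrightarrow> Far F (f \<Zsemi>\<^bsub>C\<^esub> g) = Far F f \<Zsemi> Far F g"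
  by (rule Far_cmp) (simp_all add: C.hom_iff)

lemma mu_simps [simp]:
  assumes "A \<in> obj C" "B \<in> obj C"
  shows "D.iso (Fmu F A B)" "Dom D (Fmu F A B) = Fob F A \<boxtimes> Fob F B" "Cod D (Fmu F A B) = Fob F (A \<boxtimes>\<^bsub>C\<^esub> B)"
  using Fmu_iso[OF assms] D.iso_inD D.iso_in_arr by auto

lemma eps_simps [simp]:
  "D.iso (Feps F)" "Dom D (Feps F) = unt D" "Cod D (Feps F) = Fob F (unt C)"
  using Feps_iso D.iso_inD D.iso_in_arr by auto

lemma mu_nat:
  "\<lbrakk>f \<in> arr C; g \<in> arr C; Dom C f = A; Dom C g = B\<rbrakk> \<Longrightarrow>
    Fmu F A B \<Zsemi> Far F (f \<otimes>\<^bsub>C\<^esub> g) = (Far F f \<otimes> Far F g) \<Zsemi> Fmu F (Cod C f) (Cod C g)"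
  by (rule Fmu_natural[symmetric]) (simp_all add: C.hom_iff)

definition lift where
  "lift A B h = (THE f. f \<in> hom C A B \<and> Far F f = h)"

lemma lift_simps [simp]:
  assumes "A \<in> obj C" "B \<in> obj C" "h \<in> arr D" "Dom D h = Fob F A" "Cod D h = Fob F B"
  shows "lift A B h \<in> arr C" "Dom C (lift A B h) = A" "Cod C (lift A B h) = B" "Far F (lift A B h) = h"
proof -
  have "lift A B h \<in> hom C A B \<and> Far F (lift A B h) = h"
    unfolding lift_def by (rule theI', rule fully_faithful) (use assms in \<open>simp_all add: D.hom_iff\<close>)
  then show "lift A B h \<in> arr C" "Dom C (lift A B h) = A" "Cod C (lift A B h) = B" "Far F (lift A B h) = h"
    by (simp_all add: C.hom_iff)
qed

lemma faithful:
  assumes "f \<in> arr C" "g \<in> arr C" "Dom C f = Dom C g" "Cod C f = Cod C g" "Far F f = Far F g"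
  shows "f = g"
proof -
  have "Far F f \<in> hom D (Fob F (Dom C f)) (Fob F (Cod C f))" using assms by (simp add: D.hom_iff)
  from fully_faithful[OF _ _ this] show ?thesis using assms by (auto simp: C.hom_iff)
qed

text \<open>Equations in \<open>C\<close> between morphisms into \<open>G0 B\<close> are checked in \<open>D\<close> after composing with
  invertible morphisms on both sides.\<close>

lemma faithful_conj:
  assumes "f \<in> arr C" "g \<in> arr C" "Dom C f = Dom C g" "Cod C f = G0 B" "Cod C g = G0 B" "B \<in> obj D"
    "D.iso k" "Cod D k = Fob F (Dom C f)" "k \<Zsemi> (Far F f \<Zsemi> e B) = k \<Zsemi> (Far F g \<Zsemi> e B)"
  shows "f = g"
proof (rule faithful)
  have "Far F f \<Zsemi> e B = Far F g \<Zsemi> e B"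
    using assms(9) by (subst (asm) D.iso_cancel_left) (use assms in simp_all)
  then show "Far F f = Far F g"
    by (subst (asm) D.iso_cancel_right) (use assms in simp_all)
qed (use assms in simp_all)

lemma reflects_iso:
  assumes "f \<in> arr C" "D.iso (Far F f)"
  shows "C.iso f"
proof (rule C.isoI)
  let ?g = "lift (Cod C f) (Dom C f) (D.ainv (Far F f))"
  show "?g \<in> arr C" "Cod C f = Dom C ?g" "Cod C ?g = Dom C f" using assms by simp_all
  show "f \<Zsemi>\<^bsub>C\<^esub> ?g = idn C (Dom C f)" "?g \<Zsemi>\<^bsub>C\<^esub> f = idn C (Cod C f)"
    using assms by (intro faithful; simp add: Far_comp Far_idn)+
qed (use assms in simp)

text \<open>Every component is the lift for which \<open>e\<close> satisfies its naturality, product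
  or unit condition; these defining equations are recorded in \<open>G_ar\<close>,
  \<open>G_mu\<close> and \<open>G_eps\<close>.\<close>

definition G :: "('p, 'n, 'o, 'm) mfunctor" where
  "G = \<lparr>Fob = G0,
    Far = (\<lambda>g. lift (G0 (Dom D g)) (G0 (Cod D g)) (e (Dom D g) \<Zsemi> (g \<Zsemi> D.ainv (e (Cod D g))))),
    Fmu = (\<lambda>A B. lift (G0 A \<boxtimes>\<^bsub>C\<^esub> G0 B) (G0 (A \<boxtimes> B))
      (D.ainv (Fmu F (G0 A) (G0 B)) \<Zsemi> ((e A \<otimes> e B) \<Zsemi> D.ainv (e (A \<boxtimes> B))))),
    Feps = lift (unt C) (G0 (unt D)) (D.ainv (Feps F) \<Zsemi> D.ainv (e (unt D)))\<rparr>"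

lemma G_ob [simp]: "Fob G = G0"
  by (simp add: G_def)

lemma G_ar:
  assumes "g \<in> arr D"
  shows "Far G g \<in> arr C" "Dom C (Far G g) = G0 (Dom D g)" "Cod C (Far G g) = G0 (Cod D g)"
    "Far F (Far G g) \<Zsemi> e (Cod D g) = e (Dom D g) \<Zsemi> g"
  using assms by (simp_all add: G_def)

lemma G_mu:
  assumes "A \<in> obj D" "B \<in> obj D"
  shows "Fmu G A B \<in> arr C" "Dom C (Fmu G A B) = G0 A \<boxtimes>\<^bsub>C\<^esub> G0 B" "Cod C (Fmu G A B) = G0 (A \<boxtimes> B)"
    "Fmu F (G0 A) (G0 B) \<Zsemi> (Far F (Fmu G A B) \<Zsemi> e (A \<boxtimes> B)) = e A \<otimes> e B"
    "C.iso (Fmu G A B)"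
proof -
  show m: "Fmu G A B \<in> arr C" "Dom C (Fmu G A B) = G0 A \<boxtimes>\<^bsub>C\<^esub> G0 B" "Cod C (Fmu G A B) = G0 (A \<boxtimes> B)"
    "Fmu F (G0 A) (G0 B) \<Zsemi> (Far F (Fmu G A B) \<Zsemi> e (A \<boxtimes> B)) = e A \<otimes> e B"
    using assms by (simp_all add: G_def)
  show "C.iso (Fmu G A B)"
    by (rule reflects_iso[OF m(1)]) (use assms in \<open>simp add: G_def\<close>)
qed

lemma G_eps:
  "Feps G \<in> arr C" "Dom C (Feps G) = unt C" "Cod C (Feps G) = G0 (unt D)"
  "Feps F \<Zsemi> (Far F (Feps G) \<Zsemi> e (unt D)) = idn D (unt D)" "C.iso (Feps G)"
proof -
  show m: "Feps G \<in> arr C" "Dom C (Feps G) = unt C" "Cod C (Feps G) = G0 (unt D)"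
    "Feps F \<Zsemi> (Far F (Feps G) \<Zsemi> e (unt D)) = idn D (unt D)"
    by (simp_all add: G_def)
  show "C.iso (Feps G)" by (rule reflects_iso[OF m(1)]) (simp add: G_def)
qed

lemma G_ar': "\<lbrakk>g \<in> arr D; Cod D g = B\<rbrakk> \<Longrightarrow> Far F (Far G g) \<Zsemi> e B = e (Dom D g) \<Zsemi> g"
  using G_ar(4)[of g] by simp

lemma G_mu':
  assumes "A \<in> obj D" "B \<in> obj D" "k \<in> arr D" "Dom D k = A \<boxtimes> B"
  shows "Fmu F (G0 A) (G0 B) \<Zsemi> (Far F (Fmu G A B) \<Zsemi> (e (A \<boxtimes> B) \<Zsemi> k)) = (e A \<otimes> e B) \<Zsemi> k"
proof -
  have "Fmu F (G0 A) (G0 B) \<Zsemi> (Far F (Fmu G A B) \<Zsemi> (e (A \<boxtimes> B) \<Zsemi> k)) =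
      (Fmu F (G0 A) (G0 B) \<Zsemi> (Far F (Fmu G A B) \<Zsemi> e (A \<boxtimes> B))) \<Zsemi> k"
    using assms G_mu(1-3)[OF assms(1,2)] by simp
  then show ?thesis by (simp only: G_mu(4)[OF assms(1,2)])
qed

lemma mu_nat':
  assumes "f \<in> arr C" "g \<in> arr C" "Dom C f = A" "Dom C g = B" "k \<in> arr D" "Dom D k = Fob F (Cod C f \<boxtimes>\<^bsub>C\<^esub> Cod C g)"
  shows "Fmu F A B \<Zsemi> (Far F (f \<otimes>\<^bsub>C\<^esub> g) \<Zsemi> k) = (Far F f \<otimes> Far F g) \<Zsemi> (Fmu F (Cod C f) (Cod C g) \<Zsemi> k)"
proof -
  have o: "A \<in> obj C" "B \<in> obj C" using assms by auto
  have "Fmu F A B \<Zsemi> (Far F (f \<otimes>\<^bsub>C\<^esub> g) \<Zsemi> k) = (Fmu F A B \<Zsemi> Far F (f \<otimes>\<^bsub>C\<^esub> g)) \<Zsemi> k"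
    using assms o by simp
  also have "\<dots> = (Far F f \<otimes> Far F g) \<Zsemi> (Fmu F (Cod C f) (Cod C g) \<Zsemi> k)"
    unfolding mu_nat[OF assms(1-4)] using assms by simp
  finally show ?thesis .
qed

text \<open>Each axiom is tested after applying \<open>F\<close>, composing with \<open>e\<close> on
  the right and, where products occur, with comparison maps of \<open>F\<close> on the left. The
  defining equations of \<open>G\<close> then eliminate \<open>G\<close> and leave an axiom of
  \<open>F\<close> or of \<open>D\<close>.\<close>

lemma functor_G: "symmetric_monoidal_functor D C G"
proof unfold_locales
  fix A assume "A \<in> obj D"
  then show "Fob G A \<in> obj C" by simp
next
  fix f A B assume "f \<in> hom D A B"
  then show "Far G f \<in> hom C (Fob G A) (Fob G B)" using G_ar by (auto simp: D.hom_iff C.hom_iff)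
next
  fix A assume A: "A \<in> obj D"
  show "Far G (idn D A) = idn C (Fob G A)"
    using A G_ar[of "idn D A"]
    by (intro faithful_conj[where B = A and k = "idn D (Fob F (G0 A))"]) (simp_all add: Far_idn)
next
  fix f g A B E assume "f \<in> hom D A B" "g \<in> hom D B E"
  then have h: "f \<in> arr D" "g \<in> arr D" "Dom D f = A" "Cod D f = B" "Dom D g = B" "Cod D g = E"
    by (simp_all add: D.hom_iff)
  note o = D.Dom_Cod_obj[OF h(1)] D.Dom_Cod_obj[OF h(2)]
  note F1 = G_ar[OF h(1)] and F2 = G_ar[OF h(2)] and F3 = G_ar[of "f \<Zsemi> g"]
  have "(Far F (Far G f) \<Zsemi> Far F (Far G g)) \<Zsemi> e E = Far F (Far G f) \<Zsemi> (Far F (Far G g) \<Zsemi> e E)"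
    using h o F1 F2 by simp
  also have "\<dots> = Far F (Far G f) \<Zsemi> (e B \<Zsemi> g)" by (simp only: G_ar'[OF h(2,6)] h(5))
  also have "\<dots> = (Far F (Far G f) \<Zsemi> e B) \<Zsemi> g" using h o F1(1-3) by simp
  also have "\<dots> = e A \<Zsemi> (f \<Zsemi> g)" unfolding G_ar'[OF h(1,4)] using h o by simp
  finally show "Far G (f \<Zsemi> g) = Far G f \<Zsemi>\<^bsub>C\<^esub> Far G g"
    using h o F1(1-3) F2(1-3) F3
    by (intro faithful_conj[where B = E and k = "idn D (Fob F (G0 A))"]) (simp_all add: Far_comp)
next
  fix A B assume "A \<in> obj D" "B \<in> obj D"
  then show "iso_in C (Fob G A \<boxtimes>\<^bsub>C\<^esub> Fob G B) (Fob G (A \<boxtimes> B)) (Fmu G A B)"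
    using G_mu by (intro C.iso_inI) simp_all
next
  fix f A A' g B B' assume "f \<in> hom D A A'" "g \<in> hom D B B'"
  then have h: "f \<in> arr D" "g \<in> arr D" "Dom D f = A" "Cod D f = A'" "Dom D g = B" "Cod D g = B'"
    by (simp_all add: D.hom_iff)
  have o: "A \<in> obj D" "A' \<in> obj D" "B \<in> obj D" "B' \<in> obj D"
    using D.Dom_Cod_obj[OF h(1)] D.Dom_Cod_obj[OF h(2)] h by simp_all
  note F = G_ar(1-3)[OF h(1)] G_ar(1-3)[OF h(2)] and M = G_mu(1-3)[OF o(1,3)] G_mu(1-3)[OF o(2,4)]
  have fg: "f \<otimes> g \<in> arr D" using h by simp
  note F3 = G_ar(1-3)[OF fg]
  let ?m = "Fmu F (G0 A) (G0 B)"
  have "?m \<Zsemi> (Far F ((Far G f \<otimes>\<^bsub>C\<^esub> Far G g) \<Zsemi>\<^bsub>C\<^esub> Fmu G A' B') \<Zsemi> e (A' \<boxtimes> B')) =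
      ?m \<Zsemi> (Far F (Far G f \<otimes>\<^bsub>C\<^esub> Far G g) \<Zsemi> (Far F (Fmu G A' B') \<Zsemi> e (A' \<boxtimes> B')))"
    using h o F M by (simp add: Far_comp)
  also have "\<dots> = (Far F (Far G f) \<otimes> Far F (Far G g)) \<Zsemi> (Fmu F (G0 A') (G0 B') \<Zsemi> (Far F (Fmu G A' B') \<Zsemi> e (A' \<boxtimes> B')))"
    using h o F M by (subst mu_nat') simp_all
  also have "\<dots> = (Far F (Far G f) \<Zsemi> e A') \<otimes> (Far F (Far G g) \<Zsemi> e B')"
    using h o F by (subst G_mu(4)) (simp_all add: D.tar_merge)
  also have "\<dots> = (e A \<otimes> e B) \<Zsemi> (f \<otimes> g)"
    using h o by (simp add: G_ar' D.tar_merge)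
  also have "\<dots> = ?m \<Zsemi> (Far F (Fmu G A B) \<Zsemi> (e (A \<boxtimes> B) \<Zsemi> (f \<otimes> g)))"
    using h o by (subst G_mu') simp_all
  also have "\<dots> = ?m \<Zsemi> (Far F (Fmu G A B) \<Zsemi> (Far F (Far G (f \<otimes> g)) \<Zsemi> e (A' \<boxtimes> B')))"
    using h o fg by (subst G_ar') simp_all
  also have "\<dots> = ?m \<Zsemi> (Far F (Fmu G A B \<Zsemi>\<^bsub>C\<^esub> Far G (f \<otimes> g)) \<Zsemi> e (A' \<boxtimes> B'))"
    using h o F3 M by (simp add: Far_comp)
  finally show "(Far G f \<otimes>\<^bsub>C\<^esub> Far G g) \<Zsemi>\<^bsub>C\<^esub> Fmu G A' B' = Fmu G A B \<Zsemi>\<^bsub>C\<^esub> Far G (f \<otimes> g)"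
    using h o F F3 M by (intro faithful_conj[where B = "A' \<boxtimes> B'" and k = ?m]) simp_all
next
  show "iso_in C (unt C) (Fob G (unt D)) (Feps G)"
    using G_eps by (intro C.iso_inI) simp_all
next
  fix A B E assume o [simp]: "A \<in> obj D" "B \<in> obj D" "E \<in> obj D"
  have ab [simp]: "A \<boxtimes> B \<in> obj D" "B \<boxtimes> E \<in> obj D" by simp_all
  note M [simp] = G_mu(1-3)[OF o(1,2)] G_mu(1-3)[OF o(2,3)] G_mu(1-3)[OF ab(1) o(3)] G_mu(1-3)[OF o(1) ab(2)]
  note F [simp] = G_ar(1-3)[OF D.asc_simps(1)[OF o]]
  \<comment> \<open>The isomorphism from the product of the three images to the image of the
    product. Prefixing it makes \<open>mu_nat'\<close> and \<open>Fmu_asc\<close>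
    applicable.\<close>
  let ?k = "(Fmu F (G0 A) (G0 B) \<otimes> idn D (Fob F (G0 E))) \<Zsemi> Fmu F (G0 A \<boxtimes>\<^bsub>C\<^esub> G0 B) (G0 E)"
  let ?l = "Fmu G A B \<otimes>\<^bsub>C\<^esub> idn C (G0 E)" and ?r = "idn C (G0 A) \<otimes>\<^bsub>C\<^esub> Fmu G B E"
  let ?a = "asc D A B E" and ?aF = "asc C (G0 A) (G0 B) (G0 E)"
  have "?k \<Zsemi> (Far F (?l \<Zsemi>\<^bsub>C\<^esub> Fmu G (A \<boxtimes> B) E \<Zsemi>\<^bsub>C\<^esub> Far G ?a) \<Zsemi> e (A \<boxtimes> (B \<boxtimes> E))) =
      (Fmu F (G0 A) (G0 B) \<otimes> idn D (Fob F (G0 E))) \<Zsemi> (Fmu F (G0 A \<boxtimes>\<^bsub>C\<^esub> G0 B) (G0 E) \<Zsemi>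
        (Far F ?l \<Zsemi> (Far F (Fmu G (A \<boxtimes> B) E) \<Zsemi> (Far F (Far G ?a) \<Zsemi> e (A \<boxtimes> (B \<boxtimes> E))))))"
    by (simp add: Far_comp)
  also have "\<dots> = (Fmu F (G0 A) (G0 B) \<otimes> idn D (Fob F (G0 E))) \<Zsemi> ((Far F (Fmu G A B) \<otimes> idn D (Fob F (G0 E))) \<Zsemi>
      (Fmu F (G0 (A \<boxtimes> B)) (G0 E) \<Zsemi> (Far F (Fmu G (A \<boxtimes> B) E) \<Zsemi> (e ((A \<boxtimes> B) \<boxtimes> E) \<Zsemi> ?a))))"
    by (subst mu_nat') (simp_all add: G_ar' Far_idn)
  also have "\<dots> = (Fmu F (G0 A) (G0 B) \<otimes> idn D (Fob F (G0 E))) \<Zsemi> ((Far F (Fmu G A B) \<otimes> idn D (Fob F (G0 E))) \<Zsemi>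
      ((e (A \<boxtimes> B) \<otimes> e E) \<Zsemi> ?a))"
    by (subst G_mu') simp_all
  also have "\<dots> = ((Fmu F (G0 A) (G0 B) \<Zsemi> (Far F (Fmu G A B) \<Zsemi> e (A \<boxtimes> B))) \<otimes> e E) \<Zsemi> ?a"
    by (simp add: D.tar_merge)
  also have "\<dots> = asc D (Fob F (G0 A)) (Fob F (G0 B)) (Fob F (G0 E)) \<Zsemi> (e A \<otimes> (e B \<otimes> e E))"
    unfolding G_mu(4)[OF o(1,2)] by (simp add: D.asc_nat)
  finally have L: "?k \<Zsemi> (Far F (?l \<Zsemi>\<^bsub>C\<^esub> Fmu G (A \<boxtimes> B) E \<Zsemi>\<^bsub>C\<^esub> Far G ?a) \<Zsemi> e (A \<boxtimes> (B \<boxtimes> E))) =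
      asc D (Fob F (G0 A)) (Fob F (G0 B)) (Fob F (G0 E)) \<Zsemi> (e A \<otimes> (e B \<otimes> e E))" .
  have "?k \<Zsemi> (Far F (?aF \<Zsemi>\<^bsub>C\<^esub> ?r \<Zsemi>\<^bsub>C\<^esub> Fmu G A (B \<boxtimes> E)) \<Zsemi> e (A \<boxtimes> (B \<boxtimes> E))) =
      (((Fmu F (G0 A) (G0 B) \<otimes> idn D (Fob F (G0 E))) \<Zsemi> Fmu F (G0 A \<boxtimes>\<^bsub>C\<^esub> G0 B) (G0 E)) \<Zsemi> Far F ?aF) \<Zsemi>
        (Far F ?r \<Zsemi> (Far F (Fmu G A (B \<boxtimes> E)) \<Zsemi> e (A \<boxtimes> (B \<boxtimes> E))))"
    by (simp add: Far_comp)
  also have "\<dots> = asc D (Fob F (G0 A)) (Fob F (G0 B)) (Fob F (G0 E)) \<Zsemi> ((idn D (Fob F (G0 A)) \<otimes> Fmu F (G0 B) (G0 E)) \<Zsemi>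
      (Fmu F (G0 A) (G0 B \<boxtimes>\<^bsub>C\<^esub> G0 E) \<Zsemi> (Far F ?r \<Zsemi> (Far F (Fmu G A (B \<boxtimes> E)) \<Zsemi> e (A \<boxtimes> (B \<boxtimes> E))))))"
    by (subst Fmu_asc) simp_all
  also have "\<dots> = asc D (Fob F (G0 A)) (Fob F (G0 B)) (Fob F (G0 E)) \<Zsemi> ((idn D (Fob F (G0 A)) \<otimes> Fmu F (G0 B) (G0 E)) \<Zsemi>
      ((idn D (Fob F (G0 A)) \<otimes> Far F (Fmu G B E)) \<Zsemi> (e A \<otimes> e (B \<boxtimes> E))))"
    by (subst mu_nat') (simp_all add: Far_idn G_mu(4))
  also have "\<dots> = asc D (Fob F (G0 A)) (Fob F (G0 B)) (Fob F (G0 E)) \<Zsemi>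
      (e A \<otimes> (Fmu F (G0 B) (G0 E) \<Zsemi> (Far F (Fmu G B E) \<Zsemi> e (B \<boxtimes> E))))"
    by (simp add: D.tar_merge)
  also have "\<dots> = asc D (Fob F (G0 A)) (Fob F (G0 B)) (Fob F (G0 E)) \<Zsemi> (e A \<otimes> (e B \<otimes> e E))"
    by (simp only: G_mu(4)[OF o(2,3)])
  finally show "(Fmu G A B \<otimes>\<^bsub>C\<^esub> idn C (Fob G E)) \<Zsemi>\<^bsub>C\<^esub> Fmu G (A \<boxtimes> B) E \<Zsemi>\<^bsub>C\<^esub> Far G (asc D A B E) =
      asc C (Fob G A) (Fob G B) (Fob G E) \<Zsemi>\<^bsub>C\<^esub> (idn C (Fob G A) \<otimes>\<^bsub>C\<^esub> Fmu G B E) \<Zsemi>\<^bsub>C\<^esub> Fmu G A (B \<boxtimes> E)"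
    using L by (intro faithful_conj[where B = "A \<boxtimes> (B \<boxtimes> E)" and k = ?k]) simp_all
next
  fix A assume o [simp]: "A \<in> obj D"
  note M [simp] = G_mu(1-3)[OF D.unt_obj o] G_eps(1-3)
  note F [simp] = G_ar(1-3)[OF D.lun_simps(1)[OF o]]
  let ?k = "(Feps F \<otimes> idn D (Fob F (G0 A))) \<Zsemi> Fmu F (unt C) (G0 A)"
  have "?k \<Zsemi> (Far F ((Feps G \<otimes>\<^bsub>C\<^esub> idn C (G0 A)) \<Zsemi>\<^bsub>C\<^esub> Fmu G (unt D) A \<Zsemi>\<^bsub>C\<^esub> Far G (lun D A)) \<Zsemi> e A) =
      (Feps F \<otimes> idn D (Fob F (G0 A))) \<Zsemi> (Fmu F (unt C) (G0 A) \<Zsemi> (Far F (Feps G \<otimes>\<^bsub>C\<^esub> idn C (G0 A)) \<Zsemi>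
        (Far F (Fmu G (unt D) A) \<Zsemi> (Far F (Far G (lun D A)) \<Zsemi> e A))))"
    by (simp add: Far_comp)
  also have "\<dots> = (Feps F \<otimes> idn D (Fob F (G0 A))) \<Zsemi> ((Far F (Feps G) \<otimes> idn D (Fob F (G0 A))) \<Zsemi>
      (Fmu F (G0 (unt D)) (G0 A) \<Zsemi> (Far F (Fmu G (unt D) A) \<Zsemi> (e (unt D \<boxtimes> A) \<Zsemi> lun D A))))"
    by (subst mu_nat') (simp_all add: G_ar' Far_idn)
  also have "\<dots> = (Feps F \<otimes> idn D (Fob F (G0 A))) \<Zsemi> ((Far F (Feps G) \<otimes> idn D (Fob F (G0 A))) \<Zsemi>
      ((e (unt D) \<otimes> e A) \<Zsemi> lun D A))"
    by (subst G_mu') simp_all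
  also have "\<dots> = ((Feps F \<Zsemi> (Far F (Feps G) \<Zsemi> e (unt D))) \<otimes> e A) \<Zsemi> lun D A"
    by (simp add: D.tar_merge)
  also have "\<dots> = lun D (Fob F (G0 A)) \<Zsemi> e A"
    unfolding G_eps(4) by (simp add: D.lun_nat)
  also have "\<dots> = (?k \<Zsemi> Far F (lun C (G0 A))) \<Zsemi> e A" by (subst Fmu_lun) simp_all
  also have "\<dots> = ?k \<Zsemi> (Far F (lun C (G0 A)) \<Zsemi> e A)" by simp
  finally show "(Feps G \<otimes>\<^bsub>C\<^esub> idn C (Fob G A)) \<Zsemi>\<^bsub>C\<^esub> Fmu G (unt D) A \<Zsemi>\<^bsub>C\<^esub> Far G (lun D A) = lun C (Fob G A)"
    by (intro faithful_conj[where B = A and k = ?k]) simp_all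
next
  fix A assume o [simp]: "A \<in> obj D"
  note M [simp] = G_mu(1-3)[OF o D.unt_obj] G_eps(1-3)
  note F [simp] = G_ar(1-3)[OF D.run_simps(1)[OF o]]
  let ?k = "(idn D (Fob F (G0 A)) \<otimes> Feps F) \<Zsemi> Fmu F (G0 A) (unt C)"
  have "?k \<Zsemi> (Far F ((idn C (G0 A) \<otimes>\<^bsub>C\<^esub> Feps G) \<Zsemi>\<^bsub>C\<^esub> Fmu G A (unt D) \<Zsemi>\<^bsub>C\<^esub> Far G (run D A)) \<Zsemi> e A) =
      (idn D (Fob F (G0 A)) \<otimes> Feps F) \<Zsemi> (Fmu F (G0 A) (unt C) \<Zsemi> (Far F (idn C (G0 A) \<otimes>\<^bsub>C\<^esub> Feps G) \<Zsemi>
        (Far F (Fmu G A (unt D)) \<Zsemi> (Far F (Far G (run D A)) \<Zsemi> e A))))"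
    by (simp add: Far_comp)
  also have "\<dots> = (idn D (Fob F (G0 A)) \<otimes> Feps F) \<Zsemi> ((idn D (Fob F (G0 A)) \<otimes> Far F (Feps G)) \<Zsemi>
      (Fmu F (G0 A) (G0 (unt D)) \<Zsemi> (Far F (Fmu G A (unt D)) \<Zsemi> (e (A \<boxtimes> unt D) \<Zsemi> run D A))))"
    by (subst mu_nat') (simp_all add: G_ar' Far_idn)
  also have "\<dots> = (idn D (Fob F (G0 A)) \<otimes> Feps F) \<Zsemi> ((idn D (Fob F (G0 A)) \<otimes> Far F (Feps G)) \<Zsemi>
      ((e A \<otimes> e (unt D)) \<Zsemi> run D A))"
    by (subst G_mu') simp_all
  also have "\<dots> = (e A \<otimes> (Feps F \<Zsemi> (Far F (Feps G) \<Zsemi> e (unt D)))) \<Zsemi> run D A"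
    by (simp add: D.tar_merge)
  also have "\<dots> = run D (Fob F (G0 A)) \<Zsemi> e A"
    unfolding G_eps(4) by (simp add: D.run_nat)
  also have "\<dots> = ?k \<Zsemi> (Far F (run C (G0 A)) \<Zsemi> e A)"
    by (subst Fmu_run[symmetric]) simp_all
  finally show "(idn C (Fob G A) \<otimes>\<^bsub>C\<^esub> Feps G) \<Zsemi>\<^bsub>C\<^esub> Fmu G A (unt D) \<Zsemi>\<^bsub>C\<^esub> Far G (run D A) = run C (Fob G A)"
    by (intro faithful_conj[where B = A and k = ?k]) simp_all
next
  fix A B assume o [simp]: "A \<in> obj D" "B \<in> obj D"
  note M [simp] = G_mu(1-3)[OF o] G_mu(1-3)[OF o(2,1)]
  note F [simp] = G_ar(1-3)[OF D.brd_simps(1)[OF o]]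
  let ?k = "Fmu F (G0 A) (G0 B)"
  have "?k \<Zsemi> (Far F (Fmu G A B \<Zsemi>\<^bsub>C\<^esub> Far G (brd D A B)) \<Zsemi> e (B \<boxtimes> A)) =
      ?k \<Zsemi> (Far F (Fmu G A B) \<Zsemi> (Far F (Far G (brd D A B)) \<Zsemi> e (B \<boxtimes> A)))"
    by (simp add: Far_comp)
  also have "\<dots> = (e A \<otimes> e B) \<Zsemi> brd D A B"
    by (simp add: G_ar' G_mu')
  also have "\<dots> = brd D (Fob F (G0 A)) (Fob F (G0 B)) \<Zsemi> (e B \<otimes> e A)"
    by (simp add: D.brd_nat)
  also have "\<dots> = (brd D (Fob F (G0 A)) (Fob F (G0 B)) \<Zsemi> Fmu F (G0 B) (G0 A)) \<Zsemi> (Far F (Fmu G B A) \<Zsemi> e (B \<boxtimes> A))"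
    by (simp add: G_mu(4))
  also have "\<dots> = ?k \<Zsemi> (Far F (brd C (G0 A) (G0 B) \<Zsemi>\<^bsub>C\<^esub> Fmu G B A) \<Zsemi> e (B \<boxtimes> A))"
    by (subst Fmu_brd[symmetric]) (simp_all add: Far_comp)
  finally show "Fmu G A B \<Zsemi>\<^bsub>C\<^esub> Far G (brd D A B) = brd C (Fob G A) (Fob G B) \<Zsemi>\<^bsub>C\<^esub> Fmu G B A"
    by (intro faithful_conj[where B = "B \<boxtimes> A" and k = ?k]) simp_all
qed

text \<open>The lift of the inverse counit at \<open>Fob F A\<close>, as one triangle identity of an
  adjoint equivalence dictates.\<close>

definition eta where "eta A = lift A (G0 (Fob F A)) (D.ainv (e (Fob F A)))"

lemma eta_simps [simp]:
  assumes "A \<in> obj C"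
  shows "eta A \<in> arr C" "Dom C (eta A) = A" "Cod C (eta A) = G0 (Fob F A)"
    "Far F (eta A) = D.ainv (e (Fob F A))" "C.iso (eta A)"
proof -
  show m: "eta A \<in> arr C" "Dom C (eta A) = A" "Cod C (eta A) = G0 (Fob F A)"
    "Far F (eta A) = D.ainv (e (Fob F A))"
    using assms by (simp_all add: eta_def)
  show "C.iso (eta A)" by (rule reflects_iso[OF m(1)]) (use assms m in simp)
qed

lemma unit_iso: "monoidal_natural_iso C C (mfunctor_id C) (mfunctor_comp C F G) eta"
  unfolding monoidal_natural_iso_def mfunctor_id_def mfunctor_comp_def mfunctor.simps G_ob
proof (intro conjI ballI allI impI)
  fix A assume "A \<in> obj C"
  then show "iso_in C A (G0 (Fob F A)) (eta A)" by (intro C.iso_inI) simp_all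
next
  fix A B f assume "f \<in> hom C A B"
  then have f: "f \<in> arr C" "Dom C f = A" "Cod C f = B" by (simp_all add: C.hom_iff)
  have o: "A \<in> obj C" "B \<in> obj C" using C.Dom_Cod_obj[OF f(1)] f by simp_all
  note G' = G_ar(1-3)[OF Far_simps(1)[OF f(1)]]
  have "Far F (eta A) \<Zsemi> (Far F (Far G (Far F f)) \<Zsemi> e (Fob F B)) = Far F f"
    using f o by (subst G_ar') simp_all
  then show "f \<Zsemi>\<^bsub>C\<^esub> eta B = eta A \<Zsemi>\<^bsub>C\<^esub> Far G (Far F f)"
    using f o G' by (intro faithful_conj[where B = "Fob F B" and k = "idn D (Fob F A)"])
      (simp_all add: Far_comp)
next
  fix A B assume o [simp]: "A \<in> obj C" "B \<in> obj C"
  have ob [simp]: "Fob F A \<in> obj D" "Fob F B \<in> obj D" by simp_all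
  note M [simp] = G_mu(1-3)[OF ob] G_ar(1-3)[OF D.iso_arr[OF mu_simps(1)[OF o]]]
  let ?k = "Fmu F A B"
  have "?k \<Zsemi> (Far F ((eta A \<otimes>\<^bsub>C\<^esub> eta B) \<Zsemi>\<^bsub>C\<^esub> (Fmu G (Fob F A) (Fob F B) \<Zsemi>\<^bsub>C\<^esub> Far G ?k)) \<Zsemi> e (Fob F (A \<boxtimes>\<^bsub>C\<^esub> B))) =
    ?k \<Zsemi> (Far F (eta A \<otimes>\<^bsub>C\<^esub> eta B) \<Zsemi> (Far F (Fmu G (Fob F A) (Fob F B)) \<Zsemi> (Far F (Far G ?k) \<Zsemi> e (Fob F (A \<boxtimes>\<^bsub>C\<^esub> B)))))"
    by (simp add: Far_comp)
  also have "\<dots> = (D.ainv (e (Fob F A)) \<otimes> D.ainv (e (Fob F B))) \<Zsemi>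
      (Fmu F (G0 (Fob F A)) (G0 (Fob F B)) \<Zsemi> (Far F (Fmu G (Fob F A) (Fob F B)) \<Zsemi> (e (Fob F A \<boxtimes> Fob F B) \<Zsemi> ?k)))"
    by (subst mu_nat') (simp_all add: G_ar')
  also have "\<dots> = ?k"
    by (subst G_mu') (simp_all add: D.tar_merge)
  finally show "idn C (A \<boxtimes>\<^bsub>C\<^esub> B) \<Zsemi>\<^bsub>C\<^esub> eta (A \<boxtimes>\<^bsub>C\<^esub> B) =
      (eta A \<otimes>\<^bsub>C\<^esub> eta B) \<Zsemi>\<^bsub>C\<^esub> (Fmu G (Fob F A) (Fob F B) \<Zsemi>\<^bsub>C\<^esub> Far G ?k)"
    by (intro faithful_conj[where B = "Fob F (A \<boxtimes>\<^bsub>C\<^esub> B)" and k = ?k]) simp_all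
next
  note M [simp] = G_eps(1-3) G_ar(1-3)[OF D.iso_arr[OF eps_simps(1)]]
  have "Feps F \<Zsemi> (Far F (Feps G \<Zsemi>\<^bsub>C\<^esub> Far G (Feps F)) \<Zsemi> e (Fob F (unt C))) =
      Feps F \<Zsemi> (Far F (Feps G) \<Zsemi> (Far F (Far G (Feps F)) \<Zsemi> e (Fob F (unt C))))"
    by (simp add: Far_comp)
  also have "\<dots> = (Feps F \<Zsemi> (Far F (Feps G) \<Zsemi> e (unt D))) \<Zsemi> Feps F"
    by (subst G_ar') simp_all
  also have "\<dots> = Feps F" unfolding G_eps(4) by simp
  finally show "idn C (unt C) \<Zsemi>\<^bsub>C\<^esub> eta (unt C) = Feps G \<Zsemi>\<^bsub>C\<^esub> Far G (Feps F)"
    by (intro faithful_conj[where B = "Fob F (unt C)" and k = "Feps F"]) simp_all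
qed

text \<open>The conditions on \<open>e\<close> are the equations by which \<open>G\<close> was
  defined.\<close>

lemma counit_iso: "monoidal_natural_iso D D (mfunctor_comp D G F) (mfunctor_id D) e"
  unfolding monoidal_natural_iso_def mfunctor_id_def mfunctor_comp_def mfunctor.simps G_ob
proof (intro conjI ballI allI impI)
  fix A B f assume "f \<in> hom D A B"
  then show "Far F (Far G f) \<Zsemi> e B = e A \<Zsemi> f" using G_ar'[of f B] by (simp add: D.hom_iff)
next
  fix A B assume "A \<in> obj D" "B \<in> obj D"
  then show "Fmu F (G0 A) (G0 B) \<Zsemi> Far F (Fmu G A B) \<Zsemi> e (A \<boxtimes> B) = (e A \<otimes> e B) \<Zsemi> idn D (A \<boxtimes> B)"
    using G_mu by simp
next
  show "Feps F \<Zsemi> Far F (Feps G) \<Zsemi> e (unt D) = idn D (unt D)" using G_eps by simp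
qed (rule e_iso)

lemma smc_equivalence: "smc_equivalence C D F"
  unfolding smc_equivalence_def
  using symmetric_monoidal_functor_axioms functor_G unit_iso counit_iso by blast

end

section \<open>The symmetric monoidal category of the algebra\<close>

lemma typed_bij_asc: "typed_bij ((X \<oplus> Y) \<oplus> Z) (X \<oplus> (Y \<oplus> Z)) asc_map"
  by (rule typed_bij_witness[where g = "\<lambda>s. case s of InL x \<Rightarrow> InL (InL x) | InR (InL x) \<Rightarrow> InL (InR x) | InR (InR x) \<Rightarrow> InR x | _ \<Rightarrow> s"])
    (auto simp: inj_image_mem_iff inj_InL_InR)

lemma typed_bij_lun: "typed_bij (Map.empty \<oplus> X) X untag"
  by (rule typed_bij_witness[where g = InR]) auto

lemma typed_bij_run: "typed_bij (X \<oplus> Map.empty) X untag"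
  by (rule typed_bij_witness[where g = InL]) auto

lemma typed_bij_swap: "typed_bij (X \<oplus> Y) (Y \<oplus> X) swap_map"
  by (rule typed_bij_witness[where g = swap_map]) auto

fun sum_map :: "('a elt \<Rightarrow> 'a elt) \<Rightarrow> ('a elt \<Rightarrow> 'a elt) \<Rightarrow> 'a elt \<Rightarrow> 'a elt" where
  "sum_map \<sigma> \<rho> (InL x) = InL (\<sigma> x)"
| "sum_map \<sigma> \<rho> (InR x) = InR (\<rho> x)"
| "sum_map \<sigma> \<rho> z = z"

context bracketed_smc
begin

lemma sum_map_push:
  assumes "typed_bij X Y \<sigma>" "typed_bij X' Y' \<rho>"
  shows "inj_on (sum_map \<sigma> \<rho>) (InL ` dom X)" "inj_on (sum_map \<sigma> \<rho>) (InR ` dom X')"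
    "push InL Y = push (sum_map \<sigma> \<rho>) (push InL X)" "push InR Y' = push (sum_map \<sigma> \<rho>) (push InR X')"
proof -
  show i: "inj_on (sum_map \<sigma> \<rho>) (InL ` dom X)" "inj_on (sum_map \<sigma> \<rho>) (InR ` dom X')"
    using typed_bij_inj[OF assms(1)] typed_bij_inj[OF assms(2)] by (simp_all add: inj_on_def)
  have "push InL Y = push (InL \<circ> \<sigma>) X"
    using push_unique[OF typed_bij_comp[OF assms(1) typed_bij_push]] by simp
  also have "InL \<circ> \<sigma> = sum_map \<sigma> \<rho> \<circ> InL" by auto
  also have "push (sum_map \<sigma> \<rho> \<circ> InL) X = push (sum_map \<sigma> \<rho>) (push InL X)" using i by (simp add: push_push)
  finally show "push InL Y = push (sum_map \<sigma> \<rho>) (push InL X)" .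
  have "push InR Y' = push (InR \<circ> \<rho>) X'"
    using push_unique[OF typed_bij_comp[OF assms(2) typed_bij_push]] by simp
  also have "InR \<circ> \<rho> = sum_map \<sigma> \<rho> \<circ> InR" by auto
  also have "push (sum_map \<sigma> \<rho> \<circ> InR) X' = push (sum_map \<sigma> \<rho>) (push InR X')" using i by (simp add: push_push)
  finally show "push InR Y' = push (sum_map \<sigma> \<rho>) (push InR X')" .
qed

lemma typed_bij_sum_push:
  assumes "typed_bij X Y \<sigma>" "typed_bij X' Y' \<rho>"
  shows "typed_bij (push InL X) (push InL Y) (sum_map \<sigma> \<rho>)" "typed_bij (push InR X') (push InR Y') (sum_map \<sigma> \<rho>)"
  unfolding sum_map_push(3,4)[OF assms] by (rule typed_bij_push; simp add: sum_map_push(1,2)[OF assms])+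

lemma typed_bij_sum:
  assumes "typed_bij X Y \<sigma>" "typed_bij X' Y' \<rho>"
  shows "typed_bij (X \<oplus> X') (Y \<oplus> Y') (sum_map \<sigma> \<rho>)"
  unfolding tsum_push by (rule typed_bij_add[OF typed_bij_sum_push[OF assms]]) auto

text \<open>Lets the pentagon, the triangle and the hexagon in the category of the algebra be
  verified as equalities between maps of labels.\<close>

lemma tn_pm:
  assumes "tfs X" "tfs Y" "tfs X'" "tfs Y'" "typed_bij X Y \<sigma>" "typed_bij X' Y' \<rho>"
  shows "tn (pm \<sigma> X Y) (pm \<rho> X' Y') = pm (sum_map \<sigma> \<rho>) (X \<oplus> X') (Y \<oplus> Y')"
proof -
  note i = sum_map_push(1,2)[OF assms(5,6)]
  have l: "rel InL InL (pm \<sigma> X Y) = pm (sum_map \<sigma> \<rho>) (push InL X) (push InL Y)"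
    using assms i by (intro rel_pm) simp_all
  have r: "rel InR InR (pm \<rho> X' Y') = pm (sum_map \<sigma> \<rho>) (push InR X') (push InR Y')"
    using assms i by (intro rel_pm) simp_all
  have d: "dom (push InL X) \<inter> dom (push InR X') = {}" "dom (push InL Y) \<inter> dom (push InR Y') = {}" by auto
  show ?thesis
    unfolding tn_def l r tsum_push
    using assms typed_bij_sum_push[OF assms(5,6)] d by (intro un_pm is_tfs_push)
qed

lemma tn_idt: "\<lbrakk>tfs X; tfs Y\<rbrakk> \<Longrightarrow> tn (idt X) (idt Y) = idt (X \<oplus> Y)"
  unfolding tsum_push tn_def by (simp add: rel_idt) (intro un_idt is_tfs_push, auto)

lemma tn_cp:
  assumes "tarr m" "tarr n" "tarr m'" "tarr n'" "cd m = dm n" "cd m' = dm n'"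
  shows "tn (m \<bullet> n) (m' \<bullet> n') = tn m m' \<bullet> tn n n'"
proof -
  have "rel InL InL (m \<bullet> n) = rel InL InL m \<bullet> rel InL InL n"
    by (rule rel_cp) (use assms in simp_all)
  moreover have "rel InR InR (m' \<bullet> n') = rel InR InR m' \<bullet> rel InR InR n'"
    by (rule rel_cp) (use assms in simp_all)
  ultimately show ?thesis
    unfolding tn_def using assms by (simp add: un_cp tn_compat)
qed

section \<open>The category of the algebra in terms of labelled morphisms\<close>

abbreviation Calg where "Calg \<equiv> smc_of_algebra (obj C) (hom_boxes C W) H"

lemma Calg_simps:
  "obj Calg = {A. tfs A}" "arr Calg = {m. tarr m}" "Dom Calg = dm" "Cod Calg = cd"
  "unt Calg = Map.empty" "tob Calg A B = A \<oplus> B"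
  "tfs A \<Longrightarrow> idn Calg A = idt A"
  "\<lbrakk>tarr m; tarr n; cd m = dm n\<rbrakk> \<Longrightarrow> cmp Calg m n = m \<bullet> n"
  "\<lbrakk>tarr m; tarr n\<rbrakk> \<Longrightarrow> tar Calg m n = tn m n"
  "\<lbrakk>tfs A; tfs B; tfs D\<rbrakk> \<Longrightarrow> asc Calg A B D = pm asc_map ((A \<oplus> B) \<oplus> D) (A \<oplus> (B \<oplus> D))"
  "tfs A \<Longrightarrow> lun Calg A = pm untag (Map.empty \<oplus> A) A"
  "tfs A \<Longrightarrow> run Calg A = pm untag (A \<oplus> Map.empty) A"
  "\<lbrakk>tfs A; tfs B\<rbrakk> \<Longrightarrow> brd Calg A B = pm swap_map (A \<oplus> B) (B \<oplus> A)"
proof -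
  show "arr Calg = {m. tarr m}"
    by (auto simp: smc_of_algebra_def Let_def tarr_def hom_boxes_def)
  show "\<lbrakk>tarr m; tarr n; cd m = dm n\<rbrakk> \<Longrightarrow> cmp Calg m n = m \<bullet> n"
    using H_seq[of m n] by (simp add: smc_of_algebra_def Let_def case_prod_beta prod_eq_iff)
  show "\<lbrakk>tarr m; tarr n\<rbrakk> \<Longrightarrow> tar Calg m n = tn m n"
    using H_para[of m n] by (simp add: smc_of_algebra_def Let_def case_prod_beta prod_eq_iff)
  have s: "(X, H [] (X, Y) (wd_sym (obj C) \<sigma> X Y) [], Y) = pm \<sigma> X Y" if "tfs X" "tfs Y" "typed_bij X Y \<sigma>" for X Y \<sigma>
    using H_sym[OF that] by (simp add: prod_eq_iff)
  show "\<lbrakk>tfs A; tfs B; tfs D\<rbrakk> \<Longrightarrow> asc Calg A B D = pm asc_map ((A \<oplus> B) \<oplus> D) (A \<oplus> (B \<oplus> D))"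
    using s[of "(A \<oplus> B) \<oplus> D" "A \<oplus> (B \<oplus> D)" asc_map]
    by (simp add: typed_bij_asc smc_of_algebra_def Let_def is_tfs_tsum)
  show "tfs A \<Longrightarrow> lun Calg A = pm untag (Map.empty \<oplus> A) A"
    using s[of "Map.empty \<oplus> A" A untag]
    by (simp add: typed_bij_lun smc_of_algebra_def Let_def is_tfs_tsum is_tfs_empty)
  show "tfs A \<Longrightarrow> run Calg A = pm untag (A \<oplus> Map.empty) A"
    using s[of "A \<oplus> Map.empty" A untag]
    by (simp add: typed_bij_run smc_of_algebra_def Let_def is_tfs_tsum is_tfs_empty)
  show "\<lbrakk>tfs A; tfs B\<rbrakk> \<Longrightarrow> brd Calg A B = pm swap_map (A \<oplus> B) (B \<oplus> A)"
    using s[of "A \<oplus> B" "B \<oplus> A" swap_map]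
    by (simp add: typed_bij_swap smc_of_algebra_def Let_def is_tfs_tsum)
  show "tfs A \<Longrightarrow> idn Calg A = idt A"
    using s[of A A id] by (simp add: typed_bij_id smc_of_algebra_def Let_def wd_unit_def)
qed (auto simp: smc_of_algebra_def Let_def case_prod_beta fun_eq_iff)

lemma Calg_hom: "m \<in> hom Calg A B \<longleftrightarrow> tarr m \<and> dm m = A \<and> cd m = B"
  by (simp add: hom_def Calg_simps(2-4))

lemma Calg_iso_pm:
  assumes "tfs X" "tfs Y" "typed_bij X Y \<sigma>"
  shows "iso_in Calg X Y (pm \<sigma> X Y)"
proof -
  note b = typed_bij_inv[OF assms(3)]
  have "inverse_in Calg X Y (pm \<sigma> X Y) (pm (inv_into (dom X) \<sigma>) Y X)"
    unfolding inverse_in_def Calg_hom using assms b pm_inv[OF assms] by (simp add: Calg_simps)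
  then show ?thesis unfolding iso_in_def by blast
qed

text \<open>Reduces a naturality square for relabellings to computing one relabelled
  morphism.\<close>

lemma natural_pm:
  assumes "tarr m" "typed_bij (dm m) X \<sigma>" "typed_bij (cd m) Y \<rho>" "rel \<sigma> \<rho> m = n"
  shows "m \<bullet> pm \<rho> (cd m) Y = pm \<sigma> (dm m) X \<bullet> n"
  using rel_square[OF assms(1) typed_bij_inj[OF assms(2)] typed_bij_inj[OF assms(3)]]
    push_unique[OF assms(2)] push_unique[OF assms(3)] assms(4) by simp

text \<open>Once the tags are turned into labels, the two bracketings carry the same labels, and the
  strict associativity of \<open>\<uplus>\<close> is all that remains.\<close>

lemma asc_rel:
  assumes "tarr f" "tarr g" "tarr h"
  shows "rel asc_map asc_map (tn (tn f g) h) = tn f (tn g h)"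
proof -
  have i: "inj_on (asc_map \<circ> InL) (dom (dm f \<oplus> dm g))" "inj_on (asc_map \<circ> InL) (dom (cd f \<oplus> cd g))"
    by (auto simp: inj_on_def)
  have "rel asc_map asc_map (tn (tn f g) h) =
      rel (asc_map \<circ> InL) (asc_map \<circ> InL) (tn f g) \<uplus> rel (asc_map \<circ> InR) (asc_map \<circ> InR) h"
    using assms by (intro rel_tn) (simp_all add: typed_bij_inj[OF typed_bij_asc] del: dom_tsum)
  also have "\<dots> = (rel (asc_map \<circ> InL \<circ> InL) (asc_map \<circ> InL \<circ> InL) f \<uplus>
      rel (asc_map \<circ> InL \<circ> InR) (asc_map \<circ> InL \<circ> InR) g) \<uplus> rel (asc_map \<circ> InR) (asc_map \<circ> InR) h"
    using assms i by (subst rel_tn) simp_all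
  also have "asc_map \<circ> InL \<circ> InL = InL" by auto
  also have "asc_map \<circ> InL \<circ> InR = InR \<circ> InL" by auto
  also have "asc_map \<circ> InR = InR \<circ> InR" by auto
  also have "(rel InL InL f \<uplus> rel (InR \<circ> InL) (InR \<circ> InL) g) \<uplus> rel (InR \<circ> InR) (InR \<circ> InR) h =
      rel InL InL f \<uplus> (rel (InR \<circ> InL) (InR \<circ> InL) g \<uplus> rel (InR \<circ> InR) (InR \<circ> InR) h)"
    using assms by (intro un_assoc tarr_rel) (auto simp: compat_def inj_on_def)
  also have "\<dots> = rel InL InL f \<uplus> rel InR InR (tn g h)"
    using assms by (simp add: rel_tn)
  finally show ?thesis by (simp add: tn_def)
qed

lemma lun_rel:
  assumes "tarr f"
  shows "rel untag untag (tn (idt Map.empty) f) = f"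
proof -
  have "rel untag untag (tn (idt Map.empty) f) =
      rel (untag \<circ> InL) (untag \<circ> InL) (idt Map.empty) \<uplus> rel (untag \<circ> InR) (untag \<circ> InR) f"
    using assms by (intro rel_tn) (simp_all add: is_tfs_empty typed_bij_inj[OF typed_bij_lun] del: dom_tsum)
  also have "untag \<circ> InR = id" by auto
  also have "rel (untag \<circ> InL) (untag \<circ> InL) (idt Map.empty) = idt Map.empty"
    using rel_idt[of Map.empty "untag \<circ> InL"] by (simp add: is_tfs_empty)
  also have "idt Map.empty \<uplus> rel id id f = rel id id f \<uplus> idt Map.empty"
    using assms by (intro un_commute) (simp_all add: compat_def is_tfs_empty)
  finally show ?thesis unfolding rel_id[OF assms] un_empty[OF assms] .
qed

lemma run_rel:
  assumes "tarr f"
  shows "rel untag untag (tn f (idt Map.empty)) = f"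
proof -
  have "rel untag untag (tn f (idt Map.empty)) =
      rel (untag \<circ> InL) (untag \<circ> InL) f \<uplus> rel (untag \<circ> InR) (untag \<circ> InR) (idt Map.empty)"
    using assms by (intro rel_tn) (simp_all add: is_tfs_empty typed_bij_inj[OF typed_bij_run] del: dom_tsum)
  also have "untag \<circ> InL = id" by auto
  also have "rel (untag \<circ> InR) (untag \<circ> InR) (idt Map.empty) = idt Map.empty"
    using rel_idt[of Map.empty "untag \<circ> InR"] by (simp add: is_tfs_empty)
  finally show ?thesis unfolding rel_id[OF assms] un_empty[OF assms] .
qed

lemma swap_rel:
  assumes "tarr f" "tarr g"
  shows "rel swap_map swap_map (tn f g) = tn g f"
proof -
  have "rel swap_map swap_map (tn f g) =
      rel (swap_map \<circ> InL) (swap_map \<circ> InL) f \<uplus> rel (swap_map \<circ> InR) (swap_map \<circ> InR) g"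
    using assms by (intro rel_tn) (simp_all add: typed_bij_inj[OF typed_bij_swap] del: dom_tsum)
  also have "swap_map \<circ> InL = InR" by auto
  also have "swap_map \<circ> InR = InL" by auto
  also have "rel InR InR f \<uplus> rel InL InL g = rel InL InL g \<uplus> rel InR InR f"
    using assms by (intro un_commute) (auto simp: compat_def)
  finally show ?thesis by (simp add: tn_def)
qed

text \<open>All structure maps are relabellings. Naturality is \<open>natural_pm\<close> with
  \<open>asc_rel\<close>, \<open>lun_rel\<close>, \<open>run_rel\<close> or \<open>swap_rel\<close>,
  and the coherence conditions become identities between maps of labels.\<close>

lemma smc_Calg: "symmetric_monoidal_category Calg"
proof unfold_locales
  note S = Calg_simps is_tfs_tsum is_tfs_empty
  note B = typed_bij_asc typed_bij_lun typed_bij_run typed_bij_swap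
  show "f \<in> arr Calg \<Longrightarrow> Dom Calg f \<in> obj Calg \<and> Cod Calg f \<in> obj Calg" for f
    using tarrD by (simp add: S)
  show "A \<in> obj Calg \<Longrightarrow> idn Calg A \<in> hom Calg A A" for A by (simp add: S Calg_hom)
  show "f \<in> hom Calg A B \<Longrightarrow> g \<in> hom Calg B D \<Longrightarrow> cmp Calg f g \<in> hom Calg A D" for f g A B D
    by (auto simp: S Calg_hom)
  show "f \<in> hom Calg A B \<Longrightarrow> cmp Calg (idn Calg A) f = f" for f A B
    using tarrD[of f] by (auto simp: S Calg_hom)
  show "f \<in> hom Calg A B \<Longrightarrow> cmp Calg f (idn Calg B) = f" for f A B
    using tarrD[of f] by (auto simp: S Calg_hom)
  show "f \<in> hom Calg A B \<Longrightarrow> g \<in> hom Calg B D \<Longrightarrow> h \<in> hom Calg D E \<Longrightarrow>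
      cmp Calg (cmp Calg f g) h = cmp Calg f (cmp Calg g h)" for f g h A B D E
    by (auto simp: S Calg_hom cp_assoc)
  show "unt Calg \<in> obj Calg" by (simp add: S)
  show "A \<in> obj Calg \<Longrightarrow> B \<in> obj Calg \<Longrightarrow> tob Calg A B \<in> obj Calg" for A B by (simp add: S)
  show "f \<in> hom Calg A B \<Longrightarrow> g \<in> hom Calg A' B' \<Longrightarrow> tar Calg f g \<in> hom Calg (tob Calg A A') (tob Calg B B')"
    for f g A B A' B'
    by (auto simp: S Calg_hom)
  show "A \<in> obj Calg \<Longrightarrow> B \<in> obj Calg \<Longrightarrow> tar Calg (idn Calg A) (idn Calg B) = idn Calg (tob Calg A B)" for A B
    by (simp add: S tn_idt)
  show "f \<in> hom Calg A B \<Longrightarrow> g \<in> hom Calg B D \<Longrightarrow> f' \<in> hom Calg A' B' \<Longrightarrow> g' \<in> hom Calg B' D' \<Longrightarrow>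
      tar Calg (cmp Calg f g) (cmp Calg f' g') = cmp Calg (tar Calg f f') (tar Calg g g')" for f g f' g' A B D A' B' D'
    by (auto simp: S Calg_hom tn_cp)
  show "A \<in> obj Calg \<Longrightarrow> B \<in> obj Calg \<Longrightarrow> D \<in> obj Calg \<Longrightarrow>
      iso_in Calg (tob Calg (tob Calg A B) D) (tob Calg A (tob Calg B D)) (asc Calg A B D)" for A B D
    by (simp add: S Calg_iso_pm B)
  show "f \<in> hom Calg A A' \<Longrightarrow> g \<in> hom Calg B B' \<Longrightarrow> h \<in> hom Calg D D' \<Longrightarrow>
      cmp Calg (tar Calg (tar Calg f g) h) (asc Calg A' B' D') =
      cmp Calg (asc Calg A B D) (tar Calg f (tar Calg g h))" for f g h A A' B B' D D'
  proof -
    assume "f \<in> hom Calg A A'" "g \<in> hom Calg B B'" "h \<in> hom Calg D D'"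
    then have t: "tarr f" "tarr g" "tarr h" "dm f = A" "cd f = A'" "dm g = B" "cd g = B'" "dm h = D" "cd h = D'"
      by (simp_all add: Calg_hom)
    note T = tarrD(1,2)[OF t(1)] tarrD(1,2)[OF t(2)] tarrD(1,2)[OF t(3)]
    have "tn (tn f g) h \<bullet> pm asc_map ((A' \<oplus> B') \<oplus> D') (A' \<oplus> (B' \<oplus> D')) =
        pm asc_map ((A \<oplus> B) \<oplus> D) (A \<oplus> (B \<oplus> D)) \<bullet> tn f (tn g h)"
      using natural_pm[where X = "A \<oplus> (B \<oplus> D)" and Y = "A' \<oplus> (B' \<oplus> D')", OF _ _ _ asc_rel[OF t(1-3)]] t by (simp add: B(1))
    then show ?thesis using t T by (simp add: S B)
  qed
  show "A \<in> obj Calg \<Longrightarrow> iso_in Calg (tob Calg (unt Calg) A) A (lun Calg A)" for A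
    by (simp add: S Calg_iso_pm B)
  show "f \<in> hom Calg A A' \<Longrightarrow> cmp Calg (tar Calg (idn Calg (unt Calg)) f) (lun Calg A') = cmp Calg (lun Calg A) f"
    for f A A'
  proof -
    assume "f \<in> hom Calg A A'"
    then have t: "tarr f" "dm f = A" "cd f = A'" by (simp_all add: Calg_hom)
    have "tn (idt Map.empty) f \<bullet> pm untag (Map.empty \<oplus> A') A' = pm untag (Map.empty \<oplus> A) A \<bullet> f"
      using natural_pm[where X = A and Y = A', OF _ _ _ lun_rel[OF t(1)]] t by (simp add: B(2) is_tfs_empty)
    then show ?thesis using t tarrD(1,2)[OF t(1)] by (simp add: S B)
  qed
  show "A \<in> obj Calg \<Longrightarrow> iso_in Calg (tob Calg A (unt Calg)) A (run Calg A)" for A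
    by (simp add: S Calg_iso_pm B)
  show "f \<in> hom Calg A A' \<Longrightarrow> cmp Calg (tar Calg f (idn Calg (unt Calg))) (run Calg A') = cmp Calg (run Calg A) f"
    for f A A'
  proof -
    assume "f \<in> hom Calg A A'"
    then have t: "tarr f" "dm f = A" "cd f = A'" by (simp_all add: Calg_hom)
    have "tn f (idt Map.empty) \<bullet> pm untag (A' \<oplus> Map.empty) A' = pm untag (A \<oplus> Map.empty) A \<bullet> f"
      using natural_pm[where X = A and Y = A', OF _ _ _ run_rel[OF t(1)]] t by (simp add: B(3) is_tfs_empty)
    then show ?thesis using t tarrD(1,2)[OF t(1)] by (simp add: S B)
  qed
  show "A \<in> obj Calg \<Longrightarrow> B \<in> obj Calg \<Longrightarrow> brd Calg A B \<in> hom Calg (tob Calg A B) (tob Calg B A)" for A B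
    by (simp add: S Calg_hom B)
  show "f \<in> hom Calg A A' \<Longrightarrow> g \<in> hom Calg B B' \<Longrightarrow>
      cmp Calg (tar Calg f g) (brd Calg A' B') = cmp Calg (brd Calg A B) (tar Calg g f)" for f g A A' B B'
  proof -
    assume "f \<in> hom Calg A A'" "g \<in> hom Calg B B'"
    then have t: "tarr f" "tarr g" "dm f = A" "cd f = A'" "dm g = B" "cd g = B'"
      by (simp_all add: Calg_hom)
    have "tn f g \<bullet> pm swap_map (A' \<oplus> B') (B' \<oplus> A') = pm swap_map (A \<oplus> B) (B \<oplus> A) \<bullet> tn g f"
      using natural_pm[where X = "B \<oplus> A" and Y = "B' \<oplus> A'", OF _ _ _ swap_rel[OF t(1,2)]] t by (simp add: B(4))
    then show ?thesis using t tarrD(1,2)[OF t(1)] tarrD(1,2)[OF t(2)] by (simp add: S B)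
  qed
  \<comment> \<open>Both sides of a coherence condition collapse to one relabelling, so it suffices
    that the maps of labels agree on the domain.\<close>
  have pe: "pm \<sigma> X Y = pm \<rho> X Y" if "\<And>x. x \<in> dom X \<Longrightarrow> \<sigma> x = \<rho> x" "tfs X" for \<sigma> \<rho> X Y
    by (rule pm_cong[OF that])
  show "A \<in> obj Calg \<Longrightarrow> B \<in> obj Calg \<Longrightarrow> D \<in> obj Calg \<Longrightarrow> E \<in> obj Calg \<Longrightarrow>
      cmp Calg (asc Calg (tob Calg A B) D E) (asc Calg A B (tob Calg D E)) =
      cmp Calg (cmp Calg (tar Calg (asc Calg A B D) (idn Calg E)) (asc Calg A (tob Calg B D) E))
        (tar Calg (idn Calg A) (asc Calg B D E))" for A B D E
    by (simp add: S B tn_pm typed_bij_sum typed_bij_id pm_pm typed_bij_comp[OF typed_bij_comp]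
        typed_bij_comp[where Y = "(A \<oplus> (B \<oplus> D)) \<oplus> E"]) (rule pe; auto simp: S)
  show "A \<in> obj Calg \<Longrightarrow> B \<in> obj Calg \<Longrightarrow>
      cmp Calg (asc Calg A (unt Calg) B) (tar Calg (idn Calg A) (lun Calg B)) =
      tar Calg (run Calg A) (idn Calg B)" for A B
    by (simp add: S B tn_pm typed_bij_sum typed_bij_id pm_pm) (rule pe; auto simp: S)
  show "A \<in> obj Calg \<Longrightarrow> B \<in> obj Calg \<Longrightarrow> cmp Calg (brd Calg A B) (brd Calg B A) = idn Calg (tob Calg A B)" for A B
    by (simp add: S B pm_pm) (rule pe; auto simp: S)
  show "A \<in> obj Calg \<Longrightarrow> B \<in> obj Calg \<Longrightarrow> D \<in> obj Calg \<Longrightarrow>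
      cmp Calg (cmp Calg (asc Calg A B D) (brd Calg A (tob Calg B D))) (asc Calg B D A) =
      cmp Calg (cmp Calg (tar Calg (brd Calg A B) (idn Calg D)) (asc Calg B A D))
        (tar Calg (idn Calg B) (brd Calg A D))" for A B D
    by (simp add: S B tn_pm typed_bij_sum typed_bij_id pm_pm typed_bij_comp[where Y = "A \<oplus> (B \<oplus> D)"]
        typed_bij_comp[where Y = "(B \<oplus> A) \<oplus> D"]) (rule pe; auto simp: S)
qed

text \<open>A typed injection that need not be onto: it moves canonical isomorphisms between parts
  of a tensor product into the typing of the whole.\<close>

definition embeds where
  "embeds X Y \<sigma> \<longleftrightarrow> inj_on \<sigma> (dom X) \<and> (\<forall>x\<in>dom X. Y (\<sigma> x) = X x)"

lemma coh_embed:
  assumes "embeds X Y \<sigma>" "well_typed (ty X) u" "well_typed (ty X) w" "set (leaves u) \<subseteq> dom X"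
    "set (leaves u) = set (leaves w)"
  shows "coh (ty X) u w = coh (ty Y) (map_word \<sigma> u) (map_word \<sigma> w)"
proof -
  have t: "ty X x = (ty Y \<circ> \<sigma>) x" if "x \<in> dom X" for x
    using assms(1) that by (simp add: embeds_def)
  have "coh (ty X) u w = coh (ty Y \<circ> \<sigma>) u w"
    by (rule coh_cong[OF assms(2,3,5)]) (use t assms(4) in blast)
  also have "\<dots> = coh (ty Y) (map_word \<sigma> u) (map_word \<sigma> w)"
  proof (rule coh_map_word[symmetric])
    show "well_typed (ty Y \<circ> \<sigma>) u" "well_typed (ty Y \<circ> \<sigma>) w"
      using assms(2-5) t unfolding well_typed_def by (metis subsetD)+
    show "inj_on \<sigma> (set (leaves u))" using assms(1,4) by (auto simp: embeds_def intro: inj_on_subset)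
  qed (rule assms(5))
  finally show ?thesis .
qed

lemma well_typed_embed:
  assumes "embeds X Y \<sigma>" "well_typed (ty X) u" "set (leaves u) \<subseteq> dom X"
  shows "well_typed (ty Y) (map_word \<sigma> u)"
  using assms unfolding embeds_def well_typed_def
  by (auto simp: distinct_map subset_iff intro: inj_on_subset)

lemma merge_embed:
  assumes "tfs X" "tfs X'" "embeds (X \<oplus> X') Y \<sigma>"
  shows "merge_tensor C W X X' = coh (ty Y) (Prod (map_word (\<sigma> \<circ> InL) (W (dom X))) (map_word (\<sigma> \<circ> InR) (W (dom X'))))
    (map_word \<sigma> (W (dom (X \<oplus> X'))))"
proof -
  note c = coh_tags[OF assms(1,2)]
  have f: "finite (dom X)" "finite (dom X')" using assms tfs_finite by auto
  have dj: "InL ` dom X \<inter> InR ` dom X' = {}" by auto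
  have "merge_tensor C W X X' = coh (ty Y) (map_word \<sigma> (Prod (map_word InL (W (dom X))) (map_word InR (W (dom X')))))
      (map_word \<sigma> (W (dom (X \<oplus> X'))))"
    unfolding merge_tensor_def by (rule coh_embed[OF assms(3)]) (use c(1-5) f dj in simp_all)
  then show ?thesis by (simp add: word.map_comp)
qed

text \<open>\<open>W {}\<close> may contain several units but has no leaf on which \<sigma> could
  act.\<close>

lemma W_empty: "map_word \<sigma> (W {}) = W {}"
proof -
  have "map_word \<sigma> (W {}) = map_word id (W {})" by (rule map_word_cong') simp
  then show ?thesis by (simp add: word.map_id)
qed

lemma coh_typed_bij:
  assumes "tfs X" "tfs Y" "typed_bij X Y \<sigma>"
  shows "embeds X Y \<sigma>" "well_typed (ty Y) (map_word \<sigma> (W (dom X)))" "well_typed (ty Y) (W (dom Y))"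
    "set (leaves (map_word \<sigma> (W (dom X)))) = dom Y" "set (leaves (W (dom Y))) = dom Y"
  using assms well_typed_map[OF assms(1,3)] well_typed_tfs[OF assms(2)] tfs_finite[OF assms(2)]
    typed_bij_inj[OF assms(3)] typed_bij_app[OF assms(3)] by (simp_all add: embeds_def)

text \<open>Every map in the axioms for the comparison morphisms, apart from their naturality, is
  canonical. Expressed over one common typing, both sides of an axiom have the same first and last
  word.\<close>

lemma functor_tensor: "symmetric_monoidal_functor Calg C (tensor_functor C W)"
proof -
  interpret A: symmetric_monoidal_category Calg by (rule smc_Calg)
  note S = Calg_simps is_tfs_tsum is_tfs_empty
  have F: "Fob (tensor_functor C W) = T" "Far (tensor_functor C W) = md" "Fmu (tensor_functor C W) = merge_tensor C W"
    "Feps (tensor_functor C W) = coh (ty Map.empty) One (W {})"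
    by (auto simp: tensor_functor_def)
  show ?thesis
  proof (unfold_locales, unfold F)
    show "A \<in> obj Calg \<Longrightarrow> T A \<in> obj C" for A by (simp add: S T_obj)
    show "f \<in> hom Calg A B \<Longrightarrow> md f \<in> hom C (T A) (T B)" for f A B
      by (auto simp: Calg_hom tarr_def)
    show "A \<in> obj Calg \<Longrightarrow> md (idn Calg A) = idn C (T A)" for A by (simp add: S md_idt del: pm_simps(3))
    show "f \<in> hom Calg A B \<Longrightarrow> g \<in> hom Calg B E \<Longrightarrow> md (cmp Calg f g) = md f \<Zsemi> md g" for f g A B E
      by (auto simp: S Calg_hom)
    show "A \<in> obj Calg \<Longrightarrow> B \<in> obj Calg \<Longrightarrow> iso_in C (T A \<boxtimes> T B) (T (tob Calg A B)) (merge_tensor C W A B)" for A B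
      using split_merge[of A B] by (intro iso_inI) (simp_all add: S)
    show "f \<in> hom Calg A A' \<Longrightarrow> g \<in> hom Calg B B' \<Longrightarrow>
        (md f \<otimes> md g) \<Zsemi> merge_tensor C W A' B' = merge_tensor C W A B \<Zsemi> md (tar Calg f g)" for f g A A' B B'
    proof -
      assume "f \<in> hom Calg A A'" "g \<in> hom Calg B B'"
      then have t: "tarr f" "tarr g" "dm f = A" "cd f = A'" "dm g = B" "cd g = B'"
        by (simp_all add: Calg_hom)
      note D = tarrD[OF t(1)] tarrD[OF t(2)]
      note s = split_merge[OF D(1,6)] split_merge[OF D(2,7)]
      show ?thesis using s D t by (simp add: S md_tn)
    qed
    have w0: "well_typed t (W {})" for t by (simp add: well_typed_def)
    show "iso_in C (unt C) (T (unt Calg)) (coh (ty Map.empty) One (W {}))"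
      using coh_simps[of "ty Map.empty" One "W {}"] w0 by (intro iso_inI) (simp_all add: S tensor_def)
    \<comment> \<open>A word without leaves does not see the typing, so the unit comparison may be
      read over any \<open>t\<close>.\<close>
    have eps: "coh (ty Map.empty) One (W {}) = coh t One (W {})" for t
      by (rule coh_cong) (simp_all add: w0)
    have idT: "idn C (T X) = coh t (map_word \<sigma> (W (dom X))) (map_word \<sigma> (W (dom X)))"
      and wT: "well_typed t (map_word \<sigma> (W (dom X)))" and iT: "interp C t (map_word \<sigma> (W (dom X))) = T X"
      if X: "tfs X" and i: "inj_on \<sigma> (dom X)" and t: "\<And>x. x \<in> dom X \<Longrightarrow> t (\<sigma> x) = ty X x" for X \<sigma> t
    proof -
      show w: "well_typed t (map_word \<sigma> (W (dom X)))"
        using X i t tfs_finite[OF X] tfs_obj[OF X] by (auto simp: well_typed_def distinct_map)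
      show i: "interp C t (map_word \<sigma> (W (dom X))) = T X"
        unfolding interp_map_word using X t by (intro T_eq) simp_all
      show "idn C (T X) = coh t (map_word \<sigma> (W (dom X))) (map_word \<sigma> (W (dom X)))"
        unfolding coh_same[OF w] i ..
    qed
    show "A \<in> obj Calg \<Longrightarrow> B \<in> obj Calg \<Longrightarrow> E \<in> obj Calg \<Longrightarrow>
        (merge_tensor C W A B \<otimes> idn C (T E)) \<Zsemi> merge_tensor C W (tob Calg A B) E \<Zsemi> md (asc Calg A B E) =
        asc C (T A) (T B) (T E) \<Zsemi> (idn C (T A) \<otimes> merge_tensor C W B E) \<Zsemi> merge_tensor C W A (tob Calg B E)" for A B E
    proof -
      assume "A \<in> obj Calg" "B \<in> obj Calg" "E \<in> obj Calg"
      then have o: "tfs A" "tfs B" "tfs E" by (simp_all add: S)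
      then have o2: "tfs (A \<oplus> B)" "tfs (B \<oplus> E)" "tfs ((A \<oplus> B) \<oplus> E)" "tfs (A \<oplus> (B \<oplus> E))" by (simp_all add: S)
      note f = tfs_finite[OF o(1)] tfs_finite[OF o(2)] tfs_finite[OF o(3)]
      \<comment> \<open>The codomain of the associator supplies the common labels; words for the
        other bracketing are carried there by \<open>asc_map\<close>.\<close>
      let ?Y = "A \<oplus> (B \<oplus> E)"
      let ?t = "ty ?Y"
      let ?a = "map_word InL (W (dom A))" and ?b = "map_word (InR \<circ> InL) (W (dom B))" and ?c = "map_word (InR \<circ> InR) (W (dom E))"
      note Y = coh_typed_bij[OF o2(3,4) typed_bij_asc]
      have e: "embeds (A \<oplus> B) ?Y (asc_map \<circ> InL)" "embeds (B \<oplus> E) ?Y InR" "embeds ?Y ?Y id"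
        by (auto simp: embeds_def inj_on_def)
      have c: "asc_map \<circ> InL \<circ> InL = InL" "asc_map \<circ> InL \<circ> InR = InR \<circ> InL" "asc_map \<circ> InR = InR \<circ> InR"
        by auto
      have wa: "well_typed ?t ?a" "idn C (T A) = coh ?t ?a ?a" "interp C ?t ?a = T A"
        by (rule wT[OF o(1)] idT[OF o(1)] iT[OF o(1)]; auto simp: inj_on_def)+
      have wb: "well_typed ?t ?b" "interp C ?t ?b = T B"
        by (rule wT[OF o(2)] iT[OF o(2)]; auto simp: inj_on_def)+
      have wc: "well_typed ?t ?c" "idn C (T E) = coh ?t ?c ?c" "interp C ?t ?c = T E"
        by (rule wT[OF o(3)] idT[OF o(3)] iT[OF o(3)]; auto simp: inj_on_def)+
      let ?ab = "map_word (asc_map \<circ> InL) (W (dom (A \<oplus> B)))" and ?be = "map_word InR (W (dom (B \<oplus> E)))"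
      have wab: "well_typed ?t ?ab" "well_typed ?t ?be"
        using well_typed_embed[OF e(1) well_typed_tfs[OF o2(1)]] well_typed_embed[OF e(2) well_typed_tfs[OF o2(2)]]
          f by simp_all
      have m1: "merge_tensor C W A B = coh ?t (Prod ?a ?b) ?ab"
        unfolding merge_embed[OF o(1,2) e(1)] c(1,2) ..
      have m2: "merge_tensor C W (A \<oplus> B) E = coh ?t (Prod ?ab ?c) (map_word asc_map (W (dom ((A \<oplus> B) \<oplus> E))))"
        unfolding merge_embed[OF o2(1) o(3) Y(1)] c(3) ..
      have m3: "merge_tensor C W B E = coh ?t (Prod ?b ?c) ?be"
        by (rule merge_embed[OF o(2,3) e(2)])
      have m4: "merge_tensor C W A (B \<oplus> E) = coh ?t (Prod ?a ?be) (W (dom ?Y))"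
        unfolding merge_embed[OF o(1) o2(2) e(3)] by (simp add: word.map_id)
      have asc: "asc C (T A) (T B) (T E) = coh ?t (Prod (Prod ?a ?b) ?c) (Prod ?a (Prod ?b ?c))"
        unfolding wa(3)[symmetric] wb(2)[symmetric] wc(3)[symmetric]
        using wa wb wc f by (intro coh_eqI[symmetric] coh_asc) auto
      have l: "set (leaves ?a) = InL ` dom A" "set (leaves ?b) = (InR \<circ> InL) ` dom B" "set (leaves ?c) = (InR \<circ> InR) ` dom E"
        "set (leaves ?ab) = InL ` dom A \<union> (InR \<circ> InL) ` dom B" "set (leaves ?be) = (InR \<circ> InL) ` dom B \<union> (InR \<circ> InR) ` dom E"
        "dom ?Y = InL ` dom A \<union> ((InR \<circ> InL) ` dom B \<union> (InR \<circ> InR) ` dom E)"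
        using f by (simp_all add: image_Un image_comp[symmetric] image_image)
      have dj: "InL ` dom A \<inter> (InR \<circ> InL) ` dom B = {}" "InL ` dom A \<inter> (InR \<circ> InR) ` dom E = {}"
        "(InR \<circ> InL) ` dom B \<inter> (InR \<circ> InR) ` dom E = {}" by auto
      have md: "md (asc Calg A B E) = coh ?t (map_word asc_map (W (dom ((A \<oplus> B) \<oplus> E)))) (W (dom ?Y))"
        using o by (simp add: S)
      have L1: "merge_tensor C W A B \<otimes> idn C (T E) = coh ?t (Prod (Prod ?a ?b) ?c) (Prod ?ab ?c)"
        unfolding m1 wc(2) by (rule coh_tensor) (use wa wb wc wab l dj in \<open>simp_all add: Int_Un_distrib Int_Un_distrib2\<close>)
      have L2: "\<dots> \<Zsemi> merge_tensor C W (A \<oplus> B) E = coh ?t (Prod (Prod ?a ?b) ?c) (map_word asc_map (W (dom ((A \<oplus> B) \<oplus> E))))"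
        unfolding m2 by (rule coh_comp) (use wa wb wc wab Y(2-5) l dj in \<open>simp_all add: Int_Un_distrib Int_Un_distrib2 Un_assoc del: leaves_map_word dom_tsum\<close>)
      have L3: "\<dots> \<Zsemi> md (asc Calg A B E) = coh ?t (Prod (Prod ?a ?b) ?c) (W (dom ?Y))"
        unfolding md by (rule coh_comp) (use wa wb wc wab Y(2-5) l dj in \<open>simp_all add: Int_Un_distrib Int_Un_distrib2 Un_assoc del: leaves_map_word dom_tsum\<close>)
      have R1: "idn C (T A) \<otimes> merge_tensor C W B E = coh ?t (Prod ?a (Prod ?b ?c)) (Prod ?a ?be)"
        unfolding m3 wa(2) by (rule coh_tensor) (use wa wb wc wab l dj in \<open>simp_all add: Int_Un_distrib Int_Un_distrib2\<close>)
      have R2: "asc C (T A) (T B) (T E) \<Zsemi> \<dots> = coh ?t (Prod (Prod ?a ?b) ?c) (Prod ?a ?be)"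
        unfolding asc by (rule coh_comp) (use wa wb wc wab l dj in \<open>simp_all add: Int_Un_distrib Int_Un_distrib2 Un_assoc del: leaves_map_word\<close>)
      have R3: "\<dots> \<Zsemi> merge_tensor C W A (B \<oplus> E) = coh ?t (Prod (Prod ?a ?b) ?c) (W (dom ?Y))"
        unfolding m4 by (rule coh_comp) (use wa wb wc wab Y(2-5) l dj in \<open>simp_all add: Int_Un_distrib Int_Un_distrib2 Un_assoc del: leaves_map_word dom_tsum\<close>)
      show ?thesis
        unfolding S(6) L1 L2 L3 R1 R2 R3 ..
    qed
    show "A \<in> obj Calg \<Longrightarrow>
        (coh (ty Map.empty) One (W {}) \<otimes> idn C (T A)) \<Zsemi> merge_tensor C W (unt Calg) A \<Zsemi> md (lun Calg A) = lun C (T A)" for A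
    proof -
      assume "A \<in> obj Calg"
      then have o: "tfs A" by (simp add: S)
      then have o2: "tfs (Map.empty \<oplus> A)" by (simp add: S)
      note Y = coh_typed_bij[OF o2 o typed_bij_lun] and f = tfs_finite[OF o]
      have w: "well_typed (ty A) (W (dom A))" "set (leaves (W (dom A))) = dom A" using Y by auto
      have id: "idn C (T A) = coh (ty A) (W (dom A)) (W (dom A))"
        unfolding coh_same[OF w(1)] by (simp add: tensor_def)
      have c: "untag \<circ> InR = id" by auto
      have m: "merge_tensor C W Map.empty A = coh (ty A) (Prod (W {}) (W (dom A))) (map_word untag (W (dom (Map.empty \<oplus> A))))"
        unfolding merge_embed[OF is_tfs_empty o Y(1)] c by (simp add: W_empty word.map_id)
      have md: "md (lun Calg A) = coh (ty A) (map_word untag (W (dom (Map.empty \<oplus> A)))) (W (dom A))"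
        using o by (simp add: S)
      have l: "lun C (T A) = coh (ty A) (Prod One (W (dom A))) (W (dom A))"
        unfolding tensor_def using w by (intro coh_eqI[symmetric] coh_lun) simp
      have L1: "coh (ty Map.empty) One (W {}) \<otimes> idn C (T A) = coh (ty A) (Prod One (W (dom A))) (Prod (W {}) (W (dom A)))"
        unfolding id eps[of "ty A"] by (rule coh_tensor) (use w w0 in simp_all)
      have L2: "\<dots> \<Zsemi> merge_tensor C W Map.empty A = coh (ty A) (Prod One (W (dom A))) (map_word untag (W (dom (Map.empty \<oplus> A))))"
        unfolding m by (rule coh_comp) (use w w0 Y(2-5) in \<open>simp_all del: leaves_map_word dom_tsum\<close>)
      have L3: "\<dots> \<Zsemi> md (lun Calg A) = coh (ty A) (Prod One (W (dom A))) (W (dom A))"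
        unfolding md by (rule coh_comp) (use w w0 Y(2-5) in \<open>simp_all del: leaves_map_word dom_tsum\<close>)
      show ?thesis unfolding S(5) L1 L2 L3 l ..
    qed
    show "A \<in> obj Calg \<Longrightarrow>
        (idn C (T A) \<otimes> coh (ty Map.empty) One (W {})) \<Zsemi> merge_tensor C W A (unt Calg) \<Zsemi> md (run Calg A) = run C (T A)" for A
    proof -
      assume "A \<in> obj Calg"
      then have o: "tfs A" by (simp add: S)
      then have o2: "tfs (A \<oplus> Map.empty)" by (simp add: S)
      note Y = coh_typed_bij[OF o2 o typed_bij_run] and f = tfs_finite[OF o]
      have w: "well_typed (ty A) (W (dom A))" "set (leaves (W (dom A))) = dom A" using Y by auto
      have id: "idn C (T A) = coh (ty A) (W (dom A)) (W (dom A))"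
        unfolding coh_same[OF w(1)] by (simp add: tensor_def)
      have c: "untag \<circ> InL = id" by auto
      have m: "merge_tensor C W A Map.empty = coh (ty A) (Prod (W (dom A)) (W {})) (map_word untag (W (dom (A \<oplus> Map.empty))))"
        unfolding merge_embed[OF o is_tfs_empty Y(1)] c by (simp add: W_empty word.map_id)
      have md: "md (run Calg A) = coh (ty A) (map_word untag (W (dom (A \<oplus> Map.empty)))) (W (dom A))"
        using o by (simp add: S)
      have l: "run C (T A) = coh (ty A) (Prod (W (dom A)) One) (W (dom A))"
        unfolding tensor_def using w by (intro coh_eqI[symmetric] coh_run) simp
      have L1: "idn C (T A) \<otimes> coh (ty Map.empty) One (W {}) = coh (ty A) (Prod (W (dom A)) One) (Prod (W (dom A)) (W {}))"
        unfolding id eps[of "ty A"] by (rule coh_tensor) (use w w0 in simp_all)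
      have L2: "\<dots> \<Zsemi> merge_tensor C W A Map.empty = coh (ty A) (Prod (W (dom A)) One) (map_word untag (W (dom (A \<oplus> Map.empty))))"
        unfolding m by (rule coh_comp) (use w w0 Y(2-5) in \<open>simp_all del: leaves_map_word dom_tsum\<close>)
      have L3: "\<dots> \<Zsemi> md (run Calg A) = coh (ty A) (Prod (W (dom A)) One) (W (dom A))"
        unfolding md by (rule coh_comp) (use w w0 Y(2-5) in \<open>simp_all del: leaves_map_word dom_tsum\<close>)
      show ?thesis unfolding S(5) L1 L2 L3 l ..
    qed
    show "A \<in> obj Calg \<Longrightarrow> B \<in> obj Calg \<Longrightarrow>
        merge_tensor C W A B \<Zsemi> md (brd Calg A B) = brd C (T A) (T B) \<Zsemi> merge_tensor C W B A" for A B
    proof -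
      assume "A \<in> obj Calg" "B \<in> obj Calg"
      then have o: "tfs A" "tfs B" by (simp_all add: S)
      then have o2: "tfs (A \<oplus> B)" "tfs (B \<oplus> A)" by (simp_all add: S)
      note Y = coh_typed_bij[OF o2 typed_bij_swap] and f = tfs_finite[OF o(1)] tfs_finite[OF o(2)]
      let ?t = "ty (B \<oplus> A)" and ?a = "map_word InR (W (dom A))" and ?b = "map_word InL (W (dom B))"
      have c: "swap_map \<circ> InL = InR" "swap_map \<circ> InR = InL" by auto
      have e: "embeds (B \<oplus> A) (B \<oplus> A) id" by (simp add: embeds_def)
      have wa: "well_typed ?t ?a" "interp C ?t ?a = T A"
        by (rule wT[OF o(1)] iT[OF o(1)]; simp)+
      have wb: "well_typed ?t ?b" "interp C ?t ?b = T B"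
        by (rule wT[OF o(2)] iT[OF o(2)]; simp)+
      have l: "set (leaves ?a) = InR ` dom A" "set (leaves ?b) = InL ` dom B" "dom (B \<oplus> A) = InL ` dom B \<union> InR ` dom A"
        using f by simp_all
      have dj: "InR ` dom A \<inter> InL ` dom B = {}" "InL ` dom B \<inter> InR ` dom A = {}" by auto
      have m1: "merge_tensor C W A B = coh ?t (Prod ?a ?b) (map_word swap_map (W (dom (A \<oplus> B))))"
        unfolding merge_embed[OF o Y(1)] c ..
      have m2: "merge_tensor C W B A = coh ?t (Prod ?b ?a) (W (dom (B \<oplus> A)))"
        unfolding merge_embed[OF o(2,1) e] by (simp add: word.map_id)
      have md: "md (brd Calg A B) = coh ?t (map_word swap_map (W (dom (A \<oplus> B)))) (W (dom (B \<oplus> A)))"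
        using o by (simp add: S)
      have b: "brd C (T A) (T B) = coh ?t (Prod ?a ?b) (Prod ?b ?a)"
        unfolding wa(2)[symmetric] wb(2)[symmetric]
        by (rule coh_eqI[symmetric, OF coh_brd]) (use wa wb l dj in \<open>simp del: leaves_map_word\<close>)
      have "merge_tensor C W A B \<Zsemi> md (brd Calg A B) = coh ?t (Prod ?a ?b) (W (dom (B \<oplus> A)))"
        unfolding m1 md by (rule coh_comp) (use wa wb l dj Y(2-5) in \<open>simp_all add: Un_commute del: leaves_map_word dom_tsum\<close>)
      moreover have "brd C (T A) (T B) \<Zsemi> merge_tensor C W B A = coh ?t (Prod ?a ?b) (W (dom (B \<oplus> A)))"
        unfolding m2 b by (rule coh_comp) (use wa wb l dj Y(2-5) in \<open>simp_all add: Un_commute del: leaves_map_word dom_tsum\<close>)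
      ultimately show ?thesis by simp
    qed
  qed
qed

lemma tensor_equivalence: "smc_equivalence Calg C (tensor_functor C W)"
proof -
  interpret F: symmetric_monoidal_functor Calg C "tensor_functor C W" by (rule functor_tensor)
  note S = Calg_simps
  have F: "Fob (tensor_functor C W) = T" "Far (tensor_functor C W) = md"
    by (auto simp: tensor_functor_def)
  \<comment> \<open>A one-element set of type \<open>B\<close>, on an element that exists whatever
    the atoms are. The bracketing of a singleton has one leaf but may contain units, so
    \<open>?e B\<close> is the canonical isomorphism that removes them.\<close>
  let ?G = "\<lambda>B. [Atom undefined \<mapsto> B] :: ('a, 'o) tfs"
  let ?e = "\<lambda>B. coh (ty (?G B)) (W {Atom undefined}) (Leaf (Atom undefined))"
  interpret monoidal_equivalence Calg C "tensor_functor C W" ?G ?e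
  proof (unfold_locales, unfold F)
    fix A A' h assume "A \<in> obj Calg" "A' \<in> obj Calg" "h \<in> hom C (T A) (T A')"
    then have "(A, h, A') \<in> hom Calg A A'" by (simp add: Calg_hom tarr_def S)
    then show "\<exists>!f. f \<in> hom Calg A A' \<and> md f = h"
      by (intro ex1I[of _ "(A, h, A')"]) (auto simp: Calg_hom prod_eq_iff)
  next
    fix B assume B: "B \<in> obj C"
    then have t: "tfs (?G B)" by (simp add: is_tfs_def)
    then show "?G B \<in> obj Calg" by (simp add: S)
    have w: "well_typed (ty (?G B)) (W {Atom undefined})" "well_typed (ty (?G B)) (Leaf (Atom undefined))"
      using well_typed_tfs[OF t] B by simp_all
    show "iso_in C (T (?G B)) B (?e B)"
      using coh_simps[OF w] by (intro iso_inI) (simp_all add: tensor_def)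
  qed
  show ?thesis by (rule smc_equivalence)
qed

end


theorem theorem5p3:
  fixes C :: "('o, 'm) smc"
    and W :: "'a elt set \<Rightarrow> 'a elt word"
  assumes "symmetric_monoidal_category C"
    and "bracketing_choice W"
  shows "\<exists>H :: ('a, 'o) box list \<Rightarrow> ('a, 'o) box \<Rightarrow> ('a, 'o) span set \<Rightarrow> 'm list \<Rightarrow> 'm.
    wd_algebra (obj C) (hom_boxes C W) H \<and>
    (\<forall>X Y Z f g. is_tfs (obj C) X \<longrightarrow> is_tfs (obj C) Y \<longrightarrow> is_tfs (obj C) Z \<longrightarrow>
       f \<in> hom_boxes C W (X, Y) \<longrightarrow> g \<in> hom_boxes C W (Y, Z) \<longrightarrow>
       H [(X, Y), (Y, Z)] (X, Z) (wd_seq (obj C) X Y Z) [f, g] = f \<Zsemi>\<^bsub>C\<^esub> g) \<and>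
    (\<forall>X Y X' Y' f g. is_tfs (obj C) X \<longrightarrow> is_tfs (obj C) Y \<longrightarrow>
       is_tfs (obj C) X' \<longrightarrow> is_tfs (obj C) Y' \<longrightarrow>
       f \<in> hom_boxes C W (X, Y) \<longrightarrow> g \<in> hom_boxes C W (X', Y') \<longrightarrow>
       H [(X, Y), (X', Y')] (X \<oplus> X', Y \<oplus> Y') (wd_para (obj C) X Y X' Y') [f, g] =
       split_tensor C W X X' \<Zsemi>\<^bsub>C\<^esub> (f \<otimes>\<^bsub>C\<^esub> g) \<Zsemi>\<^bsub>C\<^esub> merge_tensor C W Y Y') \<and>
    (\<forall>X Y \<sigma>. is_tfs (obj C) X \<longrightarrow> is_tfs (obj C) Y \<longrightarrow> typed_bij X Y \<sigma> \<longrightarrow>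
       H [] (X, Y) (wd_sym (obj C) \<sigma> X Y) [] = permute_tensor C W \<sigma> X Y) \<and>
    smc_equivalence (smc_of_algebra (obj C) (hom_boxes C W) H) C (tensor_functor C W)"
proof -
  interpret bracketed_smc C W
    using assms by (intro bracketed_smc.intro bracketed_smc_axioms.intro)
  show ?thesis
  proof (intro exI[of _ H] conjI allI impI)
    show "wd_algebra (obj C) (hom_boxes C W) H" by (rule wd_algebra_H)
    show "smc_equivalence (smc_of_algebra (obj C) (hom_boxes C W) H) C (tensor_functor C W)"
      by (rule tensor_equivalence)
  next
    fix X Y Z f g
    assume "tfs X" "tfs Y" "tfs Z" "f \<in> hom_boxes C W (X, Y)" "g \<in> hom_boxes C W (Y, Z)"
    then show "H [(X, Y), (Y, Z)] (X, Z) (wd_seq (obj C) X Y Z) [f, g] = f \<Zsemi>\<^bsub>C\<^esub> g"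
      using H_seq[of "(X, f, Y)" "(Y, g, Z)"] by (simp add: tarr_def hom_boxes_def)
  next
    fix X Y X' Y' f g
    assume "tfs X" "tfs Y" "tfs X'" "tfs Y'" "f \<in> hom_boxes C W (X, Y)" "g \<in> hom_boxes C W (X', Y')"
    then show "H [(X, Y), (X', Y')] (X \<oplus> X', Y \<oplus> Y') (wd_para (obj C) X Y X' Y') [f, g] =
       split_tensor C W X X' \<Zsemi>\<^bsub>C\<^esub> (f \<otimes>\<^bsub>C\<^esub> g) \<Zsemi>\<^bsub>C\<^esub> merge_tensor C W Y Y'"
      using H_para[of "(X, f, Y)" "(X', g, Y')"] md_tn[of "(X, f, Y)" "(X', g, Y')"]
      by (simp add: tarr_def hom_boxes_def)
  next
    fix X Y \<sigma> assume "tfs X" "tfs Y" "typed_bij X Y \<sigma>"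
    then show "H [] (X, Y) (wd_sym (obj C) \<sigma> X Y) [] = permute_tensor C W \<sigma> X Y"
      using H_sym[of X Y \<sigma>] by (simp add: pm_def)
  qed
qed

end
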